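(* Let $\lambda_1,\ldots,\lambda_n\in P^+$ and, for $m=1,\ldots,n$, let $\pi_m=(\lambda_{(m,1)},\ldots,\lambda_{(m,\kappa_m)};0=a_{(m,0)}<a_{(m,1)}<\cdots<a_{(m,\kappa_m)}=1)\in\mathbb B(\lambda_m)$, and $\pi=\pi_1\otimes\cdots\otimes\pi_n\in\mathbb B(\lambda_1)\otimes\cdots\otimes\mathbb B(\lambda_n)$. Let $\mathfrak I=\{(m,l):1\le m\le n,\ 1\le l\le\kappa_m\}$ with the lexicographic order. Then $\pi$ is standard, i.e. $\pi=F\pi_{\lambda_1}\otimes\cdots\otimes\pi_{\lambda_n}$ for some $F\in\mathcal F$, if and only if there exist $w_{(m,l)}\in\mathcal W$, $(m,l)\in\mathfrak I$, such that (1) $w_{(m,l)}\lambda_m=\lambda_{(m,l)}$ for all $(m,l)\in\mathfrak I$; (2) $w_{(1,1)}\ge\cdots\ge w_{(1,\kappa_1)}\ge w_{(2,1)}\ge\cdots\ge w_{(n-1,\kappa_{n-1})}\ge w_{(n,1)}\ge\cdots\ge w_{(n,\kappa_n)}$ in the Bruhat order of $\mathcal W$; (3) $w_{(m+1,1)}\lambda_m\in\mathcal W_{re}\lambda_m$ for $m=1,\ldots,n-1$; (4) there exists a $1$-chain for $(\lambda_{(m,\kappa_m)},w_{(m+1,1)}\lambda_m)$ in $\mathcal W\lambda_m$ for $m=1,\ldots,n-1$.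
   Context: Borcherds–Cartan datum $(A,\{\alpha_i\},\{\alpha_i^\vee\},P,P^\vee)$ over a countable $I$: $a_{ii}=2$ or $a_{ii}\in\mathbb Z_{\le0}$, $a_{ij}\in\mathbb Z_{\le0}$ ($i\ne j$), $a_{ij}=0\iff a_{ji}=0$, $\alpha_i^\vee(\alpha_j)=a_{ij}$, simple roots/coroots linearly independent; $I^{re}=\{a_{ii}=2\}$, $I^{im}=I\setminus I^{re}$; $P^+$ dominant integral weights; $\Delta^+$ positive roots of the generalized Kac–Moody algebra. $r_i(\mu)=\mu-\alpha_i^\vee(\mu)\alpha_i$; $\mathcal W_{re}=\langle r_i:i\in I^{re}\rangle$; $\Delta^+_{re}=\mathcal W_{re}\{\alpha_i\}_{i\in I^{re}}\cap\Delta^+$; $\Delta_{im}=\mathcal W_{re}\{\alpha_i\}_{i\in I^{im}}$; for $\beta=w\alpha_i$, $\beta^\vee=w\alpha_i^\vee$, $r_\beta=wr_iw^{-1}$. Monoid $\mathcal W$: generators $r_i$, relations $r_i^2=1$ (real $i$), $(r_ir_j)^m=(r_jr_i)^m=1$ (real $i\neq j$, $\mathrm{ord}(r_ir_j)=m\in\{2,3,4,6\}$), $r_ir_j=r_jr_i$ ($i\in I^{im}$, $j\ne i$, $a_{ij}=0$); $\mathcal W_{re}$ is the subgroup generated by real $r_i$ and $r_\beta=wr_iw^{-1}\in\mathcal W$; $\ell$ = length. Bruhat order: $w\to r_\beta w$ if $\beta\in\Delta^+_{re}\sqcup\Delta_{im}$ and $\ell(r_\beta w)>\ell(w)$; $\le$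 its reflexive–transitive closure. Order on $\mathcal W\lambda$ ($\lambda\in P^+$): $\mu\ge\nu$ iff there is $\mu=\lambda_0,\ldots,\lambda_k=\nu$ with $\lambda_{s-1}=r_{\beta_s}\lambda_s$, $\beta_s^\vee(\lambda_s)>0$; $\mu\xleftarrow\beta\nu$ if $\mu=r_\beta\nu$, $\beta^\vee(\nu)>0$ and $\mu$ covers $\nu$; an $a$-chain for $(\mu,\nu)$ ($a\in(0,1]$ rational) is $\mu=\nu_0\xleftarrow{\beta_1}\cdots\xleftarrow{\beta_k}\nu_k=\nu$ with $a\beta_s^\vee(\nu_s)\in\mathbb Z_{>0}$ for real $\beta_s$, $=1$ for imaginary. GLS paths, $\mathbb B(\lambda)$: pairs $(\lambda_1>\cdots>\lambda_k;0=a_0<\cdots<a_k=1)$ in $\mathcal W\lambda$ with rational $a_s$, an $a_s$-chain for $(\lambda_s,\lambda_{s+1})$ and a 1-chain for $(\lambda_k,\lambda)$, viewed as paths $\pi(t)=\sum_{l<s}(a_l-a_{l-1})\lambda_l+(t-a_{s-1})\lambda_s$ on $[a_{s-1},a_s]$. Concatenation $(\pi_1\otimes\cdots\otimes\pi_n)(t)=\sum_{l<m}\pi_l(1)+\pi_m(nt-m+1)$ on $[\frac{m-1}n,\frac mn]$; $\pi_\mu(t)=t\mu$. Root operators $f_i$ on piecewise-linear paths: with $H_i^\pi=\alpha_i^\vee\circ\pi$, $m_i^\pi=\min\{H_i^\pi(t)\in\mathbb Z\}$, $f_+^i=\max\{t:H_i^\pi(t)=m_i^\pi\}$: $f_i\pi=\mathbf0$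 if $f_+^i=1$, else $f_i\pi=\pi$ on $[0,f_+^i]$, $\pi-(H_i^\pi-m_i^\pi)\alpha_i$ on $[f_+^i,f_-^i]$ where $f_-^i=\min\{t\ge f_+^i:H_i^\pi(t)=m_i^\pi+1\}$, and $\pi-\alpha_i$ on $[f_-^i,1]$. $\mathcal F$ = monoid generated by the $f_i$. *)

theory Defs
  imports Complex_Main "HOL-Library.Countable"
begin

text \<open>The weight space is a real vector space 'v containing the weight lattice P.
  Simple roots: al i; simple coroots: co i, linear functionals on 'v, integral on P.
  The index set I is the (countable) type 'i.\<close>

definition bc_datum :: "('i::countable \<Rightarrow> 'v::real_vector \<Rightarrow> real) \<Rightarrow> ('i \<Rightarrow> 'v) \<Rightarrow> 'v set \<Rightarrow> bool" where
  "bc_datum co al P \<longleftrightarrow>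
     (\<forall>i. linear (co i)) \<and>
     0 \<in> P \<and> (\<forall>x\<in>P. \<forall>y\<in>P. x + y \<in> P \<and> x - y \<in> P) \<and>
     (\<forall>i. al i \<in> P) \<and> (\<forall>i. \<forall>x\<in>P. co i x \<in> \<int>) \<and>
     (\<forall>i. co i (al i) = 2 \<or> co i (al i) \<le> 0) \<and>
     (\<forall>i j. i \<noteq> j \<longrightarrow> co i (al j) \<le> 0) \<and>
     (\<forall>i j. co i (al j) = 0 \<longleftrightarrow> co j (al i) = 0) \<and>
     (\<forall>S c. finite S \<longrightarrow> (\<Sum>i\<in>S. c i *\<^sub>R al i) = 0 \<longrightarrow> (\<forall>i\<in>S. c i = 0)) \<and>
     (\<forall>S c. finite S \<longrightarrow> (\<forall>x. (\<Sum>i\<in>S. c i * co i x) = 0) \<longrightarrow> (\<forall>i\<in>S. c i = 0))"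

definition Ire :: "('i \<Rightarrow> 'v \<Rightarrow> real) \<Rightarrow> ('i \<Rightarrow> 'v) \<Rightarrow> 'i set" where
  "Ire co al = {i. co i (al i) = 2}"

definition Iim :: "('i \<Rightarrow> 'v \<Rightarrow> real) \<Rightarrow> ('i \<Rightarrow> 'v) \<Rightarrow> 'i set" where
  "Iim co al = - Ire co al"

definition Pplus :: "('i \<Rightarrow> 'v \<Rightarrow> real) \<Rightarrow> 'v set \<Rightarrow> 'v set" where
  "Pplus co P = {lam \<in> P. \<forall>i. co i lam \<ge> 0}"

text \<open>Simple reflections and the action of words (elements of the monoid W are
  represented by words; the word [i1,...,ik] stands for r_i1 ... r_ik).\<close>
definition srefl :: "('i \<Rightarrow> 'v::real_vector \<Rightarrow> real) \<Rightarrow> ('i \<Rightarrow> 'v) \<Rightarrow> 'i \<Rightarrow> 'v \<Rightarrow> 'v" where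
  "srefl co al i mu = mu - co i mu *\<^sub>R al i"

definition act :: "('i \<Rightarrow> 'v::real_vector \<Rightarrow> real) \<Rightarrow> ('i \<Rightarrow> 'v) \<Rightarrow> 'i list \<Rightarrow> 'v \<Rightarrow> 'v" where
  "act co al ws mu = foldr (srefl co al) ws mu"

definition orbit :: "('i \<Rightarrow> 'v::real_vector \<Rightarrow> real) \<Rightarrow> ('i \<Rightarrow> 'v) \<Rightarrow> 'v \<Rightarrow> 'v set" where
  "orbit co al lam = {act co al ws lam | ws. True}"

definition re_orbit :: "('i \<Rightarrow> 'v::real_vector \<Rightarrow> real) \<Rightarrow> ('i \<Rightarrow> 'v) \<Rightarrow> 'v \<Rightarrow> 'v set" where
  "re_orbit co al lam = {act co al ws lam | ws. set ws \<subseteq> Ire co al}"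

definition Qplus :: "('i \<Rightarrow> 'v::real_vector) \<Rightarrow> 'v set" where
  "Qplus al = {v. \<exists>S k. finite S \<and> v = (\<Sum>i\<in>S. of_nat (k i) *\<^sub>R al i)}"

definition pos_re_roots :: "('i \<Rightarrow> 'v::real_vector \<Rightarrow> real) \<Rightarrow> ('i \<Rightarrow> 'v) \<Rightarrow> 'v set" where
  "pos_re_roots co al =
     {act co al ws (al i) | ws i. set ws \<subseteq> Ire co al \<and> i \<in> Ire co al} \<inter> Qplus al"

definition im_roots :: "('i \<Rightarrow> 'v::real_vector \<Rightarrow> real) \<Rightarrow> ('i \<Rightarrow> 'v) \<Rightarrow> 'v set" where
  "im_roots co al = {act co al ws (al i) | ws i. set ws \<subseteq> Ire co al \<and> i \<in> Iim co al}"

text \<open>A representation beta = w alpha_i (w in W_re given by a word ws of real indices)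
  of a root beta in Delta^+_re \<union> Delta_im.  Then r_beta = w r_i w^{-1} is the word
  ws @ [i] @ rev ws and beta^vee(mu) = alpha_i^vee(w^{-1} mu).\<close>
definition root_rep :: "('i \<Rightarrow> 'v::real_vector \<Rightarrow> real) \<Rightarrow> ('i \<Rightarrow> 'v) \<Rightarrow> 'i list \<Rightarrow> 'i \<Rightarrow> bool" where
  "root_rep co al ws i \<longleftrightarrow> set ws \<subseteq> Ire co al \<and>
     act co al ws (al i) \<in> pos_re_roots co al \<union> im_roots co al"

definition corv :: "('i \<Rightarrow> 'v::real_vector \<Rightarrow> real) \<Rightarrow> ('i \<Rightarrow> 'v) \<Rightarrow> 'i list \<Rightarrow> 'i \<Rightarrow> 'v \<Rightarrow> real" where
  "corv co al ws i mu = co i (act co al (rev ws) mu)"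

definition rword :: "'i list \<Rightarrow> 'i \<Rightarrow> 'i list" where
  "rword ws i = ws @ [i] @ rev ws"

definition ordrr :: "('i \<Rightarrow> 'v::real_vector \<Rightarrow> real) \<Rightarrow> ('i \<Rightarrow> 'v) \<Rightarrow> 'i \<Rightarrow> 'i \<Rightarrow> nat" where
  "ordrr co al i j =
     (if \<exists>m>0. (srefl co al i \<circ> srefl co al j) ^^ m = id
      then LEAST m. m > 0 \<and> (srefl co al i \<circ> srefl co al j) ^^ m = id else 0)"

text \<open>The defining congruence of the monoid W on words.\<close>
inductive weq :: "('i \<Rightarrow> 'v::real_vector \<Rightarrow> real) \<Rightarrow> ('i \<Rightarrow> 'v) \<Rightarrow> 'i list \<Rightarrow> 'i list \<Rightarrow> bool"
  for co al where
  weq_refl: "weq co al xs xs"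
| weq_sym: "weq co al xs ys \<Longrightarrow> weq co al ys xs"
| weq_trans: "weq co al xs ys \<Longrightarrow> weq co al ys zs \<Longrightarrow> weq co al xs zs"
| weq_ctxt: "weq co al xs ys \<Longrightarrow> weq co al (as @ xs @ bs) (as @ ys @ bs)"
| weq_inv: "i \<in> Ire co al \<Longrightarrow> weq co al [i, i] []"
| weq_braid: "i \<in> Ire co al \<Longrightarrow> j \<in> Ire co al \<Longrightarrow> i \<noteq> j \<Longrightarrow> ordrr co al i j = m \<Longrightarrow>
     m \<in> {2,3,4,6} \<Longrightarrow> weq co al (concat (replicate m [i, j])) []"
| weq_comm: "i \<in> Iim co al \<Longrightarrow> j \<noteq> i \<Longrightarrow> co i (al j) = 0 \<Longrightarrow> weq co al [i, j] [j, i]"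

definition wlen :: "('i \<Rightarrow> 'v::real_vector \<Rightarrow> real) \<Rightarrow> ('i \<Rightarrow> 'v) \<Rightarrow> 'i list \<Rightarrow> nat" where
  "wlen co al w = (LEAST k. \<exists>ys. weq co al ys w \<and> length ys = k)"

definition bedge :: "('i \<Rightarrow> 'v::real_vector \<Rightarrow> real) \<Rightarrow> ('i \<Rightarrow> 'v) \<Rightarrow> 'i list \<Rightarrow> 'i list \<Rightarrow> bool" where
  "bedge co al u v \<longleftrightarrow> (\<exists>ws i. root_rep co al ws i \<and> weq co al v (rword ws i @ u) \<and>
      wlen co al v > wlen co al u)"

definition bruhat_le :: "('i \<Rightarrow> 'v::real_vector \<Rightarrow> real) \<Rightarrow> ('i \<Rightarrow> 'v) \<Rightarrow> 'i list \<Rightarrow> 'i list \<Rightarrow> bool" where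
  "bruhat_le co al u v \<longleftrightarrow> (\<exists>u'. weq co al u u' \<and> (bedge co al)\<^sup>*\<^sup>* u' v)"

definition wstep :: "('i \<Rightarrow> 'v::real_vector \<Rightarrow> real) \<Rightarrow> ('i \<Rightarrow> 'v) \<Rightarrow> 'v \<Rightarrow> 'v \<Rightarrow> bool" where
  "wstep co al mu nu \<longleftrightarrow> (\<exists>ws i. root_rep co al ws i \<and> corv co al ws i nu > 0 \<and>
      mu = act co al (rword ws i) nu)"

definition wge :: "('i \<Rightarrow> 'v::real_vector \<Rightarrow> real) \<Rightarrow> ('i \<Rightarrow> 'v) \<Rightarrow> 'v \<Rightarrow> 'v \<Rightarrow> bool" where
  "wge co al = (wstep co al)\<^sup>*\<^sup>*"

definition wgt :: "('i \<Rightarrow> 'v::real_vector \<Rightarrow> real) \<Rightarrow> ('i \<Rightarrow> 'v) \<Rightarrow> 'v \<Rightarrow> 'v \<Rightarrow> bool" where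
  "wgt co al mu nu \<longleftrightarrow> wge co al mu nu \<and> mu \<noteq> nu"

definition wcovers :: "('i \<Rightarrow> 'v::real_vector \<Rightarrow> real) \<Rightarrow> ('i \<Rightarrow> 'v) \<Rightarrow> 'v \<Rightarrow> 'v \<Rightarrow> bool" where
  "wcovers co al mu nu \<longleftrightarrow> wgt co al mu nu \<and> \<not> (\<exists>xi. wgt co al mu xi \<and> wgt co al xi nu)"

definition warrow :: "('i \<Rightarrow> 'v::real_vector \<Rightarrow> real) \<Rightarrow> ('i \<Rightarrow> 'v) \<Rightarrow> 'i list \<Rightarrow> 'i \<Rightarrow> 'v \<Rightarrow> 'v \<Rightarrow> bool" where
  "warrow co al ws i mu nu \<longleftrightarrow> root_rep co al ws i \<and> mu = act co al (rword ws i) nu \<and>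
      corv co al ws i nu > 0 \<and> wcovers co al mu nu"

text \<open>a-chain for (mu, nu) (a chain of length 0 is allowed, meaning mu = nu).\<close>
definition a_chain :: "('i \<Rightarrow> 'v::real_vector \<Rightarrow> real) \<Rightarrow> ('i \<Rightarrow> 'v) \<Rightarrow> real \<Rightarrow> 'v \<Rightarrow> 'v \<Rightarrow> bool" where
  "a_chain co al a mu nu \<longleftrightarrow> (\<exists>nus. nus \<noteq> [] \<and> hd nus = mu \<and> last nus = nu \<and>
     (\<forall>s. s + 1 < length nus \<longrightarrow> (\<exists>ws i. warrow co al ws i (nus ! s) (nus ! (s+1)) \<and>
        (i \<in> Ire co al \<longrightarrow> a * corv co al ws i (nus ! (s+1)) \<in> \<int> \<and> a * corv co al ws i (nus ! (s+1)) > 0) \<and>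
        (i \<in> Iim co al \<longrightarrow> a * corv co al ws i (nus ! (s+1)) = 1))))"

text \<open>GLS paths: (lams, as) with lams = [lambda_1,...,lambda_k], as = [a_1,...,a_k]
  (a_0 = 0 implicit).\<close>
definition is_GLS :: "('i \<Rightarrow> 'v::real_vector \<Rightarrow> real) \<Rightarrow> ('i \<Rightarrow> 'v) \<Rightarrow> 'v \<Rightarrow> 'v list \<times> real list \<Rightarrow> bool" where
  "is_GLS co al lam p \<longleftrightarrow> (let lams = fst p; as = snd p; k = length lams in
     k \<ge> 1 \<and> length as = k \<and> set lams \<subseteq> orbit co al lam \<and>
     (\<forall>s. s + 1 < k \<longrightarrow> wgt co al (lams ! s) (lams ! (s+1))) \<and>
     (\<forall>s<k. as ! s \<in> \<rat>) \<and> 0 < as ! 0 \<and> (\<forall>s. s + 1 < k \<longrightarrow> as ! s < as ! (s+1)) \<and>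
     as ! (k - 1) = 1 \<and>
     (\<forall>s. s + 1 < k \<longrightarrow> a_chain co al (as ! s) (lams ! s) (lams ! (s+1))) \<and>
     a_chain co al 1 (lams ! (k - 1)) lam)"

definition path_of :: "'v::real_vector list \<times> real list \<Rightarrow> real \<Rightarrow> 'v" where
  "path_of p t = (let lams = fst p; as = snd p; k = length lams;
       ap = (\<lambda>s. if s = 0 then 0 else as ! (s - 1));
       s = (if \<exists>s<k. t \<le> as ! s then LEAST s. s < k \<and> t \<le> as ! s else k - 1)
     in (\<Sum>l<s. (as ! l - ap l) *\<^sub>R lams ! l) + (t - ap s) *\<^sub>R lams ! s)"

definition path_line :: "'v::real_vector \<Rightarrow> real \<Rightarrow> 'v" where
  "path_line mu t = t *\<^sub>R mu"

text \<open>Concatenation pi_1 \<otimes> ... \<otimes> pi_n (paths indexed 0..n-1).\<close>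
definition tensor :: "nat \<Rightarrow> (nat \<Rightarrow> real \<Rightarrow> 'v::real_vector) \<Rightarrow> real \<Rightarrow> 'v" where
  "tensor n ps t = (let j = min (n - 1) (nat (\<lceil>real n * t\<rceil> - 1))
     in (\<Sum>l<j. ps l 1) + ps j (real n * t - real j))"

text \<open>Root operator f_i; None stands for the zero path \<zero>.\<close>
definition froot :: "('i \<Rightarrow> 'v::real_vector \<Rightarrow> real) \<Rightarrow> ('i \<Rightarrow> 'v) \<Rightarrow> 'i \<Rightarrow> (real \<Rightarrow> 'v) \<Rightarrow> (real \<Rightarrow> 'v) option" where
  "froot co al i path = (let H = (\<lambda>t. co i (path t));
      m = Inf {H t | t. t \<in> {0..1} \<and> H t \<in> \<int>};
      fp = Sup {t \<in> {0..1}. H t = m}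
    in if fp = 1 then None else
      (let fm = Inf {t \<in> {fp..1}. H t = m + 1}
       in Some (\<lambda>t. if t \<le> fp then path t
                    else if t \<le> fm then path t - (H t - m) *\<^sub>R al i
                    else path t - al i)))"

definition apply_F :: "('i \<Rightarrow> 'v::real_vector \<Rightarrow> real) \<Rightarrow> ('i \<Rightarrow> 'v) \<Rightarrow> 'i list \<Rightarrow> (real \<Rightarrow> 'v) \<Rightarrow> (real \<Rightarrow> 'v) option" where
  "apply_F co al F path = foldr (\<lambda>i acc. Option.bind acc (froot co al i)) F (Some path)"

end

theory Submission
  imports Defs "HOL-Library.Function_Algebras"
begin

text \<open>A path obtained from the straight concatenation is described by a list of segments
  \<open>(\<tau>, w)\<close>: the segment ends at time \<open>\<tau>\<close> (time running over \<open>[0, n]\<close>) and, inside the \<open>m\<close>-th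
  factor, has direction \<open>w \<lambda>_m\<close>. Conditions (1)-(4) say that such a list exists whose words
  decrease in the Bruhat order, with an \<open>a\<close>-chain at every break point.

  A root operator \<open>f_i\<close> multiplies by \<open>r_i\<close> the words of the segments between the last minimum of
  the height function and the point where it has increased by one. Integrality of the heights at
  the local minima makes the \<open>a\<close>-chains survive. To carry the Bruhat relation
  through left multiplication by an imaginary \<open>r_i\<close> it is replaced by the finer relation \<open>mv\<close>, in
  which every reflection strictly moves the weight; hence every standard path carries such data.

  Conversely the data are unwound to the straight path. If some real height function is negative
  somewhere, a real \<open>f_j\<close> can be undone. Otherwise the first segment that is not straight has a
  direction which is dominant for all letters stabilising the previous weights, and then the top
  step of its chain is a simple imaginary reflection, which can be undone as well. Each step
  lowers the height of \<open>\<Sum> \<lambda>_m - \<pi>(1)\<close> by one.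

  The facts about lengths come from the correspondence between \<open>\<ell>(r_i w) < \<ell>(w)\<close> and the sign of
  \<open>w\<^sup>-\<^sup>1 \<alpha>_i\<close>, proved by reduction to rank two.\<close>

section \<open>Cones and words\<close>

text \<open>Imaginary \<open>r_i\<close> have no inverse in the monoid, so Coxeter arguments that
  undo a letter fail for them. Signs replace those arguments: \<open>co i (al j)\<close> is never
  positive when \<open>i\<close> or \<open>j\<close> is imaginary. Hence an imaginary coroot is
  nonnegative on the orbit of a dominant weight and monotone along the order, and where it stays
  constant every reflection involved commutes with \<open>r_i\<close>. Two relations on words occur
  because the two directions ask for different things. Applying an imaginary operator multiplies a
  whole initial stretch of words by \<open>r_i\<close>. A Bruhat edge that fixes the weight carries
  no information on orthogonality to \<open>i\<close>, whereas an \<open>mv\<close> step does.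
  Undoing operators gets by with the Bruhat order: for real \<open>j\<close> the lifting property is
  enough, and for imaginary \<open>i\<close> all words up to the end of the block are replaced by
  one word. At dominant weights \<open>mv\<close> implies the Bruhat order, so both directions meet.
  Cones have real coefficients so that combinations may be divided; integrality is carried
  separately by \<open>lat\<close>.\<close>

instantiation "fun" :: (type, real_vector) real_vector
begin

text \<open>With the pointwise structure the simple coroots live in a real vector space as well, so
  \<open>comb\<close>, \<open>cone\<close> and \<open>indep\<close> serve roots and coroots
  alike.\<close>

definition scaleR_fun :: "real \<Rightarrow> ('a \<Rightarrow> 'b) \<Rightarrow> 'a \<Rightarrow> 'b" where
  "scaleR_fun r f = (\<lambda>x. r *\<^sub>R f x)"

instance
  by standard (auto simp: scaleR_fun_def fun_eq_iff scaleR_add_right scaleR_add_left)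

end

lemma scaleR_fun_apply [simp]: "(r *\<^sub>R f) x = r *\<^sub>R f x"
  by (simp add: scaleR_fun_def)

lemma sum_fun_apply: "(\<Sum>i\<in>S. f i) x = (\<Sum>i\<in>S. f i x)"
  by (induction S rule: infinite_finite_induct) auto

section \<open>Finitely supported combinations and the cones they span\<close>

definition fsup :: "('i \<Rightarrow> real) \<Rightarrow> bool" where
  "fsup k \<longleftrightarrow> finite {i. k i \<noteq> 0}"

text \<open>The sum over an infinite support takes the default value 0, which is why
  \<open>fsup\<close> accompanies \<open>comb\<close>.\<close>

definition comb :: "('i \<Rightarrow> 'u::real_vector) \<Rightarrow> ('i \<Rightarrow> real) \<Rightarrow> 'u" where
  "comb b k = (\<Sum>i | k i \<noteq> 0. k i *\<^sub>R b i)"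

definition indep :: "('i \<Rightarrow> 'u::real_vector) \<Rightarrow> bool" where
  "indep b \<longleftrightarrow> (\<forall>S c. finite S \<longrightarrow> (\<Sum>i\<in>S. c i *\<^sub>R b i) = 0 \<longrightarrow> (\<forall>i\<in>S. c i = 0))"

text \<open>\<open>cone b UNIV\<close> is the positive cone; a smaller \<open>Z\<close> records in
  which letters a positive vector is supported.\<close>

definition cone :: "('i \<Rightarrow> 'u::real_vector) \<Rightarrow> 'i set \<Rightarrow> 'u set" where
  "cone b Z = {comb b k | k. fsup k \<and> (\<forall>i. 0 \<le> k i) \<and> (\<forall>i. k i \<noteq> 0 \<longrightarrow> i \<in> Z)}"

lemma comb_superset:
  assumes "finite S" "{i. k i \<noteq> 0} \<subseteq> S" shows "comb b k = (\<Sum>i\<in>S. k i *\<^sub>R b i)"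
  unfolding comb_def by (rule sum.mono_neutral_left) (use assms in auto)

lemma fsup_add: "fsup k \<Longrightarrow> fsup l \<Longrightarrow> fsup (\<lambda>i. k i + l i)"
  unfolding fsup_def by (rule finite_subset[of _ "{i. k i \<noteq> 0} \<union> {i. l i \<noteq> 0}"]) auto

lemma fsup_diff: "fsup k \<Longrightarrow> fsup l \<Longrightarrow> fsup (\<lambda>i. k i - l i)"
  unfolding fsup_def by (rule finite_subset[of _ "{i. k i \<noteq> 0} \<union> {i. l i \<noteq> 0}"]) auto

lemma fsup_scale: "fsup k \<Longrightarrow> fsup (\<lambda>i. x * k i)"
  unfolding fsup_def by (rule finite_subset[of _ "{i. k i \<noteq> 0}"]) auto

lemma fsup_single: "fsup (\<lambda>j. if j = i then x else 0)"
  unfolding fsup_def by (rule finite_subset[of _ "{i}"]) auto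

lemma fsup_0: "fsup (\<lambda>j. 0)"
  by (simp add: fsup_def)

lemma comb_add: assumes "fsup k" "fsup l"
  shows "comb b (\<lambda>i. k i + l i) = comb b k + comb b l"
proof -
  let ?S = "{i. k i \<noteq> 0} \<union> {i. l i \<noteq> 0}"
  have f: "finite ?S" using assms by (simp add: fsup_def)
  have e: "comb b (\<lambda>i. k i + l i) = (\<Sum>i\<in>?S. (k i + l i) *\<^sub>R b i)"
    by (rule comb_superset[OF f]) auto
  have "comb b k = (\<Sum>i\<in>?S. k i *\<^sub>R b i)" by (rule comb_superset[OF f]) auto
  moreover have "comb b l = (\<Sum>i\<in>?S. l i *\<^sub>R b i)" by (rule comb_superset[OF f]) auto
  ultimately show ?thesis using e by (simp add: scaleR_add_left sum.distrib)
qed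

lemma comb_scale: assumes "fsup k" shows "comb b (\<lambda>i. x * k i) = x *\<^sub>R comb b k"
proof -
  let ?S = "{i. k i \<noteq> 0}"
  have f: "finite ?S" using assms by (simp add: fsup_def)
  have "comb b (\<lambda>i. x * k i) = (\<Sum>i\<in>?S. (x * k i) *\<^sub>R b i)" by (rule comb_superset[OF f]) auto
  then show ?thesis by (simp add: comb_def scaleR_sum_right)
qed

lemma comb_diff: assumes "fsup k" "fsup l"
  shows "comb b (\<lambda>i. k i - l i) = comb b k - comb b l"
  using comb_add[OF assms(1) fsup_scale[OF assms(2), of "-1"], of b]
    comb_scale[OF assms(2), of b "-1"] by simp

lemma comb_single: "comb b (\<lambda>j. if j = i then x else 0) = x *\<^sub>R b i"
  by (subst comb_superset[of "{i}"]) auto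

lemma comb_0: "comb b (\<lambda>j. 0) = 0"
  by (simp add: comb_def)

lemma comb_linear:
  fixes f :: "'u::real_vector \<Rightarrow> real"
  assumes "linear f" shows "f (comb b k) = (\<Sum>i | k i \<noteq> 0. k i * f (b i))"
  unfolding comb_def by (simp add: linear_sum[OF assms] linear_cmul[OF assms])

lemma comb_fun_apply: "comb b k x = (\<Sum>i | k i \<noteq> 0. k i * b i x)"
  for b :: "'i \<Rightarrow> 'v \<Rightarrow> real"
  by (simp add: comb_def sum_fun_apply)

lemma comb_inj: assumes "indep b" "fsup k" "fsup l" "comb b k = comb b l" shows "k = l"
proof -
  have "comb b (\<lambda>i. k i - l i) = 0" using comb_diff[OF assms(2,3), of b] assms(4) by simp
  moreover have "finite {i. k i - l i \<noteq> 0}" using fsup_diff[OF assms(2,3)] by (simp add: fsup_def)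
  ultimately have "\<forall>i\<in>{i. k i - l i \<noteq> 0}. k i - l i = 0"
    using assms(1)[unfolded indep_def, rule_format, of "{i. k i - l i \<noteq> 0}" "\<lambda>i. k i - l i"]
    unfolding comb_def by auto
  then show ?thesis by (auto simp: fun_eq_iff)
qed

lemma coneI: "fsup k \<Longrightarrow> (\<And>i. 0 \<le> k i) \<Longrightarrow> (\<And>i. k i \<noteq> 0 \<Longrightarrow> i \<in> Z) \<Longrightarrow> u = comb b k \<Longrightarrow> u \<in> cone b Z"
  unfolding cone_def by blast

lemma coneE:
  assumes "u \<in> cone b Z"
  obtains k where "fsup k" "\<forall>i. 0 \<le> k i" "\<forall>i. k i \<noteq> 0 \<longrightarrow> i \<in> Z" "u = comb b k"
  using assms unfolding cone_def by blast

lemma cone_0: "0 \<in> cone b Z"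
  by (rule coneI[OF fsup_0]) (simp_all add: comb_0)

lemma cone_add: assumes "u \<in> cone b Z" "v \<in> cone b Z" shows "u + v \<in> cone b Z"
proof -
  obtain k where k: "fsup k" "\<forall>i. 0 \<le> k i" "\<forall>i. k i \<noteq> 0 \<longrightarrow> i \<in> Z" "u = comb b k"
    by (rule coneE[OF assms(1)])
  obtain l where l: "fsup l" "\<forall>i. 0 \<le> l i" "\<forall>i. l i \<noteq> 0 \<longrightarrow> i \<in> Z" "v = comb b l"
    by (rule coneE[OF assms(2)])
  have "i \<in> Z" if "k i + l i \<noteq> 0" for i using that k(3) l(3) by (cases "k i = 0") auto
  then show ?thesis using k l by (intro coneI[OF fsup_add[OF k(1) l(1)]]) (simp_all add: comb_add)
qed

lemma cone_scale: assumes "u \<in> cone b Z" "0 \<le> x" shows "x *\<^sub>R u \<in> cone b Z"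
proof -
  obtain k where k: "fsup k" "\<forall>i. 0 \<le> k i" "\<forall>i. k i \<noteq> 0 \<longrightarrow> i \<in> Z" "u = comb b k"
    by (rule coneE[OF assms(1)])
  then show ?thesis using assms(2) by (intro coneI[OF fsup_scale[OF k(1), of x]]) (auto simp: comb_scale)
qed

lemma cone_base: "i \<in> Z \<Longrightarrow> b i \<in> cone b Z"
  by (rule coneI[OF fsup_single[of i 1]]) (auto simp: comb_single split: if_splits)

lemma cone_scale_base: "i \<in> Z \<Longrightarrow> 0 \<le> x \<Longrightarrow> x *\<^sub>R b i \<in> cone b Z"
  by (simp add: cone_base cone_scale)

lemma cone_mono: "Z \<subseteq> Y \<Longrightarrow> cone b Z \<subseteq> cone b Y"
  unfolding cone_def by blast

lemma cone_linear_nonpos: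
  fixes f :: "'u::real_vector \<Rightarrow> real"
  assumes "u \<in> cone b Z" "linear f" "\<And>i. i \<in> Z \<Longrightarrow> f (b i) \<le> 0" shows "f u \<le> 0"
  using assms(1,3)
  by (elim coneE) (auto simp: comb_linear[OF assms(2)] intro!: sum_nonpos simp: mult_nonneg_nonpos)

lemma cone_fun_nonneg:
  fixes b :: "'i \<Rightarrow> 'v \<Rightarrow> real"
  assumes "\<phi> \<in> cone b Z" "\<And>i. i \<in> Z \<Longrightarrow> 0 \<le> b i x" shows "0 \<le> \<phi> x"
  using assms by (elim coneE) (auto simp: comb_fun_apply intro!: sum_nonneg)

lemma cone_fun_nonpos:
  fixes b :: "'i \<Rightarrow> 'v \<Rightarrow> real"
  assumes "\<phi> \<in> cone b Z" "\<And>i. i \<in> Z \<Longrightarrow> b i x \<le> 0" shows "\<phi> x \<le> 0"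
  using assms
  by (elim coneE) (auto simp: comb_fun_apply intro!: sum_nonpos simp: mult_nonneg_nonpos)

text \<open>Independence makes coefficients unique, and two nonnegative families with sum 0 both
  vanish: the cone is pointed.\<close>

lemma cone_antisym: assumes "indep b" "u \<in> cone b Z" "- u \<in> cone b Y" shows "u = 0"
proof -
  obtain k l where kl: "fsup k" "fsup l" "\<forall>i. 0 \<le> k i" "\<forall>i. 0 \<le> l i" "u = comb b k" "- u = comb b l"
    using assms(2,3) by (elim coneE) blast
  have "comb b (\<lambda>i. k i + l i) = comb b (\<lambda>i. 0)" using comb_add[OF kl(1,2), of b] kl(5) kl(6)[symmetric] by (simp add: comb_0)
  then have "(\<lambda>i. k i + l i) = (\<lambda>i. 0)"
    using comb_inj[OF assms(1) fsup_add[OF kl(1,2)] fsup_0] by simp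
  then have "k = (\<lambda>i. 0)" using kl(3,4) by (auto simp: fun_eq_iff add_nonneg_eq_0_iff)
  then show ?thesis using kl(5) comb_0 by simp
qed

lemma cone_add_eq_0: assumes "indep b" "u \<in> cone b Z" "v \<in> cone b Y" "u + v = 0" shows "u = 0" "v = 0"
proof -
  have "- u = v" using assms(4) by (simp add: minus_unique)
  then show "u = 0" using cone_antisym[OF assms(1,2)] assms(3) by simp
  then show "v = 0" using assms(4) by simp
qed

text \<open>Nonnegative coefficients cannot cancel, so the support of a summand lies in that of the
  sum. This is how a bound on a difference of weights passes to a single root of a chain.\<close>

lemma cone_add_restrict:
  assumes "indep b" "u \<in> cone b UNIV" "v \<in> cone b UNIV" "u + v \<in> cone b Z" shows "u \<in> cone b Z"
proof -
  obtain k l m where kl: "fsup k" "fsup l" "fsup m" "\<forall>i. 0 \<le> k i" "\<forall>i. 0 \<le> l i" "u = comb b k" "v = comb b l"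
     "u + v = comb b m" "\<forall>i. m i \<noteq> 0 \<longrightarrow> i \<in> Z"
    using assms(2-4) by (elim coneE) blast
  have "comb b (\<lambda>i. k i + l i) = comb b m" using comb_add[OF kl(1,2), of b] kl by simp
  then have *: "(\<lambda>i. k i + l i) = m"
    using comb_inj[OF assms(1) fsup_add[OF kl(1,2)] kl(3)] by simp
  have "i \<in> Z" if "k i \<noteq> 0" for i
  proof -
    have "k i + l i \<noteq> 0" using that kl(4,5) by (simp add: add_nonneg_eq_0_iff)
    then have "m i \<noteq> 0" using * by auto
    then show ?thesis using kl(9) by blast
  qed
  then show ?thesis using kl by (intro coneI[of k]) auto
qed

section \<open>Words acting by reflections; alternating words\<close>

lemma act_Nil [simp]: "act c b [] u = u" by (simp add: act_def)
lemma act_Cons [simp]: "act c b (i # w) u = srefl c b i (act c b w u)" by (simp add: act_def)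
lemma act_append [simp]: "act c b (x @ y) u = act c b x (act c b y u)" by (simp add: act_def)

lemma linear_srefl:
  fixes c :: "'i \<Rightarrow> 'u::real_vector \<Rightarrow> real"
  shows "linear (c i) \<Longrightarrow> linear (srefl c b i)"
  unfolding srefl_def
  by (rule linearI) (simp_all add: linear_add linear_cmul algebra_simps)

lemma linear_act:
  fixes c :: "'i \<Rightarrow> 'u::real_vector \<Rightarrow> real" and b :: "'i \<Rightarrow> 'u"
  assumes "\<And>i. linear (c i)" shows "linear (act c b w)"
proof (induction w)
  case Nil
  have "act c b [] = (\<lambda>x. x)" by (simp add: fun_eq_iff)
  then show ?case by (simp add: linear_ident)
next
  case (Cons i w)
  have "act c b (i # w) = srefl c b i \<circ> act c b w" by (simp add: fun_eq_iff)
  then show ?case using linear_compose[OF Cons linear_srefl[where c = c and i = i and b = b, OF assms]]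
    by (simp only:)
qed

text \<open>Alternating words are what remains of a word in two real letters when equal neighbours
  are cancelled.\<close>

fun alt :: "'i \<Rightarrow> 'i \<Rightarrow> nat \<Rightarrow> 'i list" where
  "alt i j 0 = []"
| "alt i j (Suc n) = i # alt j i n"

lemma length_alt [simp]: "length (alt i j n) = n"
  by (induction n arbitrary: i j) auto

lemma set_alt: "set (alt i j n) \<subseteq> {i, j}"
  by (induction n arbitrary: i j) (simp, fastforce)

lemma alt_add: "alt i j (m + d) = alt i j m @ (if even m then alt i j d else alt j i d)"
  by (induction m arbitrary: i j) auto

lemma distinct_adj_alt:
  "distinct_adj g \<Longrightarrow> set g \<subseteq> {i, j} \<Longrightarrow> g = [] \<or> hd g = i \<Longrightarrow> g = alt i j (length g)"
proof (induction g arbitrary: i j)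
  case (Cons a g)
  have "g = [] \<or> hd g = j"
    using Cons.prems by (cases g) auto
  moreover have "distinct_adj g" using Cons.prems(1) by (cases g) auto
  ultimately have "g = alt j i (length g)" using Cons.IH[of j i] Cons.prems(2) by auto
  then show ?case using Cons.prems(3) by simp
qed simp

section \<open>The datum, the congruence of words and the length function\<close>

locale bc =
  fixes co :: "'i::countable \<Rightarrow> 'v::real_vector \<Rightarrow> real" and al :: "'i \<Rightarrow> 'v" and P :: "'v set"
  assumes datum: "bc_datum co al P"
begin

abbreviation Re where "Re \<equiv> Ire co al"
abbreviation Im where "Im \<equiv> Iim co al"
abbreviation W where "W \<equiv> act co al"
abbreviation r where "r \<equiv> srefl co al"
abbreviation weqv (infix "\<approx>" 50) where "u \<approx> v \<equiv> weq co al u v"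
abbreviation len where "len \<equiv> wlen co al"

lemma lin_co: "linear (co i)" using datum by (simp add: bc_datum_def)

lemma co_simps [simp]:
  "co i (x + y) = co i x + co i y" "co i (x - y) = co i x - co i y" "co i (s *\<^sub>R x) = s * co i x"
  "co i (- x) = - co i x" "co i 0 = 0"
  using lin_co[of i] by (simp_all add: linear_add linear_diff linear_cmul linear_neg linear_0)

lemma indep_al: "indep al" using datum by (simp add: bc_datum_def indep_def)

lemma indep_co: "indep co"
proof -
  have "\<forall>i\<in>S. c i = 0" if "finite S" "(\<Sum>i\<in>S. c i *\<^sub>R co i) = 0" for S c
  proof -
    have "(\<Sum>i\<in>S. c i * co i x) = 0" for x
      using fun_cong[OF that(2), of x] by (simp add: sum_fun_apply)
    moreover have "\<forall>S c. finite S \<longrightarrow> (\<forall>x. (\<Sum>i\<in>S. c i * co i x) = 0) \<longrightarrow> (\<forall>i\<in>S. c i = 0)"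
      using datum unfolding bc_datum_def by (elim conjE)
    ultimately show ?thesis using that(1) by (elim allE[of _ S] allE[of _ c]) simp
  qed
  then show ?thesis unfolding indep_def by simp
qed

lemma int_co: "x \<in> P \<Longrightarrow> co i x \<in> \<int>" using datum by (simp add: bc_datum_def)
lemma al_P: "al i \<in> P" using datum by (simp add: bc_datum_def)
lemma co_al_int: "co i (al j) \<in> \<int>" by (simp add: int_co al_P)
lemma co_al_offdiag: "i \<noteq> j \<Longrightarrow> co i (al j) \<le> 0" using datum by (simp add: bc_datum_def)
lemma co_al_sym: "co i (al j) = 0 \<longleftrightarrow> co j (al i) = 0" using datum by (simp add: bc_datum_def)
lemma co_al_Re: "i \<in> Re \<Longrightarrow> co i (al i) = 2" by (simp add: Ire_def)
lemma Im_iff: "i \<in> Im \<longleftrightarrow> i \<notin> Re" by (simp add: Iim_def)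
lemma co_al_Im: "i \<in> Im \<Longrightarrow> co i (al i) \<le> 0"
  using datum by (auto simp: bc_datum_def Iim_def Ire_def)
lemma co_Im_nonpos: "i \<in> Im \<Longrightarrow> co i (al j) \<le> 0"
  by (cases "i = j") (simp_all add: co_al_Im co_al_offdiag)
lemma co_al_Im_nonpos: "j \<in> Im \<Longrightarrow> co i (al j) \<le> 0"
  by (cases "i = j") (simp_all add: co_al_Im co_al_offdiag)
lemma al_nonzero: "al i \<noteq> 0"
  using comb_inj[OF indep_al fsup_single[of i 1] fsup_0] comb_single[of al i 1] comb_0[of al]
  by (auto simp: fun_eq_iff split: if_splits)

lemma srefl_Re_Re [simp]: "i \<in> Re \<Longrightarrow> r i (r i x) = x"
  by (simp add: srefl_def co_al_Re algebra_simps flip: scaleR_add_left)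

lemma W_lin: "linear (W w)" using lin_co by (rule linear_act)
lemmas W_diff = linear_diff[OF W_lin]
  and W_scale = linear_cmul[OF W_lin] and W_neg = linear_neg[OF W_lin] and W_0 [simp] = linear_0[OF W_lin]

lemma W_rev [simp]: "set w \<subseteq> Re \<Longrightarrow> W (rev w) (W w x) = x"
  by (induction w arbitrary: x) auto

lemma W_rev' [simp]: "set w \<subseteq> Re \<Longrightarrow> W w (W (rev w) x) = x"
  using W_rev[of "rev w" x] by simp

text \<open>An imaginary \<open>r i\<close> is not an involution, but it multiplies
  \<open>al i\<close> by \<open>1 - co i (al i)\<close>, which is at least 1, and so it is still
  onto.\<close>

lemma srefl_surj: "\<exists>x. r i x = y"
proof (cases "i \<in> Re")
  case True
  then show ?thesis by (intro exI[of _ "r i y"]) simp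
next
  case False
  then have n: "1 - co i (al i) > 0" using co_al_Im[of i] Im_iff by force
  define x where "x = y + (co i y / (1 - co i (al i))) *\<^sub>R al i"
  have "co i x = co i y / (1 - co i (al i))"
    using n by (simp add: x_def field_simps)
  then have "r i x = y" by (simp add: srefl_def x_def)
  then show ?thesis by blast
qed

lemma W_surj: "\<exists>x. W w x = y"
proof (induction w arbitrary: y)
  case (Cons i w)
  then show ?case using srefl_surj[of i y] by (metis act_Cons)
qed simp

lemma weq_refl' [simp]: "x \<approx> x" by (rule weq_refl)
lemma weq_append: "a \<approx> b \<Longrightarrow> c \<approx> d \<Longrightarrow> a @ c \<approx> b @ d"
  using weq_ctxt[of co al a b "[]" c] weq_ctxt[of co al c d b "[]"] weq_trans[of co al "a @ c" "b @ c" "b @ d"]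
  by simp
lemma weq_Cons: "a \<approx> b \<Longrightarrow> i # a \<approx> i # b"
  using weq_append[of "[i]" "[i]" a b] by simp
lemmas weq_tr [trans] = weq_trans[of co al]
lemma weq_cancel2: "i \<in> Re \<Longrightarrow> i # i # w \<approx> w"
  using weq_append[OF weq_inv, of i w w] by simp
lemma weq_rev_cancel: "set w \<subseteq> Re \<Longrightarrow> rev w @ w \<approx> []"
proof (induction w)
  case (Cons i w)
  have "rev w @ [i, i] @ w \<approx> rev w @ [] @ w"
    using Cons by (intro weq_ctxt weq_inv) auto
  moreover have "rev w @ w \<approx> []" using Cons by simp
  ultimately show ?case using weq_trans by fastforce
qed simp
lemma weq_rev_cancel': "set w \<subseteq> Re \<Longrightarrow> w @ rev w \<approx> []"
  using weq_rev_cancel[of "rev w"] by simp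
lemma weq_left_cancel: assumes "set g \<subseteq> Re" "g @ x \<approx> y" shows "x \<approx> rev g @ y"
proof -
  have "x \<approx> rev g @ g @ x"
    using weq_append[OF weq_rev_cancel[OF assms(1)], of x x] by (simp add: weq_sym)
  also have "\<dots> \<approx> rev g @ y" using assms(2) by (simp add: weq_append)
  finally show ?thesis .
qed

lemma weq_act: "x \<approx> y \<Longrightarrow> W x v = W y v"
proof (induction x y arbitrary: v rule: weq.induct)
  case (weq_braid i j m)
  \<comment> \<open>\<open>ordrr\<close> returns 0 for infinite order, so a nonzero value comes from
    the \<open>LEAST\<close> branch.\<close>
  then have "m = ordrr co al i j" "m \<noteq> 0" by auto
  then have ex: "\<exists>m>0. (r i \<circ> r j) ^^ m = id" unfolding ordrr_def by presburger
  then have "m = (LEAST m. m > 0 \<and> (r i \<circ> r j) ^^ m = id)" 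
    using \<open>m = _\<close> unfolding ordrr_def by simp
  then have "(r i \<circ> r j) ^^ m = id" using LeastI_ex[OF ex] by simp
  moreover have "W (concat (replicate k [i, j])) v = ((r i \<circ> r j) ^^ k) v" for k
    by (induction k) auto
  ultimately show ?case by simp
next
  case (weq_comm i j)
  then have "co j (al i) = 0" using co_al_sym by blast
  then show ?case using weq_comm by (simp add: srefl_def algebra_simps)
qed auto

text \<open>Reversal is an anti-automorphism of the monoid and replaces the inverse, with which it
  agrees on real words. A reversed braid relation is the inverse of a real word equal to 1, hence
  also equal to 1.\<close>

lemma weq_rev: "x \<approx> y \<Longrightarrow> rev x \<approx> rev y"
proof (induction x y rule: weq.induct)
  case (weq_ctxt xs ys as bs)
  then show ?case using weq.weq_ctxt[OF weq_ctxt(2), of "rev bs" "rev as"] by simp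
next
  case (weq_braid i j m)
  let ?w = "concat (replicate m [i, j])"
  have w: "?w \<approx> []" using weq.weq_braid[OF weq_braid] .
  have s: "set ?w \<subseteq> Re" using weq_braid by auto
  have "?w @ rev ?w \<approx> []" using weq_rev_cancel'[OF s] .
  moreover have "?w @ rev ?w \<approx> [] @ rev ?w" using w by (intro weq_append) auto
  ultimately show ?case using weq_trans[OF weq_sym] by fastforce
next
  case (weq_comm i j)
  show ?case using weq.weq_sym[OF weq.weq_comm[OF weq_comm]] by simp
next
  case (weq_trans xs ys zs)
  show ?case by (rule weq.weq_trans[OF weq_trans(3,4)])
qed (simp_all add: weq_inv weq_sym)

text \<open>Every relation preserves the parity of the length; this excludes equal lengths of
  \<open>w\<close> and \<open>i # w\<close>.\<close>

lemma weq_even: "x \<approx> y \<Longrightarrow> even (length x) = even (length y)"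
proof (induction x y rule: weq.induct)
  case (weq_braid i j m)
  have "even (length (concat (replicate m [i, j])))" by (induction m) auto
  then show ?case by simp
qed auto

text \<open>Imaginary letters occur only in the commutation relations, so their multiplicities are
  invariants of the monoid element.\<close>

lemma weq_count_Im: assumes "x \<approx> y" "k \<in> Im" shows "count_list x k = count_list y k"
  using assms(1)
proof (induction x y rule: weq.induct)
  case (weq_inv i)
  then show ?case using assms(2) by (auto simp: Im_iff)
next
  case (weq_braid i j m)
  have "count_list (concat (replicate m [i, j])) k = 0" using weq_braid(1,2) assms(2) by (induction m) (auto simp: Im_iff)
  then show ?case by simp
qed simp_all

lemma weq_real: assumes "x \<approx> y" "set x \<subseteq> Re" shows "set y \<subseteq> Re"
proof
  fix k assume k: "k \<in> set y"
  show "k \<in> Re"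
  proof (rule ccontr)
    assume n: "k \<notin> Re"
    then have "count_list x k = 0" using assms(2) by (auto simp: count_list_0_iff)
    then show False using weq_count_Im[OF assms(1), of k] n k by (auto simp: Im_iff count_list_0_iff)
  qed
qed

lemma len_le: "y \<approx> w \<Longrightarrow> len w \<le> length y"
  unfolding wlen_def by (rule Least_le) auto

lemma len_ex: "\<exists>y. y \<approx> w \<and> length y = len w"
  unfolding wlen_def by (rule LeastI_ex[of "\<lambda>k. \<exists>y. y \<approx> w \<and> length y = k"]) (use weq_refl' in blast)

lemma len_cong: assumes "x \<approx> y" shows "len x = len y"
  using assms len_ex[of x] len_ex[of y] len_le
  by (metis le_antisym weq_sym weq_trans)

lemma len_append_le: "len (x @ y) \<le> length x + len y"
proof -
  obtain z where "z \<approx> y" "length z = len y" using len_ex by blast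
  then show ?thesis using len_le[of "x @ z" "x @ y"] weq_append[of x x z y] by simp
qed

lemma len_Cons_le: "len (i # y) \<le> Suc (len y)" using len_append_le[of "[i]" y] by simp

lemma len_Nil [simp]: "len [] = 0" using len_le[of "[]" "[]"] by simp

lemma len_0: "len w = 0 \<Longrightarrow> w \<approx> []"
  using len_ex[of w] weq_sym by auto

lemma len_even: "even (len w) = even (length w)"
  using len_ex[of w] weq_even by metis

lemma len_Cons_ne: "len (i # w) \<noteq> len w"
  using len_even[of "i # w"] len_even[of w] by auto

lemma len_Cons_Re: assumes "i \<in> Re" shows "len (i # w) = Suc (len w) \<or> len w = Suc (len (i # w))"
proof -
  have "len w \<le> Suc (len (i # w))"
    using len_Cons_le[of i "i # w"] len_cong[OF weq_cancel2[OF assms, of w]] by simp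
  then show ?thesis using len_Cons_le[of i w] len_Cons_ne[of i w] by linarith
qed

lemma len_pos_split: assumes "len w > 0"
  shows "\<exists>i w'. w \<approx> i # w' \<and> len w = Suc (len w') \<and> length w' = len w'"
proof -
  obtain y where y: "y \<approx> w" "length y = len w" using len_ex by blast
  obtain i w' where [simp]: "y = i # w'" using y(2) assms by (cases y) auto
  have "len w' \<le> length w'" using len_le[OF weq_refl'] .
  moreover have "len w \<le> Suc (len w')" using len_cong[OF y(1)] len_Cons_le[of i w'] by simp
  ultimately show ?thesis using y by (intro exI[of _ i] exI[of _ w']) (auto intro: weq_sym)
qed

lemma red_tl: "len (i # w) = length (i # w) \<Longrightarrow> len w = length w \<and> len (i # w) > len w"
  using len_le[OF weq_refl', of w] len_Cons_le[of i w] by simp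

end

lemma not_distinct_adj: "\<not> distinct_adj g \<Longrightarrow> \<exists>x a y. g = x @ [a, a] @ y"
proof (induction g)
  case (Cons i g)
  show ?case
  proof (cases "distinct_adj g")
    case True
    then obtain g' where "g = i # g'" using Cons.prems by (cases g) auto
    then show ?thesis by (metis append_Cons append_Nil)
  next
    case False
    then obtain x a y where "g = x @ [a, a] @ y" using Cons.IH by blast
    then show ?thesis by (metis append_Cons)
  qed
qed simp

lemma rev_alt: "rev (alt i j n) = (if even n then alt j i n else alt i j n)"
proof (induction n arbitrary: i j)
  case (Suc n)
  show ?case using Suc[of j i] Suc[of i j] alt_add[of i j n 1] alt_add[of j i n 1] by auto
qed simp

lemma concat_replicate_alt: "concat (replicate m [i, j]) = alt i j (2 * m)"
  by (induction m) auto

section \<open>Lengths and signs of roots\<close>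

text \<open>Coefficients of a vector \<open>p b_i + q b_j\<close> under alternating reflections, where
  \<open>x\<close> and \<open>y\<close> are the negatives of the two off-diagonal entries of the Cartan matrix.\<close>

fun dq :: "real \<Rightarrow> real \<Rightarrow> real \<Rightarrow> real \<Rightarrow> nat \<Rightarrow> real \<times> real" where
  "dq x y p q 0 = (p, q)"
| "dq x y p q (Suc k) = prod.swap (dq y x (x * p - q) p k)"

text \<open>The hypothesis \<open>2 * q \<le> x * p\<close> makes the induction run: it gives
  \<open>x * p - q \<ge> x * p / 2\<close>, hence \<open>y * (x * p - q) \<ge> 2 * p\<close>, the
  same condition after the swap.\<close>

lemma dq_infinite:
  assumes "4 \<le> x * y" "0 \<le> x" "0 \<le> y" "0 \<le> p" "0 \<le> q" "2 * q \<le> x * p"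
  shows "0 \<le> fst (dq x y p q k) \<and> 0 \<le> snd (dq x y p q k)"
  using assms
proof (induction k arbitrary: x y p q)
  case (Suc k)
  have "4 * p \<le> (x * y) * p" using Suc.prems by (intro mult_right_mono) auto
  moreover have "y * (2 * q) \<le> y * (x * p)" using Suc.prems by (intro mult_left_mono) auto
  ultimately have "2 * p \<le> y * (x * p - q)" by (simp add: algebra_simps)
  then have "0 \<le> fst (dq y x (x * p - q) p k) \<and> 0 \<le> snd (dq y x (x * p - q) p k)"
    using Suc.prems by (intro Suc.IH) (auto simp: mult.commute)
  then show ?case by simp
qed simp

text \<open>The finite rank-two types A1 x A1, A2, B2 and G2, the last two in both orientations,
  checked by computation; \<open>m\<close> is the order of the product of the two
  reflections.\<close>

lemma dq_small:
  assumes "(x, y, m) \<in> {(0,0,2::nat), (1,1,3), (1,2,4), (2,1,4), (1,3,6), (3,1,6)}" "k < m"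
  shows "0 \<le> fst (dq x y 1 0 k) \<and> 0 \<le> snd (dq x y 1 0 k)"
proof -
  consider "x = 0" "y = 0" "m = 2" | "x = 1" "y = 1" "m = 3" | "x = 1" "y = 2" "m = 4"
    | "x = 2" "y = 1" "m = 4" | "x = 1" "y = 3" "m = 6" | "x = 3" "y = 1" "m = 6"
    using assms(1) by (elim insertE emptyE) simp_all
  then show ?thesis using assms(2)
    by cases (simp_all add: eval_nat_numeral less_Suc_eq, (elim disjE; simp)+)
qed

text \<open>Coordinates, along two simple roots, of the displacement of a vector under the
  \<open>n\<close>-th power of the product of their reflections. \<open>f\<close> and
  \<open>g\<close> are the coroot values of the vector, \<open>x\<close> and \<open>y\<close> the
  negated off-diagonal entries.\<close>

fun itr :: "real \<Rightarrow> real \<Rightarrow> real \<Rightarrow> real \<Rightarrow> nat \<Rightarrow> real \<times> real" where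
  "itr x y f g 0 = (0, 0)"
| "itr x y f g (Suc n) = (let q = y * fst (itr x y f g n) - snd (itr x y f g n) - g
     in (x * q - fst (itr x y f g n) - f, q))"

lemma Ints_ge_1: "x \<in> \<int> \<Longrightarrow> 0 < x \<Longrightarrow> 1 \<le> x" for x :: real
  by (auto elim!: Ints_cases)

lemma Ints_mult_small:
  fixes x y :: real
  assumes "x \<in> \<int>" "y \<in> \<int>" "0 \<le> x" "0 \<le> y" "x = 0 \<longleftrightarrow> y = 0" "x * y < 4"
  shows "(x, y) \<in> {(0,0), (1,1), (1,2), (2,1), (1,3), (3,1)}"
proof -
  obtain a b :: int where ab: "x = of_int a" "y = of_int b" using assms by (auto elim!: Ints_cases)
  have 0: "a \<ge> 0" "b \<ge> 0" "a = 0 \<longleftrightarrow> b = 0" using assms ab by auto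
  have p: "a * b < 4" using assms(6) ab by (metis of_int_less_numeral_iff of_int_mult)
  show ?thesis
  proof (cases "a = 0")
    case False
    then have "a \<ge> 1" "b \<ge> 1" using 0 by auto
    then have "a * 1 \<le> a * b" "1 * b \<le> a * b" by (intro mult_left_mono mult_right_mono; simp)+
    then have "a \<le> 3" "b \<le> 3" using p by linarith+
    then have "a \<in> {1,2,3}" "b \<in> {1,2,3}" using \<open>a \<ge> 1\<close> \<open>b \<ge> 1\<close> by auto
    then show ?thesis using p ab by auto
  qed (use 0 ab in auto)
qed

context bc
begin

section \<open>Rank two: the order of a product of two real reflections\<close>

lemma co_al_neg: "co i (al j) \<noteq> 0 \<Longrightarrow> co i (al j) \<le> 0 \<Longrightarrow> co i (al j) \<le> -1"
  using Ints_ge_1[of "- co i (al j)"] co_al_int[of i j] by simp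

lemma al_pair_indep: assumes "i \<noteq> j" "p *\<^sub>R al i + q *\<^sub>R al j = 0" shows "p = 0 \<and> q = 0"
proof -
  have "comb al (\<lambda>l. (if l = i then p else 0) + (if l = j then q else 0)) = comb al (\<lambda>l. 0)"
    using assms(2) by (simp add: comb_add fsup_single comb_single comb_0)
  then have "(\<lambda>l. (if l = i then p else 0) + (if l = j then q else 0)) = (\<lambda>l. 0)"
    by (intro comb_inj[OF indep_al]) (simp_all add: fsup_add fsup_single fsup_0)
  then show ?thesis using assms(1) by (auto dest: fun_cong[of _ _ i] fun_cong[of _ _ j])
qed

lemma srefl_pair:
  assumes "j \<in> Re"
  shows "r j (v + p *\<^sub>R al i + q *\<^sub>R al j) = v + p *\<^sub>R al i + (- co j (al i) * p - q - co j v) *\<^sub>R al j"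
proof -
  have "co j (v + p *\<^sub>R al i + q *\<^sub>R al j) = q - (- co j (al i) * p - q - co j v)"
    using co_al_Re[OF assms] by simp
  then show ?thesis unfolding srefl_def by (simp only: scaleR_left_diff_distrib) simp
qed

lemma srefl_pair':
  assumes "j \<in> Re"
  shows "r j (v + q *\<^sub>R al j + p *\<^sub>R al i) = v + (- co j (al i) * p - q - co j v) *\<^sub>R al j + p *\<^sub>R al i"
proof -
  have e: "v + s *\<^sub>R al j + p *\<^sub>R al i = v + p *\<^sub>R al i + s *\<^sub>R al j" for s by (simp add: add_ac)
  show ?thesis unfolding e by (rule srefl_pair[OF assms])
qed

lemma funpow_itr:
  assumes "i \<in> Re" "j \<in> Re"
  shows "((r i \<circ> r j) ^^ k) v = v + fst (itr (- co i (al j)) (- co j (al i)) (co i v) (co j v) k) *\<^sub>R al i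
    + snd (itr (- co i (al j)) (- co j (al i)) (co i v) (co j v) k) *\<^sub>R al j"
proof (induction k)
  case (Suc k)
  let ?p = "fst (itr (- co i (al j)) (- co j (al i)) (co i v) (co j v) k)"
  let ?q = "snd (itr (- co i (al j)) (- co j (al i)) (co i v) (co j v) k)"
  have e: "((r i \<circ> r j) ^^ Suc k) v = r i (r j (v + ?p *\<^sub>R al i + ?q *\<^sub>R al j))"
    by (subst funpow.simps(2), subst comp_apply, subst Suc, subst comp_apply, rule refl)
  show ?case unfolding e srefl_pair[OF assms(2)] srefl_pair'[OF assms(1)] by (simp add: Let_def)
qed simp

text \<open>A power of the product moves vectors only along \<open>al i\<close> and
  \<open>al j\<close>, so its triviality is read off from two coefficients. For exponents below
  \<open>m\<close> the test vector is \<open>al i\<close>, with coroot values 2 and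
  \<open>co j (al i)\<close>.\<close>

lemma ordrr_eqI:
  assumes "i \<in> Re" "j \<in> Re" "i \<noteq> j" "0 < m"
    "\<And>f g. itr (- co i (al j)) (- co j (al i)) f g m = (0, 0)"
    "\<And>k. 0 < k \<Longrightarrow> k < m \<Longrightarrow> itr (- co i (al j)) (- co j (al i)) 2 (co j (al i)) k \<noteq> (0, 0)"
  shows "ordrr co al i j = m"
proof -
  have 1: "(r i \<circ> r j) ^^ m = id"
    using funpow_itr[OF assms(1,2), of m] assms(5) by (auto simp: fun_eq_iff)
  have 2: "(r i \<circ> r j) ^^ k \<noteq> id" if "0 < k" "k < m" for k
  proof
    assume "(r i \<circ> r j) ^^ k = id"
    then have "((r i \<circ> r j) ^^ k) (al i) = al i" by simp
    then have "fst (itr (- co i (al j)) (- co j (al i)) 2 (co j (al i)) k) *\<^sub>R al i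
      + snd (itr (- co i (al j)) (- co j (al i)) 2 (co j (al i)) k) *\<^sub>R al j = 0"
      using funpow_itr[OF assms(1,2), of k "al i"] co_al_Re[OF assms(1)] by (simp add: add.assoc)
    then show False using al_pair_indep[OF assms(3)] assms(6)[OF that] by (metis prod.collapse)
  qed
  have "(LEAST m. m > 0 \<and> (r i \<circ> r j) ^^ m = id) = m"
    using 1 2 assms(4) by (intro Least_equality) (auto simp: not_less[symmetric])
  then show ?thesis using 1 assms(4) unfolding ordrr_def by auto
qed

lemma ordrr_small:
  assumes "i \<in> Re" "j \<in> Re" "i \<noteq> j" "co i (al j) * co j (al i) < 4"
  shows "(- co i (al j), - co j (al i), ordrr co al i j) \<in>
     {(0,0,2), (1,1,3), (1,2,4), (2,1,4), (1,3,6), (3,1,6)}"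
proof -
  define x y where xy: "x = - co i (al j)" "y = - co j (al i)"
  have "(x, y) \<in> {(0,0), (1,1), (1,2), (2,1), (1,3), (3,1)}"
    using assms co_al_int co_al_offdiag co_al_sym[of i j] unfolding xy
    by (intro Ints_mult_small) auto
  moreover have "ordrr co al i j = m"
    if "0 < m" "\<And>f g. itr x y f g m = (0,0)" "\<And>k. 0 < k \<Longrightarrow> k < m \<Longrightarrow> itr x y 2 (- y) k \<noteq> (0,0)" for m
    using ordrr_eqI[OF assms(1-3) that(1)] that(2,3) unfolding xy by simp
  moreover have "k \<in> {1}" if "0 < k" "k < 2" for k :: nat using that by auto
  moreover have "k \<in> {1,2}" if "0 < k" "k < 3" for k :: nat using that by auto
  moreover have "k \<in> {1,2,3}" if "0 < k" "k < 4" for k :: nat using that by auto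
  moreover have "k \<in> {1,2,3,4,5}" if "0 < k" "k < 6" for k :: nat using that by auto
  ultimately show ?thesis unfolding xy[symmetric]
  proof -
    assume o: "\<And>m. 0 < m \<Longrightarrow> (\<And>f g. itr x y f g m = (0,0)) \<Longrightarrow>
       (\<And>k. 0 < k \<Longrightarrow> k < m \<Longrightarrow> itr x y 2 (- y) k \<noteq> (0,0)) \<Longrightarrow> ordrr co al i j = m"
    assume "(x, y) \<in> {(0,0), (1,1), (1,2), (2,1), (1,3), (3,1)}"
    then consider "x = 0" "y = 0" | "x = 1" "y = 1" | "x = 1" "y = 2" | "x = 2" "y = 1" | "x = 1" "y = 3" | "x = 3" "y = 1"
      by auto
    then show "(x, y, ordrr co al i j) \<in> {(0,0,2), (1,1,3), (1,2,4), (2,1,4), (1,3,6), (3,1,6)}"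
    proof cases
      case 1
      then have "ordrr co al i j = 2" by (intro o) (auto simp: eval_nat_numeral less_Suc_eq Let_def)
      then show ?thesis using 1 by simp
    next
      case 2
      then have "ordrr co al i j = 3" by (intro o) (auto simp: eval_nat_numeral less_Suc_eq Let_def)
      then show ?thesis using 2 by simp
    next
      case 3
      then have "ordrr co al i j = 4" by (intro o) (auto simp: eval_nat_numeral less_Suc_eq Let_def algebra_simps)
      then show ?thesis using 3 by simp
    next
      case 4
      then have "ordrr co al i j = 4" by (intro o) (auto simp: eval_nat_numeral less_Suc_eq Let_def algebra_simps)
      then show ?thesis using 4 by simp
    next
      case 5
      then have "ordrr co al i j = 6" by (intro o) (auto simp: eval_nat_numeral less_Suc_eq Let_def algebra_simps)
      then show ?thesis using 5 by simp
    next
      case 6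
      then have "ordrr co al i j = 6" by (intro o) (auto simp: eval_nat_numeral less_Suc_eq Let_def algebra_simps)
      then show ?thesis using 6 by simp
    qed
  qed
qed

text \<open>Half of the braid word is moved to the other side, where reversal turns it into an
  alternating word again; its first letter depends on the parity of \<open>m\<close>, but the
  resulting equality is the same.\<close>

lemma weq_alt:
  assumes "i \<in> Re" "j \<in> Re" "i \<noteq> j" "ordrr co al i j = m" "m \<in> {2,3,4,6}"
  shows "alt i j m \<approx> alt j i m"
proof -
  have s: "set (alt i j m) \<subseteq> Re" using set_alt[of i j m] assms by auto
  have "alt i j m @ (if even m then alt i j m else alt j i m) \<approx> []"
    using weq_braid[OF assms] alt_add[of i j m m] by (simp add: concat_replicate_alt mult_2)
  from weq_left_cancel[OF s this] show ?thesis by (auto simp: rev_alt intro: weq_sym split: if_splits)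
qed

end

text \<open>The parameter \<open>b\<close> is instantiated both by the simple roots and by the simple coroots; the
  matrix is transposed in the second case.\<close>

locale refl_rep = bc co al P
  for co :: "'i::countable \<Rightarrow> 'v::real_vector \<Rightarrow> real" and al :: "'i \<Rightarrow> 'v" and P :: "'v set" +
  fixes c :: "'i \<Rightarrow> 'u::real_vector \<Rightarrow> real" and b :: "'i \<Rightarrow> 'u"
  assumes lin_c: "linear (c i)"
    and mat: "(\<forall>i j. c i (b j) = co i (al j)) \<or> (\<forall>i j. c i (b j) = co j (al i))"
    and inv: "weq co al x y \<Longrightarrow> act c b (rev x) (b k) = act c b (rev y) (b k)"
begin

text \<open>\<open>T w\<close> is the action of the inverse of \<open>w\<close> when \<open>w\<close> is real: its values on \<open>b i\<close> have the
  sign that decides whether \<open>i # w\<close> is longer than \<open>w\<close>.\<close>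

abbreviation T where "T w \<equiv> act c b (rev w)"
abbreviation C where "C \<equiv> cone b UNIV"

lemma c_simps [simp]:
  "c i (x + y) = c i x + c i y" "c i (x - y) = c i x - c i y" "c i (s *\<^sub>R x) = s * c i x"
  using lin_c[of i] by (simp_all add: linear_add linear_diff linear_cmul)

lemmas T_add = linear_add[OF linear_act[OF lin_c]] and T_diff = linear_diff[OF linear_act[OF lin_c]]
  and T_scale = linear_cmul[OF linear_act[OF lin_c]]

lemma c_Re: "i \<in> Re \<Longrightarrow> c i (b i) = 2" using mat co_al_Re by auto
lemma c_off: "i \<noteq> j \<Longrightarrow> c i (b j) \<le> 0" using mat co_al_offdiag by metis
lemma c_Im: "j \<in> Im \<Longrightarrow> c i (b j) \<le> 0" using mat co_al_Im_nonpos co_Im_nonpos by metis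
lemma c_sym: "c i (b j) = 0 \<longleftrightarrow> c j (b i) = 0" using mat co_al_sym by metis
lemma c_0: "c i (b j) = 0 \<longleftrightarrow> co i (al j) = 0" using mat co_al_sym by metis
lemma c_neg: "c i (b j) \<noteq> 0 \<Longrightarrow> c i (b j) \<le> 0 \<Longrightarrow> c i (b j) \<le> -1" using mat co_al_neg by metis

lemma T_alt_dq:
  assumes "i \<in> Re" "j \<in> Re"
  shows "T (alt i j k) (p *\<^sub>R b j + q *\<^sub>R b i) =
     fst (dq (- c i (b j)) (- c j (b i)) p q k) *\<^sub>R b j + snd (dq (- c i (b j)) (- c j (b i)) p q k) *\<^sub>R b i"
  using assms
proof (induction k arbitrary: i j p q)
  case (Suc k)
  have "T (alt i j (Suc k)) (p *\<^sub>R b j + q *\<^sub>R b i) =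
     T (alt j i k) (srefl c b i (p *\<^sub>R b j + q *\<^sub>R b i))" by simp
  also have "srefl c b i (p *\<^sub>R b j + q *\<^sub>R b i) = ((- c i (b j)) * p - q) *\<^sub>R b i + p *\<^sub>R b j"
  proof -
    have "c i (p *\<^sub>R b j + q *\<^sub>R b i) = q - ((- c i (b j)) * p - q)"
      using c_Re[OF Suc.prems(1)] by simp
    then show ?thesis unfolding srefl_def by (simp only: scaleR_left_diff_distrib) simp
  qed
  finally show ?case using Suc.IH[OF Suc.prems(2,1), of "(- c i (b j)) * p - q" p] by (simp add: add.commute)
qed simp

lemma dq_finite:
  assumes "i \<in> Re" "j \<in> Re" "i \<noteq> j" "co i (al j) * co j (al i) < 4" "k < ordrr co al j i"
  shows "0 \<le> fst (dq (- c i (b j)) (- c j (b i)) 1 0 k) \<and> 0 \<le> snd (dq (- c i (b j)) (- c j (b i)) 1 0 k)"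
proof -
  have s: "(- co j (al i), - co i (al j), ordrr co al j i) \<in>
     {(0,0,2), (1,1,3), (1,2,4), (2,1,4), (1,3,6), (3,1,6)}"
    using ordrr_small[of j i] assms by (simp add: mult.commute)
  have s': "(- co i (al j), - co j (al i), ordrr co al j i) \<in>
     {(0,0,2), (1,1,3), (1,2,4), (2,1,4), (1,3,6), (3,1,6)}"
    using s by (elim insertE emptyE) simp_all
  from mat show ?thesis
  proof
    assume "\<forall>i j. c i (b j) = co i (al j)"
    then show ?thesis using dq_small[OF s' assms(5)] by simp
  next
    assume "\<forall>i j. c i (b j) = co j (al i)"
    then show ?thesis using dq_small[OF s assms(5)] by simp
  qed
qed

text \<open>Induction on length, as for Coxeter groups: the word is split into an element of the
  rank-two group of \<open>j\<close> and a first letter \<open>t\<close>, and a rest on which both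
  \<open>b j\<close> and \<open>b t\<close> stay positive; then one computes in rank two. An
  imaginary first letter is handled by positivity of the imaginary vectors instead.\<close>

theorem T_base_cone:
  "(\<forall>t\<in>Im. T w (b t) \<in> C) \<and> (\<forall>j\<in>Re. len w < len (j # w) \<longrightarrow> T w (b j) \<in> C)"
proof (induction "len w" arbitrary: w rule: less_induct)
  case less
  define L where "L = len w"
  have IHI: "T v (b t) \<in> C" if "len v < L" "t \<in> Im" for v t using less that L_def by blast
  have IHP: "T v (b j) \<in> C" if "len v < L" "j \<in> Re" "len v < len (j # v)" for v j using less that L_def by blast
  \<comment> \<open>Imaginary vectors at length \<open>L\<close> come first: the real case below
    uses them for \<open>j # w'\<close>, which may have length \<open>L\<close> as well.\<close>
  have I: "T v (b t) \<in> C" if v: "len v = L" and t: "t \<in> Im" for v t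
  proof (cases "L = 0")
    case True
    then have "T v (b t) = b t" using inv[OF len_0[of v]] v by simp
    then show ?thesis by (simp add: cone_base)
  next
    case False
    then obtain s v' where s: "v \<approx> s # v'" "len v = Suc (len v')" using len_pos_split[of v] v by auto
    have l: "len v' < L" using s v by simp
    have 1: "T v' (b t) \<in> C" using IHI[OF l t] .
    have 2: "T v' (b s) \<in> C"
      using IHI[OF l] IHP[OF l, of s] len_cong[OF s(1)] s(2) by (cases "s \<in> Im") (auto simp: Im_iff)
    have "T v (b t) = T v' (b t) + (- c s (b t)) *\<^sub>R T v' (b s)"
      using inv[OF s(1)] by (simp add: srefl_def T_diff T_scale)
    then show ?thesis using 1 2 c_Im[OF t, of s] by (simp add: cone_add cone_scale del: scaleR_minus_left)
  qed
  have "T w (b j) \<in> C" if j: "j \<in> Re" "len w < len (j # w)" for j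
  proof (cases "L = 0")
    case True
    then have "T w (b j) = b j" using inv[OF len_0[of w]] L_def by simp
    then show ?thesis by (simp add: cone_base)
  next
    case False
    then obtain t w' where t: "w \<approx> t # w'" "len w = Suc (len w')" using len_pos_split[of w] L_def by auto
    have l: "len w' < L" using t L_def by simp
    have Tw: "T w (b k) = T w' (b k) - c t (b k) *\<^sub>R T w' (b t)" for k
      using inv[OF t(1)] by (simp add: srefl_def T_diff T_scale)
    have lj: "len (j # w) = len (j # t # w')" by (rule len_cong[OF weq_Cons[OF t(1)]])
    show ?thesis
    proof (cases "t \<in> Im")
      case True
      show ?thesis
      proof (cases "c t (b j) = 0")
        case z: True
        have "j \<noteq> t" using True j(1) by (auto simp: Im_iff)
        then have "[t, j] \<approx> [j, t]" using True z c_0 by (intro weq_comm) auto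
        then have "len (j # t # w') = len (t # j # w')"
          using len_cong[OF weq_append[of "[t, j]" "[j, t]" w' w']] by simp
        then have "len w' < len (j # w')" using lj len_Cons_le[of t "j # w'"] j(2) t(2) by linarith
        then show ?thesis using Tw[of j] IHP[OF l j(1)] z by simp
      next
        case nz: False
        \<comment> \<open>\<open>T w' (b j)\<close> itself need not be positive. It is eliminated
          through the imaginary vector of \<open>j # w'\<close>; the remaining coefficient
          \<open>m - 1 / n\<close> is nonnegative since nonzero integer entries make
          \<open>m\<close> and \<open>n\<close> at least 1.\<close>
        define m n where "m = - c t (b j)" and "n = - c j (b t)"
        have "m \<ge> 1" "n \<ge> 1"
          using nz c_sym[of t j] c_neg[of t j] c_neg[of j t] c_Im[OF True, of j] c_off[of t j] j(1) True
          by (auto simp: m_def n_def Im_iff)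
        have e: "T (j # w') (b t) = T w' (b t) + n *\<^sub>R T w' (b j)"
          by (simp add: srefl_def T_diff T_scale n_def)
        have "T w (b j) = T w' (b j) + m *\<^sub>R T w' (b t)" using Tw[of j] by (simp add: m_def)
        also have "\<dots> = (1 / n) *\<^sub>R T (j # w') (b t) + (m - 1 / n) *\<^sub>R T w' (b t)"
          unfolding e using \<open>n \<ge> 1\<close> by (simp add: algebra_simps)
        also have "\<dots> \<in> C"
        proof (intro cone_add cone_scale)
          show "T (j # w') (b t) \<in> C"
            using I[of "j # w'"] IHI[of "j # w'"] True len_Cons_le[of j w'] t(2) L_def
            by (cases "len (j # w') = L") auto
          show "T w' (b t) \<in> C" using IHI[OF l True] .
          have "1 / n \<le> 1" using \<open>n \<ge> 1\<close> by simp
          then show "0 \<le> m - 1 / n" using \<open>m \<ge> 1\<close> by linarith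
        qed (use \<open>n \<ge> 1\<close> in simp)
        finally show ?thesis .
      qed
    next
      case False
      then have tR: "t \<in> Re" by (simp add: Im_iff)
      have "t \<noteq> j"
      proof
        assume "t = j"
        then have "len (j # w) = len w'" using lj len_cong[OF weq_cancel2[OF j(1)]] by simp
        then show False using j(2) t(2) by simp
      qed
      \<comment> \<open>Among the factorizations with additive lengths whose first part uses only
        \<open>j\<close> and \<open>t\<close>, one with the shortest rest is chosen: neither letter
        shortens that rest, so the induction hypothesis applies to both.\<close>
      define Q where "Q n \<longleftrightarrow> (\<exists>g v. set g \<subseteq> {j, t} \<and> g @ v \<approx> w \<and> length g + len v = L \<and> len v = n)" for n
      have "Q (len w')" unfolding Q_def
        by (rule exI[of _ "[t]"], rule exI[of _ w']) (use t L_def weq_sym in auto)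
      then have Q0: "Q (LEAST n. Q n)" and Qle: "(LEAST n. Q n) \<le> len w'" by (auto intro: LeastI Least_le)
      then obtain g v where g: "set g \<subseteq> {j, t}" "g @ v \<approx> w" "length g + len v = L" "len v = (LEAST n. Q n)"
        unfolding Q_def by blast
      have lv: "len v < L" using g(4) Qle l by simp
      have gR: "set g \<subseteq> Re" using g(1) j(1) tR by auto
      have "T v (b s) \<in> C" if s: "s \<in> {j, t}" for s
      proof -
        have sR: "s \<in> Re" using s j tR by auto
        have "len v < len (s # v)"
        proof (rule ccontr)
          assume "\<not> len v < len (s # v)"
          then have d: "len v = Suc (len (s # v))" using len_Cons_Re[OF sR, of v] by auto
          have "(g @ [s]) @ (s # v) \<approx> g @ v" using weq_append[OF weq_refl' weq_cancel2[OF sR]] by simp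
          then have "(g @ [s]) @ (s # v) \<approx> w" using weq_tr g(2) by blast
          then have "Q (len (s # v))" unfolding Q_def using g(1,3) d s
            by (intro exI[of _ "g @ [s]"] exI[of _ "s # v"]) auto
          then have "(LEAST n. Q n) \<le> len (s # v)" by (rule Least_le)
          then show False using g(4) d by simp
        qed
        then show ?thesis using IHP[OF lv sR] by simp
      qed
      then have Tv: "T v (b j) \<in> C" "T v (b t) \<in> C" by auto
      have "distinct_adj g"
      proof (rule ccontr)
        assume "\<not> distinct_adj g"
        then obtain x a y where xy: "g = x @ [a, a] @ y" using not_distinct_adj by blast
        have "a \<in> Re" using gR xy by auto
        then have "g @ v \<approx> x @ y @ v" unfolding xy using weq_append[OF weq_refl' weq_cancel2, of a x "y @ v"] by simp
        then have "len w = len ((x @ y) @ v)" using len_cong[OF g(2)] len_cong by fastforce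
        then show False using len_append_le[of "x @ y" v] g(3) xy L_def by simp
      qed
      moreover have "g = [] \<or> hd g = t"
      proof (rule ccontr)
        assume "\<not> (g = [] \<or> hd g = t)"
        then obtain g' where g': "g = j # g'" using g(1) by (cases g) auto
        have "j # w \<approx> j # g @ v" using weq_sym[OF g(2)] weq_Cons by simp
        also have "\<dots> \<approx> g' @ v" using g' weq_cancel2[OF j(1)] by simp
        finally show False using len_cong len_append_le[of g' v] g(3) g' j(2) L_def by fastforce
      qed
      ultimately have ga: "g = alt t j (length g)" using distinct_adj_alt[of g t j] g(1) by (simp add: insert_commute)
      define k where "k = length g"
      have gk: "g = alt t j k" using ga k_def by simp
      have "0 \<le> fst (dq (- c t (b j)) (- c j (b t)) 1 0 k) \<and> 0 \<le> snd (dq (- c t (b j)) (- c j (b t)) 1 0 k)"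
      proof (cases "co t (al j) * co j (al t) < 4")
        case True
        define m where "m = ordrr co al j t"
        have m: "m \<in> {2,3,4,6}" using ordrr_small[OF j(1) tR] \<open>t \<noteq> j\<close> True by (auto simp: m_def mult.commute)
        \<comment> \<open>For \<open>k\<close> at least \<open>m\<close> the braid relation would
          let \<open>g\<close> begin with \<open>j\<close>, and then \<open>j # w\<close> would be
          shorter than \<open>w\<close>.\<close>
        have "k < m"
        proof (rule ccontr)
          assume "\<not> k < m"
          then obtain d where d: "k = m + d" using le_Suc_ex not_less by blast
          obtain m' where m': "m = Suc m'" using m by (cases m) auto
          define h where "h = (if even m then alt t j d else alt j t d)"
          have gh: "g = alt t j m @ h" using gk d alt_add[of t j m d] h_def by simp
          have "j # w \<approx> j # alt t j m @ h @ v" using weq_Cons[OF weq_sym[OF g(2)]] gh by simp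
          also have "\<dots> \<approx> j # alt j t m @ h @ v"
            using weq_alt[OF j(1) tR _ m_def[symmetric] m] \<open>t \<noteq> j\<close>
            by (intro weq_Cons weq_append) (auto intro: weq_sym)
          also have "\<dots> \<approx> alt t j m' @ h @ v" using m' weq_cancel2[OF j(1)] by simp
          finally have "len (j # w) \<le> length (alt t j m' @ h) + len v"
            using len_append_le[of "alt t j m' @ h" v] len_cong by fastforce
          then show False using g(3) gh m' j(2) L_def by simp
        qed
        then show ?thesis using dq_finite[OF tR j(1) \<open>t \<noteq> j\<close> True] m_def by simp
      next
        case False
        have "c t (b j) * c j (b t) = co t (al j) * co j (al t)" using mat by auto
        then show ?thesis using False c_off[of t j] c_off[of j t] \<open>t \<noteq> j\<close>
          by (intro dq_infinite) auto
      qed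
      moreover have "T w (b j) = T v (T g (1 *\<^sub>R b j + 0 *\<^sub>R b t))"
        using inv[OF g(2), of j] by simp
      ultimately show ?thesis unfolding gk T_alt_dq[OF tR j(1)]
        using Tv by (simp add: T_add T_scale cone_add cone_scale)
    qed
  qed
  then show ?case using I L_def by blast
qed

end

section \<open>The sign theorem for roots and for coroots\<close>

context bc
begin

interpretation rt: refl_rep co al P co al
  by unfold_locales (auto simp: lin_co weq_act weq_rev)

text \<open>Reflecting a functional by subtracting its value at \<open>al i\<close> times
  \<open>co i\<close> is composing it with \<open>r i\<close>; so the reversed word acts by pulling
  back along \<open>w\<close>, and the sign theorem for coroots becomes a statement on values at
  weights.\<close>

lemma act_dual: "linear \<phi> \<Longrightarrow> act (\<lambda>i \<phi>. \<phi> (al i)) co (rev w) \<phi> = (\<lambda>x. \<phi> (W w x))" for \<phi> :: "'v \<Rightarrow> real"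
proof (induction w arbitrary: \<phi>)
  case (Cons i w)
  have e: "srefl (\<lambda>i \<phi>. \<phi> (al i)) co i \<phi> = (\<lambda>x. \<phi> (r i x))"
    by (simp add: srefl_def fun_eq_iff linear_diff[OF Cons.prems] linear_cmul[OF Cons.prems])
  have "linear (\<lambda>x. \<phi> (r i x))"
    using linear_compose[OF linear_srefl[where c = co and i = i and b = al, OF lin_co] Cons.prems] by (simp only: comp_def)
  then show ?case using Cons.IH[of "\<lambda>x. \<phi> (r i x)"] e by simp
qed simp

lemma refl_rep_dual: "refl_rep co al P (\<lambda>i \<phi>. \<phi> (al i)) co"
proof -
  have 2: "act (\<lambda>i \<phi>. \<phi> (al i)) co (rev x) (co k) = act (\<lambda>i \<phi>. \<phi> (al i)) co (rev y) (co k)"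
    if "x \<approx> y" for x y k
    using weq_act[OF that] by (simp add: act_dual lin_co)
  show ?thesis by unfold_locales (simp, simp, simp, rule 2)
qed

interpretation dl: refl_rep co al P "\<lambda>i \<phi>. \<phi> (al i)" co
  by (rule refl_rep_dual)

text \<open>In this form lengths meet dominant weights: a functional in \<open>cone co UNIV\<close>
  is nonnegative on them.\<close>

lemma co_cone: "j \<in> Re \<Longrightarrow> len w < len (j # w) \<Longrightarrow> (\<lambda>x. co j (W w x)) \<in> cone co UNIV"
  using dl.T_base_cone[of w, unfolded act_dual[OF lin_co]] by blast

lemma co_Im_cone: "t \<in> Im \<Longrightarrow> (\<lambda>x. co t (W w x)) \<in> cone co UNIV"
  using dl.T_base_cone[of w, unfolded act_dual[OF lin_co]] by blast

lemma al_cone: "j \<in> Re \<Longrightarrow> len w < len (j # w) \<Longrightarrow> W (rev w) (al j) \<in> cone al UNIV"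
  using rt.T_base_cone[of w] by blast

lemma al_Im_cone: "t \<in> Im \<Longrightarrow> W w (al t) \<in> cone al UNIV"
  using rt.T_base_cone[of "rev w"] unfolding rev_rev_ident by blast

end

section \<open>Roots and reflections\<close>

context bc
begin

abbreviation rt where "rt ws i \<equiv> W ws (al i)"
abbreviation cv where "cv \<equiv> corv co al"
abbreviation rrep where "rrep \<equiv> root_rep co al"

text \<open>The root lattice. Positivity and integrality of a root are kept apart and are joined in
  \<open>cone_lat_Qplus\<close>.\<close>

definition lat :: "'v set" where
  "lat = {comb al k | k. fsup k \<and> (\<forall>i. k i \<in> \<int>)}"

definition dom :: "'v \<Rightarrow> bool" where "dom x \<longleftrightarrow> (\<forall>i. 0 \<le> co i x)"

lemma latI: "fsup k \<Longrightarrow> (\<And>i. k i \<in> \<int>) \<Longrightarrow> u = comb al k \<Longrightarrow> u \<in> lat"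
  unfolding lat_def by blast

lemma lat_add: assumes "u \<in> lat" "v \<in> lat" shows "u + v \<in> lat"
proof -
  obtain k l where "fsup k" "\<forall>i. k i \<in> \<int>" "u = comb al k" "fsup l" "\<forall>i. l i \<in> \<int>" "v = comb al l"
    using assms unfolding lat_def by blast
  then show ?thesis by (intro latI[OF fsup_add, of k l]) (simp_all add: comb_add)
qed

lemma lat_scale: assumes "u \<in> lat" "x \<in> \<int>" shows "x *\<^sub>R u \<in> lat"
proof -
  obtain k where "fsup k" "\<forall>i. k i \<in> \<int>" "u = comb al k" using assms unfolding lat_def by blast
  then show ?thesis using assms(2) by (intro latI[OF fsup_scale, of k x]) (simp_all add: comb_scale)
qed

lemma lat_diff: assumes "u \<in> lat" "v \<in> lat" shows "u - v \<in> lat"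
  using lat_add[OF assms(1) lat_scale[OF assms(2), of "-1"]] by simp

lemma lat_al: "al i \<in> lat"
  by (rule latI[OF fsup_single[of i 1]]) (simp_all add: comb_single)

lemma lat_co: assumes "u \<in> lat" shows "co j u \<in> \<int>"
proof -
  obtain k where "fsup k" "\<forall>i. k i \<in> \<int>" "u = comb al k" using assms unfolding lat_def by blast
  then show ?thesis by (auto simp: comb_linear[OF lin_co] co_al_int intro!: Ints_sum)
qed

lemma lat_coef: assumes "comb al k \<in> lat" "fsup k" shows "k i \<in> \<int>"
proof -
  obtain l where "fsup l" "\<forall>i. l i \<in> \<int>" "comb al k = comb al l" using assms unfolding lat_def by blast
  then show ?thesis using comb_inj[OF indep_al assms(2)] by simp
qed

lemma W_lat: "u \<in> lat \<Longrightarrow> W w u \<in> lat"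
  by (induction w) (simp_all add: srefl_def lat_diff lat_scale lat_al lat_co)

lemma cone_coef:
  assumes "comb al k \<in> cone al Z" "fsup k" shows "0 \<le> k i" "k i \<noteq> 0 \<Longrightarrow> i \<in> Z"
proof -
  obtain l where l: "fsup l" "\<forall>i. 0 \<le> l i" "\<forall>i. l i \<noteq> 0 \<longrightarrow> i \<in> Z" "comb al k = comb al l"
    by (rule coneE[OF assms(1)])
  have "k = l" by (rule comb_inj[OF indep_al assms(2) l(1,4)])
  then show "0 \<le> k i" "k i \<noteq> 0 \<Longrightarrow> i \<in> Z" using l by auto
qed

text \<open>The height, extended linearly to the real span \<open>sp\<close> of the simple roots. It
  is the induction measure of \<open>real_supp\<close> and of \<open>Sdata_standard\<close>.\<close>

definition ht :: "'v \<Rightarrow> real" where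
  "ht u = (let k = (THE k. fsup k \<and> u = comb al k) in \<Sum>i | k i \<noteq> 0. k i)"

definition sp :: "'v set" where "sp = {comb al k | k. fsup k}"

lemma ht_comb: assumes "fsup k" shows "ht (comb al k) = (\<Sum>i | k i \<noteq> 0. k i)"
proof -
  have "(THE l. fsup l \<and> comb al k = comb al l) = k"
    using assms comb_inj[OF indep_al] by (intro the_equality) auto
  then show ?thesis unfolding ht_def by simp
qed

lemma ht_comb_superset: "fsup k \<Longrightarrow> finite S \<Longrightarrow> {i. k i \<noteq> 0} \<subseteq> S \<Longrightarrow> ht (comb al k) = sum k S"
  unfolding ht_comb by (rule sum.mono_neutral_left) auto

lemma ht_add: assumes "u \<in> sp" "v \<in> sp" shows "ht (u + v) = ht u + ht v"
proof -
  obtain k l where k: "fsup k" "u = comb al k" and l: "fsup l" "v = comb al l"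
    using assms unfolding sp_def by blast
  let ?S = "{i. k i \<noteq> 0} \<union> {i. l i \<noteq> 0}"
  have f: "finite ?S" using k l by (simp add: fsup_def)
  have "ht (u + v) = (\<Sum>i\<in>?S. k i + l i)"
    unfolding k(2) l(2) comb_add[OF k(1) l(1), symmetric]
    by (rule ht_comb_superset[OF fsup_add[OF k(1) l(1)] f]) auto
  moreover have "ht u = sum k ?S" unfolding k(2) by (rule ht_comb_superset[OF k(1) f]) auto
  moreover have "ht v = sum l ?S" unfolding l(2) by (rule ht_comb_superset[OF l(1) f]) auto
  ultimately show ?thesis by (simp add: sum.distrib)
qed

lemma ht_scale_al: "ht (x *\<^sub>R al i) = x"
  unfolding comb_single[symmetric] by (subst ht_comb_superset[of _ "{i}"]) (auto simp: fsup_single)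

lemma cone_sp: "u \<in> cone al Z \<Longrightarrow> u \<in> sp"
  unfolding sp_def by (elim coneE) blast

lemma sp_scale_al: "x *\<^sub>R al i \<in> sp"
  unfolding sp_def using comb_single[of al i x, symmetric] fsup_single[of i x] by blast

lemma ht_nonneg: "u \<in> cone al Z \<Longrightarrow> 0 \<le> ht u"
  by (elim coneE) (auto simp: ht_comb intro!: sum_nonneg)

lemma ht_sub_al: assumes "u \<in> sp" shows "ht (u - x *\<^sub>R al i) = ht u - x"
  using ht_add[OF assms sp_scale_al[of "- x" i]] ht_scale_al[of "- x" i] by simp

lemma W_rword: "set ws \<subseteq> Re \<Longrightarrow> W (rword ws i) x = x - cv ws i x *\<^sub>R rt ws i"
  by (simp add: rword_def corv_def srefl_def W_diff W_scale)

lemma set_rword: "set (rword ws i) = insert i (set ws)" by (auto simp: rword_def)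

lemma rword_Cons: "rword (j # ws) i = j # rword ws i @ [j]" by (simp add: rword_def)

lemma cv_lin: "linear (cv ws i)"
  using linear_compose[OF W_lin[of "rev ws"] lin_co[of i]] by (simp only: comp_def corv_def[abs_def])

lemmas cv_diff = linear_diff[OF cv_lin] and cv_scale = linear_cmul[OF cv_lin]
  and cv_add = linear_add[OF cv_lin] and cv_neg = linear_neg[OF cv_lin]

lemma cv_rt: "set ws \<subseteq> Re \<Longrightarrow> cv ws i (rt ws i) = co i (al i)" by (simp add: corv_def)

lemma cv_Cons: "j \<in> Re \<Longrightarrow> cv (j # ws) i (r j x) = cv ws i x" by (simp add: corv_def)

lemma cv_Cons': "cv (j # ws) i x = cv ws i (r j x)" by (simp add: corv_def)

lemma rt_nonzero: "set ws \<subseteq> Re \<Longrightarrow> rt ws i \<noteq> 0"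
  using W_rev[of ws "al i"] al_nonzero[of i] by force

lemma cv_nonzero: assumes "set ws \<subseteq> Re" shows "\<exists>x. cv ws i x \<noteq> 0"
proof -
  have "co i \<noteq> (\<lambda>x. 0)"
  proof
    assume "co i = (\<lambda>x. 0)"
    then have "comb co (\<lambda>j. if j = i then 1 else 0) = comb co (\<lambda>j. 0)"
      by (simp add: comb_single comb_0 zero_fun_def)
    then show False using comb_inj[OF indep_co fsup_single[of i 1] fsup_0] by (auto simp: fun_eq_iff split: if_splits)
  qed
  then obtain z where "co i z \<noteq> 0" by auto
  then show ?thesis using assms by (intro exI[of _ "W ws z"]) (simp add: corv_def)
qed

text \<open>A reflection moves \<open>x\<close> by the coroot value times the root, and the root is
  nonzero; so reflection and root determine the coroot, whichever word represents them.\<close>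

lemma cv_eqI: assumes "set ws \<subseteq> Re" "set xs \<subseteq> Re" "rword ws i \<approx> rword xs j" "rt ws i = rt xs j"
  shows "cv ws i x = cv xs j x"
proof -
  have "cv ws i x *\<^sub>R rt ws i = cv xs j x *\<^sub>R rt ws i"
    using weq_act[OF assms(3), of x] W_rword[OF assms(1)] W_rword[OF assms(2)] assms(4) by simp
  then show ?thesis using rt_nonzero[OF assms(1)] by simp
qed

lemma Qplus_cone: "u \<in> Qplus al \<Longrightarrow> u \<in> cone al UNIV"
proof -
  assume "u \<in> Qplus al"
  then obtain S k where S: "finite S" "u = (\<Sum>i\<in>S. of_nat (k i) *\<^sub>R al i)" unfolding Qplus_def by blast
  have "(\<Sum>i\<in>S. of_nat (k i) *\<^sub>R al i) \<in> cone al UNIV" using S(1)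
    by (induction S) (simp_all add: cone_0 cone_add cone_scale_base)
  then show ?thesis using S by simp
qed

lemma cone_lat_Qplus: assumes "u \<in> cone al UNIV" "u \<in> lat" shows "u \<in> Qplus al"
proof -
  obtain k where k: "fsup k" "\<forall>i. 0 \<le> k i" "u = comb al k" by (rule coneE[OF assms(1)])
  have "k i = of_nat (nat \<lfloor>k i\<rfloor>)" for i
  proof -
    have "k i \<in> \<int>" using lat_coef[of k i] k assms(2) by simp
    then show ?thesis using k(2) by (auto elim!: Ints_cases)
  qed
  then have "u = (\<Sum>i | k i \<noteq> 0. of_nat (nat \<lfloor>k i\<rfloor>) *\<^sub>R al i)"
    unfolding k(3) comb_def by (intro sum.cong) auto
  then show ?thesis unfolding Qplus_def using k(1) unfolding fsup_def
    by (intro CollectI exI[of _ "{i. k i \<noteq> 0}"] exI[of _ "\<lambda>i. nat \<lfloor>k i\<rfloor>"] conjI)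
qed

text \<open>Both branches of the definition reduce to positivity: a real root lies in the lattice
  anyway, and an imaginary one is automatically positive.\<close>

lemma rrep_iff: "rrep ws i \<longleftrightarrow> set ws \<subseteq> Re \<and> rt ws i \<in> cone al UNIV"
proof
  assume r: "rrep ws i"
  have "rt ws i \<in> cone al UNIV"
  proof (cases "rt ws i \<in> pos_re_roots co al")
    case True
    then show ?thesis unfolding pos_re_roots_def using Qplus_cone by blast
  next
    case False
    then have "rt ws i \<in> im_roots co al" using r unfolding root_rep_def by blast
    then show ?thesis unfolding im_roots_def using al_Im_cone by auto
  qed
  then show "set ws \<subseteq> Re \<and> rt ws i \<in> cone al UNIV" using r unfolding root_rep_def by blast
next
  assume r: "set ws \<subseteq> Re \<and> rt ws i \<in> cone al UNIV"
  show "rrep ws i"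
  proof (cases "i \<in> Re")
    case True
    have "rt ws i \<in> Qplus al" using r by (intro cone_lat_Qplus W_lat lat_al) auto
    then show ?thesis using r True unfolding root_rep_def pos_re_roots_def by blast
  next
    case False
    then show ?thesis using r unfolding root_rep_def im_roots_def Iim_def by blast
  qed
qed

lemma rrep_Im: "set ws \<subseteq> Re \<Longrightarrow> i \<in> Im \<Longrightarrow> rrep ws i"
  using rrep_iff al_Im_cone by blast

lemma rrep_Nil: "rrep [] i" using rrep_iff cone_base[of i UNIV al] by simp

lemma rt_neg_cone: assumes "i \<in> Re" "len (i # rev ws) < len (rev ws)" shows "- rt ws i \<in> cone al UNIV"
proof -
  have "len (i # i # rev ws) = len (rev ws)" by (rule len_cong[OF weq_cancel2[OF assms(1)]])
  then have "W (rev (i # rev ws)) (al i) \<in> cone al UNIV" using assms by (intro al_cone) auto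
  moreover have "r i (al i) = - al i" using assms(1) by (simp add: srefl_def co_al_Re scaleR_2)
  ultimately show ?thesis by (simp add: W_neg)
qed

lemma rt_sign: assumes "i \<in> Re" shows "rt ws i \<in> cone al UNIV \<or> - rt ws i \<in> cone al UNIV"
  using rt_neg_cone[OF assms, of ws] al_cone[OF assms, of "rev ws"] len_Cons_Re[OF assms, of "rev ws"] by auto

lemma rrep_len: assumes "rrep ws i" "i \<in> Re" shows "len (rev ws) < len (i # rev ws)"
proof (rule ccontr)
  assume "\<not> ?thesis"
  then have "len (i # rev ws) < len (rev ws)" using len_Cons_Re[OF assms(2), of "rev ws"] by linarith
  then have "- rt ws i \<in> cone al UNIV" by (rule rt_neg_cone[OF assms(2)])
  then show False using cone_antisym[OF indep_al] assms(1) rt_nonzero unfolding rrep_iff by blast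
qed

lemma cv_cone: assumes "rrep ws i" shows "cv ws i \<in> cone co UNIV"
proof -
  have "(\<lambda>x. co i (W (rev ws) x)) \<in> cone co UNIV"
    using co_cone[OF _ rrep_len[OF assms]] co_Im_cone by (cases "i \<in> Re") (auto simp: Im_iff)
  then show ?thesis by (simp only: corv_def[abs_def])
qed

lemma W_real_span: "set ws \<subseteq> Re \<Longrightarrow> \<exists>k. fsup k \<and> (\<forall>j. k j \<noteq> 0 \<longrightarrow> j \<in> Re) \<and> W ws u = u + comb al k"
proof (induction ws)
  case Nil
  then show ?case by (intro exI[of _ "\<lambda>j. 0"]) (simp add: fsup_0 comb_0)
next
  case (Cons s ws)
  then obtain k where k: "fsup k" "\<forall>j. k j \<noteq> 0 \<longrightarrow> j \<in> Re" "W ws u = u + comb al k" by auto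
  define x where "x = - co s (W ws u)"
  have "W (s # ws) u = W ws u + x *\<^sub>R al s" by (simp add: srefl_def x_def)
  then have "W (s # ws) u = u + comb al (\<lambda>j. k j + (if j = s then x else 0))"
    using k by (simp add: comb_add[OF k(1) fsup_single] comb_single)
  then show ?case using k Cons.prems
    by (intro exI[of _ "\<lambda>j. k j + (if j = s then x else 0)"]) (auto simp: fsup_add fsup_single)
qed

text \<open>Real reflections change only the coefficients at real letters, so those at imaginary
  letters are still the ones of \<open>al i\<close>.\<close>

lemma rt_Im_coef:
  assumes "set ws \<subseteq> Re" "i \<in> Im" "fsup k" "rt ws i = comb al k" "j \<in> Im"
  shows "k j = (if j = i then 1 else 0)"
proof -
  obtain l where l: "fsup l" "\<forall>j. l j \<noteq> 0 \<longrightarrow> j \<in> Re" "rt ws i = al i + comb al l"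
    using W_real_span[OF assms(1)] by blast
  have "comb al k = comb al (\<lambda>j. (if j = i then 1 else 0) + l j)"
    using assms(4) l by (simp add: comb_add fsup_single comb_single)
  then have "k = (\<lambda>j. (if j = i then 1 else 0) + l j)"
    using comb_inj[OF indep_al assms(3)] fsup_add[OF fsup_single l(1)] by blast
  then show ?thesis using l(2) assms(5) Im_iff by auto
qed

lemma rt_Im_not_real: assumes "set ws \<subseteq> Re" "i \<in> Im" "j \<in> Re" shows "rt ws i \<noteq> x *\<^sub>R al j"
proof
  assume "rt ws i = x *\<^sub>R al j"
  then have "rt ws i = comb al (\<lambda>l. if l = j then x else 0)" by (simp add: comb_single)
  from rt_Im_coef[OF assms(1,2) fsup_single this assms(2)] show False
    using assms(2,3) by (auto simp: Im_iff split: if_splits)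
qed

text \<open>The usual argument that \<open>r j\<close> permutes the positive roots other than
  \<open>al j\<close>: a real root made negative is supported at \<open>j\<close> alone, and
  integrality leaves only \<open>al j\<close>. For imaginary \<open>i\<close> positivity is
  automatic.\<close>

lemma rrep_Cons: assumes "rrep ws i" "j \<in> Re" "rt ws i \<noteq> al j" shows "rrep (j # ws) i"
proof (cases "i \<in> Im")
  case True
  then show ?thesis using assms by (intro rrep_Im) (auto simp: rrep_iff)
next
  case False
  then have iR: "i \<in> Re" by (simp add: Im_iff)
  have ws: "set ws \<subseteq> Re" and pos: "rt ws i \<in> cone al UNIV" using assms(1) rrep_iff by auto
  show ?thesis
  proof (rule ccontr)
    assume "\<not> ?thesis"
    then have "rt (j # ws) i \<notin> cone al UNIV" using ws assms(2) rrep_iff by auto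
    then have neg: "- rt (j # ws) i \<in> cone al UNIV" using rt_sign[OF iR, of "j # ws"] by blast
    obtain k where k: "fsup k" "\<forall>i. 0 \<le> k i" "rt ws i = comb al k" by (rule coneE[OF pos])
    obtain l where l: "fsup l" "\<forall>i. 0 \<le> l i" "- rt (j # ws) i = comb al l" by (rule coneE[OF neg])
    have "comb al k + comb al l = co j (rt ws i) *\<^sub>R al j"
      unfolding k(3)[symmetric] l(3)[symmetric] by (simp add: srefl_def)
    then have "comb al (\<lambda>x. k x + l x) = comb al (\<lambda>x. if x = j then co j (rt ws i) else 0)"
      by (simp add: comb_add[OF k(1) l(1)] comb_single)
    then have kl: "(\<lambda>x. k x + l x) = (\<lambda>x. if x = j then co j (rt ws i) else 0)"
      by (intro comb_inj[OF indep_al fsup_add[OF k(1) l(1)] fsup_single])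
    have k0: "k x = 0" if "x \<noteq> j" for x
      using fun_cong[OF kl, of x] that k(2) l(2) by (simp add: add_nonneg_eq_0_iff)
    then have "k = (\<lambda>x. if x = j then k j else 0)" by (auto simp: fun_eq_iff)
    then have "comb al k = comb al (\<lambda>x. if x = j then k j else 0)" by (rule arg_cong)
    then have e: "rt ws i = k j *\<^sub>R al j" using k(3) by (simp add: comb_single)
    have kZ: "k j \<in> \<int>" using lat_coef[of k j] k W_lat[OF lat_al, of ws i] by simp
    obtain h where h: "fsup h" "\<forall>x. h x \<in> \<int>" "W (rev ws) (al j) = comb al h"
      using W_lat[OF lat_al, of "rev ws" j] unfolding lat_def by blast
    \<comment> \<open>Pulled back to \<open>al i\<close>, the factor \<open>k j\<close> is seen to
      be an integer dividing 1.\<close>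
    have "al i = k j *\<^sub>R W (rev ws) (al j)" using W_rev[OF ws, of "al i"] e by (simp add: W_scale)
    then have "comb al (\<lambda>x. if x = i then 1 else 0) = comb al (\<lambda>x. k j * h x)"
      by (simp add: comb_single comb_scale[OF h(1)] h(3))
    then have "(\<lambda>x. if x = i then 1 else 0) = (\<lambda>x. k j * h x)"
      by (intro comb_inj[OF indep_al fsup_single fsup_scale[OF h(1)]])
    from fun_cong[OF this, of i] have "k j * h i = 1" by simp
    moreover obtain a b :: int where ab: "k j = of_int a" "h i = of_int b" using kZ h(2) by (metis Ints_cases)
    ultimately have "a * b = 1" by (metis of_int_eq_1_iff of_int_mult)
    moreover have "0 \<le> a" using k(2) ab by (metis of_int_0_le_iff)
    ultimately have "a = 1" using pos_zmult_eq_1_iff_lemma[of a b] by auto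
    then show False using e ab assms(3) by simp
  qed
qed

text \<open>The action detects the identity among real words: a nontrivial real element makes some
  simple root negative. The product of \<open>rword ws i\<close> with \<open>j\<close> fixes
  \<open>al j\<close> and changes every other \<open>al l\<close> only by a multiple of
  \<open>al j\<close>, so nothing becomes negative.\<close>

lemma rword_simple: assumes "rrep ws i" "j \<in> Re" "rt ws i = al j" shows "rword ws i \<approx> [j]"
proof -
  have ws: "set ws \<subseteq> Re" using assms(1) rrep_iff by auto
  have iR: "i \<in> Re" using rt_Im_not_real[OF ws _ assms(2), of i 1] assms(3) by (auto simp: Im_iff)
  define T where "T = rword ws i @ [j]"
  have TR: "set T \<subseteq> Re" using ws iR assms(2) by (auto simp: T_def set_rword)
  have "T \<approx> []"
  proof (rule ccontr)
    assume "\<not> T \<approx> []"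
    then have "\<not> rev T \<approx> []" using weq_rev[of "rev T" "[]"] by auto
    then have "len (rev T) > 0" using len_0[of "rev T"] by auto
    then obtain l T' where l: "rev T \<approx> l # T'" "len (rev T) = Suc (len T')" using len_pos_split by blast
    have lR: "l \<in> Re" using weq_real[OF l(1)] TR by auto
    have "l # rev T \<approx> T'" using weq_tr[OF weq_Cons[OF l(1)] weq_cancel2[OF lR]] .
    then have "len (l # rev T) < len (rev T)" using len_cong l(2) by force
    then have n: "- W T (al l) \<in> cone al UNIV" using rt_neg_cone[OF lR] by blast
    have "\<exists>s. W T (al l) = al l + s *\<^sub>R al j"
    proof -
      have "W T (al l) = r j (al l) - cv ws i (r j (al l)) *\<^sub>R al j"
        using W_rword[OF ws, of i] assms(3) by (simp add: T_def)
      also have "\<dots> = al l + (- co j (al l) - cv ws i (r j (al l))) *\<^sub>R al j"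
        by (simp add: srefl_def algebra_simps)
      finally show ?thesis by blast
    qed
    then obtain s where s: "W T (al l) = al l + s *\<^sub>R al j" by blast
    show False
    proof (cases "l = j")
      case True
      have "r j (al j) = - al j" using assms(2) by (simp add: srefl_def co_al_Re scaleR_2)
      moreover have "cv ws i (al j) = 2" using cv_rt[OF ws, of i] assms(3) co_al_Re[OF iR] by simp
      ultimately have "W T (al l) = al j" using W_rword[OF ws, of i] assms(3) True
        by (simp add: T_def cv_neg scaleR_2)
      then show False using n cone_antisym[OF indep_al _ n[simplified]] cone_base[of j UNIV al] al_nonzero by auto
    next
      case False
      define k where "k x = (if x = l then - 1 else 0) + (if x = j then - s else 0)" for x
      have fk: "fsup k" unfolding k_def[abs_def] by (intro fsup_add fsup_single)
      have "comb al k = - W T (al l)" unfolding k_def[abs_def] s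
        by (simp add: comb_add[OF fsup_single fsup_single] comb_single)
      then have "0 \<le> k l" using n fk by (intro cone_coef(1)[of k UNIV]) auto
      then show False using False by (simp add: k_def)
    qed
  qed
  then have "T @ [j] \<approx> [j]" using weq_append[of T "[]" "[j]" "[j]"] by simp
  moreover have "T @ [j] \<approx> rword ws i"
    unfolding T_def using weq_append[OF weq_refl'[of "rword ws i"] weq_inv[OF assms(2)]] by simp
  ultimately show ?thesis using weq_tr weq_sym by blast
qed

text \<open>All coroots are nonpositive on \<open>al i\<close>, so each letter of a reduced real
  word can only add to it; if nothing is added in total, every letter is orthogonal to
  \<open>al i\<close>.\<close>

lemma stab_Im_al:
  assumes "i \<in> Im" "set x \<subseteq> Re" "len x = length x"
  shows "W x (al i) - al i \<in> cone al UNIV \<and> (W x (al i) = al i \<longrightarrow> (\<forall>k\<in>set x. co k (al i) = 0))"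
  using assms(2,3)
proof (induction x)
  case Nil
  then show ?case by (simp add: cone_0)
next
  case (Cons k y)
  have y: "len y = length y" "len y < len (k # y)" using red_tl[OF Cons.prems(2)] by auto
  have IH: "W y (al i) - al i \<in> cone al UNIV" "W y (al i) = al i \<Longrightarrow> \<forall>k\<in>set y. co k (al i) = 0"
    using Cons.IH Cons.prems y by auto
  define n where "n = - co k (W y (al i))"
  have "co k (W y (al i)) \<le> 0"
    using cone_fun_nonpos[OF co_cone[OF _ y(2)], of "al i"] Cons.prems co_al_Im_nonpos[OF assms(1)] by auto
  then have n: "0 \<le> n" by (simp add: n_def)
  have e: "W (k # y) (al i) - al i = (W y (al i) - al i) + n *\<^sub>R al k" by (simp add: srefl_def n_def)
  have c: "n *\<^sub>R al k \<in> cone al UNIV" using n by (simp add: cone_scale_base)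
  show ?case
  proof (intro conjI impI)
    show "W (k # y) (al i) - al i \<in> cone al UNIV" unfolding e by (rule cone_add[OF IH(1) c])
    assume "W (k # y) (al i) = al i"
    then have z: "(W y (al i) - al i) + n *\<^sub>R al k = 0" using e by simp
    have "W y (al i) = al i" using cone_add_eq_0(1)[OF indep_al IH(1) c z] by simp
    moreover have "n = 0" using cone_add_eq_0(2)[OF indep_al IH(1) c z] al_nonzero by simp
    ultimately show "\<forall>k\<in>set (k # y). co k (al i) = 0" using IH(2) by (simp add: n_def)
  qed
qed

text \<open>The transposed argument for \<open>co i\<close>; the functional \<open>\<psi>\<close>
  added at each letter is nonzero because words act surjectively.\<close>

lemma stab_Im_co:
  assumes "i \<in> Im" "set x \<subseteq> Re" "len x = length x"
  shows "(\<lambda>z. co i (W x z)) - co i \<in> cone co UNIV \<and>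
    ((\<lambda>z. co i (W x z)) = co i \<longrightarrow> (\<forall>k\<in>set x. co k (al i) = 0))"
  using assms(2,3)
proof (induction x)
  case Nil
  have e: "(\<lambda>z. co i (W [] z)) - co i = 0" by (simp add: fun_eq_iff)
  show ?case unfolding e by (intro conjI cone_0) simp
next
  case (Cons k y)
  have y: "len y = length y" "len y < len (k # y)" using red_tl[OF Cons.prems(2)] by auto
  have yR: "set y \<subseteq> Re" using Cons.prems(1) by simp
  note IH0 = Cons.IH[OF yR y(1)]
  have IH: "(\<lambda>z. co i (W y z)) - co i \<in> cone co UNIV" by (rule conjunct1[OF IH0])
  have IH2: "(\<lambda>z. co i (W y z)) = co i \<Longrightarrow> \<forall>k\<in>set y. co k (al i) = 0"
    by (rule mp[OF conjunct2[OF IH0]])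
  have kR: "k \<in> Re" using Cons.prems by auto
  define n where "n = - co i (al k)"
  have n: "0 \<le> n" using co_Im_nonpos[OF assms(1)] by (simp add: n_def)
  define \<psi> where "\<psi> = (\<lambda>z. co k (W y z))"
  have e: "(\<lambda>z. co i (W (k # y) z)) - co i = ((\<lambda>z. co i (W y z)) - co i) + n *\<^sub>R \<psi>"
    by (simp add: srefl_def n_def fun_eq_iff \<psi>_def)
  have c: "n *\<^sub>R \<psi> \<in> cone co UNIV" using n co_cone[OF kR y(2)] \<psi>_def by (intro cone_scale) auto
  show ?case
  proof (intro conjI impI)
    show "(\<lambda>z. co i (W (k # y) z)) - co i \<in> cone co UNIV" unfolding e by (rule cone_add[OF IH c])
    assume "(\<lambda>z. co i (W (k # y) z)) = co i"
    then have "(\<lambda>z. co i (W (k # y) z)) - co i = 0" by (simp only: right_minus_eq)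
    then have z: "((\<lambda>z. co i (W y z)) - co i) + n *\<^sub>R \<psi> = 0" using e by (simp only:)
    have "(\<lambda>z. co i (W y z)) = co i"
      using cone_add_eq_0(1)[OF indep_co IH c z] by (simp only: right_minus_eq)
    moreover have "n = 0"
    proof -
      obtain z where "W y z = al k" using W_surj by blast
      then have "\<psi> z = 2" using co_al_Re[OF kR] by (simp add: \<psi>_def)
      then show ?thesis using fun_cong[OF cone_add_eq_0(2)[OF indep_co IH c z], of z] by simp
    qed
    ultimately show "\<forall>k\<in>set (k # y). co k (al i) = 0" using IH2 co_al_sym by (auto simp: n_def)
  qed
qed

lemma orth_word_comm: "i \<in> Im \<Longrightarrow> \<forall>k\<in>set x. k \<noteq> i \<and> co k (al i) = 0 \<Longrightarrow> x @ [i] \<approx> [i] @ x"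
proof (induction x)
  case (Cons k x)
  have "(k # x) @ [i] \<approx> k # i # x" using Cons weq_Cons by auto
  also have "k # i # x \<approx> i # k # x"
  proof -
    have "[i, k] \<approx> [k, i]" using Cons.prems co_al_sym by (intro weq_comm) auto
    from weq_append[OF weq_sym[OF this], of x x] show ?thesis by simp
  qed
  finally show ?case by simp
qed simp

text \<open>A reduced word of the reflection fixes \<open>al i\<close>, or \<open>co i\<close> in
  the second case, so all its letters are orthogonal to \<open>i\<close>. They then commute with
  \<open>i\<close> in the monoid, and both orthogonality relations follow.\<close>

lemma real_refl_comm:
  assumes "set ws \<subseteq> Re" "s \<in> Re" "i \<in> Im" "cv ws s (al i) = 0 \<or> co i (rt ws s) = 0"
  shows "rword ws s @ [i] \<approx> [i] @ rword ws s \<and> cv ws s (al i) = 0 \<and> co i (rt ws s) = 0"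
proof -
  obtain x where x: "x \<approx> rword ws s" "length x = len (rword ws s)" using len_ex by blast
  have xr: "len x = length x" using x len_cong by simp
  have xR: "set x \<subseteq> Re" using weq_real[OF weq_sym[OF x(1)]] assms(1,2) by (simp add: set_rword)
  have Wx: "W x z = z - cv ws s z *\<^sub>R rt ws s" for z using weq_act[OF x(1)] W_rword[OF assms(1)] by simp
  have o: "\<forall>k\<in>set x. co k (al i) = 0"
    using assms(4)
  proof
    assume "cv ws s (al i) = 0"
    then have "W x (al i) = al i" using Wx by simp
    then show ?thesis using stab_Im_al[OF assms(3) xR xr] by blast
  next
    assume "co i (rt ws s) = 0"
    then have "(\<lambda>z. co i (W x z)) = co i" using Wx by (simp add: fun_eq_iff)
    then show ?thesis using stab_Im_co[OF assms(3) xR xr] by blast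
  qed
  have "x @ [i] \<approx> [i] @ x" using o xR assms(3) by (intro orth_word_comm) (auto simp: Im_iff)
  then have 1: "rword ws s @ [i] \<approx> [i] @ rword ws s"
    using weq_tr[OF weq_append[OF weq_sym[OF x(1)] weq_refl'[of "[i]"]]]
      weq_tr[OF _ weq_append[OF weq_refl'[of "[i]"] x(1)]] by blast
  have "set x \<subseteq> {k. co k (al i) = 0}" using o by blast
  then have "W x (al i) = al i" by (induction x) (auto simp: srefl_def)
  then have 2: "cv ws s (al i) = 0" using Wx rt_nonzero[OF assms(1)] by simp
  have "\<forall>k\<in>set x. co i (al k) = 0" using o co_al_sym by blast
  then have "co i (W x z) = co i z" for z by (induction x) (auto simp: srefl_def)
  then have "co i (W x (rt ws s)) = co i (rt ws s)" .
  then have "cv ws s (rt ws s) * co i (rt ws s) = 0" using Wx[of "rt ws s"] by simp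
  then have "co i (rt ws s) = 0" using cv_rt[OF assms(1), of s] co_al_Re[OF assms(2)] by simp
  then show ?thesis using 1 2 by blast
qed

text \<open>Words along which the imaginary root \<open>w \<alpha>_k\<close> grows with every letter, so that the support of
  the root contains all letters of the word.\<close>

inductive good :: "'i \<Rightarrow> 'i list \<Rightarrow> bool" for k where
  good_Nil: "good k []"
| good_Cons: "good k x \<Longrightarrow> s \<in> Re \<Longrightarrow> co s (rt x k) < 0 \<Longrightarrow> good k (s # x)"

lemma good_real: "good k x \<Longrightarrow> set x \<subseteq> Re"
  by (induction rule: good.induct) auto

text \<open>Moved to the right of \<open>x\<close>, the letter \<open>s\<close> becomes the real
  reflection \<open>?g\<close>, whose coroot vanishes on \<open>al k\<close>; it commutes with
  \<open>k\<close> and cancels against the copy of \<open>s\<close> on the other side.\<close>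

lemma rword_drop:
  assumes "k \<in> Im" "set x \<subseteq> Re" "s \<in> Re" "co s (rt x k) = 0"
  shows "rword (s # x) k \<approx> rword x k"
proof -
  let ?g = "rword (rev x) s"
  have "cv (rev x) s (al k) = 0" using assms(4) by (simp add: corv_def)
  moreover have "set (rev x) \<subseteq> Re" using assms(2) by simp
  ultimately have c: "?g @ [k] \<approx> [k] @ ?g" using real_refl_comm[OF _ assms(3,1)] by blast
  have xg: "x @ ?g \<approx> s # x"
    unfolding rword_def using weq_append[OF weq_rev_cancel'[OF assms(2)], of "s # x" "s # x"] by simp
  have gx: "?g @ rev x @ [s] \<approx> rev x"
  proof -
    have "?g @ rev x @ [s] \<approx> rev x @ [s] @ [] @ [s]"
      using weq_append[OF weq_refl'[of "rev x @ [s]"] weq_append[OF weq_rev_cancel'[OF assms(2)] weq_refl'[of "[s]"]]]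
      unfolding rword_def by simp
    also have "\<dots> \<approx> rev x @ []"
      using weq_append[OF weq_refl'[of "rev x"] weq_inv[OF assms(3)]] by simp
    finally show ?thesis by simp
  qed
  have "rword (s # x) k \<approx> (x @ ?g) @ [k] @ rev x @ [s]"
    using weq_append[OF weq_sym[OF xg] weq_refl'[of "[k] @ rev x @ [s]"]] by (simp add: rword_def)
  also have "\<dots> \<approx> x @ [k] @ ?g @ rev x @ [s]"
    using weq_append[OF weq_refl'[of x] weq_append[OF c weq_refl'[of "rev x @ [s]"]]] by simp
  also have "\<dots> \<approx> x @ [k] @ rev x" using weq_append[OF weq_refl'[of "x @ [k]"] gx] by simp
  finally show ?thesis by (simp add: rword_def)
qed

text \<open>Along a reduced word \<open>co s\<close> is never positive on the root, so a letter
  either raises the root or fixes it; in the second case \<open>rword_drop\<close> removes it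
  without changing the reflection.\<close>

lemma good_ex_red:
  assumes "k \<in> Im" "set y \<subseteq> Re" "len y = length y"
  shows "\<exists>x. good k x \<and> rt x k = rt y k \<and> rword x k \<approx> rword y k"
  using assms(2,3)
proof (induction y)
  case Nil
  then show ?case using good_Nil by (intro exI[of _ "[]"]) simp
next
  case (Cons s y)
  have y: "len y = length y" "len y < len (s # y)" using red_tl[OF Cons.prems(2)] by auto
  obtain x where x: "good k x" "rt x k = rt y k" "rword x k \<approx> rword y k" using Cons y by auto
  have sR: "s \<in> Re" using Cons.prems by auto
  have w: "rword (s # x) k \<approx> rword (s # y) k"
    unfolding rword_Cons using weq_Cons[OF weq_append[OF x(3) weq_refl'[of "[s]"]]] by simp
  have "co s (rt x k) \<le> 0"
    using cone_fun_nonpos[OF co_cone[OF sR y(2)], of "al k"] co_al_Im_nonpos[OF assms(1)] x(2) by auto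
  then consider "co s (rt x k) < 0" | "co s (rt x k) = 0" by linarith
  then show ?case
  proof cases
    case 1
    then show ?thesis using x w sR by (intro exI[of _ "s # x"]) (auto intro: good_Cons)
  next
    case 2
    have "rword x k \<approx> rword (s # y) k"
      using weq_tr[OF weq_sym[OF rword_drop[OF assms(1) good_real[OF x(1)] sR 2]] w] .
    moreover have "rt x k = rt (s # y) k" using 2 x(2) by (simp add: srefl_def)
    ultimately show ?thesis using x(1) by blast
  qed
qed

lemma good_ex:
  assumes "k \<in> Im" "set ws \<subseteq> Re"
  shows "\<exists>x. good k x \<and> rt x k = rt ws k \<and> rword x k \<approx> rword ws k \<and> (\<forall>z. cv x k z = cv ws k z)"
proof -
  obtain y where y: "y \<approx> ws" "length y = len ws" using len_ex by blast
  have yR: "set y \<subseteq> Re" using weq_real[OF weq_sym[OF y(1)] assms(2)] .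
  obtain x where x: "good k x" "rt x k = rt y k" "rword x k \<approx> rword y k"
    using good_ex_red[OF assms(1) yR] y len_cong[OF y(1)] by auto
  have 1: "rt x k = rt ws k" using x(2) weq_act[OF y(1)] by simp
  have "rword y k \<approx> rword ws k"
    unfolding rword_def using y(1) weq_rev[OF y(1)] by (intro weq_append) auto
  then have 2: "rword x k \<approx> rword ws k" using x(3) weq_tr by blast
  then show ?thesis using x(1) 1 cv_eqI[OF good_real[OF x(1)] assms(2) 2 1] by blast
qed

lemma good_supp:
  assumes "k \<in> Im" "good k x" "rt x k \<in> cone al Z" shows "set x \<subseteq> Z \<and> k \<in> Z"
  using assms(2,3)
proof (induction rule: good.induct)
  case good_Nil
  then have "comb al (\<lambda>j. if j = k then 1 else 0) \<in> cone al Z" by (simp add: comb_single)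
  from cone_coef(2)[OF this fsup_single, of k] show ?case by simp
next
  case (good_Cons x s)
  define n where "n = - co s (rt x k)"
  have n: "n > 0" using good_Cons by (simp add: n_def)
  have e: "rt (s # x) k = rt x k + n *\<^sub>R al s" by (simp add: srefl_def n_def)
  have c: "rt x k \<in> cone al UNIV" "n *\<^sub>R al s \<in> cone al UNIV"
    using al_Im_cone[OF assms(1)] n by (simp_all add: cone_scale_base)
  have "rt x k \<in> cone al Z" using cone_add_restrict[OF indep_al c] good_Cons.prems e by simp
  moreover have "n *\<^sub>R al s \<in> cone al Z"
    using cone_add_restrict[OF indep_al c(2,1)] good_Cons.prems e by (simp add: add.commute)
  then have "comb al (\<lambda>j. if j = s then n else 0) \<in> cone al Z" by (simp add: comb_single)
  from cone_coef(2)[OF this fsup_single, of s] have "s \<in> Z" using n by simp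
  ultimately show ?case using good_Cons by simp
qed

text \<open>\<open>co i\<close> is nonpositive on all simple roots, so its value on a root built up
  along a good word is 0 only if every added term is orthogonal.\<close>

lemma good_orth:
  assumes "k \<in> Im" "i \<in> Im" "good k x" "co i (rt x k) = 0"
  shows "(\<forall>s\<in>set x. co s (al i) = 0) \<and> co i (al k) = 0"
  using assms(3,4)
proof (induction rule: good.induct)
  case (good_Cons x s)
  define n where "n = - co s (rt x k)"
  have n: "n > 0" using good_Cons by (simp add: n_def)
  have e: "co i (rt (s # x) k) = co i (rt x k) + n * co i (al s)" by (simp add: srefl_def n_def)
  have 1: "co i (rt x k) \<le> 0"
    by (rule cone_linear_nonpos[OF al_Im_cone[OF assms(1)] lin_co co_Im_nonpos[OF assms(2)]])
  have 2: "n * co i (al s) \<le> 0" using n co_Im_nonpos[OF assms(2), of s] by (simp add: mult_nonneg_nonpos)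
  have "co i (rt x k) = 0" "n * co i (al s) = 0" using e good_Cons.prems 1 2 by linarith+
  then show ?case using good_Cons.IH n co_al_sym[of i s] by simp
qed simp

lemma Im_refl_comm:
  assumes "set ws \<subseteq> Re" "k \<in> Im" "i \<in> Im" "co i (rt ws k) = 0"
  shows "rword ws k @ [i] \<approx> [i] @ rword ws k"
proof -
  obtain x where x: "good k x" "rt x k = rt ws k" "rword x k \<approx> rword ws k" using good_ex[OF assms(2,1)] by blast
  have o: "\<forall>s\<in>set x. co s (al i) = 0" "co i (al k) = 0" using good_orth[OF assms(2,3) x(1)] x(2) assms(4) by auto
  have "rword x k @ [i] \<approx> [i] @ rword x k"
  proof (cases "k = i")
    case True
    \<comment> \<open>A letter of a good word has to move the root, but here all letters are
      orthogonal to \<open>k\<close>.\<close>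
    have "x = []" using x(1)
    proof (cases rule: good.cases)
      case (good_Cons y s)
      have "\<forall>t\<in>set y. co t (al k) = 0" using o(1) good_Cons True by simp
      then have "rt y k = al k" by (induction y) (auto simp: srefl_def)
      then show ?thesis using good_Cons o(1) True by simp
    qed simp
    then show ?thesis using True by (simp add: rword_def)
  next
    case False
    have "\<forall>s\<in>set (rword x k). s \<noteq> i \<and> co s (al i) = 0"
      using o good_real[OF x(1)] assms(3) False co_al_sym[of i k] by (auto simp: set_rword Im_iff)
    then show ?thesis by (rule orth_word_comm[OF assms(3)])
  qed
  then show ?thesis
    using weq_tr[OF weq_append[OF weq_sym[OF x(3)] weq_refl'[of "[i]"]]]
      weq_tr[OF _ weq_append[OF weq_refl'[of "[i]"] x(3)]] by blast
qed

lemma refl_comm: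
  assumes "rrep ws k" "i \<in> Im" "co i (rt ws k) = 0"
  shows "rword ws k @ [i] \<approx> [i] @ rword ws k" "cv ws k (al i) = 0"
proof -
  have ws: "set ws \<subseteq> Re" using assms(1) rrep_iff by auto
  show c: "rword ws k @ [i] \<approx> [i] @ rword ws k"
  proof (cases "k \<in> Re")
    case True
    then show ?thesis using real_refl_comm[OF ws True assms(2)] assms(3) by blast
  next
    case False
    then show ?thesis using Im_refl_comm[OF ws _ assms(2,3)] Im_iff by blast
  qed
  \<comment> \<open>Comparing both orders of the product on a vector where \<open>co i\<close> is
    nonzero converts commutation into the other orthogonality.\<close>
  obtain z where "cv [] i z \<noteq> 0" using cv_nonzero[of "[]" i] by auto
  then have z: "co i z \<noteq> 0" by (simp add: corv_def)
  have "W (rword ws k) (r i z) = r i (W (rword ws k) z)" using weq_act[OF c, of z] by simp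
  then have "cv ws k (r i z) *\<^sub>R rt ws k = cv ws k z *\<^sub>R rt ws k"
    using assms(3) by (simp add: W_rword[OF ws] srefl_def)
  then have "cv ws k (r i z) = cv ws k z" using rt_nonzero[OF ws] by simp
  then show "cv ws k (al i) = 0" using z by (simp add: srefl_def cv_diff cv_scale)
qed

text \<open>Induction on the height. As the coroot takes the value 2 on its root, some
  \<open>j\<close> occurs in the coroot and is positive on the root. Such a \<open>j\<close> is real
  and lies in \<open>Z\<close>, and reflecting in it lowers the height while changing both supports
  only at \<open>j\<close>.\<close>

lemma real_supp:
  assumes "rrep ws s" "s \<in> Re" "rt ws s \<in> cone al Z" shows "cv ws s \<in> cone co Z"
proof -
  have "cv ws s \<in> cone co Z" if "ht (rt ws s) \<le> real n" "rrep ws s" "rt ws s \<in> cone al Z" for n ws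
    using that
  proof (induction n arbitrary: ws rule: nat_less_induct)
    case (1 n)
    have ws: "set ws \<subseteq> Re" and pos: "rt ws s \<in> cone al UNIV" using 1 rrep_iff by auto
    obtain c where c: "fsup c" "\<forall>i. 0 \<le> c i" "cv ws s = comb co c" by (rule coneE[OF cv_cone[OF "1"(3)]])
    have "cv ws s (rt ws s) = 2" using cv_rt[OF ws] co_al_Re[OF assms(2)] by simp
    then have "(\<Sum>i | c i \<noteq> 0. c i * co i (rt ws s)) > 0" using c(3) by (simp add: comb_fun_apply)
    have "\<exists>j. 0 < c j * co j (rt ws s)"
    proof (rule ccontr)
      assume "\<nexists>j. 0 < c j * co j (rt ws s)"
      then have "(\<Sum>i | c i \<noteq> 0. c i * co i (rt ws s)) \<le> 0" by (intro sum_nonpos) (simp add: not_less)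
      then show False using \<open>(\<Sum>i | c i \<noteq> 0. c i * co i (rt ws s)) > 0\<close> by simp
    qed
    then obtain j where cj: "0 < c j * co j (rt ws s)" by blast
    have j: "co j (rt ws s) > 0"
    proof (rule ccontr)
      assume "\<not> ?thesis"
      then have "c j * co j (rt ws s) \<le> 0" using c(2) by (intro mult_nonneg_nonpos) auto
      then show False using cj by simp
    qed
    have jZ: "j \<in> Z"
    proof (rule ccontr)
      assume "j \<notin> Z"
      then have "co j (al i) \<le> 0" if "i \<in> Z" for i using that by (intro co_al_offdiag) auto
      then have "co j (rt ws s) \<le> 0" by (rule cone_linear_nonpos[OF "1"(4) lin_co])
      then show False using j by simp
    qed
    have jR: "j \<in> Re"
    proof (rule ccontr)
      assume "j \<notin> Re"
      then have "co j (rt ws s) \<le> 0"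
        by (intro cone_linear_nonpos[OF pos lin_co] co_Im_nonpos) (simp add: Im_iff)
      then show False using j by simp
    qed
    show ?case
    proof (cases "rt ws s = al j")
      case True
      have "cv ws s x = co j x" for x
      proof -
        have "rword ws s \<approx> rword [] j" using rword_simple[OF "1"(3) jR True] by (simp add: rword_def)
        then have "cv ws s x = cv [] j x" using ws True by (intro cv_eqI) auto
        then show ?thesis by (simp add: corv_def)
      qed
      then have "cv ws s = co j" by (simp add: fun_eq_iff)
      then show ?thesis using cone_base[OF jZ, of co] by simp
    next
      case False
      have rr: "rrep (j # ws) s" using rrep_Cons[OF "1"(3) jR False] .
      have e: "rt (j # ws) s = rt ws s - co j (rt ws s) *\<^sub>R al j" by (simp add: srefl_def)
      have pos': "rt (j # ws) s \<in> cone al UNIV" using rr rrep_iff by blast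
      have "rt (j # ws) s \<in> cone al Z"
      proof (rule cone_add_restrict[OF indep_al pos'])
        show "co j (rt ws s) *\<^sub>R al j \<in> cone al UNIV" using j by (simp add: cone_scale_base)
        show "rt (j # ws) s + co j (rt ws s) *\<^sub>R al j \<in> cone al Z" using "1"(4) e by simp
      qed
      moreover have h: "ht (rt (j # ws) s) = ht (rt ws s) - co j (rt ws s)"
        unfolding e by (rule ht_sub_al[OF cone_sp[OF pos]])
      have j1: "co j (rt ws s) \<ge> 1" using Ints_ge_1[OF lat_co[OF W_lat[OF lat_al]] j] .
      have "n \<ge> 1" using h j1 ht_nonneg[OF pos'] "1"(2) by (cases n) auto
      then have "ht (rt (j # ws) s) \<le> real (n - 1)" using h j1 "1"(2) by (simp add: of_nat_diff)
      moreover have "n - 1 < n" using \<open>n \<ge> 1\<close> by simp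
      ultimately have "cv (j # ws) s \<in> cone co Z" using 1(1) rr by blast
      then obtain d where d: "fsup d" "\<forall>i. 0 \<le> d i" "\<forall>i. d i \<noteq> 0 \<longrightarrow> i \<in> Z" "cv (j # ws) s = comb co d"
        by (rule coneE)
      define t where "t = - cv (j # ws) s (al j)"
      have "cv ws s x = cv (j # ws) s x + t * co j x" for x
        using cv_Cons[OF jR, of ws s x, symmetric] by (simp add: srefl_def cv_diff cv_scale t_def)
      then have "cv ws s = comb co d + t *\<^sub>R co j" using d(4) by (simp add: fun_eq_iff)
      then have "comb co c = comb co (\<lambda>i. d i + (if i = j then t else 0))"
        using c(3) by (simp add: comb_add[OF d(1) fsup_single] comb_single)
      then have cd: "c = (\<lambda>i. d i + (if i = j then t else 0))"
        using comb_inj[OF indep_co c(1) fsup_add[OF d(1) fsup_single]] by blast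
      show ?thesis
      proof (rule coneI[OF c(1) _ _ c(3)])
        show "0 \<le> c i" for i using c(2) by blast
        show "i \<in> Z" if "c i \<noteq> 0" for i using that d(3) jZ unfolding cd by (cases "i = j") auto
      qed
    qed
  qed
  moreover have "ht (rt ws s) \<le> real (nat \<lceil>ht (rt ws s)\<rceil>)" by linarith
  ultimately show ?thesis using assms by blast
qed

text \<open>For a real root this is \<open>real_supp\<close>; for an imaginary one the letters of a
  good word lie in the support and fix \<open>x\<close>.\<close>

lemma supp_zero:
  assumes "rrep ws s" "rt ws s \<in> cone al Z" "\<forall>k\<in>Z. co k x = 0" shows "cv ws s x = 0"
proof (cases "s \<in> Re")
  case True
  then have "cv ws s \<in> cone co Z" using real_supp assms by blast
  then show ?thesis using assms(3) cone_fun_nonneg[of _ co Z x] cone_fun_nonpos[of _ co Z x] by (simp add: order_antisym)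
next
  case False
  then have sI: "s \<in> Im" by (simp add: Im_iff)
  obtain y where y: "good s y" "rt y s = rt ws s" "\<forall>z. cv y s z = cv ws s z"
    using good_ex[OF sI, of ws] assms(1) rrep_iff by blast
  have Z: "set y \<subseteq> Z" "s \<in> Z" using good_supp[OF sI y(1)] y(2) assms(2) by auto
  have "W (rev y) x = x" if "set y \<subseteq> Z" for y
    using that assms(3) by (induction y rule: rev_induct) (auto simp: srefl_def)
  then have "cv y s x = 0" using Z assms(3) by (simp add: corv_def)
  then show ?thesis using y(3) by simp
qed

end

section \<open>The Bruhat order\<close>

context bc
begin

text \<open>An exchange condition. Moving along \<open>v\<close>, the root either meets the simple
  root of the next letter, which is then deleted, or passes it: by conjugation at a real letter, by
  commutation at an orthogonal imaginary one. An imaginary letter that is not orthogonal forces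
  positivity.\<close>

lemma refl_del:
  assumes "rrep ws s" "s \<in> Re"
  shows "(\<lambda>x. cv ws s (W v x)) \<in> cone co UNIV \<or> (\<exists>v'. length v' < length v \<and> rword ws s @ v \<approx> v')"
  using assms(1)
proof (induction v arbitrary: ws)
  case Nil
  then show ?case using cv_cone[OF Nil] by simp
next
  case (Cons i v)
  have ws: "set ws \<subseteq> Re" using Cons.prems rrep_iff by blast
  show ?case
  proof (cases "i \<in> Re")
    case iR: True
    show ?thesis
    proof (cases "rt ws s = al i")
      case True
      have "rword ws s @ i # v \<approx> [i] @ i # v"
        using rword_simple[OF Cons.prems iR True] by (intro weq_append) auto
      also have "[i] @ i # v \<approx> v" using weq_cancel2[OF iR] by simp
      finally show ?thesis by (intro disjI2 exI[of _ v]) simp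
    next
      case False
      have rr: "rrep (i # ws) s" by (rule rrep_Cons[OF Cons.prems iR False])
      have e: "cv ws s (W (i # v) x) = cv (i # ws) s (W v x)" for x by (simp add: cv_Cons')
      from Cons.IH[OF rr] show ?thesis
      proof
        assume "(\<lambda>x. cv (i # ws) s (W v x)) \<in> cone co UNIV"
        then show ?thesis unfolding e by (rule disjI1)
      next
        assume "\<exists>v'. length v' < length v \<and> rword (i # ws) s @ v \<approx> v'"
        then obtain v' where v': "length v' < length v" "rword (i # ws) s @ v \<approx> v'" by blast
        have "rword ws s @ i # v \<approx> i # i # rword ws s @ i # v" using weq_sym[OF weq_cancel2[OF iR]] .
        also have "\<dots> \<approx> i # v'" using weq_Cons[OF v'(2)] by (simp add: rword_Cons)
        finally show ?thesis using v'(1) by (intro disjI2 exI[of _ "i # v'"]) simp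
      qed
    qed
  next
    case False
    then have iI: "i \<in> Im" by (simp add: Im_iff)
    show ?thesis
    proof (cases "cv ws s (al i) = 0")
      case True
      have e: "cv ws s (W (i # v) x) = cv ws s (W v x)" for x
        using True by (simp add: srefl_def cv_diff cv_scale)
      have c: "rword ws s @ [i] \<approx> [i] @ rword ws s" using real_refl_comm[OF ws assms(2) iI] True by blast
      from Cons.IH[OF Cons.prems] show ?thesis
      proof
        assume "(\<lambda>x. cv ws s (W v x)) \<in> cone co UNIV"
        then show ?thesis unfolding e by (rule disjI1)
      next
        assume "\<exists>v'. length v' < length v \<and> rword ws s @ v \<approx> v'"
        then obtain v' where v': "length v' < length v" "rword ws s @ v \<approx> v'" by blast
        have "rword ws s @ i # v \<approx> i # rword ws s @ v" using weq_append[OF c weq_refl'[of v]] by simp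
        also have "\<dots> \<approx> i # v'" by (rule weq_Cons[OF v'(2)])
        finally show ?thesis using v'(1) by (intro disjI2 exI[of _ "i # v'"]) simp
      qed
    next
      case nz: False
      \<comment> \<open>The combination of \<open>T_base_cone\<close> again: the pullbacks of
        \<open>co i\<close> along \<open>v\<close> and along the reflected word are both positive,
        and \<open>m - 1 / n\<close> is nonnegative.\<close>
      define m n where "m = - cv ws s (al i)" and "n = - co i (rt ws s)"
      have "cv ws s (al i) \<le> 0"
        by (rule cone_fun_nonpos[OF cv_cone[OF Cons.prems] co_al_Im_nonpos[OF iI]])
      moreover have "cv ws s (al i) \<in> \<int>" unfolding corv_def by (rule lat_co[OF W_lat[OF lat_al]])
      ultimately have m: "m \<ge> 1" using nz Ints_ge_1[of m] by (simp add: m_def)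
      have "co i (rt ws s) \<noteq> 0" using real_refl_comm[OF ws assms(2) iI] nz by blast
      moreover have "co i (rt ws s) \<le> 0"
        using cone_linear_nonpos[of "rt ws s" al UNIV "co i"] Cons.prems co_Im_nonpos[OF iI] lin_co rrep_iff by blast
      moreover have "co i (rt ws s) \<in> \<int>" by (rule lat_co[OF W_lat[OF lat_al]])
      ultimately have n: "n \<ge> 1" using Ints_ge_1[of n] by (simp add: n_def)
      have e: "(\<lambda>x. cv ws s (W (i # v) x)) =
        (1 / n) *\<^sub>R (\<lambda>x. co i (W (rword ws s @ v) x)) + (m - 1 / n) *\<^sub>R (\<lambda>x. co i (W v x))"
      proof
        fix x
        have "cv ws s (W (i # v) x) = cv ws s (W v x) + m * co i (W v x)"
          by (simp add: srefl_def cv_diff cv_scale m_def)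
        moreover have "co i (W (rword ws s @ v) x) = co i (W v x) + n * cv ws s (W v x)"
          by (simp add: W_rword[OF ws] n_def)
        ultimately show "cv ws s (W (i # v) x) =
          ((1 / n) *\<^sub>R (\<lambda>x. co i (W (rword ws s @ v) x)) + (m - 1 / n) *\<^sub>R (\<lambda>x. co i (W v x))) x"
          using n by (simp add: field_simps)
      qed
      have "1 / n \<le> 1" using n by simp
      then have "0 \<le> m - 1 / n" using m by linarith
      then have "(\<lambda>x. cv ws s (W (i # v) x)) \<in> cone co UNIV"
        unfolding e using n by (intro cone_add cone_scale co_Im_cone[OF iI]) auto
      then show ?thesis by (rule disjI1)
    qed
  qed
qed

lemma rev_rword [simp]: "rev (rword ws s) = rword ws s" by (simp add: rword_def)

lemma rword_rword: assumes "set ws \<subseteq> Re" "s \<in> Re" shows "rword ws s @ rword ws s @ v \<approx> v"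
proof -
  have "set (rword ws s) \<subseteq> Re" using assms by (simp add: set_rword)
  from weq_append[OF weq_rev_cancel[OF this] weq_refl'[of v]] show ?thesis by simp
qed

lemma refl_down:
  assumes "rrep ws s" "s \<in> Re" "(\<lambda>x. cv ws s (W v x)) \<notin> cone co UNIV"
  shows "len (rword ws s @ v) < len v"
proof -
  obtain y where y: "y \<approx> v" "length y = len v" using len_ex by blast
  have e: "W v x = W y x" for x using weq_act[OF y(1)] by simp
  obtain v' where v': "length v' < length y" "rword ws s @ y \<approx> v'"
    using refl_del[OF assms(1,2), of y] assms(3) unfolding e by blast
  have "len (rword ws s @ v) = len (rword ws s @ y)"
    by (rule len_cong[OF weq_append[OF weq_refl' weq_sym[OF y(1)]]])
  also have "\<dots> \<le> length v'" by (rule len_le[OF weq_sym[OF v'(2)]])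
  finally show ?thesis using v'(1) y(2) by simp
qed

lemma cv_rword: assumes "set ws \<subseteq> Re" "s \<in> Re" shows "cv ws s (W (rword ws s) x) = - cv ws s x"
  using assms by (simp add: W_rword cv_diff cv_scale cv_rt co_al_Re)

lemma cv_W_nonzero: assumes "set ws \<subseteq> Re" shows "\<exists>x. cv ws s (W v x) \<noteq> 0"
  using cv_nonzero[OF assms, of s] W_surj[of v] by metis

lemma refl_cone_excl:
  assumes "set ws \<subseteq> Re" "(\<lambda>x. cv ws s (W v x)) \<in> cone co UNIV" "(\<lambda>x. - cv ws s (W v x)) \<in> cone co UNIV"
  shows False
proof -
  have "- (\<lambda>x. cv ws s (W v x)) = (\<lambda>x. - cv ws s (W v x))" by (simp add: fun_eq_iff)
  then have "(\<lambda>x. cv ws s (W v x)) = 0" using cone_antisym[OF indep_co assms(2)] assms(3) by simp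
  then show False using cv_W_nonzero[OF assms(1), of s v] by (auto simp: fun_eq_iff)
qed

lemma refl_up:
  assumes "rrep ws s" "s \<in> Re" "(\<lambda>x. cv ws s (W v x)) \<in> cone co UNIV"
  shows "len v < len (rword ws s @ v)"
proof -
  have ws: "set ws \<subseteq> Re" using assms(1) rrep_iff by blast
  have e: "cv ws s (W (rword ws s @ v) x) = - cv ws s (W v x)" for x
    using cv_rword[OF ws assms(2)] by simp
  have "(\<lambda>x. cv ws s (W (rword ws s @ v) x)) \<notin> cone co UNIV"
    unfolding e using refl_cone_excl[OF ws assms(3)] by blast
  from refl_down[OF assms(1,2) this] show ?thesis using len_cong[OF rword_rword[OF ws assms(2)]] by simp
qed

text \<open>If neither sign occurred, \<open>refl_down\<close> would apply to \<open>v\<close> and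
  to its reflection, each being shorter than the other.\<close>

lemma refl_dichot:
  assumes "rrep ws s" "s \<in> Re"
  shows "(\<lambda>x. cv ws s (W v x)) \<in> cone co UNIV \<or> (\<lambda>x. - cv ws s (W v x)) \<in> cone co UNIV"
proof (rule ccontr)
  assume n: "\<not> ?thesis"
  have ws: "set ws \<subseteq> Re" using assms(1) rrep_iff by blast
  have e: "cv ws s (W (rword ws s @ v) x) = - cv ws s (W v x)" for x
    using cv_rword[OF ws assms(2)] by simp
  have 1: "len (rword ws s @ v) < len v" using n by (intro refl_down[OF assms]) blast
  have "(\<lambda>x. cv ws s (W (rword ws s @ v) x)) \<notin> cone co UNIV" unfolding e using n by blast
  from refl_down[OF assms this] show False using len_cong[OF rword_rword[OF ws assms(2)], of v] 1 by simp
qed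

text \<open>Only commutations involve an imaginary letter, so deleting an occurrence respects the
  congruence. This stands in for the missing inverse.\<close>

lemma weq_remove1: "x \<approx> y \<Longrightarrow> i \<in> Im \<Longrightarrow> remove1 i x \<approx> remove1 i y"
proof (induction x y rule: weq.induct)
  case (weq_ctxt xs ys as bs)
  have c: "i \<in> set xs \<longleftrightarrow> i \<in> set ys"
    using weq_count_Im[OF weq_ctxt(1) weq_ctxt(3)] by (metis count_list_0_iff)
  have IH: "remove1 i xs \<approx> remove1 i ys" using weq_ctxt by blast
  show ?case
    using c weq.weq_ctxt[OF IH, of as bs] weq.weq_ctxt[OF weq_ctxt(1), of "remove1 i as" bs]
      weq.weq_ctxt[OF weq_ctxt(1), of as "remove1 i bs"]
    by (simp add: remove1_append)
next
  case (weq_trans xs ys zs)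
  show ?case by (rule weq.weq_trans[OF weq_trans(3,4)[OF weq_trans(5)]])
next
  case (weq_inv k)
  then have "k \<noteq> i" by (auto simp: Im_iff)
  then show ?case using weq.weq_inv[OF weq_inv(1)] by simp
next
  case (weq_braid k j m)
  then have "i \<notin> set (concat (replicate m [k, j]))" by (auto simp: Im_iff)
  then show ?case using weq.weq_braid[OF weq_braid(1-5)] by (simp add: remove1_idem)
next
  case (weq_comm k j)
  show ?case using weq.weq_comm[OF weq_comm(1-3)] by simp
qed (simp_all add: weq_sym)

text \<open>Deleting \<open>i\<close> from a shortest word of \<open>rword ws i @ v\<close> leaves a
  shorter word for \<open>v\<close>.\<close>

lemma len_Im_up: assumes "set ws \<subseteq> Re" "i \<in> Im" shows "len v < len (rword ws i @ v)"
proof -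
  obtain y where y: "y \<approx> rword ws i @ v" "length y = len (rword ws i @ v)" using len_ex by blast
  have "i \<notin> set ws" using assms by (auto simp: Im_iff)
  then have e: "remove1 i (rword ws i @ v) = ws @ rev ws @ v" by (simp add: rword_def remove1_append)
  have "remove1 i y \<approx> ws @ rev ws @ v" using weq_remove1[OF y(1) assms(2)] e by simp
  also have "\<dots> \<approx> v" using weq_append[OF weq_rev_cancel'[OF assms(1)] weq_refl'[of v]] by simp
  finally have "len v \<le> length (remove1 i y)" by (rule len_le)
  moreover have "count_list y i \<noteq> 0"
    using weq_count_Im[OF y(1) assms(2)] by (simp add: rword_def)
  then have "i \<in> set y" by (simp add: count_list_0_iff)
  then have "length (remove1 i y) < length y" using length_pos_if_in_set[of i y] by (simp add: length_remove1)
  ultimately show ?thesis using y(2) by simp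
qed

lemma dom_cone_nonneg: "\<phi> \<in> cone co UNIV \<Longrightarrow> dom x \<Longrightarrow> 0 \<le> \<phi> x"
  unfolding dom_def by (rule cone_fun_nonneg) auto

text \<open>Unlike for a real letter, no condition on lengths enters: imaginary coroots pull back to
  positive functionals along every word.\<close>

lemma co_Im_orbit: "i \<in> Im \<Longrightarrow> dom x \<Longrightarrow> 0 \<le> co i (W w x)"
  by (rule dom_cone_nonneg[OF co_Im_cone])

text \<open>Converts a strict inequality at a dominant weight into a comparison of lengths.
  \<open>rrep_nonneg\<close> goes back, with a weak inequality only, since the reflection may fix
  the weight.\<close>

lemma rrep_up:
  assumes "rrep ws i" "dom x" "cv ws i (W v x) > 0" shows "len v < len (rword ws i @ v)"
proof (cases "i \<in> Re")
  case True
  have "(\<lambda>x. - cv ws i (W v x)) \<notin> cone co UNIV" using dom_cone_nonneg[OF _ assms(2)] assms(3) by force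
  then show ?thesis using refl_up[OF assms(1) True] refl_dichot[OF assms(1) True] by blast
next
  case False
  then show ?thesis using len_Im_up assms(1) rrep_iff Im_iff by blast
qed

lemma rrep_nonneg:
  assumes "rrep ws i" "dom x" "len v < len (rword ws i @ v)" shows "0 \<le> cv ws i (W v x)"
proof (cases "i \<in> Re")
  case True
  have "(\<lambda>x. cv ws i (W v x)) \<in> cone co UNIV"
    using refl_down[OF assms(1) True, of v] assms(3) by (meson not_less_iff_gr_or_eq)
  then show ?thesis by (rule dom_cone_nonneg[OF _ assms(2)])
next
  case False
  then have "0 \<le> co i (W (rev ws @ v) x)" by (intro co_Im_orbit assms(2)) (simp add: Im_iff)
  then show ?thesis by (simp add: corv_def)
qed

section \<open>Bruhat edges and the lifting property\<close>

abbreviation ble where "ble \<equiv> bruhat_le co al"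
abbreviation be where "be \<equiv> bedge co al"

lemma be_cong: assumes "be u v" "u \<approx> u'" "v \<approx> v'" shows "be u' v'"
proof -
  obtain ws i where w: "rrep ws i" "v \<approx> rword ws i @ u" "len u < len v" using assms(1) unfolding bedge_def by blast
  have "v' \<approx> v" by (rule weq_sym[OF assms(3)])
  also have "v \<approx> rword ws i @ u" by (rule w(2))
  also have "\<dots> \<approx> rword ws i @ u'" by (rule weq_append[OF weq_refl' assms(2)])
  finally show ?thesis unfolding bedge_def using w len_cong[OF assms(2)] len_cong[OF assms(3)] by auto
qed

lemma ble_weq: "u \<approx> v \<Longrightarrow> ble u v" unfolding bruhat_le_def by blast
lemma ble_be: "be u v \<Longrightarrow> ble u v" unfolding bruhat_le_def using weq_refl' by blast

text \<open>\<open>bruhat_le\<close> allows a change of word only at the lower end, so a change in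
  the middle has to be absorbed by a neighbouring edge, if there is one.\<close>

lemma ble_trans: assumes "ble u v" "ble v w" shows "ble u w"
proof -
  obtain u' where u': "u \<approx> u'" "be\<^sup>*\<^sup>* u' v" using assms(1) unfolding bruhat_le_def by blast
  obtain v' where v': "v \<approx> v'" "be\<^sup>*\<^sup>* v' w" using assms(2) unfolding bruhat_le_def by blast
  show ?thesis
  proof (cases "v' = w")
    case True
    show ?thesis
    proof (cases "u' = v")
      case eq: True
      then show ?thesis using ble_weq weq_tr[OF u'(1)] v'(1) True by simp
    next
      case False
      then obtain y where "be\<^sup>*\<^sup>* u' y" "be y v" using u'(2) by (metis rtranclp.cases)
      then have "be\<^sup>*\<^sup>* u' w" using be_cong[OF _ weq_refl' v'(1)] True by (auto intro: rtranclp.rtrancl_into_rtrancl)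
      then show ?thesis using u'(1) unfolding bruhat_le_def by blast
    qed
  next
    case False
    then obtain z where "be v' z" "be\<^sup>*\<^sup>* z w" using v'(2) by (metis converse_rtranclpE)
    then have "be v z" using be_cong weq_sym[OF v'(1)] weq_refl' by blast
    then have "be\<^sup>*\<^sup>* u' w" using u'(2) \<open>be\<^sup>*\<^sup>* z w\<close> by (meson rtranclp.rtrancl_into_rtrancl rtranclp_trans)
    then show ?thesis using u'(1) unfolding bruhat_le_def by blast
  qed
qed

lemma ble_induct [consumes 1, case_names weq edge trans]:
  assumes "ble u v" "\<And>u v. u \<approx> v \<Longrightarrow> Q u v" "\<And>u v. be u v \<Longrightarrow> Q u v"
    "\<And>u v w. Q u v \<Longrightarrow> Q v w \<Longrightarrow> Q u w"
  shows "Q u v"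
proof -
  obtain u' where u': "u \<approx> u'" "be\<^sup>*\<^sup>* u' v" using assms(1) unfolding bruhat_le_def by blast
  have "Q u' v" using u'(2) by (induction rule: rtranclp_induct) (use assms(2-4) weq_refl' in blast)+
  then show ?thesis using assms(2)[OF u'(1)] assms(4) by blast
qed

text \<open>On dominant weights this choice of the shorter word corresponds to \<open>lo\<close>,
  see \<open>W_dn\<close>.\<close>

definition dn :: "'i \<Rightarrow> 'i list \<Rightarrow> 'i list" where
  "dn j w = (if len (j # w) < len w then j # w else w)"

lemma be_simple: assumes "j \<in> Re" "len w < len (j # w)" shows "be w (j # w)"
  unfolding bedge_def using rrep_Nil[of j] assms(2) by (intro exI[of _ "[]"] exI[of _ j]) (simp add: rword_def)

lemma dn_le: assumes "j \<in> Re" shows "ble (dn j w) w"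
proof (cases "len (j # w) < len w")
  case True
  have c: "j # j # w \<approx> w" by (rule weq_cancel2[OF assms])
  then have "be (j # w) (j # j # w)" using True len_cong[OF c] by (intro be_simple[OF assms]) simp
  then have "be (j # w) w" using be_cong[OF _ weq_refl' c] by blast
  then show ?thesis using True ble_be by (simp add: dn_def)
qed (simp add: dn_def ble_weq)

text \<open>Conjugation by \<open>j\<close> keeps the root positive. For a real root the pulled-back
  coroot is unchanged, and its sign decides the length; for an imaginary one the length always
  grows.\<close>

lemma be_conj:
  assumes "rrep ws i" "j \<in> Re" "rt ws i \<noteq> al j" "u \<approx> rword ws i @ v" "len v < len u"
  shows "be (j # v) (j # u)"
proof -
  have rr: "rrep (j # ws) i" by (rule rrep_Cons[OF assms(1-3)])
  have "j # u \<approx> j # rword ws i @ v" by (rule weq_Cons[OF assms(4)])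
  also have "\<dots> \<approx> (j # rword ws i) @ (j # j # v)" using weq_append[OF weq_refl' weq_sym[OF weq_cancel2[OF assms(2)]], of "j # rword ws i" v]
    by simp
  finally have e: "j # u \<approx> rword (j # ws) i @ j # v" by (simp add: rword_Cons)
  have "len (j # v) < len (rword (j # ws) i @ j # v)"
  proof (cases "i \<in> Re")
    case True
    have "len v < len (rword ws i @ v)" using assms(5) len_cong[OF assms(4)] by simp
    then have "(\<lambda>x. cv ws i (W v x)) \<in> cone co UNIV"
      using refl_down[OF assms(1) True, of v] by (meson not_less_iff_gr_or_eq)
    moreover have "cv (j # ws) i (W (j # v) x) = cv ws i (W v x)" for x using cv_Cons[OF assms(2)] by simp
    ultimately have "(\<lambda>x. cv (j # ws) i (W (j # v) x)) \<in> cone co UNIV" by simp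
    then show ?thesis by (rule refl_up[OF rr True])
  next
    case False
    then show ?thesis using len_Im_up rr rrep_iff Im_iff by blast
  qed
  then show ?thesis unfolding bedge_def using rr e len_cong[OF e] by auto
qed

text \<open>The lifting property of the Bruhat order. An edge whose root is \<open>al j\<close>
  joins \<open>v\<close> to \<open>j # v\<close> and collapses; every other edge is conjugated by
  \<open>j\<close>.\<close>

lemma dn_mono: assumes "ble v u" "j \<in> Re" shows "ble (dn j v) (dn j u)"
  using assms(1)
proof (induction rule: ble_induct)
  case (weq u v)
  have "len (j # u) = len (j # v)" "len u = len v" using len_cong[OF weq_Cons[OF weq]] len_cong[OF weq] by auto
  then show ?case using ble_weq[OF weq] ble_weq[OF weq_Cons[OF weq]] by (simp add: dn_def)
next
  case (edge v u)
  obtain ws i where w: "rrep ws i" "u \<approx> rword ws i @ v" "len v < len u" using edge unfolding bedge_def by blast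
  have d: "ble (dn j v) v" by (rule dn_le[OF assms(2)])
  show ?case
  proof (cases "len (j # u) < len u")
    case False
    then show ?thesis using ble_trans[OF d ble_be[OF edge]] by (simp add: dn_def)
  next
    case True
    show ?thesis
    proof (cases "rt ws i = al j")
      case eq: True
      have "u \<approx> [j] @ v" using weq_tr[OF w(2) weq_append[OF rword_simple[OF w(1) assms(2) eq] weq_refl']] .
      then have "j # u \<approx> j # j # v" using weq_Cons by simp
      then have "j # u \<approx> v" by (rule weq_tr[OF _ weq_cancel2[OF assms(2)]])
      then have "ble v (j # u)" by (rule ble_weq[OF weq_sym])
      then show ?thesis using ble_trans[OF d] True by (simp add: dn_def)
    next
      case False
      have b: "be (j # v) (j # u)" by (rule be_conj[OF w(1) assms(2) False w(2,3)])
      show ?thesis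
      proof (cases "len (j # v) < len v")
        case lt: True
        then show ?thesis using ble_be[OF b] True by (simp add: dn_def)
      next
        case ge: False
        then have "be v (j # v)" using len_Cons_Re[OF assms(2), of v] by (intro be_simple[OF assms(2)]) auto
        then show ?thesis using ble_trans[OF ble_be ble_be[OF b]] True ge by (simp add: dn_def)
      qed
    qed
  qed
next
  case (trans u v w)
  then show ?case by (rule ble_trans)
qed

section \<open>The order on weights and the relation \<open>mv\<close>\<close>

abbreviation wst where "wst \<equiv> wstep co al"
abbreviation ge where "ge \<equiv> wge co al"
abbreviation gt where "gt \<equiv> wgt co al"
abbreviation cov where "cov \<equiv> wcovers co al"

lemma ge_refl [simp]: "ge x x" by (simp add: wge_def)
lemma ge_trans: "ge x y \<Longrightarrow> ge y z \<Longrightarrow> ge x z" unfolding wge_def by (rule rtranclp_trans)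
lemma ge_step: "wst x y \<Longrightarrow> ge x y" unfolding wge_def by blast

lemma wstI: "rrep ws i \<Longrightarrow> 0 < cv ws i y \<Longrightarrow> x = W (rword ws i) y \<Longrightarrow> wst x y"
  unfolding wstep_def by blast

text \<open>An edge whose reflection fixes the weight becomes an equality, every other one a
  step.\<close>

lemma ble_ge: assumes "ble v u" "dom x" shows "ge (W u x) (W v x)"
  using assms(1)
proof (induction rule: ble_induct)
  case (weq u v)
  then show ?case using weq_act[OF weq] by simp
next
  case (edge v u)
  obtain ws i where w: "rrep ws i" "u \<approx> rword ws i @ v" "len v < len u" using edge unfolding bedge_def by blast
  have "0 \<le> cv ws i (W v x)" using w(3) len_cong[OF w(2)] by (intro rrep_nonneg[OF w(1) assms(2)]) simp
  moreover have e: "W u x = W (rword ws i) (W v x)" using weq_act[OF w(2)] by simp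
  moreover have "set ws \<subseteq> Re" using w(1) rrep_iff by blast
  ultimately show ?case using wstI[OF w(1)] ge_step W_rword
    by (cases "cv ws i (W v x) = 0") simp_all
next
  case (trans u v w)
  then show ?case using ge_trans by blast
qed

text \<open>Unlike the Bruhat order, \<open>mv x\<close> only allows reflections that move the weight \<open>v x\<close>. This is
  what makes it compatible with left multiplication by imaginary letters (\<open>mv_Im\<close>).\<close>

definition mvs :: "'v \<Rightarrow> 'i list \<Rightarrow> 'i list \<Rightarrow> bool" where
  "mvs x v u \<longleftrightarrow> v \<approx> u \<or> (\<exists>ws i. rrep ws i \<and> u \<approx> rword ws i @ v \<and> 0 < cv ws i (W v x))"

definition mv :: "'v \<Rightarrow> 'i list \<Rightarrow> 'i list \<Rightarrow> bool" where "mv x = (mvs x)\<^sup>*\<^sup>*"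

lemma mv_refl [simp]: "mv x v v" by (simp add: mv_def)
lemma mv_trans: "mv x u v \<Longrightarrow> mv x v w \<Longrightarrow> mv x u w" unfolding mv_def by (rule rtranclp_trans)
lemma mv_step: "rrep ws i \<Longrightarrow> u \<approx> rword ws i @ v \<Longrightarrow> 0 < cv ws i (W v x) \<Longrightarrow> mv x v u"
  unfolding mv_def mvs_def by blast
lemma mv_weq: "v \<approx> u \<Longrightarrow> mv x v u" unfolding mv_def mvs_def by blast

lemma mv_induct [consumes 1, case_names base step]:
  assumes "mv x v u" "Q v" "\<And>y z. mv x v y \<Longrightarrow> mvs x y z \<Longrightarrow> Q y \<Longrightarrow> Q z" shows "Q u"
  using assms(1) unfolding mv_def by (induction rule: rtranclp_induct) (use assms(2,3) mv_def in auto)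

lemma mvs_mv: "mvs x v u \<Longrightarrow> mv x v u" unfolding mv_def by blast

lemma mv_simple: "0 < co j (W v x) \<Longrightarrow> mv x v (j # v)"
  by (rule mv_step[OF rrep_Nil[of j]]) (simp_all add: rword_def corv_def)

lemma mv_ble: assumes "mv x v u" "dom x" shows "ble v u"
  using assms(1)
proof (induction rule: mv_induct)
  case base
  then show ?case by (simp add: ble_weq)
next
  case (step y z)
  have "ble y z"
  proof (cases "y \<approx> z")
    case False
    then obtain ws i where w: "rrep ws i" "z \<approx> rword ws i @ y" "0 < cv ws i (W y x)"
      using step(2) unfolding mvs_def by blast
    then have "be y z" unfolding bedge_def using rrep_up[OF w(1) assms(2) w(3)] len_cong[OF w(2)] by auto
    then show ?thesis by (rule ble_be)
  qed (rule ble_weq)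
  then show ?case using step(3) ble_trans by blast
qed

text \<open>The lifting property for \<open>mv\<close>. The second alternative arises when the chain
  passes through \<open>r_j\<close> itself: there \<open>j # y\<close> already equals the upper word
  \<open>z\<close>.\<close>

lemma mv_real:
  assumes "mv x v u" "j \<in> Re" shows "mv x (j # v) (j # u) \<or> mv x (j # v) u"
  using assms(1)
proof (induction rule: mv_induct)
  case base
  then show ?case by simp
next
  case (step y z)
  have yz: "mv x y z" by (rule mvs_mv[OF step(2)])
  from step(3) show ?case
  proof
    assume "mv x (j # v) y"
    then show ?thesis using mv_trans[OF _ yz] by blast
  next
    assume a: "mv x (j # v) (j # y)"
    show ?thesis
    proof (cases "y \<approx> z")
      case True
      show ?thesis by (rule disjI1[OF mv_trans[OF a mv_weq[OF weq_Cons[OF True]]]])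
    next
      case False
      then obtain ws i where w: "rrep ws i" "z \<approx> rword ws i @ y" "0 < cv ws i (W y x)"
        using step(2) unfolding mvs_def by blast
      show ?thesis
      proof (cases "rt ws i = al j")
        case True
        have "z \<approx> [j] @ y" using weq_tr[OF w(2) weq_append[OF rword_simple[OF w(1) assms(2) True] weq_refl']] .
        then have "mv x (j # y) z" by (intro mv_weq) (simp add: weq_sym)
        then show ?thesis by (rule disjI2[OF mv_trans[OF a]])
      next
        case ne: False
        have rr: "rrep (j # ws) i" by (rule rrep_Cons[OF w(1) assms(2) ne])
        have "j # z \<approx> j # rword ws i @ y" by (rule weq_Cons[OF w(2)])
        also have "\<dots> \<approx> (j # rword ws i) @ (j # j # y)"
          using weq_append[OF weq_refl' weq_sym[OF weq_cancel2[OF assms(2)]], of "j # rword ws i" y] by simp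
        finally have "j # z \<approx> rword (j # ws) i @ j # y" by (simp add: rword_Cons)
        moreover have "0 < cv (j # ws) i (W (j # y) x)" using w(3) cv_Cons[OF assms(2)] by simp
        ultimately have "mv x (j # y) (j # z)" by (rule mv_step[OF rr])
        then show ?thesis by (rule disjI1[OF mv_trans[OF a]])
      qed
    qed
  qed
qed

text \<open>Greater in the order means lower as a weight: an upward step subtracts a positive
  multiple of a positive root.\<close>

lemma wst_diff: assumes "wst x y" shows "y - x \<in> cone al UNIV" "x \<noteq> y"
proof -
  obtain ws i where w: "rrep ws i" "0 < cv ws i y" "x = W (rword ws i) y" using assms unfolding wstep_def by blast
  have ws: "set ws \<subseteq> Re" "rt ws i \<in> cone al UNIV" using w(1) rrep_iff by auto
  have e: "y - x = cv ws i y *\<^sub>R rt ws i" using w(3) W_rword[OF ws(1)] by simp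
  show "y - x \<in> cone al UNIV" unfolding e using w(2) ws(2) by (intro cone_scale) auto
  show "x \<noteq> y" using e w(2) rt_nonzero[OF ws(1)] by auto
qed

lemma ge_diff: assumes "ge x y" shows "y - x \<in> cone al UNIV"
  using assms unfolding wge_def
proof (induction rule: rtranclp_induct)
  case base
  then show ?case by (simp add: cone_0)
next
  case (step y z)
  have "z - x = (y - x) + (z - y)" by simp
  then show ?case using cone_add[OF step(3) wst_diff(1)[OF step(2)]] by simp
qed

lemma ge_antisym: assumes "ge x y" "ge y x" shows "x = y"
proof -
  have "y - x = 0" using cone_antisym[OF indep_al ge_diff[OF assms(1)], of UNIV] ge_diff[OF assms(2)] by simp
  then show ?thesis by simp
qed

text \<open>Going up subtracts positive roots, on which an imaginary coroot is never
  positive.\<close>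

lemma co_Im_mono: assumes "i \<in> Im" "ge x y" shows "co i y \<le> co i x"
  using cone_linear_nonpos[OF ge_diff[OF assms(2)] lin_co co_Im_nonpos[OF assms(1)]] by simp

lemma mv_ge: assumes "mv x v u" shows "ge (W u x) (W v x)"
  using assms
proof (induction rule: mv_induct)
  case (step y z)
  have "ge (W z x) (W y x)"
  proof (cases "y \<approx> z")
    case True
    then show ?thesis using weq_act[OF True] by simp
  next
    case False
    then obtain ws i where w: "rrep ws i" "z \<approx> rword ws i @ y" "0 < cv ws i (W y x)"
      using step(2) unfolding mvs_def by blast
    show ?thesis using weq_act[OF w(2), of x] by (intro ge_step wstI[OF w(1,3)]) simp
  qed
  then show ?case using step(3) ge_trans by blast
qed simp

text \<open>By monotonicity \<open>co i\<close> is constant along the whole chain. Each step really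
  moves the weight, so its root is orthogonal to \<open>i\<close> and its reflection commutes with
  \<open>i\<close>.\<close>

lemma mv_Im:
  assumes "mv x v u" "i \<in> Im" "co i (W u x) = co i (W v x)" shows "mv x (i # v) (i # u)"
  using assms(1,3)
proof (induction rule: mv_induct)
  case (step y z)
  have vy: "mv x v y" "mv x y z" using step(1) mvs_mv[OF step(2)] by auto
  have e: "co i (W y x) = co i (W v x)" "co i (W z x) = co i (W y x)"
    using co_Im_mono[OF assms(2) mv_ge[OF vy(1)]] co_Im_mono[OF assms(2) mv_ge[OF vy(2)]] step(4) by linarith+
  have "mv x (i # y) (i # z)"
  proof (cases "y \<approx> z")
    case True
    then show ?thesis by (intro mv_weq weq_Cons)
  next
    case False
    then obtain ws k where w: "rrep ws k" "z \<approx> rword ws k @ y" "0 < cv ws k (W y x)"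
      using step(2) unfolding mvs_def by blast
    have "set ws \<subseteq> Re" using w(1) rrep_iff by blast
    then have "co i (rt ws k) = 0" using e(2) weq_act[OF w(2), of x] w(3) W_rword by simp
    note c = refl_comm[OF w(1) assms(2) this]
    have "i # z \<approx> i # rword ws k @ y" by (rule weq_Cons[OF w(2)])
    also have "\<dots> \<approx> rword ws k @ i # y" using weq_append[OF weq_sym[OF c(1)] weq_refl'[of y]] by simp
    finally show ?thesis using w(3) c(2) by (intro mv_step[OF w(1)]) (simp_all add: srefl_def cv_diff cv_scale)
  qed
  then show ?case using step(3)[OF e(1)] mv_trans by blast
qed simp

end

section \<open>The order on an orbit and chains\<close>

context bc
begin

lemma co_r: "j \<in> Re \<Longrightarrow> co j (r j x) = - co j x"
  by (simp add: srefl_def co_al_Re)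

lemma r_fix: "co j x = 0 \<Longrightarrow> r j x = x"
  by (simp add: srefl_def)

lemma cone_single: assumes "u \<in> cone al {j}" shows "\<exists>x. u = x *\<^sub>R al j"
proof -
  obtain k where k: "fsup k" "\<forall>i. k i \<noteq> 0 \<longrightarrow> i \<in> {j}" "u = comb al k" by (rule coneE[OF assms])
  have "k = (\<lambda>i. if i = j then k j else 0)" using k(2) by (auto simp: fun_eq_iff)
  then have "comb al k = comb al (\<lambda>i. if i = j then k j else 0)" by (rule arg_cong)
  then show ?thesis using k(3) by (auto simp: comb_single)
qed

text \<open>For real \<open>j\<close> a root other than \<open>al j\<close> would stay positive
  under \<open>r j\<close>, yet a multiple of \<open>al j\<close> is negated. For imaginary
  \<open>j\<close> a good word supported in \<open>j\<close> alone has no real letters and is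
  empty.\<close>

lemma rep_multiple: assumes "rrep ws i" "rt ws i \<in> cone al {j}" shows "rword ws i \<approx> [j]"
proof -
  have ws: "set ws \<subseteq> Re" and pos: "rt ws i \<in> cone al UNIV" using assms(1) rrep_iff by auto
  obtain x where x: "rt ws i = x *\<^sub>R al j" using cone_single[OF assms(2)] by blast
  have x0: "x \<noteq> 0" using rt_nonzero[OF ws, of i] x by auto
  have xc: "rt ws i = comb al (\<lambda>l. if l = j then x else 0)" using x by (simp add: comb_single)
  show ?thesis
  proof (cases "j \<in> Re")
    case True
    have "rt ws i = al j"
    proof (rule ccontr)
      assume "rt ws i \<noteq> al j"
      then have "rt (j # ws) i \<in> cone al UNIV" using rrep_Cons[OF assms(1) True] rrep_iff by blast
      moreover have "rt (j # ws) i = - rt ws i"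
        using True by (simp add: x srefl_def co_al_Re) (simp flip: scaleR_left_diff_distrib scaleR_minus_left)
      ultimately show False using cone_antisym[OF indep_al pos] rt_nonzero[OF ws] by simp
    qed
    then show ?thesis by (rule rword_simple[OF assms(1) True])
  next
    case False
    then have jI: "j \<in> Im" by (simp add: Im_iff)
    have iI: "i \<in> Im"
    proof (rule ccontr)
      assume "i \<notin> Im"
      then have iR: "i \<in> Re" by (simp add: Im_iff)
      obtain l where l: "fsup l" "\<forall>j. l j \<noteq> 0 \<longrightarrow> j \<in> Re" "rt ws i = al i + comb al l"
        using W_real_span[OF ws] by blast
      have "comb al (\<lambda>l. if l = j then x else 0) = comb al (\<lambda>j. (if j = i then 1 else 0) + l j)"
        using xc l by (simp add: comb_add fsup_single comb_single)
      then have "(\<lambda>l. if l = j then x else 0) = (\<lambda>j. (if j = i then 1 else 0) + l j)"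
        using comb_inj[OF indep_al fsup_single] fsup_add[OF fsup_single l(1)] by blast
      from fun_cong[OF this, of j] have "x = (if j = i then 1 else 0) + l j" by simp
      moreover have "j \<noteq> i" "l j = 0" using False iR l(2) by auto
      ultimately show False using x0 by simp
    qed
    have "i = j" using rt_Im_coef[OF ws iI fsup_single xc iI] by (auto split: if_splits)
    obtain y where y: "good i y" "rt y i = rt ws i" "rword y i \<approx> rword ws i" using good_ex[OF iI ws] by blast
    have "set y \<subseteq> {j}" using good_supp[OF iI y(1)] y(2) assms(2) by simp
    then have "y = []" using good_real[OF y(1)] False by (cases y) auto
    then show ?thesis using weq_sym[OF y(3)] \<open>i = j\<close> by (simp add: rword_def)
  qed
qed

text \<open>For real \<open>j\<close>, \<open>up\<close> and \<open>lo\<close> are the upper and the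
  lower one, with respect to \<open>ge\<close>, of \<open>x\<close> and
  \<open>r j x\<close>.\<close>

definition up :: "'i \<Rightarrow> 'v \<Rightarrow> 'v" where "up j x = (if co j x \<le> 0 then x else r j x)"
definition lo :: "'i \<Rightarrow> 'v \<Rightarrow> 'v" where "lo j x = (if co j x < 0 then r j x else x)"

lemma ge_induct [consumes 1, case_names base step]:
  assumes "ge x u" "Q x" "\<And>y z. ge x y \<Longrightarrow> wst y z \<Longrightarrow> Q y \<Longrightarrow> Q z" shows "Q u"
  using assms(1) unfolding wge_def
  by (induction rule: rtranclp_induct) (use assms(2,3)[unfolded wge_def] in blast)+

lemma wst_simple: "0 < co j y \<Longrightarrow> wst (r j y) y"
  by (rule wstI[OF rrep_Nil[of j]]) (simp_all add: corv_def rword_def)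

lemma wst_conj: assumes "wst x y" "j \<in> Re" shows "x = r j y \<or> wst (r j x) (r j y)"
proof -
  obtain ws i where w: "rrep ws i" "0 < cv ws i y" "x = W (rword ws i) y" using assms unfolding wstep_def by blast
  show ?thesis
  proof (cases "rt ws i = al j")
    case True
    then show ?thesis using weq_act[OF rword_simple[OF w(1) assms(2)]] w(3) by simp
  next
    case False
    have rr: "rrep (j # ws) i" by (rule rrep_Cons[OF w(1) assms(2) False])
    have "wst (r j x) (r j y)"
      using w(2,3) assms(2) by (intro wstI[OF rr]) (simp_all add: cv_Cons rword_Cons)
    then show ?thesis by blast
  qed
qed

lemma ge_r: assumes "j \<in> Re" "0 \<le> co j x" shows "ge (r j x) x"
  using wst_simple[of j x] ge_step r_fix[of j x] assms(2) by (cases "co j x = 0") auto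

lemma up_ge: assumes "j \<in> Re" shows "ge (up j x) x" "ge (up j x) (r j x)"
proof -
  show "ge (up j x) x" using ge_r[OF assms, of x] by (simp add: up_def)
  have "ge x (r j x)" if "co j x \<le> 0" using ge_r[OF assms, of "r j x"] that assms by (simp add: co_r)
  then show "ge (up j x) (r j x)" by (simp add: up_def)
qed

lemma lo_ge: assumes "j \<in> Re" shows "ge x (lo j x)" "ge (r j x) (lo j x)"
proof -
  show "ge x (lo j x)" using ge_r[OF assms, of "r j x"] assms by (simp add: lo_def co_r)
  show "ge (r j x) (lo j x)" using ge_r[OF assms, of x] by (simp add: lo_def)
qed

text \<open>The lifting property on weights: a step is either \<open>r j\<close> itself, and then
  both ends have the same upper element, or it is conjugated by \<open>r j\<close>.\<close>

lemma up_mono: assumes "ge x y" "j \<in> Re" shows "ge (up j x) (up j y)"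
  using assms(1)
proof (induction rule: ge_induct)
  case (step y z)
  have "ge (up j y) (up j z)"
  proof (cases "y = r j z")
    case True
    have "up j y = up j z" using True assms(2) r_fix[of j z] by (auto simp: up_def co_r)
    then show ?thesis by simp
  next
    case False
    then have "ge (r j y) (r j z)" using wst_conj[OF step(2) assms(2)] ge_step by blast
    then have "ge (up j y) (r j z)" by (rule ge_trans[OF up_ge(2)[OF assms(2)]])
    moreover have "ge (up j y) z" by (rule ge_trans[OF up_ge(1)[OF assms(2)] ge_step[OF step(2)]])
    ultimately show ?thesis by (simp add: up_def[of j z])
  qed
  then show ?case by (rule ge_trans[OF step(3)])
qed simp

lemma lo_mono: assumes "ge x y" "j \<in> Re" shows "ge (lo j x) (lo j y)"
  using assms(1)
proof (induction rule: ge_induct)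
  case (step y z)
  have "ge (lo j y) (lo j z)"
  proof (cases "y = r j z")
    case True
    have "lo j y = lo j z" using True assms(2) r_fix[of j z] by (auto simp: lo_def co_r)
    then show ?thesis by simp
  next
    case False
    then have "ge (r j y) (r j z)" using wst_conj[OF step(2) assms(2)] ge_step by blast
    then have "ge (r j y) (lo j z)" by (rule ge_trans[OF _ lo_ge(2)[OF assms(2)]])
    moreover have "ge y (lo j z)" by (rule ge_trans[OF ge_step[OF step(2)] lo_ge(1)[OF assms(2)]])
    ultimately show ?thesis by (simp add: lo_def[of j y])
  qed
  then show ?case by (rule ge_trans[OF step(3)])
qed simp

lemma cov_gt: "cov x y \<Longrightarrow> ge x y \<and> x \<noteq> y" by (simp add: wcovers_def wgt_def)

lemma cov_between: "cov x y \<Longrightarrow> ge x z \<Longrightarrow> ge z y \<Longrightarrow> z = x \<or> z = y"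
  unfolding wcovers_def wgt_def by blast

lemma covI: "ge x y \<Longrightarrow> x \<noteq> y \<Longrightarrow> (\<And>z. ge x z \<Longrightarrow> ge z y \<Longrightarrow> z \<noteq> x \<Longrightarrow> z \<noteq> y \<Longrightarrow> False) \<Longrightarrow> cov x y"
  unfolding wcovers_def wgt_def by blast

text \<open>Lifting places \<open>r j y\<close>, or \<open>r j x\<close> if \<open>y\<close> is on
  the wall, between \<open>x\<close> and \<open>y\<close>, where a cover leaves no room.\<close>

lemma cov_cross:
  assumes "cov x y" "j \<in> Re" "co j x \<le> 0" "0 \<le> co j y" "co j x \<noteq> 0 \<or> co j y \<noteq> 0" shows "x = r j y"
proof (cases "co j y = 0")
  case False
  have "ge x (r j y)" using up_mono[OF _ assms(2), of x y] cov_gt[OF assms(1)] assms(3,4) False by (simp add: up_def)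
  moreover have "ge (r j y) y" by (rule ge_r[OF assms(2,4)])
  moreover have "r j y \<noteq> y" using co_r[OF assms(2), of y] False by force
  ultimately show ?thesis using cov_between[OF assms(1)] by metis
next
  case True
  then have n: "co j x < 0" using assms by simp
  have "ge (r j x) y" using lo_mono[OF _ assms(2), of x y] cov_gt[OF assms(1)] n True by (simp add: lo_def)
  moreover have "ge x (r j x)" using ge_r[OF assms(2), of "r j x"] n assms(2) by (simp add: co_r)
  moreover have "r j x \<noteq> x" using co_r[OF assms(2), of x] n by force
  ultimately have "r j x = y" using cov_between[OF assms(1)] by metis
  then show ?thesis using assms(2) by auto
qed

text \<open>An element between the reflected weights is brought by \<open>lo\<close> or
  \<open>up\<close> to the side of \<open>x\<close> and \<open>y\<close>, where the cover leaves
  only the two ends; these are excluded by comparison with their reflections.\<close>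

lemma cov_refl:
  assumes "cov x y" "j \<in> Re" "0 < co j x \<and> 0 < co j y \<or> co j x < 0 \<and> co j y < 0"
  shows "cov (r j x) (r j y)"
proof -
  have xy: "ge x y" "x \<noteq> y" using cov_gt[OF assms(1)] by auto
  from assms(3) show ?thesis
  proof
    assume p: "0 < co j x \<and> 0 < co j y"
    show ?thesis
    proof (rule covI)
      show "ge (r j x) (r j y)" using up_mono[OF xy(1) assms(2)] p by (simp add: up_def)
      show "r j x \<noteq> r j y" using xy(2) srefl_Re_Re[OF assms(2)] by metis
      fix z assume z: "ge (r j x) z" "ge z (r j y)" "z \<noteq> r j x" "z \<noteq> r j y"
      have "ge x (lo j z)" "ge (lo j z) y"
        using lo_mono[OF z(1) assms(2)] lo_mono[OF z(2) assms(2)] p assms(2) by (simp_all add: lo_def co_r)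
      then consider "lo j z = x" | "lo j z = y" using cov_between[OF assms(1)] by blast
      then show False
      proof cases
        case 1
        then have "z = x" using z(3) assms(2) by (auto simp: lo_def split: if_splits)
        then have "ge x (r j y)" using z(2) by simp
        moreover have "ge (r j y) y" using ge_r[OF assms(2)] p by simp
        ultimately have "r j y = x \<or> r j y = y" using cov_between[OF assms(1)] by blast
        then show False using co_r[OF assms(2), of y] p by force
      next
        case 2
        then have "z = y" using z(4) assms(2) by (auto simp: lo_def split: if_splits)
        moreover have "ge (r j y) y" using ge_r[OF assms(2)] p by simp
        ultimately show False using ge_antisym[of y "r j y"] z(2,4) by simp
      qed
    qed
  next
    assume p: "co j x < 0 \<and> co j y < 0"
    have xr: "ge x (r j x)" using ge_r[OF assms(2), of "r j x"] p assms(2) by (simp add: co_r)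
    show ?thesis
    proof (rule covI)
      show "ge (r j x) (r j y)" using lo_mono[OF xy(1) assms(2)] p by (simp add: lo_def)
      show "r j x \<noteq> r j y" using xy(2) srefl_Re_Re[OF assms(2)] by metis
      fix z assume z: "ge (r j x) z" "ge z (r j y)" "z \<noteq> r j x" "z \<noteq> r j y"
      have "ge x (up j z)" "ge (up j z) y"
        using up_mono[OF z(1) assms(2)] up_mono[OF z(2) assms(2)] p assms(2) by (simp_all add: up_def co_r)
      then consider "up j z = x" | "up j z = y" using cov_between[OF assms(1)] by blast
      then show False
      proof cases
        case 1
        then have "z = x" using z(3) assms(2) by (auto simp: up_def split: if_splits)
        then show False using ge_antisym[of x "r j x"] z(1,3) xr by simp
      next
        case 2
        then have "z = y" using z(4) assms(2) by (auto simp: up_def split: if_splits)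
        then have "ge (r j x) y" using z(1) by simp
        then have "r j x = x \<or> r j x = y" using cov_between[OF assms(1) xr] by blast
        then show False using co_r[OF assms(2), of x] p by force
      qed
    qed
  qed
qed

text \<open>Everything between the two weights differs from \<open>y\<close> by a multiple of
  \<open>al j\<close>, so the last step below it has a root proportional to \<open>al j\<close> and
  is \<open>r j\<close> by \<open>rep_multiple\<close>.\<close>

lemma cov_simple: assumes "0 < co j y" shows "cov (r j y) y"
proof (rule covI)
  show "ge (r j y) y" by (rule ge_step[OF wst_simple[OF assms]])
  show "r j y \<noteq> y" using assms al_nonzero by (simp add: srefl_def)
  fix z assume z: "ge (r j y) z" "ge z y" "z \<noteq> r j y" "z \<noteq> y"
  obtain x where x: "ge z x" "wst x y" using z(2,4) unfolding wge_def by (metis rtranclp.cases)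
  obtain ws i where w: "rrep ws i" "0 < cv ws i y" "x = W (rword ws i) y" using x(2) unfolding wstep_def by blast
  have ws: "set ws \<subseteq> Re" using w(1) rrep_iff by blast
  have e: "y - x = cv ws i y *\<^sub>R rt ws i" using w(3) W_rword[OF ws] by simp
  have "y - x \<in> cone al {j}"
  proof (rule cone_add_restrict[OF indep_al wst_diff(1)[OF x(2)] ge_diff[OF ge_trans[OF z(1) x(1)]]])
    have "y - x + (x - r j y) = co j y *\<^sub>R al j" by (simp add: srefl_def)
    then show "y - x + (x - r j y) \<in> cone al {j}" using assms by (simp add: cone_scale_base)
  qed
  then have "(1 / cv ws i y) *\<^sub>R (y - x) \<in> cone al {j}" using w(2) by (intro cone_scale) auto
  then have "rt ws i \<in> cone al {j}" unfolding e using w(2) by simp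
  then have "x = r j y" using weq_act[OF rep_multiple[OF w(1)]] w(3) by simp
  then show False using ge_antisym[OF z(1)] x(1) z(3) by simp
qed

section \<open>Single steps of chains and their behaviour under simple reflections\<close>

definition acstep :: "real \<Rightarrow> 'v \<Rightarrow> 'v \<Rightarrow> bool" where
  "acstep a x y \<longleftrightarrow> (\<exists>ws i. warrow co al ws i x y \<and>
     (i \<in> Re \<longrightarrow> a * cv ws i y \<in> \<int> \<and> a * cv ws i y > 0) \<and> (i \<in> Im \<longrightarrow> a * cv ws i y = 1))"

abbreviation ach where "ach a \<equiv> (acstep a)\<^sup>*\<^sup>*"

lemma ach_a_chain: assumes "ach a x y" shows "a_chain co al a x y"
  using assms
proof (induction rule: converse_rtranclp_induct)
  case base
  show ?case unfolding a_chain_def by (rule exI[of _ "[y]"]) simp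
next
  case (step x z)
  obtain nus where n: "nus \<noteq> []" "hd nus = z" "last nus = y"
    "\<forall>s. s + 1 < length nus \<longrightarrow> (\<exists>ws i. warrow co al ws i (nus ! s) (nus ! (s+1)) \<and>
        (i \<in> Re \<longrightarrow> a * cv ws i (nus ! (s+1)) \<in> \<int> \<and> a * cv ws i (nus ! (s+1)) > 0) \<and>
        (i \<in> Im \<longrightarrow> a * cv ws i (nus ! (s+1)) = 1))"
    using step(3) unfolding a_chain_def by blast
  show ?case unfolding a_chain_def
  proof (rule exI[of _ "x # nus"], intro conjI allI impI)
    fix s assume s: "s + 1 < length (x # nus)"
    show "\<exists>ws i. warrow co al ws i ((x # nus) ! s) ((x # nus) ! (s+1)) \<and>
        (i \<in> Re \<longrightarrow> a * cv ws i ((x # nus) ! (s+1)) \<in> \<int> \<and> a * cv ws i ((x # nus) ! (s+1)) > 0) \<and>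
        (i \<in> Im \<longrightarrow> a * cv ws i ((x # nus) ! (s+1)) = 1)"
    proof (cases s)
      case 0
      then show ?thesis using step(1) n(1,2) unfolding acstep_def by (simp add: hd_conv_nth)
    next
      case (Suc t)
      then show ?thesis using n(4)[rule_format, of t] s by simp
    qed
  qed (use n in simp_all)
qed

lemma a_chain_ach: assumes "a_chain co al a x y" shows "ach a x y"
proof -
  have "ach a (hd nus) (last nus)" if "nus \<noteq> []" "\<forall>s. s + 1 < length nus \<longrightarrow> acstep a (nus ! s) (nus ! (s+1))" for nus
    using that
  proof (induction nus)
    case (Cons z nus)
    show ?case
    proof (cases "nus = []")
      case False
      have "acstep a z (hd nus)" using Cons.prems(2)[rule_format, of 0] False by (simp add: hd_conv_nth)
      moreover have "\<forall>s. s + 1 < length nus \<longrightarrow> acstep a (nus ! s) (nus ! (s+1))"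
      proof (intro allI impI)
        fix s assume "s + 1 < length nus"
        then show "acstep a (nus ! s) (nus ! (s+1))" using Cons.prems(2)[rule_format, of "s + 1"] by simp
      qed
      then have "ach a (hd nus) (last nus)" by (rule Cons.IH[OF False])
      ultimately show ?thesis using False by (simp add: converse_rtranclp_into_rtranclp)
    qed simp
  qed simp
  then show ?thesis using assms unfolding a_chain_def acstep_def by blast
qed

lemma acstepE:
  assumes "acstep a x y"
  obtains ws i where "rrep ws i" "x = W (rword ws i) y" "0 < cv ws i y" "cov x y" "a * cv ws i y \<in> \<int>"
    "i \<in> Re \<longrightarrow> 0 < a * cv ws i y" "i \<in> Im \<longrightarrow> a * cv ws i y = 1"
proof -
  obtain ws i where w: "warrow co al ws i x y" "i \<in> Re \<longrightarrow> a * cv ws i y \<in> \<int> \<and> a * cv ws i y > 0"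
    "i \<in> Im \<longrightarrow> a * cv ws i y = 1" using assms unfolding acstep_def by blast
  have "a * cv ws i y \<in> \<int>" using w(2,3) Im_iff by (cases "i \<in> Re") auto
  then show ?thesis using that[of ws i] w unfolding warrow_def by blast
qed

lemma acstepI:
  assumes "rrep ws i" "x = W (rword ws i) y" "0 < cv ws i y" "cov x y" "a * cv ws i y \<in> \<int>"
    "i \<in> Re \<Longrightarrow> 0 < a * cv ws i y" "i \<in> Im \<Longrightarrow> a * cv ws i y = 1"
  shows "acstep a x y"
  unfolding acstep_def warrow_def using assms by blast

lemma acstep_cov: "acstep a x y \<Longrightarrow> cov x y" by (erule acstepE)

lemma ach_ge: assumes "ach a x y" shows "ge x y"
  using assms
proof (induction rule: rtranclp_induct)
  case (step y z)
  have "ge y z" using cov_gt[OF acstep_cov[OF step(2)]] by blast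
  then show ?case by (rule ge_trans[OF step(3)])
qed simp

text \<open>The chain condition says exactly that \<open>a\<close> times the displacement is an
  integral multiple of a root. Hence integrality of \<open>a * co j\<close> does not change along a
  chain.\<close>

lemma acstep_lat: assumes "acstep a x y" shows "a *\<^sub>R (y - x) \<in> lat"
proof -
  obtain ws i where w: "rrep ws i" "x = W (rword ws i) y" "a * cv ws i y \<in> \<int>" by (rule acstepE[OF assms])
  have "set ws \<subseteq> Re" using w(1) rrep_iff by blast
  then have "a *\<^sub>R (y - x) = (a * cv ws i y) *\<^sub>R rt ws i" using w(2) W_rword by simp
  then show ?thesis using lat_scale[OF W_lat[OF lat_al] w(3)] by simp
qed

lemma ach_lat: assumes "ach a x y" shows "a *\<^sub>R (y - x) \<in> lat"
  using assms
proof (induction rule: rtranclp_induct)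
  case base
  then show ?case using lat_scale[OF lat_al, of 0] by simp
next
  case (step y z)
  have "a *\<^sub>R (z - x) = a *\<^sub>R (y - x) + a *\<^sub>R (z - y)" by (simp flip: scaleR_add_right)
  then show ?case using lat_add[OF step(3) acstep_lat[OF step(2)]] by simp
qed

lemma ach_co_int: assumes "ach a x y" shows "a * co j x \<in> \<int> \<longleftrightarrow> a * co j y \<in> \<int>"
proof -
  have "a * co j y - a * co j x \<in> \<int>" using lat_co[OF ach_lat[OF assms], of j] by (simp add: right_diff_distrib)
  then show ?thesis by (metis Ints_diff Ints_add diff_add_cancel add_diff_cancel_left' diff_diff_eq2)
qed

lemma acstep_refl:
  assumes "acstep a x y" "j \<in> Re" "0 < co j x \<and> 0 < co j y \<or> co j x < 0 \<and> co j y < 0"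
  shows "acstep a (r j x) (r j y)"
proof -
  obtain ws i where w: "rrep ws i" "x = W (rword ws i) y" "0 < cv ws i y" "cov x y" "a * cv ws i y \<in> \<int>"
    "i \<in> Re \<longrightarrow> 0 < a * cv ws i y" "i \<in> Im \<longrightarrow> a * cv ws i y = 1" by (rule acstepE[OF assms(1)])
  have "rt ws i \<noteq> al j"
  proof
    assume "rt ws i = al j"
    then have "x = r j y" using weq_act[OF rword_simple[OF w(1) assms(2)]] w(2) by simp
    then show False using assms(3) co_r[OF assms(2), of y] by auto
  qed
  then have rr: "rrep (j # ws) i" by (rule rrep_Cons[OF w(1) assms(2)])
  have c: "cv (j # ws) i (r j y) = cv ws i y" by (rule cv_Cons[OF assms(2)])
  show ?thesis
    by (rule acstepI[OF rr]) (use w c assms(2) cov_refl[OF w(4) assms(2,3)] in \<open>simp_all add: rword_Cons\<close>)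
qed

lemma acstep_simple_Re:
  assumes "j \<in> Re" "0 < co j y" "0 < a" "a * co j y \<in> \<int>" shows "acstep a (r j y) y"
  by (rule acstepI[OF rrep_Nil[of j]])
    (use assms cov_simple[OF assms(2)] in \<open>auto simp: rword_def corv_def Im_iff\<close>)

lemma acstep_simple_Im:
  assumes "j \<in> Im" "0 < co j y" "a * co j y = 1" shows "acstep a (r j y) y"
  by (rule acstepI[OF rrep_Nil[of j]])
    (use assms cov_simple[OF assms(2)] in \<open>auto simp: rword_def corv_def Im_iff\<close>)

lemma acstep_cross_int:
  assumes "acstep a x y" "j \<in> Re" "x = r j y" shows "a * co j y \<in> \<int>"
proof -
  have "a *\<^sub>R (y - x) = (a * co j y) *\<^sub>R al j" using assms(3) by (simp add: srefl_def)
  then have "comb al (\<lambda>l. if l = j then a * co j y else 0) \<in> lat"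
    using acstep_lat[OF assms(1)] by (simp add: comb_single)
  from lat_coef[OF this fsup_single, of j] show ?thesis by simp
qed

text \<open>If \<open>a * co j\<close> is not integral at one end, it is so at no weight of the
  chain; thus none lies on the wall, and crossing the wall would be the step \<open>r j\<close>,
  which needs an integer. The chain stays on one side and can be reflected.\<close>

lemma ach_interior_pos:
  assumes "ach a x y" "j \<in> Re" "0 < co j y" "a * co j y \<notin> \<int>"
  shows "0 < co j x \<and> ach a (r j x) (r j y)"
  using assms(1)
proof (induction rule: converse_rtranclp_induct)
  case base
  then show ?case using assms(3) by simp
next
  case (step x z)
  have nz: "a * co j z \<notin> \<int>" using ach_co_int[OF step(2)] assms(4) by blast
  have nx: "a * co j x \<notin> \<int>" using ach_co_int[OF r_into_rtranclp, of a x z j] step(1) nz by blast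
  then have "co j x \<noteq> 0" by auto
  moreover have "\<not> co j x < 0"
  proof
    assume "co j x < 0"
    then have "x = r j z" using step(3) by (intro cov_cross[OF acstep_cov[OF step(1)] assms(2)]) auto
    then show False using acstep_cross_int[OF step(1) assms(2)] nz by blast
  qed
  ultimately have p: "0 < co j x" by simp
  then have "acstep a (r j x) (r j z)" using step(3) by (intro acstep_refl[OF step(1) assms(2)]) auto
  then show ?case using p step(3) by (auto intro: converse_rtranclp_into_rtranclp)
qed

lemma ach_interior_neg:
  assumes "ach a x y" "j \<in> Re" "co j x < 0" "a * co j x \<notin> \<int>"
  shows "co j y < 0 \<and> ach a (r j x) (r j y)"
  using assms(1)
proof (induction rule: rtranclp_induct)
  case base
  then show ?case using assms(3) by simp
next
  case (step y z)
  have ny: "a * co j y \<notin> \<int>" using ach_co_int[OF step(1)] assms(4) by blast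
  have nz: "a * co j z \<notin> \<int>" using ach_co_int[OF r_into_rtranclp, of a y z j] step(2) ny by blast
  then have "co j z \<noteq> 0" by auto
  moreover have "\<not> co j z > 0"
  proof
    assume "co j z > 0"
    then have "y = r j z" using step(3) by (intro cov_cross[OF acstep_cov[OF step(2)] assms(2)]) auto
    then show False using acstep_cross_int[OF step(2) assms(2)] nz by blast
  qed
  ultimately have p: "co j z < 0" by simp
  then have "acstep a (r j y) (r j z)" using step(3) by (intro acstep_refl[OF step(2) assms(2)]) auto
  then show ?case using p step(3) by (auto intro: rtranclp.rtrancl_into_rtrancl)
qed

text \<open>With integral values the simple step \<open>r j\<close> satisfies the chain condition,
  so a chain is pushed to the upper side of the wall by inserting or cancelling such a step.\<close>

lemma ach_up:
  assumes "ach a x y" "j \<in> Re" "0 < a" "a * co j y \<in> \<int>" shows "ach a (up j x) (up j y)"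
  using assms(1)
proof (induction rule: converse_rtranclp_induct)
  case (step x z)
  have zi: "a * co j z \<in> \<int>" using ach_co_int[OF step(2)] assms(4) by blast
  have xi: "a * co j x \<in> \<int>" using ach_co_int[OF r_into_rtranclp, of a x z j] step(1) zi by blast
  have "ach a (up j x) (up j z)"
  proof (cases "co j z \<le> 0")
    case True
    then have "ach a x (up j z)" using step(1) by (simp add: up_def r_into_rtranclp)
    moreover have "ach a (up j x) x"
      using acstep_simple_Re[OF assms(2) _ assms(3) xi] by (auto simp: up_def)
    ultimately show ?thesis by (rule rtranclp_trans[rotated])
  next
    case False
    show ?thesis
    proof (cases "co j x \<le> 0")
      case True
      then have "x = r j z" using False by (intro cov_cross[OF acstep_cov[OF step(1)] assms(2)]) auto
      then show ?thesis using True False by (simp add: up_def)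
    next
      case x: False
      then have "acstep a (r j x) (r j z)" using False by (intro acstep_refl[OF step(1) assms(2)]) auto
      then show ?thesis using x False by (simp add: up_def r_into_rtranclp)
    qed
  qed
  then show ?case using step(3) by (rule rtranclp_trans)
qed simp

lemma ach_lo:
  assumes "ach a x y" "j \<in> Re" "0 < a" "a * co j y \<in> \<int>" shows "ach a (lo j x) (lo j y)"
  using assms(1)
proof (induction rule: converse_rtranclp_induct)
  case (step x z)
  have zi: "a * co j z \<in> \<int>" using ach_co_int[OF step(2)] assms(4) by blast
  have "ach a (lo j x) (lo j z)"
  proof (cases "0 \<le> co j x")
    case True
    then have "ach a (lo j x) z" using step(1) by (simp add: lo_def r_into_rtranclp)
    moreover have "ach a z (lo j z)"
    proof (cases "co j z < 0")
      case True
      then have "acstep a (r j (r j z)) (r j z)"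
        using zi assms(2,3) by (intro acstep_simple_Re) (auto simp: co_r)
      then show ?thesis using True assms(2) by (simp add: lo_def r_into_rtranclp)
    qed (simp add: lo_def)
    ultimately show ?thesis by (rule rtranclp_trans)
  next
    case False
    show ?thesis
    proof (cases "0 \<le> co j z")
      case True
      then have "x = r j z" using False by (intro cov_cross[OF acstep_cov[OF step(1)] assms(2)]) auto
      then show ?thesis using True False assms(2) by (simp add: lo_def)
    next
      case z: False
      then have "acstep a (r j x) (r j z)" using False by (intro acstep_refl[OF step(1) assms(2)]) auto
      then show ?thesis using z False by (simp add: lo_def r_into_rtranclp)
    qed
  qed
  then show ?case using step(3) by (rule rtranclp_trans)
qed simp

lemma ach_up_self:
  assumes "j \<in> Re" "0 < a" "a * co j y \<in> \<int>" shows "ach a (up j y) y" "ach a (up j y) (r j y)"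
proof -
  show "ach a (up j y) y" using acstep_simple_Re[OF assms(1) _ assms(2,3)] by (auto simp: up_def)
  show "ach a (up j y) (r j y)"
  proof (cases "co j y < 0")
    case True
    then have "acstep a (r j (r j y)) (r j y)"
      using assms by (intro acstep_simple_Re) (auto simp: co_r)
    then show ?thesis using True assms(1) by (simp add: up_def r_into_rtranclp)
  next
    case False
    then show ?thesis using r_fix[of j y] by (simp add: up_def)
  qed
qed

lemma ach_self_lo:
  assumes "j \<in> Re" "0 < a" "a * co j y \<in> \<int>" shows "ach a y (lo j y)"
proof (cases "co j y < 0")
  case True
  then have "acstep a (r j (r j y)) (r j y)"
    using assms by (intro acstep_simple_Re) (auto simp: co_r)
  then show ?thesis using True assms(1) by (simp add: lo_def r_into_rtranclp)
qed (simp add: lo_def)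

text \<open>As \<open>co i\<close> is unchanged, the root of the step is orthogonal to
  \<open>i\<close>, and by \<open>refl_comm\<close> its coroot vanishes on \<open>al i\<close>.
  Order, covers and chains with constant \<open>co i\<close> therefore survive translation along
  \<open>al i\<close>, and \<open>r i\<close> acts on them as one.\<close>

lemma wst_shift:
  assumes "wst x y" "i \<in> Im" "co i x = co i y" shows "wst (x - c *\<^sub>R al i) (y - c *\<^sub>R al i)"
proof -
  obtain ws k where w: "rrep ws k" "0 < cv ws k y" "x = W (rword ws k) y" using assms unfolding wstep_def by blast
  have ws: "set ws \<subseteq> Re" using w(1) rrep_iff by blast
  have "co i (rt ws k) = 0" using assms(3) w(2,3) W_rword[OF ws] by simp
  then have "cv ws k (al i) = 0" by (rule refl_comm(2)[OF w(1) assms(2)])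
  then have c: "cv ws k (y - c *\<^sub>R al i) = cv ws k y" by (simp add: cv_diff cv_scale)
  show ?thesis using w(2,3) c by (intro wstI[OF w(1)]) (simp_all add: W_rword[OF ws])
qed

lemma ge_shift:
  assumes "ge x y" "i \<in> Im" "co i x = co i y" shows "ge (x - c *\<^sub>R al i) (y - c *\<^sub>R al i)"
  using assms(1,3)
proof (induction rule: ge_induct)
  case (step y z)
  have xy: "ge x y" "ge y z" using step(1) ge_step[OF step(2)] by auto
  have e: "co i x = co i y" "co i y = co i z"
    using co_Im_mono[OF assms(2) xy(1)] co_Im_mono[OF assms(2) xy(2)] step(4) by linarith+
  show ?case by (rule ge_trans[OF step(3)[OF e(1)] ge_step[OF wst_shift[OF step(2) assms(2) e(2)]]])
qed simp

lemma cov_shift: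
  assumes "cov x y" "i \<in> Im" "co i x = co i y" shows "cov (x - c *\<^sub>R al i) (y - c *\<^sub>R al i)"
proof (rule covI)
  show "ge (x - c *\<^sub>R al i) (y - c *\<^sub>R al i)" using ge_shift cov_gt assms by blast
  show "x - c *\<^sub>R al i \<noteq> y - c *\<^sub>R al i" using cov_gt[OF assms(1)] by simp
  fix z assume z: "ge (x - c *\<^sub>R al i) z" "ge z (y - c *\<^sub>R al i)" "z \<noteq> x - c *\<^sub>R al i" "z \<noteq> y - c *\<^sub>R al i"
  have e: "co i (x - c *\<^sub>R al i) = co i z" "co i z = co i (y - c *\<^sub>R al i)"
    using co_Im_mono[OF assms(2) z(1)] co_Im_mono[OF assms(2) z(2)] assms(3) by (simp_all)
  have "ge x (z - (- c) *\<^sub>R al i)" using ge_shift[OF z(1) assms(2) e(1), of "- c"] by simp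
  moreover have "ge (z - (- c) *\<^sub>R al i) y" using ge_shift[OF z(2) assms(2) e(2), of "- c"] by simp
  ultimately have "z + c *\<^sub>R al i = x \<or> z + c *\<^sub>R al i = y" using cov_between[OF assms(1), of "z + c *\<^sub>R al i"] by simp
  then show False using z(3,4) by auto
qed

lemma ach_Im:
  assumes "ach a x y" "i \<in> Im" "co i x = co i y" shows "ach a (r i x) (r i y)"
  using assms(1,3)
proof (induction rule: rtranclp_induct)
  case (step y z)
  have xy: "ge x y" "ge y z" using ach_ge[OF step(1)] cov_gt[OF acstep_cov[OF step(2)]] by auto
  have e: "co i x = co i y" "co i y = co i z"
    using co_Im_mono[OF assms(2) xy(1)] co_Im_mono[OF assms(2) xy(2)] step(4) by linarith+
  obtain ws k where w: "rrep ws k" "y = W (rword ws k) z" "0 < cv ws k z" "cov y z" "a * cv ws k z \<in> \<int>"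
    "k \<in> Re \<longrightarrow> 0 < a * cv ws k z" "k \<in> Im \<longrightarrow> a * cv ws k z = 1" by (rule acstepE[OF step(2)])
  have ws: "set ws \<subseteq> Re" using w(1) rrep_iff by blast
  have o: "co i (rt ws k) = 0" using e(2) w(2,3) W_rword[OF ws] by simp
  then have "cv ws k (al i) = 0" by (rule refl_comm(2)[OF w(1) assms(2)])
  then have c: "cv ws k (r i z) = cv ws k z" by (simp add: srefl_def cv_diff cv_scale)
  have "r i y = W (rword ws k) (r i z)" using w(2) o c by (simp add: W_rword[OF ws] srefl_def)
  moreover have "cov (r i y) (r i z)" using cov_shift[OF w(4) assms(2) e(2), of "co i y"] e(2) by (simp add: srefl_def)
  ultimately have "acstep a (r i y) (r i z)" using w(3,5-7) c by (intro acstepI[OF w(1)]) auto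
  then show ?case using step(3)[OF e(1)] by (rule rtranclp.rtrancl_into_rtrancl[rotated])
qed simp

end

section \<open>Segment lists\<close>

text \<open>Heights of this shape attain the infima and the supremum in \<open>froot\<close> and so
  identify them.\<close>

lemma froot_eq:
  fixes path :: "real \<Rightarrow> 'v::real_vector"
  assumes "M \<in> \<int>" "0 \<le> fp" "fp < fm" "fm \<le> 1" "\<And>t. 0 \<le> t \<Longrightarrow> t \<le> 1 \<Longrightarrow> M \<le> co i (path t)"
    "co i (path fp) = M" "\<And>t. fp < t \<Longrightarrow> t \<le> 1 \<Longrightarrow> M < co i (path t)" "co i (path fm) = M + 1"
    "\<And>t. fp \<le> t \<Longrightarrow> t < fm \<Longrightarrow> co i (path t) < M + 1"
  shows "froot co al i path = Some (\<lambda>t. if t \<le> fp then path t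
      else if t \<le> fm then path t - (co i (path t) - M) *\<^sub>R al i else path t - al i)"
proof -
  have m: "Inf {co i (path t) | t. t \<in> {0..1} \<and> co i (path t) \<in> \<int>} = M"
  proof (rule cInf_eq_minimum)
    have "fp \<in> {0..1}" using assms(2-4) by simp
    then show "M \<in> {co i (path t) | t. t \<in> {0..1} \<and> co i (path t) \<in> \<int>}" using assms(1,6) by blast
    show "M \<le> x" if "x \<in> {co i (path t) | t. t \<in> {0..1} \<and> co i (path t) \<in> \<int>}" for x
      using that assms(5) by auto
  qed
  have f: "Sup {t \<in> {0..1}. co i (path t) = M} = fp"
  proof (rule cSup_eq_maximum)
    show "fp \<in> {t \<in> {0..1}. co i (path t) = M}" using assms(2-4,6) by simp
    show "t \<le> fp" if "t \<in> {t \<in> {0..1}. co i (path t) = M}" for t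
      using that assms(7)[of t] by force
  qed
  have g: "Inf {t \<in> {fp..1}. co i (path t) = M + 1} = fm"
  proof (rule cInf_eq_minimum)
    show "fm \<in> {t \<in> {fp..1}. co i (path t) = M + 1}" using assms(2-4,8) by simp
    show "fm \<le> t" if "t \<in> {t \<in> {fp..1}. co i (path t) = M + 1}" for t
      using that assms(9)[of t] by force
  qed
  show ?thesis unfolding froot_def Let_def m f g using assms(3,4) by simp
qed

lemma froot_None:
  fixes path :: "real \<Rightarrow> 'v::real_vector"
  assumes "M \<in> \<int>" "\<And>t. 0 \<le> t \<Longrightarrow> t \<le> 1 \<Longrightarrow> M \<le> co i (path t)" "co i (path 1) = M"
  shows "froot co al i path = None"
proof -
  have m: "Inf {co i (path t) | t. t \<in> {0..1} \<and> co i (path t) \<in> \<int>} = M"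
  proof (rule cInf_eq_minimum)
    have "(1::real) \<in> {0..1}" by simp
    then show "M \<in> {co i (path t) | t. t \<in> {0..1} \<and> co i (path t) \<in> \<int>}" using assms(1,3) by blast
    show "M \<le> x" if "x \<in> {co i (path t) | t. t \<in> {0..1} \<and> co i (path t) \<in> \<int>}" for x
      using that assms(2) by auto
  qed
  have f: "Sup {t \<in> {0..1}. co i (path t) = M} = 1"
  proof (rule cSup_eq_maximum)
    show "1 \<in> {t \<in> {0..1}. co i (path t) = M}" using assms(3) by simp
    show "t \<le> 1" if "t \<in> {t \<in> {0..1}. co i (path t) = M}" for t using that by simp
  qed
  show ?thesis unfolding froot_def Let_def m f by simp
qed

text \<open>Factors are counted from 0; an integer time belongs to the factor that it
  closes.\<close>

definition fac :: "real \<Rightarrow> nat" where "fac \<tau> = nat (\<lceil>\<tau>\<rceil> - 1)"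

lemma fac_eq: assumes "0 \<le> s" "s < \<tau>" "\<tau> \<le> of_int \<lfloor>s\<rfloor> + 1" shows "fac \<tau> = nat \<lfloor>s\<rfloor>" "real (fac \<tau>) = of_int \<lfloor>s\<rfloor>"
proof -
  have "\<lceil>\<tau>\<rceil> = \<lfloor>s\<rfloor> + 1" using assms by (simp add: ceiling_eq_iff) linarith
  then show "fac \<tau> = nat \<lfloor>s\<rfloor>" by (simp add: fac_def)
  then show "real (fac \<tau>) = of_int \<lfloor>s\<rfloor>" using assms(1) by simp
qed

text \<open>All \<open>lam m\<close> are required to be dominant, also beyond \<open>n\<close>, so
  that \<open>dr\<close> needs no range conditions; the final theorem pads the family with
  0.\<close>

locale paths = bc co al P for co :: "'i::countable \<Rightarrow> 'v::real_vector \<Rightarrow> real" and al P +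
  fixes n :: nat and lam :: "nat \<Rightarrow> 'v"
  assumes n1: "1 \<le> n" and lamP: "lam m \<in> Pplus co P"
begin

lemma dom_lam: "dom (lam m)" using lamP by (simp add: dom_def Pplus_def)

lemma W_int: "(\<forall>j. co j x \<in> \<int>) \<Longrightarrow> co j (W w x) \<in> \<int>"
proof (induction w arbitrary: j)
  case (Cons i w)
  then show ?case by (simp add: srefl_def co_al_int)
qed simp

lemma W_lam_int: "co j (W w (lam m)) \<in> \<int>"
  using lamP[of m] by (intro W_int) (auto simp: Pplus_def int_co)

text \<open>A segment \<open>(\<tau>, w)\<close> ends at time \<open>\<tau>\<close>, in factor \<open>fac \<tau>\<close>; it starts where its predecessor ends.
  \<open>inc\<close> forbids a segment to cross an integer time, \<open>et\<close> is the end time, \<open>tot\<close> the total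
  displacement, \<open>Q\<close> the path itself and \<open>nw\<close> the word of the following segment. In \<open>sg\<close> an
  integer end time marks the last segment of a factor.\<close>

type_synonym ('a) seg = "real \<times> 'a list"

definition dr :: "'i seg \<Rightarrow> 'v" where "dr p = W (snd p) (lam (fac (fst p)))"

fun inc :: "real \<Rightarrow> 'i seg list \<Rightarrow> bool" where
  "inc s [] \<longleftrightarrow> True"
| "inc s (p # xs) \<longleftrightarrow> s < fst p \<and> fst p \<le> of_int \<lfloor>s\<rfloor> + 1 \<and> inc (fst p) xs"

fun et :: "real \<Rightarrow> 'i seg list \<Rightarrow> real" where
  "et s [] = s"
| "et s (p # xs) = et (fst p) xs"

fun tot :: "real \<Rightarrow> 'i seg list \<Rightarrow> 'v" where
  "tot s [] = 0"
| "tot s (p # xs) = (fst p - s) *\<^sub>R dr p + tot (fst p) xs"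

fun Q :: "real \<Rightarrow> 'i seg list \<Rightarrow> real \<Rightarrow> 'v" where
  "Q s [] t = 0"
| "Q s (p # xs) t = max 0 (min t (fst p) - s) *\<^sub>R dr p + Q (fst p) xs t"

fun nw :: "'i seg list \<Rightarrow> 'i list \<Rightarrow> 'i list" where
  "nw [] z = z"
| "nw (p # xs) z = snd p"

definition sg :: "('v \<Rightarrow> 'i list \<Rightarrow> 'i list \<Rightarrow> bool) \<Rightarrow> 'i seg \<Rightarrow> 'i list \<Rightarrow> bool" where
  "sg C p z \<longleftrightarrow> ach (fst p - fac (fst p)) (dr p) (W z (lam (fac (fst p)))) \<and>
     (fst p \<in> \<int> \<longrightarrow> W z (lam (fac (fst p))) \<in> re_orbit co al (lam (fac (fst p)))) \<and>
     C (lam (fac (fst p))) z (snd p)"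

text \<open>\<open>C\<close> is \<open>mv\<close> while operators are applied and
  \<open>bled\<close> while they are undone; \<open>z\<close> is the word that follows the
  list.\<close>

fun okn :: "('v \<Rightarrow> 'i list \<Rightarrow> 'i list \<Rightarrow> bool) \<Rightarrow> 'i seg list \<Rightarrow> 'i list \<Rightarrow> bool" where
  "okn C [] z \<longleftrightarrow> True"
| "okn C (p # xs) z \<longleftrightarrow> sg C p (nw xs z) \<and> okn C xs z"

text \<open>The final empty word encodes the 1-chain down to the last dominant weight that closes
  the last GLS path.\<close>

definition Sdata :: "('v \<Rightarrow> 'i list \<Rightarrow> 'i list \<Rightarrow> bool) \<Rightarrow> 'i seg list \<Rightarrow> bool" where
  "Sdata C xs \<longleftrightarrow> inc 0 xs \<and> et 0 xs = real n \<and> okn C xs []"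

definition pth :: "'i seg list \<Rightarrow> real \<Rightarrow> 'v" where "pth xs t = Q 0 xs (real n * t)"

section \<open>Evaluating and bounding heights along segment lists\<close>

lemma inc_append: "inc s (A @ B) \<longleftrightarrow> inc s A \<and> inc (et s A) B" by (induction A arbitrary: s) auto
lemma et_append: "et s (A @ B) = et (et s A) B" by (induction A arbitrary: s) auto
lemma tot_append: "tot s (A @ B) = tot s A + tot (et s A) B" by (induction A arbitrary: s) (auto simp: add.assoc)
lemma Q_append: "Q s (A @ B) t = Q s A t + Q (et s A) B t" by (induction A arbitrary: s) (auto simp: add.assoc)
lemma nw_append: "nw (A @ B) z = nw A (nw B z)" by (cases A) auto
lemma okn_append: "okn C (A @ B) z \<longleftrightarrow> okn C A (nw B z) \<and> okn C B z"
  by (induction A) (auto simp: nw_append)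

lemma et_mono: "inc s xs \<Longrightarrow> s \<le> et s xs"
proof (induction xs arbitrary: s)
  case (Cons p xs)
  have "fst p \<le> et (fst p) xs" using Cons by simp
  then show ?case using Cons.prems by simp
qed simp

lemma et_less: "inc s xs \<Longrightarrow> xs \<noteq> [] \<Longrightarrow> s < et s xs"
  using et_mono[of "fst (hd xs)" "tl xs"] by (cases xs) auto

lemma Q_before: "inc s xs \<Longrightarrow> t \<le> s \<Longrightarrow> Q s xs t = 0"
proof (induction xs arbitrary: s)
  case (Cons p xs)
  then show ?case using Cons.IH[of "fst p"] by simp
qed simp

lemma Q_after: "inc s xs \<Longrightarrow> et s xs \<le> t \<Longrightarrow> Q s xs t = tot s xs"
proof (induction xs arbitrary: s)
  case (Cons p xs)
  have "fst p \<le> t" using et_mono[of "fst p" xs] Cons.prems by simp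
  then show ?case using Cons by simp
qed simp

text \<open>The height is linear on each segment, so a bound at the break points is a bound
  everywhere.\<close>

lemma Q_ge:
  assumes "inc s xs" "\<And>A B. xs = A @ B \<Longrightarrow> M \<le> c + co j (tot s A)" shows "M \<le> c + co j (Q s xs t)"
  using assms
proof (induction xs arbitrary: s c)
  case Nil
  then show ?case using Nil.prems(2)[of "[]" "[]"] by simp
next
  case (Cons p xs)
  have 0: "M \<le> c" using Cons.prems(2)[of "[]" "p # xs"] by simp
  have 1: "M \<le> c + (fst p - s) * co j (dr p)" using Cons.prems(2)[of "[p]" xs] by simp
  have i: "inc (fst p) xs" "s < fst p" using Cons.prems(1) by auto
  show ?case
  proof (cases "fst p \<le> t")
    case True
    have "M \<le> (c + (fst p - s) * co j (dr p)) + co j (Q (fst p) xs t)"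
    proof (rule Cons.IH[OF i(1)])
      fix A B assume "xs = A @ B"
      then show "M \<le> c + (fst p - s) * co j (dr p) + co j (tot (fst p) A)"
        using Cons.prems(2)[of "p # A" B] by simp
    qed
    then show ?thesis using True i(2) by simp
  next
    case False
    define l where "l = max 0 (min t (fst p) - s)"
    have l: "0 \<le> l" "l \<le> fst p - s" using i(2) by (auto simp: l_def)
    have "M \<le> c + l * co j (dr p)"
    proof (cases "0 \<le> co j (dr p)")
      case True
      then show ?thesis using 0 l(1) by (simp add: add_increasing2)
    next
      case neg: False
      then have "(fst p - s) * co j (dr p) \<le> l * co j (dr p)" using l by (intro mult_right_mono_neg) auto
      then show ?thesis using 1 by linarith
    qed
    then show ?thesis using False Q_before[OF i(1), of t] by (simp add: l_def)
  qed
qed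

lemma Q_gt:
  assumes "inc s xs" "\<And>A B. xs = A @ B \<Longrightarrow> M < c + co j (tot s A)" shows "M < c + co j (Q s xs t)"
proof -
  define v where "v = Min ((\<lambda>k. c + co j (tot s (take k xs))) ` {..length xs})"
  have 1: "v \<le> c + co j (tot s A)" if "xs = A @ B" for A B
    unfolding v_def using that by (intro Min_le) (auto intro!: image_eqI[of _ _ "length A"])
  have "v \<in> (\<lambda>k. c + co j (tot s (take k xs))) ` {..length xs}" unfolding v_def by (intro Min_in) auto
  then obtain k where "v = c + co j (tot s (take k xs))" by blast
  then have "M < v" using assms(2)[of "take k xs" "drop k xs"] by simp
  moreover have "v \<le> c + co j (Q s xs t)" by (rule Q_ge[OF assms(1) 1])
  ultimately show ?thesis by simp
qed

lemma Q_gt_start: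
  assumes "inc s xs" "s < t" "M \<le> c" "\<And>A B. xs = A @ B \<Longrightarrow> A \<noteq> [] \<Longrightarrow> M < c + co j (tot s A)" "xs \<noteq> []"
  shows "M < c + co j (Q s xs t)"
proof -
  obtain p ys where xs: "xs = p # ys" using assms(5) by (cases xs) auto
  have i: "inc (fst p) ys" "s < fst p" using assms(1) xs by auto
  have 1: "M < c + (fst p - s) * co j (dr p)" using assms(4)[of "[p]" ys] xs by simp
  show ?thesis
  proof (cases "fst p \<le> t")
    case True
    have "M < (c + (fst p - s) * co j (dr p)) + co j (Q (fst p) ys t)"
    proof (rule Q_gt[OF i(1)])
      fix A B assume "ys = A @ B"
      then show "M < c + (fst p - s) * co j (dr p) + co j (tot (fst p) A)"
        using assms(4)[of "p # A" B] xs by simp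
    qed
    then show ?thesis using True i(2) xs by simp
  next
    case False
    have "M < c + (t - s) * co j (dr p)"
    proof (cases "0 < co j (dr p)")
      case True
      then have "0 < (t - s) * co j (dr p)" using assms(2) by simp
      then show ?thesis using assms(3) by linarith
    next
      case neg: False
      then have "(fst p - s) * co j (dr p) \<le> (t - s) * co j (dr p)"
        using False by (intro mult_right_mono_neg) auto
      then show ?thesis using 1 by linarith
    qed
    then show ?thesis using False Q_before[OF i(1), of t] assms(2) xs by simp
  qed
qed

lemma Q_lt_mono:
  assumes "inc s xs" "\<forall>p\<in>set xs. 0 < co j (dr p)" "t < et s xs" "xs \<noteq> []"
  shows "co j (Q s xs t) < co j (tot s xs)"
  using assms
proof (induction xs arbitrary: s)
  case (Cons p xs)
  have i: "inc (fst p) xs" "s < fst p" using Cons.prems(1) by auto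
  have d: "0 < co j (dr p)" using Cons.prems(2) by simp
  show ?case
  proof (cases "xs = []")
    case True
    then have "max 0 (min t (fst p) - s) < fst p - s" using Cons.prems(3) i(2) by simp
    then show ?thesis using True d by simp
  next
    case False
    have "co j (Q (fst p) xs t) < co j (tot (fst p) xs)" using Cons.IH[OF i(1)] Cons.prems False by simp
    moreover have "max 0 (min t (fst p) - s) * co j (dr p) \<le> (fst p - s) * co j (dr p)"
      using d i(2) by (intro mult_right_mono) auto
    ultimately show ?thesis by simp
  qed
qed simp

lemma r_add: "r i (x + y) = r i x + r i y" by (rule linear_add[OF linear_srefl[where c = co and i = i, OF lin_co]])
lemma r_scale: "r i (c *\<^sub>R x) = c *\<^sub>R r i x" by (rule linear_cmul[OF linear_srefl[where c = co and i = i, OF lin_co]])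

lemma Q_refl: "Q s (map (\<lambda>p. (fst p, i # snd p)) xs) t = r i (Q s xs t)"
proof (induction xs arbitrary: s)
  case (Cons p xs)
  have "dr (fst p, i # snd p) = r i (dr p)" by (simp add: dr_def)
  then show ?case using Cons by (simp add: r_add r_scale)
qed (simp add: srefl_def)

lemma frac_time: assumes "0 \<le> s" "s < \<tau>" "\<tau> \<le> of_int \<lfloor>s\<rfloor> + 1"
  shows "0 < \<tau> - real (fac \<tau>)" "\<tau> \<in> \<int> \<Longrightarrow> \<tau> - real (fac \<tau>) = 1" "\<tau> \<notin> \<int> \<Longrightarrow> \<lfloor>\<tau>\<rfloor> = int (fac \<tau>)"
proof -
  have f: "real (fac \<tau>) = of_int \<lfloor>s\<rfloor>" by (rule fac_eq(2)[OF assms])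
  show "0 < \<tau> - real (fac \<tau>)" using f assms by linarith
  show "\<tau> - real (fac \<tau>) = 1" if tZ: "\<tau> \<in> \<int>"
  proof -
    obtain z where z: "\<tau> = of_int z" using tZ Ints_cases by blast
    have "\<lfloor>s\<rfloor> < z" using assms(2) z by (simp add: floor_less_iff)
    moreover have "z \<le> \<lfloor>s\<rfloor> + 1" using assms(3) z by linarith
    ultimately show ?thesis using f z by simp
  qed
  have f': "int (fac \<tau>) = \<lfloor>s\<rfloor>" using fac_eq(1)[OF assms] assms(1) by simp
  show "\<lfloor>\<tau>\<rfloor> = int (fac \<tau>)" if "\<tau> \<notin> \<int>"
  proof -
    have "\<tau> \<noteq> of_int (\<lfloor>s\<rfloor> + 1)" using that Ints_of_int by metis
    then have "\<tau> < of_int \<lfloor>s\<rfloor> + 1" using assms(3) by simp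
    moreover have "of_int \<lfloor>s\<rfloor> \<le> \<tau>" using assms(2) by linarith
    ultimately have "\<lfloor>\<tau>\<rfloor> = \<lfloor>s\<rfloor>" by (simp add: floor_eq_iff)
    then show ?thesis using f' by simp
  qed
qed

text \<open>The integrality invariant at time \<open>s\<close>: after removing the contribution that the current factor
  would have made had it followed \<open>w\<close> from its start, all heights of \<open>u\<close> are integers.\<close>

definition intat :: "real \<Rightarrow> 'v \<Rightarrow> 'i list \<Rightarrow> bool" where
  "intat s u w \<longleftrightarrow> (\<forall>j. co j u - (s - of_int \<lfloor>s\<rfloor>) * co j (W w (lam (nat \<lfloor>s\<rfloor>))) \<in> \<int>)"

lemma intat_step:
  assumes "0 \<le> s" "s < fst p" "fst p \<le> of_int \<lfloor>s\<rfloor> + 1" "intat s u (snd p)"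
  shows "co j (u + (fst p - s) *\<^sub>R dr p) - (fst p - fac (fst p)) * co j (dr p) \<in> \<int>"
proof -
  note f = fac_eq[OF assms(1-3)]
  have "co j u - (s - of_int \<lfloor>s\<rfloor>) * co j (dr p) \<in> \<int>" using assms(4) f(1) unfolding intat_def dr_def by simp
  moreover have "co j (u + (fst p - s) *\<^sub>R dr p) - (fst p - fac (fst p)) * co j (dr p) =
     co j u - (s - of_int \<lfloor>s\<rfloor>) * co j (dr p)" unfolding f(2) by (simp add: algebra_simps)
  ultimately show ?thesis by (simp only:)
qed

text \<open>At an integer time the whole slope has been added, which is integral. Inside a factor
  the change of direction alters the correction by \<open>a\<close> times a difference of weights,
  which is in the lattice by \<open>ach_lat\<close>.\<close>

lemma intat_next:
  assumes "0 \<le> s" "s < fst p" "fst p \<le> of_int \<lfloor>s\<rfloor> + 1" "intat s u (snd p)" "sg C p z"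
  shows "intat (fst p) (u + (fst p - s) *\<^sub>R dr p) z"
  unfolding intat_def
proof
  fix j
  let ?u = "u + (fst p - s) *\<^sub>R dr p" and ?a = "fst p - fac (fst p)"
  have k: "co j ?u - ?a * co j (dr p) \<in> \<int>" by (rule intat_step[OF assms(1-4)])
  note f = frac_time[OF assms(1-3)]
  show "co j ?u - (fst p - of_int \<lfloor>fst p\<rfloor>) * co j (W z (lam (nat \<lfloor>fst p\<rfloor>))) \<in> \<int>"
  proof (cases "fst p \<in> \<int>")
    case True
    have "co j ?u - 1 * co j (dr p) \<in> \<int>" using k f(2)[OF True] by simp
    then have "co j ?u \<in> \<int>" using Ints_add[OF _ W_lam_int[of j "snd p" "fac (fst p)"]] unfolding dr_def by fastforce
    moreover have "fst p = of_int \<lfloor>fst p\<rfloor>" using True by (elim Ints_cases) simp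
    ultimately show ?thesis by simp
  next
    case False
    have e: "\<lfloor>fst p\<rfloor> = int (fac (fst p))" by (rule f(3)[OF False])
    have "ach ?a (dr p) (W z (lam (fac (fst p))))" using assms(5) unfolding sg_def by blast
    then have "co j (?a *\<^sub>R (W z (lam (fac (fst p))) - dr p)) \<in> \<int>" by (intro lat_co ach_lat)
    then have "co j ?u - ?a * co j (dr p) - co j (?a *\<^sub>R (W z (lam (fac (fst p))) - dr p)) \<in> \<int>"
      using k by (rule Ints_diff[rotated])
    moreover have "co j ?u - ?a * co j (dr p) - co j (?a *\<^sub>R (W z (lam (fac (fst p))) - dr p)) =
       co j ?u - ?a * co j (W z (lam (fac (fst p))))" by (simp add: algebra_simps)
    ultimately have "co j ?u - ?a * co j (W z (lam (fac (fst p)))) \<in> \<int>" by (simp only:)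
    then show ?thesis unfolding e by simp
  qed
qed

lemma intat_prefix:
  assumes "0 \<le> s" "inc s (A @ B)" "okn C (A @ B) z" "intat s u (nw (A @ B) z)"
  shows "intat (et s A) (u + tot s A) (nw B z)"
  using assms
proof (induction A arbitrary: s u)
  case (Cons p A)
  have i: "s < fst p" "fst p \<le> of_int \<lfloor>s\<rfloor> + 1" "inc (fst p) (A @ B)" using Cons.prems(2) by auto
  have "intat (fst p) (u + (fst p - s) *\<^sub>R dr p) (nw (A @ B) z)"
    using Cons.prems by (intro intat_next[OF Cons.prems(1) i(1,2)]) auto
  from Cons.IH[OF _ i(3) _ this] show ?case using Cons.prems i by (simp add: add.assoc)
qed simp

section \<open>Heights at break points and their integrality\<close>

definition hh :: "'i \<Rightarrow> 'i seg list \<Rightarrow> nat \<Rightarrow> real" where "hh j xs k = co j (tot 0 (take k xs))"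

lemma et_take: "k < length xs \<Longrightarrow> et s (take (Suc k) xs) = fst (xs ! k)"
  by (induction xs arbitrary: k s) (auto simp: take_Suc_Cons nth_Cons split: nat.splits)

lemma take_split: "k < length xs \<Longrightarrow> xs = take k xs @ xs ! k # drop (Suc k) xs"
  by (simp add: id_take_nth_drop)

lemma hh_0 [simp]: "hh j xs 0 = 0" by (simp add: hh_def)

lemma hh_Suc: "k < length xs \<Longrightarrow> hh j xs (Suc k) = hh j xs k + (fst (xs ! k) - et 0 (take k xs)) * co j (dr (xs ! k))"
  by (simp add: hh_def take_Suc_conv_app_nth tot_append)

lemma seg_times:
  assumes "inc 0 xs" "k < length xs"
  shows "0 \<le> et 0 (take k xs)" "et 0 (take k xs) < fst (xs ! k)" "fst (xs ! k) \<le> of_int \<lfloor>et 0 (take k xs)\<rfloor> + 1"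
proof -
  have "inc 0 (take k xs @ xs ! k # drop (Suc k) xs)" using assms take_split by metis
  then have "inc 0 (take k xs) \<and> inc (et 0 (take k xs)) (xs ! k # drop (Suc k) xs)" by (simp only: inc_append)
  then show "0 \<le> et 0 (take k xs)" "et 0 (take k xs) < fst (xs ! k)" "fst (xs ! k) \<le> of_int \<lfloor>et 0 (take k xs)\<rfloor> + 1"
    using et_mono[of 0 "take k xs"] by auto
qed

lemma seg_sg:
  assumes "okn C xs z" "k < length xs" shows "sg C (xs ! k) (nw (drop (Suc k) xs) z)"
proof -
  have "okn C (take k xs @ xs ! k # drop (Suc k) xs) z" using assms take_split by metis
  then show ?thesis by (simp only: okn_append okn.simps)
qed

lemma nw_drop: "k < length xs \<Longrightarrow> nw (drop k xs) z = snd (xs ! k)"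
  by (cases "drop k xs") (auto simp: drop_Suc nth_via_drop)

lemma hh_sign:
  assumes "inc 0 xs" "k < length xs"
  shows "hh j xs k < hh j xs (Suc k) \<longleftrightarrow> 0 < co j (dr (xs ! k))"
    "hh j xs (Suc k) < hh j xs k \<longleftrightarrow> co j (dr (xs ! k)) < 0"
  using seg_times(2)[OF assms] unfolding hh_Suc[OF assms(2)]
  by (simp_all add: zero_less_mult_iff mult_less_0_iff)

lemma hh_sign_le:
  assumes "inc 0 xs" "k < length xs"
  shows "hh j xs k \<le> hh j xs (Suc k) \<longleftrightarrow> 0 \<le> co j (dr (xs ! k))"
    "hh j xs (Suc k) \<le> hh j xs k \<longleftrightarrow> co j (dr (xs ! k)) \<le> 0"
  using hh_sign[OF assms, of j] by (simp_all add: not_less[symmetric])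

context
  fixes C xs assumes S: "Sdata C xs"
begin

lemma Sinc: "inc 0 xs" and Set: "et 0 xs = real n" and Sokn: "okn C xs []"
  using S by (auto simp: Sdata_def)

lemma Sne: "xs \<noteq> []" using Set n1 by auto

lemma intat_at: "k \<le> length xs \<Longrightarrow> intat (et 0 (take k xs)) (tot 0 (take k xs)) (nw (drop k xs) [])"
  using intat_prefix[of 0 "take k xs" "drop k xs" C "[]" 0] Sinc Sokn by (simp add: intat_def)

lemma hh_K:
  assumes "k < length xs"
  shows "hh j xs (Suc k) - (fst (xs ! k) - fac (fst (xs ! k))) * co j (dr (xs ! k)) \<in> \<int>"
proof -
  have "intat (et 0 (take k xs)) (tot 0 (take k xs)) (snd (xs ! k))"
    using intat_at[of k] assms nw_drop by simp
  from intat_step[OF seg_times[OF Sinc assms] this, of j] show ?thesis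
    using hh_Suc[OF assms, of j] by (simp add: hh_def)
qed

lemma hh_int_time:
  assumes "k < length xs" "fst (xs ! k) \<in> \<int>" shows "hh j xs (Suc k) \<in> \<int>"
proof -
  have "fst (xs ! k) - fac (fst (xs ! k)) = 1" by (rule frac_time(2)[OF seg_times[OF Sinc assms(1)] assms(2)])
  then have "hh j xs (Suc k) - co j (dr (xs ! k)) \<in> \<int>" using hh_K[OF assms(1), of j] by simp
  from Ints_add[OF this W_lam_int[of j "snd (xs ! k)" "fac (fst (xs ! k))"]] show ?thesis by (simp add: dr_def)
qed

lemma hh_end: "hh j xs (length xs) \<in> \<int>"
proof -
  have l: "length xs - 1 < length xs" using Sne by simp
  have "fst (xs ! (length xs - 1)) = real n" using et_take[OF l, of 0] Set Sne by simp
  then show ?thesis using hh_int_time[OF l, of j] Sne by simp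
qed

lemma same_factor:
  assumes "Suc k < length xs" "fst (xs ! k) \<notin> \<int>"
  shows "fac (fst (xs ! Suc k)) = fac (fst (xs ! k))"
proof -
  have "et 0 (take (Suc k) xs) = fst (xs ! k)" using assms by (simp add: et_take)
  then have "fac (fst (xs ! Suc k)) = nat \<lfloor>fst (xs ! k)\<rfloor>"
    using fac_eq(1)[OF seg_times[OF Sinc assms(1)]] by simp
  also have "\<dots> = fac (fst (xs ! k))"
    using frac_time(3)[OF seg_times[OF Sinc, of k] assms(2)] assms(1) by simp
  finally show ?thesis .
qed

lemma same_factor_ach:
  assumes "Suc k < length xs" "fst (xs ! k) \<notin> \<int>"
  shows "ach (fst (xs ! k) - fac (fst (xs ! k))) (dr (xs ! k)) (dr (xs ! Suc k))"
proof -
  have "sg C (xs ! k) (snd (xs ! Suc k))" using seg_sg[OF Sokn, of k] nw_drop[of "Suc k" xs] assms(1) by simp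
  then show ?thesis unfolding sg_def dr_def[of "xs ! Suc k"] same_factor[OF assms] by blast
qed

text \<open>At a break inside a factor, a nonintegral \<open>a * co j\<close> would keep the chain
  strictly on the negative side, contrary to the turn. So it is integral, and by \<open>hh_K\<close>
  so is the height.\<close>

lemma hh_local_min:
  assumes "Suc k < length xs" "j \<in> Re" "co j (dr (xs ! k)) \<le> 0" "0 \<le> co j (dr (xs ! Suc k))"
  shows "hh j xs (Suc k) \<in> \<int>"
proof (cases "fst (xs ! k) \<in> \<int>")
  case True
  then show ?thesis using hh_int_time assms(1) by simp
next
  case False
  let ?a = "fst (xs ! k) - fac (fst (xs ! k))"
  have "?a * co j (dr (xs ! k)) \<in> \<int>"
  proof (rule ccontr)
    assume n: "?a * co j (dr (xs ! k)) \<notin> \<int>"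
    then have "co j (dr (xs ! k)) \<noteq> 0" by auto
    then have "co j (dr (xs ! k)) < 0" using assms(3) by simp
    from ach_interior_neg[OF same_factor_ach[OF assms(1) False] assms(2) this n] show False using assms(4) by simp
  qed
  from Ints_add[OF hh_K[of k j] this] assms(1) show ?thesis by simp
qed

lemma hh_min_int:
  assumes "j \<in> Re" "k \<le> length xs" "\<And>l. l \<le> length xs \<Longrightarrow> hh j xs k \<le> hh j xs l"
  shows "hh j xs k \<in> \<int>"
proof -
  consider "k = 0" | "k = length xs" | l where "k = Suc l" "Suc l < length xs"
    using assms(2) by (cases k) (auto simp: le_less)
  then show ?thesis
  proof cases
    case 3
    have "co j (dr (xs ! l)) \<le> 0" using assms(3)[of l] hh_sign_le(2)[OF Sinc, of l j] 3 by simp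
    moreover have "0 \<le> co j (dr (xs ! Suc l))" using assms(3)[of "Suc (Suc l)"] hh_sign_le(1)[OF Sinc, of "Suc l" j] 3 by simp
    ultimately show ?thesis using hh_local_min[OF 3(2) assms(1)] 3 by simp
  qed (use hh_end in auto)
qed

lemma prefix_hh: "xs = A @ B \<Longrightarrow> co j (tot 0 A) = hh j xs (length A)"
  by (simp add: hh_def)

lemma pth_ge: "(\<And>l. l \<le> length xs \<Longrightarrow> M \<le> hh j xs l) \<Longrightarrow> M \<le> co j (pth xs t)"
  unfolding pth_def using Q_ge[OF Sinc, of M 0 j] prefix_hh by fastforce

end

lemma fac_split: assumes "0 \<le> s" "s < \<sigma>" "\<sigma> \<le> \<tau>" "\<tau> \<le> of_int \<lfloor>s\<rfloor> + 1" shows "fac \<sigma> = fac \<tau>"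
  using fac_eq(1)[of s \<sigma>] fac_eq(1)[of s \<tau>] assms by simp

text \<open>Both parts carry the same word, so the new break needs only the trivial chain; it lies
  strictly inside a factor, so no condition at integer times arises.\<close>

lemma Sdata_split:
  assumes "Sdata C (A @ p # B)" "et 0 A < \<sigma>" "\<sigma> < fst p" "\<And>x w. C x w w"
  shows "Sdata C (A @ (\<sigma>, snd p) # p # B) \<and> pth (A @ (\<sigma>, snd p) # p # B) = pth (A @ p # B) \<and>
    dr (\<sigma>, snd p) = dr p"
proof -
  have i: "inc 0 A" "et 0 A < fst p" "fst p \<le> of_int \<lfloor>et 0 A\<rfloor> + 1" "inc (fst p) B" and
    e: "et (fst p) B = real n" and o: "okn C A (snd p)" "sg C p (nw B [])" "okn C B []"
    using assms(1) by (auto simp: Sdata_def inc_append et_append okn_append)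
  have s0: "0 \<le> et 0 A" using et_mono[OF i(1)] .
  have f: "fac \<sigma> = fac (fst p)" using fac_split[OF s0 assms(2), of "fst p"] assms(3) i(3) by simp
  have d: "dr (\<sigma>, snd p) = dr p" by (simp add: dr_def f)
  have nz: "\<sigma> \<notin> \<int>"
  proof
    assume "\<sigma> \<in> \<int>"
    then have "\<sigma> - real (fac \<sigma>) = 1" using frac_time(2)[OF s0 assms(2)] assms(3) i(3) by simp
    moreover have "real (fac \<sigma>) = of_int \<lfloor>et 0 A\<rfloor>" using fac_eq(2)[OF s0 assms(2)] assms(3) i(3) by simp
    ultimately show False using assms(3) i(3) by simp
  qed
  have fl: "\<lfloor>\<sigma>\<rfloor> = \<lfloor>et 0 A\<rfloor>"
    using frac_time(3)[OF s0 assms(2) _ nz] fac_eq(1)[OF s0 assms(2)] assms(3) i(3) s0 by simp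
  have "sg C (\<sigma>, snd p) (snd p)" unfolding sg_def using nz d assms(4) f by (simp add: dr_def)
  then have 1: "Sdata C (A @ (\<sigma>, snd p) # p # B)"
    using i e o assms(2,3) fl by (simp add: Sdata_def inc_append et_append okn_append)
  have "max 0 (min t \<sigma> - et 0 A) *\<^sub>R dr p + max 0 (min t (fst p) - \<sigma>) *\<^sub>R dr p = max 0 (min t (fst p) - et 0 A) *\<^sub>R dr p" for t
    unfolding scaleR_left_distrib[symmetric] using assms(2,3) by (auto simp: min_def max_def)
  then have "Q 0 (A @ (\<sigma>, snd p) # p # B) t = Q 0 (A @ p # B) t" for t
    by (simp add: Q_append d add.assoc[symmetric])
  then have "pth (A @ (\<sigma>, snd p) # p # B) = pth (A @ p # B)" by (simp add: fun_eq_iff pth_def)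
  then show ?thesis using 1 d by blast
qed

end

section \<open>Applying root operators\<close>

context paths
begin

abbreviation flip where "flip j \<equiv> map (\<lambda>p. (fst p, j # snd p))"

text \<open>Words may differ as long as the weights do not, which allows letters that fix the
  relevant weight to be added without changing the path.\<close>

definition sim :: "'i seg list \<Rightarrow> 'i seg list \<Rightarrow> bool" where
  "sim = list_all2 (\<lambda>p q. fst p = fst q \<and> dr p = dr q)"

lemma sim_refl [simp]: "sim A A" by (simp add: sim_def list_all2_refl)

lemma sim_eqs:
  assumes "sim A B" shows "Q s A t = Q s B t" "tot s A = tot s B" "et s A = et s B" "inc s A = inc s B"
  using assms unfolding sim_def by (induction arbitrary: s rule: list_all2_induct) auto

lemma sim_append: "sim A A' \<Longrightarrow> sim B B' \<Longrightarrow> sim (A @ B) (A' @ B')"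
  unfolding sim_def by (rule list_all2_appendI)

lemma sim_pth: "sim A B \<Longrightarrow> pth A = pth B" by (simp add: pth_def sim_eqs fun_eq_iff)

lemma flip_eqs: "et s (flip j A) = et s A" "inc s (flip j A) = inc s A" "flip j A = [] \<longleftrightarrow> A = []"
  by (induction A arbitrary: s) auto

lemma dr_flip: "dr (fst p, j # snd p) = r j (dr p)" by (simp add: dr_def)

lemma sim_flip: "\<forall>p\<in>set A. co j (dr p) = 0 \<Longrightarrow> sim A (flip j A)"
  unfolding sim_def by (induction A) (auto simp: dr_flip r_fix)

lemma tot_pos: "inc s B \<Longrightarrow> B \<noteq> [] \<Longrightarrow> \<forall>p\<in>set B. 0 < co j (dr p) \<Longrightarrow> 0 < co j (tot s B)"
proof (induction B arbitrary: s)
  case (Cons p B)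
  have "0 < (fst p - s) * co j (dr p)" using Cons.prems by simp
  moreover have "0 \<le> co j (tot (fst p) B)"
    using Cons.IH[of "fst p"] Cons.prems by (cases "B = []") auto
  ultimately show ?case by simp
qed simp

lemma tot_flat: "\<forall>p\<in>set A. co j (dr p) = 0 \<Longrightarrow> co j (tot s A) = 0"
  by (induction A arbitrary: s) auto

text \<open>On \<open>B\<close> the height above \<open>M\<close> is the coroot value of the
  displacement along \<open>B\<close>, so subtracting that multiple of \<open>al j\<close> reflects
  the displacement; at the end of \<open>B\<close> it has reached 1.\<close>

theorem froot_data:
  assumes "inc 0 (A @ B @ D)" "et 0 (A @ B @ D) = real n" "B \<noteq> []" "\<forall>p\<in>set B. 0 < co j (dr p)" "M \<in> \<int>"
    "co j (tot 0 A) = M" "co j (tot (et 0 A) B) = 1" "\<And>t. M \<le> co j (pth (A @ B @ D) t)"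
    "\<And>t. et 0 A < real n * t \<Longrightarrow> M < co j (pth (A @ B @ D) t)"
    "\<And>t. 0 \<le> t \<Longrightarrow> t \<le> 1 \<Longrightarrow> path t = pth (A @ B @ D) t"
  shows "\<exists>q. froot co al j path = Some q \<and> (\<forall>t. 0 \<le> t \<longrightarrow> t \<le> 1 \<longrightarrow> q t = pth (A @ flip j B @ D) t)"
proof -
  have i: "inc 0 A" "inc (et 0 A) B" "inc (et (et 0 A) B) D" and e: "et (et (et 0 A) B) D = real n"
    using assms(1,2) by (auto simp: inc_append et_append)
  define a b where "a = et 0 A" and "b = et a B"
  have n0: "real n > 0" using n1 by simp
  have ab: "0 \<le> a" "a < b" "b \<le> real n"
    using et_mono[OF i(1)] et_less[OF i(2) assms(3)] et_mono[OF i(3)] e by (auto simp: a_def b_def)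
  have Qs: "pth (A @ B @ D) t = Q 0 A (real n * t) + (Q a B (real n * t) + Q b D (real n * t))" for t
    by (simp add: pth_def Q_append a_def b_def)
  have Qs': "pth (A @ flip j B @ D) t = Q 0 A (real n * t) + (r j (Q a B (real n * t)) + Q b D (real n * t))" for t
    by (simp add: pth_def Q_append flip_eqs a_def b_def Q_refl)
  have T1: "real n * t \<le> a \<longleftrightarrow> t \<le> a / real n" "real n * t < a \<longleftrightarrow> t < a / real n" "a < real n * t \<longleftrightarrow> a / real n < t" for t a
    using n0 by (simp_all add: field_simps)
  have HB: "co j (pth (A @ B @ D) t) = M + co j (Q a B (real n * t))" if "a \<le> real n * t" "real n * t \<le> b" for t
    using that Q_after[OF i(1), of "real n * t"] Q_before[of b D "real n * t"] i(3) assms(6)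
    by (simp add: Qs a_def b_def)
  have fr: "froot co al j path = Some (\<lambda>t. if t \<le> a / real n then path t
      else if t \<le> b / real n then path t - (co j (path t) - M) *\<^sub>R al j else path t - al j)"
  proof (rule froot_eq[OF assms(5)])
    show "0 \<le> a / real n" "a / real n < b / real n" using ab n0 by (simp_all add: divide_strict_right_mono)
    show b1: "b / real n \<le> 1" using ab n0 by simp
    have a1: "a / real n \<le> 1" using ab n0 by simp
    have a0: "0 \<le> a / real n" "0 \<le> b / real n" using ab n0 by simp_all
    show "M \<le> co j (path t)" if "0 \<le> t" "t \<le> 1" for t using assms(8,10) that by simp
    show "co j (path (a / real n)) = M"
      using HB[of "a / real n"] Q_before[OF i(2), of a] assms(10)[OF a0(1) a1] n0 ab by (simp add: a_def[symmetric])
    show "M < co j (path t)" if "a / real n < t" "t \<le> 1" for t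
      using assms(9)[of t] assms(10)[of t] that T1(3)[of a t] a0 by (simp add: a_def)
    show "co j (path (b / real n)) = M + 1"
      using HB[of "b / real n"] Q_after[OF i(2), of b] assms(7) assms(10)[OF a0(2) b1] n0 ab by (simp add: a_def[symmetric] b_def[symmetric])
    show "co j (path t) < M + 1" if "a / real n \<le> t" "t < b / real n" for t
    proof -
      have T: "a \<le> real n * t" "real n * t < b" using that n0 by (simp_all add: field_simps)
      have "co j (Q a B (real n * t)) < 1"
        using Q_lt_mono[OF i(2) assms(4) _ assms(3), of "real n * t"] T(2) assms(7) by (simp add: a_def b_def)
      moreover have "path t = pth (A @ B @ D) t" using that a0 b1 by (intro assms(10)) auto
      ultimately show ?thesis using HB[OF T(1)] T(2) by simp
    qed
  qed
  show ?thesis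
  proof (intro exI conjI allI impI, rule fr)
    fix t :: real assume t: "0 \<le> t" "t \<le> 1"
    have pt: "path t = pth (A @ B @ D) t" using assms(10) t by simp
    show "(if t \<le> a / real n then path t
      else if t \<le> b / real n then path t - (co j (path t) - M) *\<^sub>R al j else path t - al j) = pth (A @ flip j B @ D) t"
    proof (cases "t \<le> a / real n")
      case True
      then have "Q a B (real n * t) = 0" using Q_before[OF i(2), of "real n * t"] T1(1) by (simp add: a_def)
      then show ?thesis using True pt by (simp add: Qs Qs' srefl_def)
    next
      case False
      then have aT: "a \<le> real n * t" using T1(3)[of a t] by simp
      show ?thesis
      proof (cases "t \<le> b / real n")
        case True
        then have "real n * t \<le> b" using T1(1) by simp
        then show ?thesis using True False pt HB[OF aT] by (simp add: Qs Qs' srefl_def)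
      next
        case bF: False
        then have "b \<le> real n * t" using T1(3)[of b t] by simp
        then have "Q a B (real n * t) = tot a B" using Q_after[OF i(2), of "real n * t"] by (simp add: a_def b_def)
        then have "r j (Q a B (real n * t)) = Q a B (real n * t) - al j" using assms(7) by (simp add: a_def srefl_def)
        then show ?thesis using False bF pt by (simp add: Qs Qs')
      qed
    qed
  qed
qed

text \<open>The segments between the last time the height function equals \<open>M\<close> and the first later
  time it equals \<open>M + 1\<close>, after splitting a segment if necessary.\<close>

lemma decomp:
  assumes S: "Sdata C xs" and refl: "\<And>x w. C x w w" and "k0 < length xs" "hh j xs k0 = M" "M \<in> \<int>"
    "\<And>k. k \<le> length xs \<Longrightarrow> M \<le> hh j xs k" "\<And>k. k0 < k \<Longrightarrow> k \<le> length xs \<Longrightarrow> M < hh j xs k"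
    "\<And>s. k0 \<le> s \<Longrightarrow> s < length xs \<Longrightarrow> hh j xs s < M + 1 \<Longrightarrow> 0 < co j (dr (xs ! s))"
  shows "\<exists>A B D. Sdata C (A @ B @ D) \<and> pth (A @ B @ D) = pth xs \<and> A = take k0 xs \<and> B \<noteq> [] \<and>
    (\<forall>p\<in>set B. 0 < co j (dr p)) \<and> co j (tot 0 A) = M \<and> co j (tot (et 0 A) B) = 1 \<and>
    (\<forall>t. M \<le> co j (pth xs t)) \<and> (\<forall>t. et 0 A < real n * t \<longrightarrow> M < co j (pth xs t))"
proof -
  let ?N = "length xs"
  have "hh j xs ?N \<ge> M + 1"
  proof -
    have "hh j xs ?N - M \<in> \<int>" using hh_end[OF S] assms(5) by (rule Ints_diff)
    moreover have "0 < hh j xs ?N - M" using assms(3) assms(7)[of ?N] by simp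
    ultimately show ?thesis using Ints_ge_1 by fastforce
  qed
  define R where "R = (LEAST r. k0 < r \<and> M + 1 \<le> hh j xs r)"
  have "k0 < ?N \<and> M + 1 \<le> hh j xs ?N" using assms(3) \<open>hh j xs ?N \<ge> M + 1\<close> by simp
  then have R: "k0 < R" "M + 1 \<le> hh j xs R" "R \<le> ?N"
    unfolding R_def using LeastI[of "\<lambda>r. k0 < r \<and> M + 1 \<le> hh j xs r" ?N] Least_le[of "\<lambda>r. k0 < r \<and> M + 1 \<le> hh j xs r" ?N] by auto
  have Rl: "hh j xs k < M + 1" if "k0 \<le> k" "k < R" for k
    using that assms(4) not_less_Least[of k "\<lambda>r. k0 < r \<and> M + 1 \<le> hh j xs r"] unfolding R_def
    by (cases "k = k0") auto
  obtain q where q: "R = Suc q" using R(1) by (cases R) auto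
  have qN: "q < ?N" "k0 \<le> q" using R q by auto
  define A B0 p D0 where "A = take k0 xs" and "B0 = take (q - k0) (drop k0 xs)" and "p = xs ! q" and "D0 = drop (Suc q) xs"
  have tq: "take q xs = A @ B0" using qN(2) by (simp add: A_def B0_def take_add[symmetric])
  have xs: "xs = A @ B0 @ p # D0" using take_split[OF qN(1)] tq by (simp add: p_def D0_def)
  have B0: "\<forall>x\<in>set B0. 0 < co j (dr x)"
  proof
    fix x assume "x \<in> set B0"
    then obtain l where l: "l < length B0" "x = B0 ! l" by (auto simp: in_set_conv_nth)
    then have "l < q - k0" by (simp add: B0_def)
    then have "x = xs ! (k0 + l)" "k0 + l < q" using l qN by (auto simp: B0_def)
    then show "0 < co j (dr x)" using assms(8)[of "k0 + l"] Rl[of "k0 + l"] q qN by simp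
  qed
  have pp: "0 < co j (dr p)" unfolding p_def using assms(8)[of q] Rl[of q] q qN by simp
  have hA: "co j (tot 0 A) = M" using assms(4) by (simp add: hh_def A_def)
  have hq: "hh j xs q = M + co j (tot (et 0 A) B0)" unfolding hh_def tq using hA by (simp add: tot_append)
  define s where "s = et 0 (take q xs)"
  have sA: "s = et (et 0 A) B0" by (simp add: s_def tq et_append)
  have hR: "hh j xs R = hh j xs q + (fst p - s) * co j (dr p)" using hh_Suc[OF qN(1)] by (simp add: q p_def s_def)
  note st = seg_times[OF Sinc[OF S] qN(1), folded s_def p_def]
  have P1: "\<forall>t. M \<le> co j (pth xs t)" using pth_ge[OF S, of M j] assms(6) by blast
  have P2: "M < co j (pth xs t)" if t: "et 0 A < real n * t" for t
  proof -
    have ii: "inc 0 A" "inc (et 0 A) (drop k0 xs)" using Sinc[OF S] append_take_drop_id[of k0 xs] unfolding A_def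
      by (metis inc_append)+
    have "pth xs t = Q 0 A (real n * t) + Q (et 0 A) (drop k0 xs) (real n * t)"
      unfolding pth_def A_def by (metis Q_append append_take_drop_id)
    also have "Q 0 A (real n * t) = tot 0 A" using Q_after[OF ii(1)] t by simp
    finally have "co j (pth xs t) = M + co j (Q (et 0 A) (drop k0 xs) (real n * t))" using hA by simp
    also have "M < \<dots>"
    proof (rule Q_gt_start[OF ii(2) t])
      show "drop k0 xs \<noteq> []" using assms(3) by simp
      fix A' B' assume a: "drop k0 xs = A' @ B'" "A' \<noteq> []"
      have xe: "xs = (A @ A') @ B'" using a(1) append_take_drop_id[of k0 xs] by (simp add: A_def)
      have la: "length A = k0" using assms(3) by (simp add: A_def)
      have "hh j xs (length (A @ A')) = M + co j (tot (et 0 A) A')"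
        using prefix_hh[OF S xe, of j] hA by (simp add: tot_append)
      moreover have "k0 < length (A @ A')" using a(2) la by simp
      moreover have "length (A @ A') \<le> ?N" using xe by (metis le_add1 length_append)
      ultimately show "M < M + co j (tot (et 0 A) A')" using assms(7)[of "length (A @ A')"] by simp
    qed simp
    finally show ?thesis .
  qed
  show ?thesis
  proof (cases "hh j xs R = M + 1")
    case True
    have "co j (tot (et 0 A) (B0 @ [p])) = 1"
      using True hR hq by (simp add: tot_append sA)
    then have "A @ (B0 @ [p]) @ D0 = xs \<and> co j (tot (et 0 A) (B0 @ [p])) = 1 \<and> (\<forall>x\<in>set (B0 @ [p]). 0 < co j (dr x))"
      using xs B0 pp by auto
    then show ?thesis using S hA P1 P2 A_def
      by (intro exI[of _ A] exI[of _ "B0 @ [p]"] exI[of _ D0]) auto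
  next
    case False
    then have gtR: "M + 1 < hh j xs R" using R(2) by simp
    \<comment> \<open>The time at which the segment \<open>p\<close> reaches height
      \<open>M + 1\<close>.\<close>
    define \<sigma> where "\<sigma> = s + (M + 1 - hh j xs q) / co j (dr p)"
    have s1: "s < \<sigma>" using Rl[of q] q qN pp by (simp add: \<sigma>_def)
    have "(\<sigma> - s) * co j (dr p) = M + 1 - hh j xs q" using pp by (simp add: \<sigma>_def)
    then have s3: "(\<sigma> - s) * co j (dr p) < (fst p - s) * co j (dr p)" using gtR hR by simp
    then have s2: "\<sigma> < fst p" using pp by (simp add: mult_less_cancel_right)
    have sp: "Sdata C ((A @ B0) @ (\<sigma>, snd p) # p # D0)" "pth ((A @ B0) @ (\<sigma>, snd p) # p # D0) = pth ((A @ B0) @ p # D0)"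
      "dr (\<sigma>, snd p) = dr p"
      using Sdata_split[of C "A @ B0" p D0 \<sigma>] S xs s1 s2 refl unfolding s_def tq by auto
    have "co j (tot (et 0 A) (B0 @ [(\<sigma>, snd p)])) = co j (tot (et 0 A) B0) + (\<sigma> - s) * co j (dr p)"
      using sp(3) by (simp add: tot_append sA)
    then have "co j (tot (et 0 A) (B0 @ [(\<sigma>, snd p)])) = 1"
      using \<open>(\<sigma> - s) * co j (dr p) = M + 1 - hh j xs q\<close> hq by simp
    moreover have "\<forall>x\<in>set (B0 @ [(\<sigma>, snd p)]). 0 < co j (dr x)" using B0 pp sp(3) by auto
    moreover have "Sdata C (A @ (B0 @ [(\<sigma>, snd p)]) @ p # D0)" using sp(1) by simp
    moreover have "pth (A @ (B0 @ [(\<sigma>, snd p)]) @ p # D0) = pth xs" using sp(2) by (simp add: xs[symmetric])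
    moreover have "\<forall>t. et 0 A < real n * t \<longrightarrow> M < co j (pth xs t)" using P2 by blast
    ultimately show ?thesis
      by (intro exI[of _ A] exI[of _ "B0 @ [(\<sigma>, snd p)]"] exI[of _ "p # D0"] conjI A_def hA P1; (assumption | simp))
  qed
qed

lemma re_orbit_r: "x \<in> re_orbit co al y \<Longrightarrow> j \<in> Re \<Longrightarrow> r j x \<in> re_orbit co al y"
proof -
  assume "x \<in> re_orbit co al y" "j \<in> Re"
  then obtain ws where "x = W ws y" "set ws \<subseteq> Re" unfolding re_orbit_def by blast
  then have "r j x = W (j # ws) y" "set (j # ws) \<subseteq> Re" using \<open>j \<in> Re\<close> by auto
  then show ?thesis unfolding re_orbit_def by blast
qed

text \<open>With integral values the upper direction has chains both to the next weight and to its
  reflection, so the next word may be kept or multiplied by \<open>j\<close>.\<close>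

lemma sg_up:
  assumes "sg C p v" "j \<in> Re" "0 < fst p - fac (fst p)" "(fst p - fac (fst p)) * co j (dr p) \<in> \<int>" "v' = v \<or> v' = j # v"
  shows "ach (fst p - fac (fst p)) (up j (dr p)) (W v' (lam (fac (fst p))))"
    "fst p \<in> \<int> \<Longrightarrow> W v' (lam (fac (fst p))) \<in> re_orbit co al (lam (fac (fst p)))"
proof -
  let ?a = "fst p - real (fac (fst p))" and ?x = "lam (fac (fst p))"
  have c: "ach ?a (dr p) (W v ?x)" using assms(1) unfolding sg_def by blast
  have z: "?a * co j (W v ?x) \<in> \<int>" using ach_co_int[OF c] assms(4) by blast
  have u: "ach ?a (up j (dr p)) (up j (W v ?x))" by (rule ach_up[OF c assms(2,3) z])
  show "ach ?a (up j (dr p)) (W v' ?x)" using assms(5)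
  proof
    assume "v' = v"
    then show ?thesis using rtranclp_trans[OF u ach_up_self(1)[OF assms(2,3) z]] by simp
  next
    assume "v' = j # v"
    then show ?thesis using rtranclp_trans[OF u ach_up_self(2)[OF assms(2,3) z]] by simp
  qed
  show "W v' ?x \<in> re_orbit co al ?x" if "fst p \<in> \<int>"
    using assms(1,5) that re_orbit_r[OF _ assms(2)] unfolding sg_def by auto
qed

text \<open>Inside the block the height is strictly between \<open>M\<close> and
  \<open>M + 1\<close>, so no break is at an integer time, and every chain stays on the positive
  side and can be reflected. At the end the height is integral, and the simple step
  \<open>r j\<close> goes on top of the chain.\<close>

lemma okn_flip_real:
  assumes "j \<in> Re" "0 \<le> s" "inc s B" "okn mv B z" "intat s u (nw B z)" "\<forall>p\<in>set B. 0 < co j (dr p)"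
    "M \<in> \<int>" "M \<le> co j u" "co j u + co j (tot s B) = M + 1"
  shows "okn mv (flip j B) z"
  using assms(2-)
proof (induction B arbitrary: s u)
  case (Cons p B)
  let ?a = "fst p - real (fac (fst p))" and ?x = "lam (fac (fst p))"
  have i: "s < fst p" "fst p \<le> of_int \<lfloor>s\<rfloor> + 1" "inc (fst p) B" using Cons.prems by auto
  have sg: "sg mv p (nw B z)" and ok: "okn mv B z" using Cons.prems by auto
  have d: "0 < co j (dr p)" using Cons.prems by simp
  define u' where "u' = u + (fst p - s) *\<^sub>R dr p"
  note ft = frac_time[OF Cons.prems(1) i(1,2)]
  have K: "co j u' - ?a * co j (dr p) \<in> \<int>"
    unfolding u'_def using Cons.prems by (intro intat_step[OF Cons.prems(1) i(1,2)]) simp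
  have ia: "intat (fst p) u' (nw B z)"
    unfolding u'_def using Cons.prems by (intro intat_next[OF Cons.prems(1) i(1,2) _ sg]) simp
  have "0 < (fst p - s) * co j (dr p)" using d i(1) by simp
  then have Mu: "M < co j u'" using Cons.prems(7) by (simp add: u'_def)
  have su: "co j u' + co j (tot (fst p) B) = M + 1" using Cons.prems(8) by (simp add: u'_def algebra_simps)
  have IH: "okn mv (flip j B) z"
    using Cons.IH[OF _ i(3) ok ia] Cons.prems Mu su ft(1) i by simp
  have c: "ach ?a (dr p) (W (nw B z) ?x)" and m: "mv ?x (nw B z) (snd p)" using sg unfolding sg_def by auto
  have m': "mv ?x (snd p) (j # snd p)" using d by (intro mv_simple) (simp add: dr_def)
  have "sg mv (fst p, j # snd p) (nw (flip j B) z)"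
  proof (cases "B = []")
    case True
    then have "co j u' = M + 1" using su by simp
    then have "?a * co j (dr p) \<in> \<int>" using K Cons.prems(6) Ints_diff[OF _ K, of "co j u'"] by simp
    then have "acstep ?a (r j (dr p)) (dr p)" by (intro acstep_simple_Re[OF assms(1) d ft(1)])
    then have "ach ?a (r j (dr p)) (W z ?x)" using c True by (simp add: converse_rtranclp_into_rtranclp)
    then show ?thesis using True sg mv_trans[OF m m'] unfolding sg_def by (simp add: dr_flip)
  next
    case False
    then obtain p' B' where B: "B = p' # B'" by (cases B) auto
    have "0 < co j (tot (fst p) B)" using tot_pos[OF i(3) False] Cons.prems by simp
    then have lt: "co j u' < M + 1" using su by simp
    have nZ: "co j u' \<notin> \<int>"
    proof
      assume "co j u' \<in> \<int>"
      then have "1 \<le> co j u' - M" using Cons.prems(6) Mu by (intro Ints_ge_1 Ints_diff) auto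
      then show False using lt by simp
    qed
    have naZ: "?a * co j (dr p) \<notin> \<int>" using nZ Ints_add[OF K] by auto
    have npZ: "fst p \<notin> \<int>"
    proof
      assume "fst p \<in> \<int>"
      then have "?a = 1" by (rule ft(2))
      then show False using naZ W_lam_int[of j "snd p" "fac (fst p)"] by (simp add: dr_def)
    qed
    have "fac (fst p') = nat \<lfloor>fst p\<rfloor>" using fac_eq(1)[of "fst p" "fst p'"] i B Cons.prems(1) by simp
    then have f: "fac (fst p') = fac (fst p)" using ft(3)[OF npZ] by simp
    have d': "0 < co j (W (snd p') ?x)" using Cons.prems(5) B f by (auto simp: dr_def)
    have c': "ach ?a (dr p) (W (snd p') ?x)" using c B by simp
    have "?a * co j (W (snd p') ?x) \<notin> \<int>" using ach_co_int[OF c'] naZ by blast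
    then have "ach ?a (r j (dr p)) (r j (W (snd p') ?x))" using ach_interior_pos[OF c' assms(1) d'] by blast
    moreover have "mv ?x (j # snd p') (j # snd p)"
      using mv_real[OF m assms(1)] mv_trans[OF _ m'] B by auto
    ultimately show ?thesis using npZ B unfolding sg_def by (simp add: dr_flip)
  qed
  then show ?case using IH by simp
qed simp

text \<open>Multiplying a word by \<open>j\<close> may spoil its comparison with the word before it;
  \<open>mv_real\<close> then multiplies that one too or leaves it. On flat segments neither choice
  changes the direction, so the correction passes backwards.\<close>

lemma okn_flat:
  assumes "j \<in> Re" "0 \<le> s" "inc s A" "okn mv A z" "\<forall>p\<in>set A. co j (dr p) = 0" "z' = z \<or> z' = j # z"
  shows "\<exists>A'. sim A A' \<and> okn mv A' z' \<and> (nw A' z' = nw A z \<or> nw A' z' = j # nw A z)"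
  using assms(2-5)
proof (induction A arbitrary: s)
  case Nil
  then show ?case using assms(6) by (intro exI[of _ "[]"]) simp
next
  case (Cons p A)
  let ?a = "fst p - real (fac (fst p))" and ?x = "lam (fac (fst p))"
  have i: "s < fst p" "fst p \<le> of_int \<lfloor>s\<rfloor> + 1" "inc (fst p) A" using Cons.prems by auto
  have sg: "sg mv p (nw A z)" using Cons.prems by auto
  have d: "co j (dr p) = 0" using Cons.prems by simp
  obtain A' where A': "sim A A'" "okn mv A' z'" "nw A' z' = nw A z \<or> nw A' z' = j # nw A z"
    using Cons.IH[of "fst p"] Cons.prems i by auto
  define v where "v = nw A' z'"
  have ft: "0 < ?a" by (rule frac_time(1)[OF Cons.prems(1) i(1,2)])
  have "up j (dr p) = dr p" using d by (simp add: up_def)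
  then have c: "ach ?a (dr p) (W v ?x)" and b: "fst p \<in> \<int> \<Longrightarrow> W v ?x \<in> re_orbit co al ?x"
    using sg_up[OF sg assms(1) ft _ A'(3)] d by (auto simp: v_def)
  have m: "mv ?x (nw A z) (snd p)" using sg unfolding sg_def by blast
  have "\<exists>w. (w = snd p \<or> w = j # snd p) \<and> mv ?x v w"
    using A'(3)
  proof
    assume "nw A' z' = nw A z"
    then show ?thesis using m by (auto simp: v_def)
  next
    assume "nw A' z' = j # nw A z"
    then show ?thesis using mv_real[OF m assms(1)] by (auto simp: v_def)
  qed
  then obtain w where w: "w = snd p \<or> w = j # snd p" "mv ?x v w" by blast
  have dw: "dr (fst p, w) = dr p" using w(1) d by (auto simp: dr_flip r_fix)
  have "sg mv (fst p, w) v" unfolding sg_def using c b w(2) dw by simp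
  then show ?case using A' w dw
    by (intro exI[of _ "(fst p, w) # A'"]) (auto simp: sim_def v_def)
qed

lemma flat_suffix:
  "\<exists>A1 A2. A = A1 @ A2 \<and> (\<forall>p\<in>set A2. co j (dr p) = 0) \<and> (A1 = [] \<or> co j (dr (last A1)) \<noteq> 0)"
proof (induction A rule: rev_induct)
  case (snoc p A)
  show ?case
  proof (cases "co j (dr p) = 0")
    case True
    obtain A1 A2 where "A = A1 @ A2" "\<forall>p\<in>set A2. co j (dr p) = 0" "A1 = [] \<or> co j (dr (last A1)) \<noteq> 0" using snoc by blast
    then show ?thesis using True by (intro exI[of _ A1] exI[of _ "A2 @ [p]"]) auto
  next
    case False
    then show ?thesis by (intro exI[of _ "A @ [p]"] exI[of _ "[]"]) auto
  qed
qed simp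

text \<open>The letter \<open>j\<close> in front of the first word of \<open>B\<close> is passed
  back through the flat segments before it and absorbed by the descending segment that precedes
  them, if there is one.\<close>

lemma flip_real_Sdata:
  assumes S: "Sdata mv (A @ B @ D)" and "j \<in> Re" "B \<noteq> []" "\<forall>p\<in>set B. 0 < co j (dr p)" "M \<in> \<int>"
    "co j (tot 0 A) = M" "co j (tot (et 0 A) B) = 1" "\<And>k. M \<le> co j (tot 0 (take k A))"
  shows "\<exists>ys. Sdata mv ys \<and> pth ys = pth (A @ flip j B @ D)"
proof -
  have i: "inc 0 A" "inc (et 0 A) B" "inc (et (et 0 A) B) D" and e: "et (et (et 0 A) B) D = real n"
    and o: "okn mv A (nw (B @ D) [])" "okn mv B (nw D [])" "okn mv D []"
    using S by (auto simp: Sdata_def inc_append et_append okn_append nw_append)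
  have a0: "0 \<le> et 0 A" by (rule et_mono[OF i(1)])
  obtain p0 B0 where B: "B = p0 # B0" using assms(3) by (cases B) auto
  have ia: "intat (et 0 X) (tot 0 X) (nw Y [])" if "A @ B @ D = X @ Y" for X Y
    using intat_prefix[of 0 X Y mv "[]" 0] S that by (simp add: Sdata_def intat_def)
  have "intat (et 0 A) (tot 0 A) (nw B (nw D []))" using ia[of A "B @ D"] by (simp add: nw_append)
  then have oB: "okn mv (flip j B) (nw D [])"
    using assms(4-7) by (intro okn_flip_real[OF assms(2) a0 i(2) o(2), of "tot 0 A" M]) auto
  obtain A1 A2 where A: "A = A1 @ A2" "\<forall>p\<in>set A2. co j (dr p) = 0" "A1 = [] \<or> co j (dr (last A1)) \<noteq> 0"
    using flat_suffix[of A j] by blast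
  define z where "z = snd p0"
  have zz: "nw (B @ D) [] = z" "nw (flip j B @ D) [] = j # z" by (simp_all add: B z_def)
  have iA: "inc 0 A1" "inc (et 0 A1) A2" using i(1) A(1) by (auto simp: inc_append)
  have oA: "okn mv A1 (nw A2 z)" "okn mv A2 z" using o(1) A(1) zz by (auto simp: okn_append)
  obtain A2' where A2': "sim A2 A2'" "okn mv A2' (j # z)" "nw A2' (j # z) = nw A2 z \<or> nw A2' (j # z) = j # nw A2 z"
    using okn_flat[OF assms(2) et_mono[OF iA(1)] iA(2) oA(2) A(2), of "j # z"] by blast
  have oA1: "okn mv A1 (nw A2' (j # z))"
  proof (cases "A1 = []")
    case False
    then obtain A0 p where A1: "A1 = A0 @ [p]" by (metis append_butlast_last_id)
    let ?a = "fst p - real (fac (fst p))" and ?x = "lam (fac (fst p))"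
    have o0: "okn mv A0 (snd p)" and sg: "sg mv p (nw A2 z)" using oA(1) A1 by (auto simp: okn_append)
    have ii: "inc 0 A0" "et 0 A0 < fst p" "fst p \<le> of_int \<lfloor>et 0 A0\<rfloor> + 1" using iA(1) A1 by (auto simp: inc_append)
    have s0: "0 \<le> et 0 A0" by (rule et_mono[OF ii(1)])
    have "take (length A0) A = A0" using A(1) A1 by simp
    then have M0: "M \<le> co j (tot 0 A0)" using assms(8)[of "length A0"] by simp
    have M1: "co j (tot 0 A1) = M" using assms(6) A tot_flat[OF A(2)] by (simp add: tot_append)
    then have t1: "co j (tot 0 A0 + (fst p - et 0 A0) *\<^sub>R dr p) = M" using A1 by (simp add: tot_append)
    then have "(fst p - et 0 A0) * co j (dr p) \<le> 0" using M0 by simp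
    then have neg: "co j (dr p) < 0" using ii(2) A(3) A1 by (auto simp: mult_le_0_iff)
    have "intat (et 0 A0) (tot 0 A0) (snd p)" using ia[of A0 "p # A2 @ B @ D"] A(1) A1 by simp
    from intat_step[OF s0 ii(2,3) this, of j] t1 have "M - ?a * co j (dr p) \<in> \<int>" by simp
    then have aZ: "?a * co j (dr p) \<in> \<int>" using Ints_diff[OF assms(5)] by fastforce
    have ft: "0 < ?a" by (rule frac_time(1)[OF s0 ii(2,3)])
    define v where "v = nw A2' (j # z)"
    have "up j (dr p) = dr p" using neg by (simp add: up_def)
    then have c: "ach ?a (dr p) (W v ?x)" and b: "fst p \<in> \<int> \<Longrightarrow> W v ?x \<in> re_orbit co al ?x"
      using sg_up[OF sg assms(2) ft aZ A2'(3)] by (auto simp: v_def)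
    have m: "mv ?x (nw A2 z) (snd p)" using sg unfolding sg_def by blast
    have "mv ?x v (snd p)"
      using A2'(3)
    proof
      assume "nw A2' (j # z) = nw A2 z"
      then show ?thesis using m by (simp add: v_def)
    next
      assume v: "nw A2' (j # z) = j # nw A2 z"
      \<comment> \<open>Since \<open>p\<close> descends, its weight lies above the reflected one;
        the simple step back up cancels the extra \<open>j\<close>, so the word of \<open>p\<close>
        can stay.\<close>
      have "mv ?x (j # snd p) (j # j # snd p)" using neg assms(2) by (intro mv_simple) (simp add: co_r dr_def)
      then have "mv ?x (j # snd p) (snd p)" using mv_trans[OF _ mv_weq[OF weq_cancel2[OF assms(2)]]] by blast
      then show ?thesis using mv_real[OF m assms(2)] mv_trans v by (auto simp: v_def)
    qed
    then have "sg mv p v" unfolding sg_def using c b by simp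
    then show ?thesis using o0 A1 v_def by (simp add: okn_append)
  qed simp
  define ys where "ys = A1 @ A2' @ flip j B @ D"
  have sA: "sim A (A1 @ A2')" unfolding A(1) by (rule sim_append[OF sim_refl A2'(1)])
  have sm: "sim (A @ flip j B @ D) ys" unfolding ys_def using sim_append[OF sA sim_refl[of "flip j B @ D"]] by simp
  have "inc 0 (A @ flip j B @ D)" "et 0 (A @ flip j B @ D) = real n"
    using i e by (auto simp: inc_append et_append flip_eqs)
  then have "inc 0 ys" "et 0 ys = real n" using sim_eqs(3,4)[OF sm] by auto
  moreover have "okn mv ys []"
    unfolding ys_def using oA1 A2'(2) oB o(3) zz(2) by (simp add: okn_append nw_append)
  ultimately have "Sdata mv ys" by (simp add: Sdata_def)
  then show ?thesis using sim_pth[OF sm] by metis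
qed

theorem f_real_closed:
  assumes S: "Sdata mv xs" and "j \<in> Re" "\<And>t. 0 \<le> t \<Longrightarrow> t \<le> 1 \<Longrightarrow> path t = pth xs t" "froot co al j path = Some q"
  shows "\<exists>ys. Sdata mv ys \<and> (\<forall>t. 0 \<le> t \<longrightarrow> t \<le> 1 \<longrightarrow> q t = pth ys t)"
proof -
  let ?N = "length xs" and ?h = "hh j xs"
  define M where "M = Min (?h ` {..?N})"
  have Ml: "M \<le> ?h k" if "k \<le> ?N" for k unfolding M_def using that by (intro Min_le) auto
  define K where "K = {k. k \<le> ?N \<and> ?h k = M}"
  have "M \<in> ?h ` {..?N}" unfolding M_def by (intro Min_in) auto
  then have Kne: "K \<noteq> {}" by (auto simp: K_def)
  have Kf: "finite K" unfolding K_def by simp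
  define k0 where "k0 = Max K"
  have k0: "k0 \<le> ?N" "?h k0 = M" using Max_in[OF Kf Kne] by (auto simp: K_def k0_def)
  have k0l: "M < ?h k" if "k0 < k" "k \<le> ?N" for k
  proof -
    have "k \<notin> K" using that Max_ge[OF Kf, of k] by (auto simp: k0_def)
    then show ?thesis using Ml[OF that(2)] that(2) by (auto simp: K_def)
  qed
  have MZ: "M \<in> \<int>" using hh_min_int[OF S assms(2) k0(1)] Ml k0(2) by simp
  show ?thesis
  proof (cases "k0 = ?N")
    case True
    have "co j (path 1) = M"
    proof -
      have "pth xs 1 = tot 0 xs" unfolding pth_def using Q_after[OF Sinc[OF S]] Set[OF S] by simp
      then show ?thesis using assms(3)[of 1] k0(2) True by (simp add: hh_def)
    qed
    then have "froot co al j path = None" using pth_ge[OF S, of M j] Ml assms(3) by (intro froot_None[OF MZ]) auto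
    then show ?thesis using assms(4) by simp
  next
    case False
    then have k0N: "k0 < ?N" using k0(1) by simp
    have pos: "0 < co j (dr (xs ! s))" if s: "k0 \<le> s" "s < ?N" "?h s < M + 1" for s
    proof (rule ccontr)
      assume n: "\<not> 0 < co j (dr (xs ! s))"
      have "s \<noteq> k0" using n hh_sign(1)[OF Sinc[OF S] s(2), of j] k0l[of "Suc k0"] k0(2) k0N by auto
      then have sk: "k0 < s" using s by simp
      \<comment> \<open>Once the height fails to rise below \<open>M + 1\<close> it never rises
        again: a turn would be a local minimum of integral height greater than \<open>M\<close>. But
        the final height is at least \<open>M + 1\<close>.\<close>
      have "q < ?N \<longrightarrow> co j (dr (xs ! q)) \<le> 0 \<and> ?h (Suc q) \<le> ?h s" if "s \<le> q" for q
        using that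
      proof (induction q rule: dec_induct)
        case base
        then show ?case using n hh_sign_le(2)[OF Sinc[OF S] s(2), of j] by simp
      next
        case (step q)
        show ?case
        proof
          assume q: "Suc q < ?N"
          then have IH: "co j (dr (xs ! q)) \<le> 0" "?h (Suc q) \<le> ?h s" using step by auto
          have "co j (dr (xs ! Suc q)) \<le> 0"
          proof (rule ccontr)
            assume "\<not> ?thesis"
            then have "?h (Suc q) \<in> \<int>" using hh_local_min[OF S q assms(2) IH(1)] by simp
            then have "1 \<le> ?h (Suc q) - M" using k0l[of "Suc q"] q step sk MZ by (intro Ints_ge_1 Ints_diff) auto
            then show False using IH(2) s(3) by simp
          qed
          then show "co j (dr (xs ! Suc q)) \<le> 0 \<and> ?h (Suc (Suc q)) \<le> ?h s"
            using hh_sign_le(2)[OF Sinc[OF S] q, of j] IH(2) by simp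
        qed
      qed
      moreover obtain N' where N': "?N = Suc N'" using s(2) by (cases ?N) auto
      ultimately have "?h ?N \<le> ?h s" using s(2) by simp
      moreover have "1 \<le> ?h ?N - M" using k0l[of ?N] k0N hh_end[OF S] MZ by (intro Ints_ge_1 Ints_diff) auto
      ultimately show False using s(3) by simp
    qed
    obtain A B D where X: "Sdata mv (A @ B @ D)" "pth (A @ B @ D) = pth xs" "A = take k0 xs" "B \<noteq> []"
      "\<forall>p\<in>set B. 0 < co j (dr p)" "co j (tot 0 A) = M" "co j (tot (et 0 A) B) = 1"
      "\<forall>t. M \<le> co j (pth xs t)" "\<forall>t. et 0 A < real n * t \<longrightarrow> M < co j (pth xs t)"
      using decomp[OF S _ k0N k0(2) MZ Ml k0l pos] by auto
    have "\<exists>q. froot co al j path = Some q \<and> (\<forall>t. 0 \<le> t \<longrightarrow> t \<le> 1 \<longrightarrow> q t = pth (A @ flip j B @ D) t)"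
      using X assms(3) MZ by (intro froot_data[of A B D j M path]) (auto simp: Sdata_def)
    then have q: "\<forall>t. 0 \<le> t \<longrightarrow> t \<le> 1 \<longrightarrow> q t = pth (A @ flip j B @ D) t" using assms(4) by auto
    have "M \<le> co j (tot 0 (take k A))" for k
      using Ml[of "min k k0"] k0(1) by (simp add: X(3) hh_def)
    then obtain ys where "Sdata mv ys" "pth ys = pth (A @ flip j B @ D)"
      using flip_real_Sdata[OF X(1) assms(2) X(4,5) MZ X(6,7)] by blast
    then show ?thesis using q by auto
  qed
qed

text \<open>There is no choice as in \<open>okn_flat\<close>: every earlier word is multiplied by
  \<open>i\<close>. The slope is 0, also at the lower end of each chain by monotonicity, so
  directions stay and \<open>mv_Im\<close> applies.\<close>

lemma okn_flip_Im_flat: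
  assumes "i \<in> Im" "okn mv A z" "\<forall>p\<in>set A. co i (dr p) = 0" shows "okn mv (flip i A) (i # z)"
  using assms(2,3)
proof (induction A)
  case (Cons p A)
  let ?a = "fst p - real (fac (fst p))" and ?x = "lam (fac (fst p))"
  have sg: "sg mv p (nw A z)" using Cons.prems by auto
  have c: "ach ?a (dr p) (W (nw A z) ?x)" and m: "mv ?x (nw A z) (snd p)" using sg unfolding sg_def by auto
  have d: "co i (dr p) = 0" using Cons.prems by simp
  have d': "co i (W (nw A z) ?x) = 0"
    using co_Im_mono[OF assms(1) ach_ge[OF c]] co_Im_orbit[OF assms(1) dom_lam, of "nw A z" "fac (fst p)"] d by simp
  have n: "nw (flip i A) (i # z) = i # nw A z" by (cases A) auto
  have "ach ?a (r i (dr p)) (r i (W (nw A z) ?x))" using ach_Im[OF c assms(1)] d d' by simp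
  moreover have "mv ?x (i # nw A z) (i # snd p)" using mv_Im[OF m assms(1)] d d' by (simp add: dr_def)
  ultimately have "sg mv (fst p, i # snd p) (i # nw A z)" using sg d' unfolding sg_def by (simp add: dr_flip r_fix)
  then show ?case using Cons n by simp
qed simp

text \<open>Across a break the slope \<open>co i\<close> can only drop, and \<open>a\<close> times
  the drop is an integer; but \<open>a\<close> times the slope is the height, which is below 1
  inside the block. So the slope is constant, and \<open>ach_Im\<close> and \<open>mv_Im\<close>
  apply. At the end the height 1 is exactly the chain condition for an imaginary step.\<close>

lemma okn_flip_Im:
  assumes "i \<in> Im" "0 \<le> s" "inc s B" "okn mv B z" "\<forall>p\<in>set B. 0 < co i (dr p)"
    "B \<noteq> [] \<Longrightarrow> co i u = (s - of_int \<lfloor>s\<rfloor>) * co i (dr (hd B))" "co i u + co i (tot s B) = 1"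
  shows "okn mv (flip i B) z"
  using assms(2-)
proof (induction B arbitrary: s u)
  case (Cons p B)
  let ?a = "fst p - real (fac (fst p))" and ?x = "lam (fac (fst p))"
  have i: "s < fst p" "fst p \<le> of_int \<lfloor>s\<rfloor> + 1" "inc (fst p) B" using Cons.prems by auto
  have sg: "sg mv p (nw B z)" and ok: "okn mv B z" using Cons.prems by auto
  have d: "0 < co i (dr p)" using Cons.prems by simp
  note ft = frac_time[OF Cons.prems(1) i(1,2)]
  have fs: "real (fac (fst p)) = of_int \<lfloor>s\<rfloor>" by (rule fac_eq(2)[OF Cons.prems(1) i(1,2)])
  define u' where "u' = u + (fst p - s) *\<^sub>R dr p"
  have u': "co i u' = ?a * co i (dr p)" using Cons.prems(5) fs by (simp add: u'_def algebra_simps)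
  have su: "co i u' + co i (tot (fst p) B) = 1" using Cons.prems(6) by (simp add: u'_def algebra_simps)
  have c: "ach ?a (dr p) (W (nw B z) ?x)" and m: "mv ?x (nw B z) (snd p)" using sg unfolding sg_def by auto
  have m': "mv ?x (snd p) (i # snd p)" using d by (intro mv_simple) (simp add: dr_def)
  show ?case
  proof (cases "B = []")
    case True
    then have "?a * co i (dr p) = 1" using su u' by simp
    then have "acstep ?a (r i (dr p)) (dr p)" by (intro acstep_simple_Im[OF assms(1) d])
    then have "ach ?a (r i (dr p)) (W z ?x)" using c True by (simp add: converse_rtranclp_into_rtranclp)
    then show ?thesis using True sg mv_trans[OF m m'] by (simp add: dr_flip sg_def)
  next
    case False
    then obtain p' B' where B: "B = p' # B'" by (cases B) auto
    have "0 < co i (tot (fst p) B)" using tot_pos[OF i(3) False] Cons.prems by simp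
    then have lt: "?a * co i (dr p) < 1" using su u' by simp
    have npZ: "fst p \<notin> \<int>"
    proof
      assume "fst p \<in> \<int>"
      then have "?a = 1" by (rule ft(2))
      moreover have "1 \<le> co i (dr p)"
        using d W_lam_int[of i "snd p" "fac (fst p)"] by (intro Ints_ge_1) (auto simp: dr_def)
      ultimately show False using lt by simp
    qed
    have "fac (fst p') = nat \<lfloor>fst p\<rfloor>" using fac_eq(1)[of "fst p" "fst p'"] i B Cons.prems(1) by simp
    then have f: "fac (fst p') = fac (fst p)" using ft(3)[OF npZ] by simp
    define d' where "d' = W (snd p') ?x"
    have dp': "dr p' = d'" by (simp add: dr_def d'_def f)
    have c': "ach ?a (dr p) d'" using c B by (simp add: d'_def)
    have le: "co i d' \<le> co i (dr p)" by (rule co_Im_mono[OF assms(1) ach_ge[OF c']])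
    have d'0: "0 < co i d'" using Cons.prems(4) B dp' by simp
    have eq: "co i (dr p) = co i d'"
    proof (rule ccontr)
      assume "co i (dr p) \<noteq> co i d'"
      then have "0 < ?a * (co i (dr p) - co i d')" using le ft(1) by simp
      moreover have "co i (?a *\<^sub>R (d' - dr p)) \<in> \<int>" by (rule lat_co[OF ach_lat[OF c']])
      then have "- co i (?a *\<^sub>R (d' - dr p)) \<in> \<int>" by (rule Ints_minus)
      then have "?a * (co i (dr p) - co i d') \<in> \<int>" by (simp add: algebra_simps)
      ultimately have "1 \<le> ?a * (co i (dr p) - co i d')" by (intro Ints_ge_1)
      moreover have "0 < ?a * co i d'" using ft(1) d'0 by simp
      ultimately show False using lt by (simp add: right_diff_distrib)
    qed
    have fl: "of_int \<lfloor>fst p\<rfloor> = real (fac (fst p))" using ft(3)[OF npZ] by simp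
    have "okn mv (flip i B) z"
      using Cons.IH[OF _ i(3) ok _ _ su] Cons.prems(1,4) u' eq dp' B i(1) fl by simp
    moreover have "ach ?a (r i (dr p)) (r i d')" by (rule ach_Im[OF c' assms(1) eq])
    moreover have "mv ?x (i # snd p') (i # snd p)" using mv_Im[OF m assms(1)] eq B by (simp add: dr_def d'_def)
    ultimately show ?thesis using npZ B by (simp add: dr_flip d'_def sg_def)
  qed
qed simp

theorem f_Im_closed:
  assumes S: "Sdata mv xs" and "i \<in> Im" "\<And>t. 0 \<le> t \<Longrightarrow> t \<le> 1 \<Longrightarrow> path t = pth xs t" "froot co al i path = Some q"
  shows "\<exists>ys. Sdata mv ys \<and> (\<forall>t. 0 \<le> t \<longrightarrow> t \<le> 1 \<longrightarrow> q t = pth ys t)"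
proof -
  let ?N = "length xs" and ?h = "hh i xs"
  have nn: "0 \<le> co i (dr p)" for p unfolding dr_def by (rule co_Im_orbit[OF assms(2) dom_lam])
  have mono1: "?h k \<le> ?h (Suc k)" if "k < ?N" for k using hh_sign_le(1)[OF Sinc[OF S] that, of i] nn by simp
  have mono: "?h k \<le> ?h l" if "k \<le> l" "l \<le> ?N" for k l
    using that by (induction l rule: dec_induct) (auto intro: order_trans[OF _ mono1])
  have h0: "0 \<le> ?h k" if "k \<le> ?N" for k using mono[of 0 k] that by simp
  define K where "K = {k. k \<le> ?N \<and> ?h k = 0}"
  have Kne: "K \<noteq> {}" by (auto simp: K_def intro!: exI[of _ 0])
  have Kf: "finite K" unfolding K_def by simp
  define k0 where "k0 = Max K"
  have k0: "k0 \<le> ?N" "?h k0 = 0" using Max_in[OF Kf Kne] by (auto simp: K_def k0_def)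
  have k0l: "0 < ?h k" if "k0 < k" "k \<le> ?N" for k
  proof -
    have "k \<notin> K" using that Max_ge[OF Kf, of k] by (auto simp: k0_def)
    then show ?thesis using h0[OF that(2)] that(2) by (auto simp: K_def)
  qed
  show ?thesis
  proof (cases "k0 = ?N")
    case True
    have "co i (path 1) = 0"
    proof -
      have "pth xs 1 = tot 0 xs" unfolding pth_def using Q_after[OF Sinc[OF S]] Set[OF S] by simp
      then show ?thesis using assms(3)[of 1] k0(2) True by (simp add: hh_def)
    qed
    then have "froot co al i path = None" using pth_ge[OF S, of 0 i] h0 assms(3) by (intro froot_None[of 0]) auto
    then show ?thesis using assms(4) by simp
  next
    case False
    then have k0N: "k0 < ?N" using k0(1) by simp
    have first: "0 < co i (dr (xs ! k0))"
      using hh_sign(1)[OF Sinc[OF S] k0N, of i] k0l[of "Suc k0"] k0(2) k0N by simp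
    have pos: "0 < co i (dr (xs ! s))" if s: "k0 \<le> s" "s < ?N" "?h s < 0 + 1" for s
    proof (rule ccontr)
      assume n: "\<not> 0 < co i (dr (xs ! s))"
      have "s \<noteq> k0" using n first by auto
      then have sk: "0 < ?h s" using k0l[of s] s by simp
      have nZ: "?h s \<notin> \<int>" using Ints_ge_1[of "?h s"] sk s(3) by auto
      \<comment> \<open>A zero slope persists to the end: within a factor it can only drop, and no
        factor ends at a nonintegral height. The final height would then be nonintegral.\<close>
      have "q < ?N \<longrightarrow> co i (dr (xs ! q)) = 0 \<and> ?h (Suc q) = ?h s" if "s \<le> q" for q
        using that
      proof (induction q rule: dec_induct)
        case base
        have "co i (dr (xs ! s)) = 0" using n nn[of "xs ! s"] by simp
        then show ?case using hh_Suc[OF s(2), of i] by simp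
      next
        case (step q)
        show ?case
        proof
          assume q: "Suc q < ?N"
          then have IH: "co i (dr (xs ! q)) = 0" "?h (Suc q) = ?h s" using step by auto
          have "fst (xs ! q) \<notin> \<int>" using hh_int_time[OF S, of q i] q IH(2) nZ by auto
          from same_factor_ach[OF S q this] have "co i (dr (xs ! Suc q)) \<le> 0"
            using co_Im_mono[OF assms(2) ach_ge] IH(1) by fastforce
          then have "co i (dr (xs ! Suc q)) = 0" using nn[of "xs ! Suc q"] by simp
          then show "co i (dr (xs ! Suc q)) = 0 \<and> ?h (Suc (Suc q)) = ?h s" using hh_Suc[OF q, of i] IH(2) by simp
        qed
      qed
      moreover obtain N' where N': "?N = Suc N'" using s(2) by (cases ?N) auto
      ultimately have "?h ?N = ?h s" using s(2) by simp
      then show False using hh_end[OF S, of i] nZ by simp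
    qed
    obtain A B D where X: "Sdata mv (A @ B @ D)" "pth (A @ B @ D) = pth xs" "A = take k0 xs" "B \<noteq> []"
      "\<forall>p\<in>set B. 0 < co i (dr p)" "co i (tot 0 A) = 0" "co i (tot (et 0 A) B) = 1"
      "\<forall>t. 0 \<le> co i (pth xs t)" "\<forall>t. et 0 A < real n * t \<longrightarrow> 0 < co i (pth xs t)"
      using decomp[OF S _ k0N k0(2) Ints_0 h0 k0l pos] by auto
    have "\<exists>q. froot co al i path = Some q \<and> (\<forall>t. 0 \<le> t \<longrightarrow> t \<le> 1 \<longrightarrow> q t = pth (A @ flip i B @ D) t)"
      using X assms(3) by (intro froot_data[of A B D i 0 path]) (auto simp: Sdata_def)
    then have q: "\<forall>t. 0 \<le> t \<longrightarrow> t \<le> 1 \<longrightarrow> q t = pth (A @ flip i B @ D) t" using assms(4) by auto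
    have ii: "inc 0 A" "inc (et 0 A) B" "inc (et (et 0 A) B) D" and e: "et (et (et 0 A) B) D = real n"
      and o: "okn mv A (nw B (nw D []))" "okn mv B (nw D [])" "okn mv D []"
      using X(1) by (auto simp: Sdata_def inc_append et_append okn_append nw_append)
    have flatA: "\<forall>p\<in>set A. co i (dr p) = 0"
    proof -
      have "\<forall>p\<in>set A. co i (dr p) = 0" if "inc s A" "co i (tot s A) = 0" for s A
        using that
      proof (induction A arbitrary: s)
        case (Cons p A)
        have t: "0 \<le> co i (tot s A)" if "inc s A" for s A
          using that nn by (induction A arbitrary: s) (auto intro!: add_nonneg_nonneg)
        have "0 \<le> (fst p - s) * co i (dr p)" using Cons.prems nn by simp
        moreover have "0 \<le> co i (tot (fst p) A)" using Cons.prems t[of "fst p" A] by simp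
        moreover have "(fst p - s) * co i (dr p) + co i (tot (fst p) A) = 0" using Cons.prems(2) by simp
        ultimately have "(fst p - s) * co i (dr p) = 0" "co i (tot (fst p) A) = 0" by linarith+
        then show ?case using Cons.IH[of "fst p"] Cons.prems by auto
      qed simp
      then show ?thesis using ii(1) X(6) by blast
    qed
    have start: "co i (tot 0 A) = (et 0 A - of_int \<lfloor>et 0 A\<rfloor>) * co i (dr (hd B))"
    proof -
      \<comment> \<open>Within a factor an imaginary slope never increases, so the first rise
        happens at an integer time.\<close>
      have "et 0 A \<in> \<int>"
      proof (cases "A = []")
        case False
        then obtain A0 p where A0: "A = A0 @ [p]" by (metis append_butlast_last_id)
        obtain p' B' where B: "B = p' # B'" using X(4) by (cases B) auto
        have "fst p \<in> \<int>"
        proof (rule ccontr)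
          assume nz: "fst p \<notin> \<int>"
          let ?ys = "A @ B @ D" and ?l = "length A0"
          have y: "?ys ! ?l = p" "?ys ! Suc ?l = p'" "Suc ?l < length ?ys" by (simp_all add: A0 B nth_append)
          have "ach (fst p - fac (fst p)) (dr p) (dr p')" using same_factor_ach[OF X(1) y(3)] y nz by simp
          then have "co i (dr p') \<le> co i (dr p)" by (rule co_Im_mono[OF assms(2) ach_ge])
          then show False using flatA A0 X(5) B by auto
        qed
        then show ?thesis using A0 by (simp add: et_append)
      qed simp
      then have "et 0 A = of_int \<lfloor>et 0 A\<rfloor>" by (elim Ints_cases) simp
      then show ?thesis using X(6) by simp
    qed
    have oB: "okn mv (flip i B) (nw D [])"
      using X(5,6,7) start by (intro okn_flip_Im[OF assms(2) et_mono[OF ii(1)] ii(2) o(2), of "tot 0 A"]) auto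
    have oA: "okn mv (flip i A) (i # nw B (nw D []))" by (rule okn_flip_Im_flat[OF assms(2) o(1) flatA])
    have nB: "nw (flip i B) (nw D []) = i # nw B (nw D [])" using X(4) by (cases B) auto
    have "Sdata mv (flip i A @ flip i B @ D)"
      using ii e oA oB o(3) nB by (simp add: Sdata_def inc_append et_append okn_append nw_append flip_eqs)
    moreover have "pth (A @ flip i B @ D) = pth (flip i A @ flip i B @ D)"
      by (rule sim_pth[OF sim_append[OF sim_flip[OF flatA] sim_refl]])
    ultimately show ?thesis using q by auto
  qed
qed

end

section \<open>Undoing root operators\<close>

context paths
begin

abbreviation bled where "bled \<equiv> (\<lambda>x v u. ble v u)"
abbreviation dnp where "dnp j \<equiv> map (\<lambda>p. (fst p, dn j (snd p)))"

lemma tot_refl: "tot s (flip j B) = r j (tot s B)"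
proof (induction B arbitrary: s)
  case (Cons p B)
  then show ?case by (simp add: dr_flip r_add r_scale)
qed (simp add: srefl_def)

text \<open>The comparison of lengths decides the sign of \<open>co j\<close> up to zero, and at
  zero both choices give the same weight.\<close>

lemma W_dn: assumes "j \<in> Re" "dom x" shows "W (dn j w) x = lo j (W w x)"
proof (cases "len (j # w) < len w")
  case True
  have "len (j # w) < len (rword [] j @ j # w)" using True len_cong[OF weq_cancel2[OF assms(1), of w]] by (simp add: rword_def)
  from rrep_nonneg[OF rrep_Nil assms(2) this] have "co j (W w x) \<le> 0" using assms(1) by (simp add: corv_def co_r)
  then show ?thesis using True r_fix[of j "W w x"] by (auto simp: dn_def lo_def)
next
  case False
  then have "len w < len (rword [] j @ w)" using len_Cons_Re[OF assms(1), of w] by (auto simp: rword_def)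
  from rrep_nonneg[OF rrep_Nil assms(2) this] have "0 \<le> co j (W w x)" by (simp add: corv_def)
  then show ?thesis using False by (simp add: dn_def lo_def)
qed

lemma dn_fix: assumes "dom x" "0 < co j (W w x)" shows "dn j w = w"
proof -
  have "len w < len (rword [] j @ w)" using assms by (intro rrep_up[OF rrep_Nil assms(1)]) (simp add: corv_def)
  then show ?thesis by (simp add: dn_def rword_def)
qed

lemma re_orbit_lo: "x \<in> re_orbit co al y \<Longrightarrow> j \<in> Re \<Longrightarrow> lo j x \<in> re_orbit co al y"
  using re_orbit_r by (simp add: lo_def)

text \<open>\<open>dn\<close> is monotone for the Bruhat order and acts as \<open>lo\<close> on
  weights. A chain with integral values is pushed down by \<open>ach_lo\<close>; one with
  nonintegral values lies strictly on the negative side and is reflected.\<close>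

lemma okn_dn:
  assumes "j \<in> Re" "0 \<le> s" "inc s L" "okn bled L z" "\<forall>p\<in>set L. co j (dr p) \<le> 0" "dn j z = z"
  shows "okn bled (dnp j L) z"
  using assms(2-5)
proof (induction L arbitrary: s)
  case (Cons p L)
  let ?a = "fst p - real (fac (fst p))" and ?x = "lam (fac (fst p))" and ?v = "nw L z"
  have i: "s < fst p" "fst p \<le> of_int \<lfloor>s\<rfloor> + 1" "inc (fst p) L" using Cons.prems by auto
  have sg: "sg bled p ?v" using Cons.prems by auto
  have d: "co j (dr p) \<le> 0" using Cons.prems by simp
  have ft: "0 < ?a" by (rule frac_time(1)[OF Cons.prems(1) i(1,2)])
  have c: "ach ?a (dr p) (W ?v ?x)" using sg unfolding sg_def by blast
  have "ach ?a (lo j (dr p)) (lo j (W ?v ?x))"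
  proof (cases "?a * co j (dr p) \<in> \<int>")
    case True
    then have "?a * co j (W ?v ?x) \<in> \<int>" using ach_co_int[OF c] by blast
    then show ?thesis by (rule ach_lo[OF c assms(1) ft])
  next
    case False
    then have "co j (dr p) \<noteq> 0" by auto
    then have "co j (dr p) < 0" using d by simp
    from ach_interior_neg[OF c assms(1) this False] show ?thesis using \<open>co j (dr p) < 0\<close> by (simp add: lo_def)
  qed
  then have "sg bled (fst p, dn j (snd p)) (dn j ?v)"
    using sg dn_mono[OF _ assms(1)] re_orbit_lo[OF _ assms(1)] unfolding sg_def
    by (simp add: dr_def W_dn[OF assms(1) dom_lam])
  moreover have "nw (dnp j L) z = dn j ?v" using assms(6) by (cases L) auto
  moreover have "okn bled (dnp j L) z" using Cons.IH[OF _ i(3)] Cons.prems i by simp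
  ultimately show ?case by simp
qed simp

lemma sim_dnp_flip: "j \<in> Re \<Longrightarrow> \<forall>p\<in>set B. co j (dr p) < 0 \<Longrightarrow> sim (flip j B) (dnp j B)"
  unfolding sim_def by (induction B) (auto simp: dr_def W_dn dom_lam lo_def)

lemma sim_dnp_flat: "j \<in> Re \<Longrightarrow> \<forall>p\<in>set B. co j (dr p) = 0 \<Longrightarrow> sim B (dnp j B)"
  unfolding sim_def by (induction B) (auto simp: dr_def W_dn dom_lam lo_def)

lemma sim_flip_flip: "j \<in> Re \<Longrightarrow> sim (flip j (flip j B)) B"
  unfolding sim_def by (induction B) (auto simp: dr_def)

text \<open>Mirror image of \<open>decomp\<close>: the block runs from the last time at height
  \<open>M + 1\<close> before the first minimum to that minimum, where the height is
  \<open>M\<close>.\<close>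

lemma e_decomp:
  assumes S: "Sdata C xs" and refl: "\<And>x w. C x w w" and "j \<in> Re" "k \<le> length xs" "hh j xs k < 0"
  shows "\<exists>A B D M. Sdata C (A @ B @ D) \<and> pth (A @ B @ D) = pth xs \<and> M \<in> \<int> \<and> B \<noteq> [] \<and>
    (\<forall>p\<in>set B. co j (dr p) < 0) \<and> co j (tot 0 A) = M + 1 \<and> co j (tot (et 0 A) B) = - 1 \<and>
    (\<forall>t. M \<le> co j (pth xs t)) \<and> (\<forall>t. M + 1 \<le> co j (Q 0 A t)) \<and>
    (\<forall>k\<le>length (A @ B @ D). M \<le> hh j (A @ B @ D) k)"
proof -
  let ?N = "length xs" and ?h = "hh j xs"
  define M where "M = Min (?h ` {..?N})"
  have Ml: "M \<le> ?h k" if "k \<le> ?N" for k unfolding M_def using that by (intro Min_le) auto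
  have "M \<in> ?h ` {..?N}" unfolding M_def by (intro Min_in) auto
  then obtain k1' where k1': "k1' \<le> ?N \<and> ?h k1' = M" by auto
  define k1 where "k1 = (LEAST k. k \<le> ?N \<and> ?h k = M)"
  have k1: "k1 \<le> ?N" "?h k1 = M" unfolding k1_def using LeastI[of "\<lambda>k. k \<le> ?N \<and> ?h k = M", OF k1'] by auto
  have k1l: "M < ?h k" if "k < k1" for k
    using not_less_Least[of k "\<lambda>k. k \<le> ?N \<and> ?h k = M"] that k1(1) Ml[of k] unfolding k1_def[symmetric] by auto
  have MZ: "M \<in> \<int>" using hh_min_int[OF S assms(3) k1(1)] Ml k1(2) by simp
  have "M < 0" using Ml[OF assms(4)] assms(5) by simp
  \<comment> \<open>The path starts at height 0, so this guarantees that the height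
    \<open>M + 1\<close> is passed before the minimum.\<close>
  then have M1: "M \<le> - 1" using Ints_ge_1[of "- M"] MZ by simp
  define K where "K = {k. k < k1 \<and> M + 1 \<le> ?h k}"
  have "k1 \<noteq> 0" using k1(2) \<open>M < 0\<close> by (metis hh_0 less_irrefl)
  then have Kne: "0 \<in> K" using M1 by (simp add: K_def)
  have Kf: "finite K" unfolding K_def by simp
  define R where "R = Max K"
  have "R \<in> K" unfolding R_def using Kne by (intro Max_in[OF Kf]) auto
  then have R: "R < k1" "M + 1 \<le> ?h R" by (auto simp: K_def)
  have Rl: "?h k < M + 1" if "R < k" "k \<le> k1" for k
  proof (cases "k = k1")
    case True
    then show ?thesis using k1(2) by simp
  next
    case False
    have "k \<notin> K" using that(1) Max_ge[OF Kf, of k] by (auto simp: R_def)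
    then show ?thesis using False that(2) by (auto simp: K_def)
  qed
  have RN: "R < ?N" using R k1 by simp
  have first: "co j (dr (xs ! R)) < 0"
    using hh_sign(2)[OF Sinc[OF S] RN, of j] Rl[of "Suc R"] R by simp
  have neg: "co j (dr (xs ! s)) < 0" if s: "R \<le> s" "s < k1" for s
  proof (rule ccontr)
    assume n: "\<not> co j (dr (xs ! s)) < 0"
    then have sR: "R < s" using first s(1) by (cases "R = s") auto
    have "R \<le> q \<longrightarrow> 0 \<le> co j (dr (xs ! q)) \<and> (R < q \<longrightarrow> ?h q \<le> ?h s)" if "q \<le> s" for q
      using that
    proof (induction q rule: inc_induct)
      case base
      then show ?case using n by simp
    next
      case (step q)
      show ?case
      proof
        assume q: "R \<le> q"
        have IH: "0 \<le> co j (dr (xs ! Suc q))" "?h (Suc q) \<le> ?h s" using step q by auto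
        have qN: "Suc q < ?N" using step s k1 by simp
        have "0 \<le> co j (dr (xs ! q))"
        proof (rule ccontr)
          assume "\<not> ?thesis"
          then have "?h (Suc q) \<in> \<int>" using hh_local_min[OF S qN assms(3)] IH(1) by simp
          then have "1 \<le> ?h (Suc q) - M" using k1l[of "Suc q"] step s MZ by (intro Ints_ge_1 Ints_diff) auto
          then show False using IH(2) Rl[OF sR] s(2) by simp
        qed
        then show "0 \<le> co j (dr (xs ! q)) \<and> (R < q \<longrightarrow> ?h q \<le> ?h s)"
          using hh_sign_le(1)[OF Sinc[OF S], of q j] qN IH(2) by simp
      qed
    qed
    from this[of R] first s(1) show False by simp
  qed
  \<comment> \<open>A lowest point below \<open>M + 1\<close> before \<open>R\<close> would be a
    local minimum, hence of integral height greater than \<open>M\<close>.\<close>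
  have low: "M + 1 \<le> ?h k" if k: "k \<le> R" for k
  proof -
    define v where "v = Min (?h ` {..R})"
    have vl: "v \<le> ?h k" if "k \<le> R" for k unfolding v_def using that by (intro Min_le) auto
    have "v \<in> ?h ` {..R}" unfolding v_def by (intro Min_in) auto
    then obtain k2 where k2: "k2 \<le> R" "?h k2 = v" by auto
    have "M + 1 \<le> v"
    proof (rule ccontr)
      assume nv: "\<not> M + 1 \<le> v"
      then have "k2 \<noteq> 0" "k2 \<noteq> R" using k2 R(2) M1 by (auto intro: ccontr)
      then obtain l where l: "k2 = Suc l" "Suc l < R" using k2(1) by (cases k2) auto
      have "co j (dr (xs ! l)) \<le> 0" using vl[of l] k2 l hh_sign_le(2)[OF Sinc[OF S], of l j] RN by simp
      moreover have "0 \<le> co j (dr (xs ! Suc l))"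
        using vl[of "Suc (Suc l)"] k2 l hh_sign_le(1)[OF Sinc[OF S], of "Suc l" j] RN by simp
      ultimately have "v \<in> \<int>" using hh_local_min[OF S, of l j] assms(3) l k2 RN by simp
      then have "1 \<le> v - M" using k1l[of k2] k2 R MZ by (intro Ints_ge_1 Ints_diff) auto
      then show False using nv by simp
    qed
    then show ?thesis using vl[OF k] by simp
  qed
  define A0 p B0 D where "A0 = take R xs" and "p = xs ! R" and "B0 = take (k1 - Suc R) (drop (Suc R) xs)" and "D = drop k1 xs"
  have "take k1 xs = take (Suc R) xs @ B0" using R(1) by (simp add: B0_def take_add[symmetric])
  then have tk1: "take k1 xs = A0 @ p # B0" using RN by (simp add: A0_def p_def take_Suc_conv_app_nth)
  then have xs: "xs = A0 @ p # B0 @ D" using append_take_drop_id[of k1 xs] by (simp add: D_def)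
  have B0: "\<forall>x\<in>set B0. co j (dr x) < 0"
  proof
    fix x assume "x \<in> set B0"
    then obtain l where l: "l < length B0" "x = B0 ! l" by (auto simp: in_set_conv_nth)
    then have "l < k1 - Suc R" by (simp add: B0_def)
    then have "x = xs ! (Suc R + l)" "Suc R + l < k1" using l k1 R by (auto simp: B0_def)
    then show "co j (dr x) < 0" using neg[of "Suc R + l"] by simp
  qed
  have pn: "co j (dr p) < 0" using first by (simp add: p_def)
  define s where "s = et 0 A0"
  have hR: "?h R = co j (tot 0 A0)" by (simp add: hh_def A0_def)
  have hM: "co j (tot 0 A0) + (fst p - s) * co j (dr p) + co j (tot (fst p) B0) = M"
    using k1(2) unfolding hh_def tk1 by (simp add: tot_append s_def)
  have P1: "\<forall>t. M \<le> co j (pth xs t)" using pth_ge[OF S, of M j] Ml by blast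
  have iA: "inc 0 A0" using Sinc[OF S] unfolding xs by (simp add: inc_append)
  have preA: "M + 1 \<le> co j (tot 0 X)" if X: "A0 = X @ Y" for X Y
  proof -
    have "length X \<le> R" using arg_cong[OF X, of length] RN by (simp add: A0_def)
    then show ?thesis using low[of "length X"] prefix_hh[OF S, of X "Y @ p # B0 @ D" j] xs X by simp
  qed
  show ?thesis
  proof (cases "?h R = M + 1")
    case True
    have "co j (tot (et 0 A0) (p # B0)) = - 1" using hM True hR by (simp add: s_def)
    moreover have "A0 @ (p # B0) @ D = xs" using xs by simp
    moreover have "\<forall>t. M + 1 \<le> co j (Q 0 A0 t)"
    proof
      fix t show "M + 1 \<le> co j (Q 0 A0 t)" using Q_ge[OF iA, of "M + 1" 0 j t] preA by simp
    qed
    ultimately show ?thesis using S MZ B0 pn True hR P1 Ml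
      by (intro exI[of _ A0] exI[of _ "p # B0"] exI[of _ D] exI[of _ M]) auto
  next
    case False
    then have gtR: "M + 1 < ?h R" using R(2) by simp
    \<comment> \<open>The time at which the segment \<open>p\<close> comes down to height
      \<open>M + 1\<close>.\<close>
    define \<sigma> where "\<sigma> = s + (M + 1 - ?h R) / co j (dr p)"
    have s1: "s < \<sigma>" using gtR pn by (simp add: \<sigma>_def divide_neg_neg)
    have e1: "(\<sigma> - s) * co j (dr p) = M + 1 - ?h R" using pn by (simp add: \<sigma>_def)
    have "?h (Suc R) = ?h R + (fst p - s) * co j (dr p)" using hh_Suc[OF RN] by (simp add: p_def s_def A0_def)
    then have "(fst p - s) * co j (dr p) < (\<sigma> - s) * co j (dr p)" using e1 Rl[of "Suc R"] R by simp
    then have s2: "\<sigma> < fst p" using pn by (simp add: mult_less_cancel_right)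
    let ?p = "(\<sigma>, snd p)"
    have sp: "Sdata C (A0 @ ?p # p # (B0 @ D))" "pth (A0 @ ?p # p # (B0 @ D)) = pth (A0 @ p # (B0 @ D))" "dr ?p = dr p"
      using Sdata_split[of C A0 p "B0 @ D" \<sigma>] S xs s1 s2 refl unfolding s_def by auto
    let ?A = "A0 @ [?p]"
    have tA: "co j (tot 0 ?A) = M + 1" using e1 hR sp(3) by (simp add: tot_append s_def)
    have "co j (tot (et 0 ?A) (p # B0)) = - 1"
    proof -
      have "(fst p - s) * co j (dr p) = (\<sigma> - s) * co j (dr p) + (fst p - \<sigma>) * co j (dr p)" by (simp add: algebra_simps)
      then show ?thesis using hM e1 hR by (simp add: et_append)
    qed
    moreover have Y: "Sdata C (?A @ (p # B0) @ D)" "pth (?A @ (p # B0) @ D) = pth xs"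
      using sp(1,2) by (simp_all add: xs[symmetric])
    moreover have "\<forall>t. M + 1 \<le> co j (Q 0 ?A t)"
    proof
      fix t
      have "inc 0 ?A" using Y(1) by (simp add: Sdata_def inc_append)
      moreover have "M + 1 \<le> 0 + co j (tot 0 X)" if X: "?A = X @ Y" for X Y
        using X preA tA by (cases Y rule: rev_cases) auto
      ultimately show "M + 1 \<le> co j (Q 0 ?A t)" using Q_ge[of 0 ?A "M + 1" 0 j t] by simp
    qed
    moreover have "\<forall>k\<le>length (?A @ (p # B0) @ D). M \<le> hh j (?A @ (p # B0) @ D) k"
    proof (intro allI impI)
      fix k assume k: "k \<le> length (?A @ (p # B0) @ D)"
      show "M \<le> hh j (?A @ (p # B0) @ D) k"
      proof (cases "k \<le> R")
        case True
        have "length A0 = R" using RN by (simp add: A0_def)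
        then have "take k (?A @ (p # B0) @ D) = take k xs" using True unfolding xs by simp
        then show ?thesis using Ml[of k] True RN by (simp add: hh_def)
      next
        case kR: False
        have lA: "length A0 = R" using RN by (simp add: A0_def)
        then obtain l where l: "k = Suc R + l" using kR by (metis add.commute less_iff_Suc_add not_le add_Suc_right add_Suc)
        have "take k (?A @ (p # B0) @ D) = ?A @ take l ((p # B0) @ D)" using l lA by simp
        show ?thesis
        proof (cases l)
          case 0
          then show ?thesis using tA l lA by (simp add: hh_def)
        next
          case (Suc l')
          have t1: "take k (?A @ (p # B0) @ D) = A0 @ ?p # p # take l' (B0 @ D)" using l lA Suc by simp
          have t2: "take (Suc R + l') xs = A0 @ p # take l' (B0 @ D)" unfolding xs using lA by simp
          have "tot 0 (A0 @ ?p # p # take l' (B0 @ D)) = tot 0 (A0 @ p # take l' (B0 @ D))"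
            using sp(3) by (simp add: tot_append s_def[symmetric] add.assoc[symmetric] scaleR_left_distrib[symmetric])
          then have "hh j (?A @ (p # B0) @ D) k = hh j xs (Suc R + l')" unfolding hh_def t1 t2 by simp
          moreover have "Suc R + l' \<le> ?N" using k l Suc lA unfolding xs by simp
          ultimately show ?thesis using Ml by simp
        qed
      qed
    qed
    moreover have "\<forall>x\<in>set (p # B0). co j (dr x) < 0" using B0 pn by simp
    ultimately show ?thesis
      by (intro exI[of _ ?A] exI[of _ "p # B0"] exI[of _ D] exI[of _ M] conjI MZ P1 tA; (assumption | simp))
  qed
qed

text \<open>The descending block is reflected, its words being replaced by \<open>dn\<close>. The
  flat segments after it are treated the same way, to keep the Bruhat order; their directions do not
  change. Applying \<open>f_j\<close> reflects the block back.\<close>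

theorem e_real:
  assumes S: "Sdata bled xs" and "j \<in> Re" "k \<le> length xs" "hh j xs k < 0"
  shows "\<exists>ys. Sdata bled ys \<and> pth ys 1 = pth xs 1 + al j \<and>
    (\<forall>path. (\<forall>t. 0 \<le> t \<longrightarrow> t \<le> 1 \<longrightarrow> path t = pth ys t) \<longrightarrow>
      (\<exists>q. froot co al j path = Some q \<and> (\<forall>t. 0 \<le> t \<longrightarrow> t \<le> 1 \<longrightarrow> q t = pth xs t)))"
proof -
  obtain A B D M where X: "Sdata bled (A @ B @ D)" "pth (A @ B @ D) = pth xs" "M \<in> \<int>" "B \<noteq> []"
    "\<forall>p\<in>set B. co j (dr p) < 0" "co j (tot 0 A) = M + 1" "co j (tot (et 0 A) B) = - 1"
    "\<forall>t. M \<le> co j (pth xs t)" "\<forall>t. M + 1 \<le> co j (Q 0 A t)" "\<forall>k\<le>length (A @ B @ D). M \<le> hh j (A @ B @ D) k"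
    using e_decomp[OF S _ assms(2-4)] ble_weq[OF weq_refl'] by auto
  have i: "inc 0 A" "inc (et 0 A) B" "inc (et (et 0 A) B) D" and e: "et (et (et 0 A) B) D = real n"
    and o: "okn bled A (nw (B @ D) [])" "okn bled (B @ D) []"
    using X(1) by (auto simp: Sdata_def inc_append et_append okn_append nw_append)
  define D1 D2 where "D1 = takeWhile (\<lambda>p. co j (dr p) = 0) D" and "D2 = dropWhile (\<lambda>p. co j (dr p) = 0) D"
  have D: "D = D1 @ D2" by (simp add: D1_def D2_def)
  have flat: "\<forall>p\<in>set D1. co j (dr p) = 0" by (auto simp: D1_def dest: set_takeWhileD)
  have dnz: "dn j (nw D2 []) = nw D2 []"
  proof (cases D2)
    case Nil
    then show ?thesis by (simp add: dn_def)
  next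
    case (Cons p D')
    have "co j (dr p) \<noteq> 0" using Cons unfolding D2_def dropWhile_eq_Cons_conv by blast
    moreover have "0 \<le> co j (dr p)"
    proof -
      let ?X = "A @ B @ D1"
      have Xe: "A @ B @ D = ?X @ p # D'" using D Cons by simp
      have l: "length ?X < length (A @ B @ D)" unfolding Xe by simp
      have "hh j (A @ B @ D) (length ?X) = co j (tot 0 ?X)" unfolding hh_def Xe by simp
      also have "\<dots> = M" using X(6,7) tot_flat[OF flat] by (simp add: tot_append)
      finally have "hh j (A @ B @ D) (length ?X) \<le> hh j (A @ B @ D) (Suc (length ?X))" using X(10) l by simp
      then have "0 \<le> co j (dr ((A @ B @ D) ! length ?X))" using hh_sign_le(1)[OF Sinc[OF X(1)] l] by simp
      moreover have "(A @ B @ D) ! length ?X = p" unfolding Xe by (rule nth_append_length)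
      ultimately show ?thesis by simp
    qed
    ultimately have "0 < co j (dr p)" by simp
    then show ?thesis using dn_fix[OF dom_lam] Cons by (simp add: dr_def)
  qed
  have a0: "0 \<le> et 0 A" by (rule et_mono[OF i(1)])
  have iBD: "inc (et 0 A) (B @ D1)" using i D by (simp add: inc_append)
  have oBD: "okn bled (B @ D1) (nw D2 [])" "okn bled D2 []" using o(2) D by (auto simp: okn_append nw_append)
  have "\<forall>p\<in>set (B @ D1). co j (dr p) \<le> 0" using X(5) flat by force
  then have oB: "okn bled (dnp j (B @ D1)) (nw D2 [])" by (rule okn_dn[OF assms(2) a0 iBD oBD(1) _ dnz])
  obtain p0 B0 where B: "B = p0 # B0" using X(4) by (cases B) auto
  have oA: "okn bled A (dn j (snd p0))"
  proof (cases A rule: rev_cases)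
    case (snoc A0 p)
    let ?a = "fst p - real (fac (fst p))" and ?x = "lam (fac (fst p))"
    have o0: "okn bled A0 (snd p)" and sg: "sg bled p (snd p0)" using o(1) snoc B by (auto simp: okn_append)
    have ii: "inc 0 A0" "et 0 A0 < fst p" "fst p \<le> of_int \<lfloor>et 0 A0\<rfloor> + 1" using i(1) snoc by (auto simp: inc_append)
    have s0: "0 \<le> et 0 A0" by (rule et_mono[OF ii(1)])
    have ft: "0 < ?a" by (rule frac_time(1)[OF s0 ii(2,3)])
    have "intat (et 0 A0) (tot 0 A0) (snd p)"
      using intat_prefix[of 0 A0 "p # B @ D" bled "[]" 0] X(1) snoc by (simp add: Sdata_def intat_def)
    from intat_step[OF s0 ii(2,3) this, of j] have "M + 1 - ?a * co j (dr p) \<in> \<int>"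
      using X(6) snoc by (simp add: tot_append)
    then have aZ: "?a * co j (dr p) \<in> \<int>" using Ints_diff[OF Ints_add[OF X(3) Ints_1]] by fastforce
    have c: "ach ?a (dr p) (W (snd p0) ?x)" using sg unfolding sg_def by blast
    then have "?a * co j (W (snd p0) ?x) \<in> \<int>" using ach_co_int[OF c] aZ by blast
    from rtranclp_trans[OF c ach_self_lo[OF assms(2) ft this]] have "ach ?a (dr p) (lo j (W (snd p0) ?x))" .
    moreover have "ble (dn j (snd p0)) (snd p)" using ble_trans[OF dn_le[OF assms(2)]] sg unfolding sg_def by blast
    ultimately have "sg bled p (dn j (snd p0))"
      using sg re_orbit_lo[OF _ assms(2)] unfolding sg_def by (simp add: W_dn[OF assms(2) dom_lam])
    then show ?thesis using o0 snoc by (simp add: okn_append)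
  qed simp
  define ys where "ys = A @ dnp j B @ dnp j D1 @ D2"
  have sm: "sim (A @ flip j B @ D) ys"
    unfolding ys_def D using sim_dnp_flip[OF assms(2) X(5)] sim_dnp_flat[OF assms(2) flat] by (intro sim_append) auto
  have SF: "inc 0 (A @ flip j B @ D)" "et 0 (A @ flip j B @ D) = real n"
    using i e by (auto simp: inc_append et_append flip_eqs)
  have "inc 0 ys" "et 0 ys = real n" using SF sim_eqs(3,4)[OF sm] by auto
  moreover have "okn bled ys []"
    unfolding ys_def using oA oB oBD(2) B by (simp add: okn_append nw_append)
  ultimately have SY: "Sdata bled ys" by (simp add: Sdata_def)
  have py: "pth ys = pth (A @ flip j B @ D)" using sim_pth[OF sm] by simp
  define a b where "a = et 0 A" and "b = et a B"
  have iF: "inc a (flip j B)" using i(2) by (simp add: flip_eqs a_def)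
  have posF: "\<forall>p\<in>set (flip j B). 0 < co j (dr p)" using X(5) assms(2) by (auto simp: dr_flip co_r)
  have Fne: "flip j B \<noteq> []" using X(4) by simp
  have tF: "co j (tot a (flip j B)) = 1" using X(7) assms(2) by (simp add: tot_refl co_r a_def)
  have QBF: "co j (Q a (flip j B) t) = - co j (Q a B t)" for t using assms(2) by (simp add: Q_refl co_r)
  have Fpos: "0 < co j (Q a (flip j B) t)" if "a < t" for t
  proof -
    have "0 < 0 + co j (Q a (flip j B) t)"
    proof (rule Q_gt_start[OF iF that])
      fix Y Z assume Y: "flip j B = Y @ Z" "Y \<noteq> []"
      have "inc a Y" using iF Y by (simp add: inc_append)
      moreover have "\<forall>p\<in>set Y. 0 < co j (dr p)" using posF Y by auto
      ultimately show "0 < 0 + co j (tot a Y)" using tot_pos[OF _ Y(2)] by simp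
    qed (use Fne in auto)
    then show ?thesis by simp
  qed
  have pe: "co j (pth (A @ flip j B @ D) t) = co j (Q 0 A (real n * t)) + co j (Q a (flip j B) (real n * t)) + co j (Q b D (real n * t))" for t
    by (simp add: pth_def Q_append flip_eqs a_def b_def)
  have pe': "co j (pth xs t) = co j (Q 0 A (real n * t)) + co j (Q a B (real n * t)) + co j (Q b D (real n * t))" for t
    unfolding X(2)[symmetric] by (simp add: pth_def Q_append a_def b_def)
  have iD: "inc b D" using i(3) by (simp add: a_def b_def)
  have ab: "a < b" using et_less[OF i(2) X(4)] by (simp add: a_def b_def)
  have P: "M + 1 \<le> co j (pth (A @ flip j B @ D) t) \<and> (a < real n * t \<longrightarrow> M + 1 < co j (pth (A @ flip j B @ D) t))" for t
  proof -
    let ?T = "real n * t"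
    have QA: "M + 1 \<le> co j (Q 0 A ?T)" using X(9) by blast
    consider "?T \<le> a" | "a < ?T" "?T \<le> b" | "b < ?T" by linarith
    then show ?thesis
    proof cases
      case 1
      then have "Q a (flip j B) ?T = 0" "Q b D ?T = 0" using Q_before[OF iF] Q_before[OF iD] ab by auto
      then show ?thesis using pe[of t] QA 1 by simp
    next
      case 2
      then have "Q b D ?T = 0" using Q_before[OF iD] by auto
      then show ?thesis using pe[of t] QA Fpos[OF 2(1)] by simp
    next
      case 3
      have bT: "et a B \<le> ?T" using 3 by (simp add: b_def)
      have "Q a B ?T = tot a B" using Q_after[OF _ bT] i(2) by (simp add: a_def)
      then have qB: "co j (Q a B ?T) = - 1" using X(7) by (simp add: a_def)
      have "Q 0 A ?T = tot 0 A" using Q_after[OF i(1)] 3 ab by (simp add: a_def)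
      then have qA: "co j (Q 0 A ?T) = M + 1" using X(6) by simp
      have "0 \<le> co j (Q b D ?T)" using pe'[of t] qA qB X(8) by (auto dest: spec[of _ t])
      then show ?thesis using pe[of t] qA qB QBF[of ?T] by simp
    qed
  qed
  have fr: "\<exists>q. froot co al j path = Some q \<and> (\<forall>t. 0 \<le> t \<longrightarrow> t \<le> 1 \<longrightarrow> q t = pth xs t)"
    if path: "\<forall>t. 0 \<le> t \<longrightarrow> t \<le> 1 \<longrightarrow> path t = pth ys t" for path
  proof -
    have "\<exists>q. froot co al j path = Some q \<and> (\<forall>t. 0 \<le> t \<longrightarrow> t \<le> 1 \<longrightarrow> q t = pth (A @ flip j (flip j B) @ D) t)"
    proof (rule froot_data[where M = "M + 1", OF SF Fne posF _ X(6)])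
      show "M + 1 \<in> \<int>" using X(3) by simp
      show "co j (tot (et 0 A) (flip j B)) = 1" using tF by (simp add: a_def)
      show "M + 1 \<le> co j (pth (A @ flip j B @ D) t)" for t using P by blast
      show "M + 1 < co j (pth (A @ flip j B @ D) t)" if "et 0 A < real n * t" for t using P that a_def by blast
      show "path t = pth (A @ flip j B @ D) t" if "0 \<le> t" "t \<le> 1" for t using path that py by simp
    qed
    moreover have "pth (A @ flip j (flip j B) @ D) = pth xs"
      unfolding X(2)[symmetric] using sim_flip_flip[OF assms(2), of B] by (intro sim_pth sim_append) auto
    ultimately show ?thesis by simp
  qed
  have "pth ys 1 = pth xs 1 + al j"
  proof -
    have "pth ys 1 = tot 0 A + (r j (tot a B) + tot b D)"
    proof -
      have "pth ys 1 = tot 0 (A @ flip j B @ D)" unfolding py pth_def using Q_after[OF SF(1)] SF(2) by simp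
      then show ?thesis by (simp add: tot_append tot_refl flip_eqs a_def b_def)
    qed
    moreover have "pth xs 1 = tot 0 A + (tot a B + tot b D)"
    proof -
      have "pth xs 1 = tot 0 (A @ B @ D)" unfolding X(2)[symmetric] pth_def
        using Q_after[OF Sinc[OF X(1)]] Set[OF X(1)] by simp
      then show ?thesis by (simp add: tot_append a_def b_def)
    qed
    moreover have "r j (tot a B) = tot a B + al j" using X(7) by (simp add: srefl_def a_def)
    ultimately show ?thesis by simp
  qed
  then show ?thesis using SY fr by blast
qed

end

section \<open>Dominant weights within their orbits\<close>

context bc
begin

text \<open>Each letter of a reduced word subtracts a nonnegative multiple of its simple root; if
  nothing is subtracted in total, every letter is orthogonal to the dominant weight.\<close>

lemma orbit_cone:
  assumes "dom x" "len y = length y"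
  shows "x - W y x \<in> cone al (set y) \<and> (W y x = x \<longrightarrow> (\<forall>i\<in>set y. co i x = 0))"
  using assms(2)
proof (induction y)
  case Nil
  then show ?case by (simp add: cone_0)
next
  case (Cons k v)
  have v: "len v = length v" "len v < len (k # v)" using red_tl[OF Cons.prems] by auto
  have IH: "x - W v x \<in> cone al (set v)" "W v x = x \<Longrightarrow> \<forall>i\<in>set v. co i x = 0" using Cons.IH v by auto
  define c where "c = co k (W v x)"
  have c: "0 \<le> c"
  proof (cases "k \<in> Re")
    case True
    show ?thesis unfolding c_def by (rule dom_cone_nonneg[OF co_cone[OF True v(2)] assms(1)])
  next
    case False
    then show ?thesis unfolding c_def by (intro co_Im_orbit assms(1)) (simp add: Im_iff)
  qed
  have e: "x - W (k # v) x = (x - W v x) + c *\<^sub>R al k" by (simp add: srefl_def c_def)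
  have 1: "x - W v x \<in> cone al (set (k # v))" using IH(1) cone_mono[of "set v" "set (k # v)" al] by auto
  have 2: "c *\<^sub>R al k \<in> cone al (set (k # v))" using c by (intro cone_scale_base) auto
  show ?case
  proof (intro conjI impI)
    show "x - W (k # v) x \<in> cone al (set (k # v))" unfolding e by (rule cone_add[OF 1 2])
    assume "W (k # v) x = x"
    then have z: "(x - W v x) + c *\<^sub>R al k = 0" using e by simp
    have "W v x = x" using cone_add_eq_0(1)[OF indep_al 1 2 z] by simp
    moreover have "c = 0" using cone_add_eq_0(2)[OF indep_al 1 2 z] al_nonzero by simp
    ultimately show "\<forall>i\<in>set (k # v). co i x = 0" using IH(2) by (simp add: c_def)
  qed
qed

lemma orbit_cone_UNIV: assumes "dom x" shows "x - W w x \<in> cone al UNIV"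
proof -
  obtain y where y: "y \<approx> w" "length y = len w" using len_ex by blast
  have "x - W y x \<in> cone al (set y)" using orbit_cone[OF assms] y len_cong[OF y(1)] by simp
  then show ?thesis using weq_act[OF y(1)] cone_mono[of "set y" UNIV al] by auto
qed

lemma dom_top: assumes "dom x" "ge x (W w x)" shows "W w x = x"
proof -
  have "- (x - W w x) \<in> cone al UNIV" using ge_diff[OF assms(2)] by simp
  from cone_antisym[OF indep_al orbit_cone_UNIV[OF assms(1)] this] have "x - W w x = 0" .
  then show ?thesis by simp
qed

text \<open>The leading letter of a reduced real word either acts trivially and is dropped, or lies
  in \<open>Z\<close> and makes its own coroot negative on the weight.\<close>

lemma re_orbit_dom:
  assumes "dom x" "\<mu> \<in> re_orbit co al x" "x - \<mu> \<in> cone al Z" "\<And>s. s \<in> Z \<Longrightarrow> 0 \<le> co s \<mu>"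
  shows "\<mu> = x"
proof -
  obtain ws where ws: "\<mu> = W ws x" "set ws \<subseteq> Re" using assms(2) unfolding re_orbit_def by blast
  obtain y where y: "y \<approx> ws" "length y = len ws" using len_ex by blast
  have main: "\<mu> = x" if "len y = length y" "set y \<subseteq> Re" "W y x = \<mu>" for y
    using that
  proof (induction y)
    case (Cons s v)
    have v: "len v = length v" "len v < len (s # v)" using red_tl[OF Cons.prems(1)] by auto
    have sR: "s \<in> Re" using Cons.prems by simp
    define c where "c = co s (W v x)"
    have c0: "0 \<le> c" unfolding c_def by (rule dom_cone_nonneg[OF co_cone[OF sR v(2)] assms(1)])
    have e: "\<mu> = W v x - c *\<^sub>R al s" using Cons.prems(3) by (simp add: srefl_def c_def)
    show ?case
    proof (cases "c = 0")
      case True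
      then show ?thesis using Cons e v by simp
    next
      case False
      have "c *\<^sub>R al s \<in> cone al Z"
      proof (rule cone_add_restrict[OF indep_al _ orbit_cone_UNIV[OF assms(1), of v]])
        show "c *\<^sub>R al s \<in> cone al UNIV" using c0 by (simp add: cone_scale_base)
        show "c *\<^sub>R al s + (x - W v x) \<in> cone al Z" using assms(3) e by (simp add: algebra_simps)
      qed
      then have "comb al (\<lambda>j. if j = s then c else 0) \<in> cone al Z" by (simp add: comb_single)
      from cone_coef(2)[OF this fsup_single, of s] have "s \<in> Z" using False by simp
      then have "0 \<le> co s \<mu>" by (rule assms(4))
      moreover have "co s \<mu> = - c" using e co_al_Re[OF sR] by (simp add: c_def)
      ultimately show ?thesis using c0 False by simp
    qed
  qed simp
  show ?thesis
  proof (rule main[of y])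
    show "len y = length y" using y(2) len_cong[OF y(1)] by simp
    show "set y \<subseteq> Re" by (rule weq_real[OF weq_sym[OF y(1)] ws(2)])
    show "W y x = \<mu>" using weq_act[OF y(1)] ws(1) by simp
  qed
qed

lemma ach_orbit: "ach a \<eta> \<nu> \<Longrightarrow> \<exists>w. W w x = \<nu> \<Longrightarrow> \<exists>w. W w x = \<eta>"
proof (induction rule: converse_rtranclp_induct)
  case (step y z)
  then obtain w where w: "W w x = z" by blast
  obtain ws i where "y = W (rword ws i) z" by (rule acstepE[OF step(1)])
  then have "W (rword ws i @ w) x = y" using w by simp
  then show ?case by blast
qed

text \<open>Weights of a chain are lifted to words one reflection at a time. All these reflections
  are supported in \<open>Z\<close>, so they fix every weight orthogonal to \<open>Z\<close>; this
  keeps the earlier factors straight in \<open>e_Im\<close>.\<close>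

lemma ach_lift:
  assumes "ach a \<eta> (W z x)" "dom x" "x - \<eta> \<in> cone al Z"
  shows "\<exists>w. W w x = \<eta> \<and> mv x z w \<and> (\<forall>x'. (\<forall>k\<in>Z. co k x' = 0) \<longrightarrow> W z x' = x' \<longrightarrow> W w x' = x')"
  using assms(1,3)
proof (induction rule: converse_rtranclp_induct)
  case base
  then show ?case by (intro exI[of _ z]) simp
next
  case (step y v)
  obtain w0 where w0: "W w0 x = v" using ach_orbit[OF step(2)] by blast
  obtain ws i where w: "rrep ws i" "y = W (rword ws i) v" "0 < cv ws i v" by (rule acstepE[OF step(1)])
  have ws: "set ws \<subseteq> Re" "rt ws i \<in> cone al UNIV" using w(1) rrep_iff by auto
  have e: "x - y = (x - v) + cv ws i v *\<^sub>R rt ws i" using w(2) W_rword[OF ws(1)] by simp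
  have c1: "x - v \<in> cone al UNIV" using orbit_cone_UNIV[OF assms(2), of w0] w0 by simp
  have c2: "cv ws i v *\<^sub>R rt ws i \<in> cone al UNIV" using w(3) ws(2) by (intro cone_scale) auto
  have vZ: "x - v \<in> cone al Z" using cone_add_restrict[OF indep_al c1 c2] step(4) e by simp
  have "cv ws i v *\<^sub>R rt ws i \<in> cone al Z"
    using cone_add_restrict[OF indep_al c2 c1] step(4) e by (simp add: add.commute)
  then have "(1 / cv ws i v) *\<^sub>R (cv ws i v *\<^sub>R rt ws i) \<in> cone al Z"
    by (rule cone_scale) (use w(3) in simp)
  moreover have "(1 / cv ws i v) *\<^sub>R (cv ws i v *\<^sub>R rt ws i) = rt ws i" using w(3) by simp
  ultimately have rZ: "rt ws i \<in> cone al Z" by (simp only:)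
  obtain u where u: "W u x = v" "mv x z u" "\<forall>x'. (\<forall>k\<in>Z. co k x' = 0) \<longrightarrow> W z x' = x' \<longrightarrow> W u x' = x'"
    using step(3)[OF vZ] by blast
  have "mv x u (rword ws i @ u)" using w(3) u(1) by (intro mv_step[OF w(1)]) auto
  then have m: "mv x z (rword ws i @ u)" using mv_trans[OF u(2)] by blast
  have "W (rword ws i @ u) x' = x'" if "\<forall>k\<in>Z. co k x' = 0" "W z x' = x'" for x'
    using u(3) that supp_zero[OF w(1) rZ that(1)] W_rword[OF ws(1)] by simp
  then show ?case using m u(1) w(2) by (intro exI[of _ "rword ws i @ u"]) simp
qed

text \<open>A covering step below a weight that is dominant on the relevant letters is a simple
  imaginary reflection: a reflection in a non-simple imaginary root would either violate the
  dominance or factor through a real simple reflection.\<close>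

lemma dominant_step:
  assumes "dom x" "acstep a \<mu> \<eta>" "W w x = \<eta>" "x - \<mu> \<in> cone al Z" "\<And>s. s \<in> Z \<Longrightarrow> 0 \<le> co s \<mu>"
  shows "\<exists>i. i \<in> Im \<and> i \<in> Z \<and> \<mu> = r i \<eta> \<and> 0 < co i \<eta> \<and> a * co i \<eta> = 1"
proof -
  obtain ws i where w: "rrep ws i" "\<mu> = W (rword ws i) \<eta>" "0 < cv ws i \<eta>" "cov \<mu> \<eta>" "a * cv ws i \<eta> \<in> \<int>"
    "i \<in> Re \<longrightarrow> 0 < a * cv ws i \<eta>" "i \<in> Im \<longrightarrow> a * cv ws i \<eta> = 1" by (rule acstepE[OF assms(2)])
  have ws: "set ws \<subseteq> Re" "rt ws i \<in> cone al UNIV" using w(1) rrep_iff by auto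
  define c where "c = cv ws i \<eta>"
  have c0: "0 < c" using w(3) by (simp add: c_def)
  have me: "\<mu> = \<eta> - c *\<^sub>R rt ws i" using w(2) W_rword[OF ws(1)] by (simp add: c_def)
  have c2: "c *\<^sub>R rt ws i \<in> cone al UNIV" using c0 ws(2) by (intro cone_scale) auto
  have c1: "x - \<eta> \<in> cone al UNIV" using orbit_cone_UNIV[OF assms(1), of w] assms(3) by simp
  have "c *\<^sub>R rt ws i \<in> cone al Z"
    using cone_add_restrict[OF indep_al c2 c1] assms(4) me by (simp add: algebra_simps)
  then have "(1 / c) *\<^sub>R (c *\<^sub>R rt ws i) \<in> cone al Z" by (rule cone_scale) (use c0 in simp)
  moreover have "(1 / c) *\<^sub>R (c *\<^sub>R rt ws i) = rt ws i" using c0 by simp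
  ultimately have rZ: "rt ws i \<in> cone al Z" by (simp only:)
  have iI: "i \<in> Im"
  proof (rule ccontr)
    assume "i \<notin> Im"
    then have iR: "i \<in> Re" by (simp add: Im_iff)
    \<comment> \<open>The coroot of a real root is supported in \<open>Z\<close> too, so dominance
      on \<open>Z\<close> makes this nonnegative, whereas the reflection makes it
      \<open>- c\<close>.\<close>
    have "0 \<le> cv ws i \<mu>" by (rule cone_fun_nonneg[OF real_supp[OF w(1) iR rZ] assms(5)])
    moreover have "cv ws i \<mu> = - c" using cv_rword[OF ws(1) iR] w(2) by (simp add: c_def)
    ultimately show False using c0 by simp
  qed
  obtain y where y: "good i y" "rt y i = rt ws i" "rword y i \<approx> rword ws i" "\<forall>z. cv y i z = cv ws i z"
    using good_ex[OF iI ws(1)] by blast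
  have Z: "set y \<subseteq> Z" "i \<in> Z" using good_supp[OF iI y(1)] y(2) rZ by auto
  have "y = []"
  proof (rule ccontr)
    assume "y \<noteq> []"
    with y(1) obtain v s where vs: "y = s # v" "good i v" "s \<in> Re" "co s (rt v i) < 0" by (cases rule: good.cases) auto
    have v: "set v \<subseteq> Re" by (rule good_real[OF vs(2)])
    define m where "m = - co s (rt v i)"
    have m1: "1 \<le> m" using vs(4) lat_co[OF W_lat[OF lat_al], of s v i] by (intro Ints_ge_1) (auto simp: m_def)
    have cvs: "cv (rev v) s (al i) = - m" by (simp add: corv_def m_def)
    have rv: "set (rev v) \<subseteq> Re" using v by simp
    \<comment> \<open>Otherwise the opposite root is positive, and its coroot takes the positive
      value \<open>m\<close> on the imaginary \<open>al i\<close>.\<close>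
    have "rt (rev v) s \<in> cone al UNIV"
    proof (rule ccontr)
      assume "rt (rev v) s \<notin> cone al UNIV"
      then have n: "- rt (rev v) s \<in> cone al UNIV" using rt_sign[OF vs(3)] by blast
      have rs: "r s (al s) = - al s" using vs(3) by (simp add: srefl_def co_al_Re scaleR_2)
      have "rrep (rev v @ [s]) s" unfolding rrep_iff using n v vs(3) rs by (simp add: W_neg)
      from cone_fun_nonpos[OF cv_cone[OF this] co_al_Im_nonpos[OF iI]] have "cv (rev v @ [s]) s (al i) \<le> 0" .
      moreover have "cv (rev v @ [s]) s (al i) = m" using vs(3) cvs by (simp add: corv_def co_r)
      ultimately show False using m1 by simp
    qed
    then have "co i (rt (rev v) s) \<le> 0" by (rule cone_linear_nonpos[OF _ lin_co co_Im_nonpos[OF iI]])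
    moreover have "co i (rt (rev v) s) \<noteq> 0" using real_refl_comm[OF rv vs(3) iI] cvs m1 by auto
    moreover have "co i (rt (rev v) s) \<in> \<int>" by (rule lat_co[OF W_lat[OF lat_al]])
    ultimately have m2: "1 \<le> - co i (rt (rev v) s)" by (intro Ints_ge_1) auto
    have ce: "c = cv v i \<eta> + co s \<eta> * (- co i (rt (rev v) s))"
    proof -
      have "c = cv v i (r s \<eta>)" using y(4) vs(1) by (simp add: c_def[symmetric] cv_Cons'[symmetric])
      also have "\<dots> = cv v i \<eta> - co s \<eta> * cv v i (al s)" by (simp add: srefl_def cv_diff cv_scale)
      finally show ?thesis by (simp add: corv_def)
    qed
    have "0 \<le> co i (W (rev v @ w) x)" by (rule co_Im_orbit[OF iI assms(1)])
    then have cv0: "0 \<le> cv v i \<eta>" using assms(3) by (simp add: corv_def)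
    have "co s (rt ws i) = m" using y(2) vs(1,3) by (simp add: co_r m_def flip: y(2))
    then have cs: "co s \<eta> = co s \<mu> + c * m" using me by simp
    have s0: "0 \<le> co s \<mu>" using Z(1) vs(1) by (intro assms(5)) simp
    have cm: "c \<le> c * m" using c0 m1 by simp
    have pos: "0 < co s \<eta>" using cs s0 cm c0 by linarith
    then have "co s \<eta> * 1 \<le> co s \<eta> * (- co i (rt (rev v) s))" using m2 by (intro mult_left_mono) auto
    \<comment> \<open>The estimates close up: \<open>c\<close> is at least
      \<open>co s \<eta>\<close>, which is \<open>co s \<mu> + c * m\<close>, and that is at least
      \<open>c\<close>. Lifting now puts \<open>r s \<eta>\<close> between \<open>\<mu>\<close> and
      \<open>\<eta>\<close>, and the cover makes the root a multiple of \<open>al s\<close>.\<close>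
    then have "co s \<mu> = 0" using ce cv0 cs s0 cm by linarith
    then have "up s \<mu> = \<mu>" by (simp add: up_def)
    moreover have "up s \<eta> = r s \<eta>" using pos by (simp add: up_def)
    ultimately have g1: "ge \<mu> (r s \<eta>)" using up_mono[OF _ vs(3), of \<mu> \<eta>] cov_gt[OF w(4)] by simp
    have g2: "ge (r s \<eta>) \<eta>" using ge_r[OF vs(3)] pos by simp
    have "r s \<eta> \<noteq> \<eta>" using co_r[OF vs(3), of \<eta>] pos by force
    then have "r s \<eta> = \<mu>" using cov_between[OF w(4) g1 g2] by simp
    then have "c *\<^sub>R rt ws i = co s \<eta> *\<^sub>R al s" using me by (simp add: srefl_def)
    then have "rt ws i = (co s \<eta> / c) *\<^sub>R al s" using c0 by (metis divide_inverse_commute less_irrefl scaleR_scaleR scaleR_one left_inverse)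
    then show False using rt_Im_not_real[OF ws(1) iI vs(3)] by blast
  qed
  then have "rt ws i = al i" "cv ws i \<eta> = co i \<eta>" using y(2,4) by (auto simp: corv_def)
  then show ?thesis using iI Z(2) me w(7) c0 by (intro exI[of _ i]) (simp add: srefl_def c_def)
qed

end

section \<open>Undoing an imaginary operator, and both directions for segment lists\<close>

context paths
begin

lemma ble_later:
  assumes "okn bled xs z" "k \<le> l" "l < length xs" shows "ble (snd (xs ! l)) (snd (xs ! k))"
  using assms(2,3)
proof (induction l rule: dec_induct)
  case base
  then show ?case by (simp add: ble_weq)
next
  case (step l)
  have "sg bled (xs ! l) (snd (xs ! Suc l))" using seg_sg[OF assms(1), of l] nw_drop[of "Suc l" xs] step by simp
  then have "ble (snd (xs ! Suc l)) (snd (xs ! l))" unfolding sg_def by blast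
  then show ?case using ble_trans step by simp
qed

lemma tot_const: "inc s B \<Longrightarrow> \<forall>p\<in>set B. dr p = d \<Longrightarrow> tot s B = (et s B - s) *\<^sub>R d"
proof (induction B arbitrary: s)
  case (Cons p B)
  then have "tot (fst p) B = (et (fst p) B - fst p) *\<^sub>R d" by simp
  then show ?case using Cons.prems by (simp flip: scaleR_left_distrib)
qed simp

lemma Q_nonneg: "(\<And>p. 0 \<le> co i (dr p)) \<Longrightarrow> 0 \<le> co i (Q s B t)"
  by (induction B arbitrary: s) (auto intro!: add_nonneg_nonneg)

lemma Q_flat: "\<forall>p\<in>set A. co j (dr p) = 0 \<Longrightarrow> co j (Q s A t) = 0"
  by (induction A arbitrary: s) auto

lemma in_set_take: "p \<in> set (take k xs) \<Longrightarrow> k \<le> length xs \<Longrightarrow> \<exists>l<k. p = xs ! l"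
  by (auto simp: in_set_conv_nth)

text \<open>All words up to the end of the block are replaced by a single \<open>w\<close> that
  fixes the weights of the earlier factors and sends \<open>lam m\<close> to \<open>\<eta>\<close>.
  Every break before the end of the block then has the trivial chain.\<close>

theorem e_Im:
  assumes S: "Sdata bled xs" and nonneg: "\<And>j k. j \<in> Re \<Longrightarrow> k \<le> length xs \<Longrightarrow> 0 \<le> hh j xs k"
    and ex: "\<exists>p\<in>set xs. dr p \<noteq> lam (fac (fst p))"
  shows "\<exists>ys i. Sdata bled ys \<and> pth ys 1 = pth xs 1 + al i \<and>
    (\<forall>path. (\<forall>t. 0 \<le> t \<longrightarrow> t \<le> 1 \<longrightarrow> path t = pth ys t) \<longrightarrow>
      (\<exists>q. froot co al i path = Some q \<and> (\<forall>t. 0 \<le> t \<longrightarrow> t \<le> 1 \<longrightarrow> q t = pth xs t)))"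
proof -
  let ?N = "length xs"
  let ?f = "\<lambda>l. fac (fst (xs ! l))" and ?w = "\<lambda>l. snd (xs ! l)"
  define k where "k = (LEAST k. k < ?N \<and> dr (xs ! k) \<noteq> lam (?f k))"
  have "\<exists>k. k < ?N \<and> dr (xs ! k) \<noteq> lam (?f k)"
  proof -
    obtain p where p: "p \<in> set xs" "dr p \<noteq> lam (fac (fst p))" using ex by blast
    obtain k where k: "k < ?N" "xs ! k = p" using p(1) unfolding in_set_conv_nth by blast
    show ?thesis by (rule exI[of _ k]) (use k p(2) in simp)
  qed
  from LeastI_ex[OF this] have k: "k < ?N" "dr (xs ! k) \<noteq> lam (?f k)" unfolding k_def by simp_all
  have kl: "dr (xs ! l) = lam (?f l)" if "l < k" for l
    using not_less_Least[of l "\<lambda>k. k < ?N \<and> dr (xs ! k) \<noteq> lam (?f k)"] that k(1) unfolding k_def[symmetric] by auto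
  define m \<mu> where "m = ?f k" and "\<mu> = dr (xs ! k)"
  have sgl: "ach (fst (xs ! l) - ?f l) (dr (xs ! l)) (W (?w (Suc l)) (lam (?f l)))" if "Suc l < ?N" for l
    using seg_sg[OF Sokn[OF S], of l] nw_drop[of "Suc l" xs] that unfolding sg_def by simp
  have start: "et 0 (take k xs) = real m"
  proof (cases k)
    case 0
    have "fac (fst (xs ! 0)) = 0" using fac_eq(1)[OF seg_times[OF Sinc[OF S] k(1)]] 0 by simp
    then show ?thesis using 0 by (simp add: m_def)
  next
    case (Suc l)
    have lN: "Suc l < ?N" using Suc k(1) by simp
    have "fst (xs ! l) \<in> \<int>"
    proof (rule ccontr)
      assume nz: "fst (xs ! l) \<notin> \<int>"
      have f: "?f k = ?f l" using same_factor[OF S lN nz] Suc by simp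
      have "ge (lam (?f l)) (W (?w k) (lam (?f l)))"
        using ach_ge[OF sgl[OF lN]] kl[of l] Suc by simp
      then have "W (?w k) (lam (?f l)) = lam (?f l)" by (rule dom_top[OF dom_lam])
      then show False using k(2) f by (simp add: dr_def)
    qed
    moreover have e: "et 0 (take k xs) = fst (xs ! l)" using Suc lN by (simp add: et_take)
    ultimately have "et 0 (take k xs) = of_int \<lfloor>et 0 (take k xs)\<rfloor>" by (elim Ints_cases) simp
    then show ?thesis using fac_eq(2)[OF seg_times[OF Sinc[OF S] k(1)]] by (simp add: m_def)
  qed
  \<comment> \<open>The letters fixing all weights before \<open>k\<close>. By the Bruhat order
    every later word fixes these weights, so a reduced word of segment \<open>k\<close> uses only
    letters of \<open>Z\<close>.\<close>
  define Z where "Z = {i. \<forall>l<k. co i (lam (?f l)) = 0}"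
  have stab: "W (?w q) (lam (?f l)) = lam (?f l)" if "l < k" "k \<le> q" "q < ?N" for l q
  proof -
    have lN: "Suc l < ?N" using that by simp
    have "ge (lam (?f l)) (W (?w (Suc l)) (lam (?f l)))" using ach_ge[OF sgl[OF lN]] kl[OF that(1)] by simp
    moreover have "ge (W (?w (Suc l)) (lam (?f l))) (W (?w q) (lam (?f l)))"
      using that by (intro ble_ge[OF ble_later[OF Sokn[OF S]] dom_lam]) auto
    ultimately show ?thesis using dom_top[OF dom_lam] ge_trans by blast
  qed
  obtain y where y: "y \<approx> ?w k" "length y = len (?w k)" using len_ex by blast
  have yr: "len y = length y" using y len_cong by simp
  have yZ: "set y \<subseteq> Z"
  proof
    fix i assume i: "i \<in> set y"
    have "co i (lam (?f l)) = 0" if "l < k" for l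
      using orbit_cone[OF dom_lam yr, of "?f l"] stab[OF that order_refl k(1)] weq_act[OF y(1)] i by simp
    then show "i \<in> Z" by (simp add: Z_def)
  qed
  have muw: "\<mu> = W (?w k) (lam m)" by (simp add: \<mu>_def m_def dr_def)
  have muZ: "lam m - \<mu> \<in> cone al Z"
    using orbit_cone[OF dom_lam yr, of m] weq_act[OF y(1)] cone_mono[OF yZ, of al] muw by auto
  have domZ: "0 \<le> co s \<mu>" if s: "s \<in> Z" for s
  proof (cases "s \<in> Re")
    case True
    have "\<forall>p\<in>set (take k xs). co s (dr p) = 0"
    proof
      fix p assume "p \<in> set (take k xs)"
      then obtain l where "l < k" "p = xs ! l" using in_set_take k(1) by (metis less_imp_le)
      then show "co s (dr p) = 0" using kl s by (simp add: Z_def)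
    qed
    then have "hh s xs k = 0" unfolding hh_def by (rule tot_flat)
    then have "hh s xs k \<le> hh s xs (Suc k)" using nonneg[OF True, of "Suc k"] k(1) by simp
    then show ?thesis using hh_sign_le(1)[OF Sinc[OF S] k(1), of s] by (simp add: \<mu>_def)
  next
    case False
    then show ?thesis unfolding muw by (intro co_Im_orbit dom_lam) (simp add: Im_iff)
  qed
  let ?z = "\<lambda>q. nw (drop (Suc q) xs) []"
  \<comment> \<open>\<open>q\<close> ends the initial run with direction \<open>\<mu>\<close>: its
    chain is nontrivial. If the run reached the end of the factor, the condition there would put
    \<open>\<mu>\<close> in the real orbit, and \<open>re_orbit_dom\<close> would make it
    straight.\<close>
  have "\<exists>q. k \<le> q \<and> q < ?N \<and> (\<forall>l. k \<le> l \<longrightarrow> l \<le> q \<longrightarrow> ?f l = m \<and> dr (xs ! l) = \<mu>) \<and> W (?z q) (lam m) \<noteq> \<mu>"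
  proof (rule ccontr)
    assume none: "\<not> ?thesis"
    have stp: "fst (xs ! q) \<notin> \<int> \<and> W (?z q) (lam m) = \<mu>"
      if q: "k \<le> q" "q < ?N" "\<forall>l. k \<le> l \<longrightarrow> l \<le> q \<longrightarrow> ?f l = m \<and> dr (xs ! l) = \<mu>" for q
    proof
      show eq: "W (?z q) (lam m) = \<mu>" using none q by blast
      show "fst (xs ! q) \<notin> \<int>"
      proof
        assume iz: "fst (xs ! q) \<in> \<int>"
        have "sg bled (xs ! q) (?z q)" by (rule seg_sg[OF Sokn[OF S] q(2)])
        then have "W (?z q) (lam m) \<in> re_orbit co al (lam m)" using iz q unfolding sg_def by auto
        then have "\<mu> = lam m" using eq re_orbit_dom[OF dom_lam _ muZ domZ] by simp
        then show False using k(2) by (simp add: \<mu>_def m_def)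
      qed
    qed
    have all: "q < ?N \<longrightarrow> (\<forall>l. k \<le> l \<longrightarrow> l \<le> q \<longrightarrow> ?f l = m \<and> dr (xs ! l) = \<mu>)" if "k \<le> q" for q
      using that
    proof (induction q rule: dec_induct)
      case base
      then show ?case using m_def \<mu>_def by (auto dest: le_antisym)
    next
      case (step q)
      show ?case
      proof
        assume qN: "Suc q < ?N"
        have IH: "\<forall>l. k \<le> l \<longrightarrow> l \<le> q \<longrightarrow> ?f l = m \<and> dr (xs ! l) = \<mu>" using step qN by simp
        have st: "fst (xs ! q) \<notin> \<int>" "W (?z q) (lam m) = \<mu>" using stp[OF step(1) _ IH] qN by auto
        have f: "?f (Suc q) = m" using same_factor[OF S qN st(1)] IH step(1) by simp
        have "dr (xs ! Suc q) = \<mu>" using st(2) nw_drop[OF qN] f by (simp add: dr_def)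
        then show "\<forall>l. k \<le> l \<longrightarrow> l \<le> Suc q \<longrightarrow> ?f l = m \<and> dr (xs ! l) = \<mu>" using IH f by (auto simp: le_Suc_eq)
      qed
    qed
    obtain N' where N': "?N = Suc N'" using k(1) by (cases ?N) auto
    have "fst (xs ! N') = real n" using et_take[of N' xs 0] Set[OF S] N' by simp
    moreover have "fst (xs ! N') \<notin> \<int>" using stp[of N'] all[of N'] k(1) N' by simp
    ultimately show False by simp
  qed
  then obtain q where q: "k \<le> q" "q < ?N" "\<And>l. k \<le> l \<Longrightarrow> l \<le> q \<Longrightarrow> ?f l = m \<and> dr (xs ! l) = \<mu>"
    "W (?z q) (lam m) \<noteq> \<mu>" by blast
  define a where "a = fst (xs ! q) - real m"
  have sgq: "sg bled (xs ! q) (?z q)" by (rule seg_sg[OF Sokn[OF S] q(2)])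
  have "ach a \<mu> (W (?z q) (lam m))" using sgq q(1) q(3)[of q] unfolding sg_def a_def by simp
  then obtain \<eta> where eta: "acstep a \<mu> \<eta>" "ach a \<eta> (W (?z q) (lam m))" using q(4) by (metis converse_rtranclpE)
  obtain w0 where w0: "W w0 (lam m) = \<eta>" using ach_orbit[OF eta(2)] by blast
  obtain i where i: "i \<in> Im" "i \<in> Z" "\<mu> = r i \<eta>" "0 < co i \<eta>" "a * co i \<eta> = 1"
    using dominant_step[OF dom_lam eta(1) w0 muZ domZ] by blast
  have etaZ: "lam m - \<eta> \<in> cone al Z"
  proof (rule cone_add_restrict[OF indep_al])
    show "lam m - \<eta> \<in> cone al UNIV" using orbit_cone_UNIV[OF dom_lam, of m w0] w0 by simp
    show "co i \<eta> *\<^sub>R al i \<in> cone al UNIV" using i(4) by (simp add: cone_scale_base)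
    have "lam m - \<eta> + co i \<eta> *\<^sub>R al i = lam m - \<mu>" unfolding i(3) by (simp add: srefl_def)
    then show "lam m - \<eta> + co i \<eta> *\<^sub>R al i \<in> cone al Z" using muZ by (simp only:)
  qed
  obtain w where w: "W w (lam m) = \<eta>" "mv (lam m) (?z q) w"
    "\<forall>x'. (\<forall>k\<in>Z. co k x' = 0) \<longrightarrow> W (?z q) x' = x' \<longrightarrow> W w x' = x'"
    using ach_lift[OF eta(2) dom_lam etaZ] by blast
  have wl: "W w (lam (?f l)) = lam (?f l)" if "l < k" for l
  proof -
    have "W (?z q) (lam (?f l)) = lam (?f l)"
    proof (cases "Suc q < ?N")
      case True
      then show ?thesis using stab[OF that _ True] q(1) nw_drop[OF True] by simp
    next
      case False
      then show ?thesis by simp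
    qed
    moreover have "\<forall>k\<in>Z. co k (lam (?f l)) = 0" using that by (simp add: Z_def)
    ultimately show ?thesis using w(3) by blast
  qed
  let ?c = "\<lambda>p :: 'i seg. (fst p, w)"
  define A B D where "A = map ?c (take k xs)" and "B = map ?c (drop k (take (Suc q) xs))" and "D = drop (Suc q) xs"
  have tq: "take (Suc q) xs = take k xs @ drop k (take (Suc q) xs)"
    using append_take_drop_id[of k "take (Suc q) xs"] q(1) by (simp add: min_def)
  have "(take k xs @ drop k (take (Suc q) xs)) @ D = xs" unfolding tq[symmetric] D_def by (rule append_take_drop_id)
  then have xs: "xs = take k xs @ drop k (take (Suc q) xs) @ D" by simp
  have fB: "\<exists>l. k \<le> l \<and> l \<le> q \<and> p = xs ! l" if pB: "p \<in> set (drop k (take (Suc q) xs))" for p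
  proof -
    obtain l where l: "l < length (drop k (take (Suc q) xs))" "p = drop k (take (Suc q) xs) ! l"
      using pB unfolding in_set_conv_nth by blast
    have lk: "k + l \<le> q" using l(1) q(1,2) by simp
    have "k \<le> k + l" by simp
    moreover have "p = xs ! (k + l)" unfolding l(2) using lk q(2) by simp
    ultimately show ?thesis using lk by blast
  qed
  have etc: "et s (map ?c X) = et s X" "inc s (map ?c X) = inc s X" for s X by (induction X arbitrary: s) auto
  have drA: "dr (?c p) = dr p" if pA: "p \<in> set (take k xs)" for p
  proof -
    obtain l where "l < k" "p = xs ! l" using in_set_take[OF pA] k(1) by auto
    then show ?thesis using kl wl by (simp add: dr_def)
  qed
  have drB: "dr (?c p) = \<eta>" "dr p = \<mu>" if pB: "p \<in> set (drop k (take (Suc q) xs))" for p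
  proof -
    obtain l where l: "k \<le> l" "l \<le> q" "p = xs ! l" using fB[OF pB] by blast
    then show "dr (?c p) = \<eta>" "dr p = \<mu>" using q(3)[OF l(1,2)] w(1) by (auto simp: dr_def)
  qed
  have simA: "sim (take k xs) A" unfolding A_def sim_def list_all2_map2 list_all2_same using drA by simp
  have simB: "sim (drop k (take (Suc q) xs)) (flip i B)"
    unfolding B_def sim_def map_map comp_def list_all2_map2 list_all2_same
  proof
    fix p assume p: "p \<in> set (drop k (take (Suc q) xs))"
    show "fst p = fst (fst (?c p), i # snd (?c p)) \<and> dr p = dr (fst (?c p), i # snd (?c p))"
      unfolding dr_flip[of "?c p" i] drB[OF p] i(3)[symmetric] by simp
  qed
  have ii: "inc 0 (take k xs)" "inc (real m) (drop k (take (Suc q) xs))" "inc (et (real m) (drop k (take (Suc q) xs))) D"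
    and ee: "et (et (real m) (drop k (take (Suc q) xs))) D = real n"
  proof -
    have "inc 0 (take k xs @ drop k (take (Suc q) xs) @ D)" "et 0 (take k xs @ drop k (take (Suc q) xs) @ D) = real n"
      using Sinc[OF S] Set[OF S] by (simp_all only: xs[symmetric])
    then show "inc 0 (take k xs)" "inc (real m) (drop k (take (Suc q) xs))"
      "inc (et (real m) (drop k (take (Suc q) xs))) D" "et (et (real m) (drop k (take (Suc q) xs))) D = real n"
      unfolding inc_append et_append start by blast+
  qed
  have etA: "et 0 A = real m" using start by (simp add: A_def etc)
  have iB: "inc (real m) B" using ii(2) by (simp add: B_def etc)
  have iD: "inc (et (real m) B) D" "et (et (real m) B) D = real n" using ii(3) ee by (simp_all add: B_def etc)
  have iA: "inc 0 A" using ii(1) by (simp add: A_def etc)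
  have etB: "et (real m) B = fst (xs ! q)"
  proof -
    have "et 0 (take (Suc q) xs) = et (real m) (drop k (take (Suc q) xs))" using et_append[of 0 "take k xs" "drop k (take (Suc q) xs)"] start by (simp only: tq[symmetric])
    then show ?thesis using et_take[OF q(2)] by (simp add: B_def etc)
  qed
  have Bne: "B \<noteq> []" using q by (simp add: B_def)
  have posB: "\<forall>p\<in>set B. 0 < co i (dr p)" and cB: "\<forall>p\<in>set B. dr p = \<eta>" using drB(1) i(4) by (auto simp: B_def)
  have flatA: "\<forall>p\<in>set A. co i (dr p) = 0"
  proof
    fix p assume "p \<in> set A"
    then obtain p0 where p0: "p0 \<in> set (take k xs)" "p = ?c p0" by (auto simp: A_def)
    obtain l where "l < k" "p0 = xs ! l" using in_set_take[OF p0(1)] k(1) by auto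
    then show "co i (dr p) = 0" using drA[OF p0(1)] p0(2) kl i(2) by (simp add: Z_def)
  qed
  have tB: "co i (tot (real m) B) = 1" using tot_const[OF iB cB] etB i(5) by (simp add: a_def)
  have nnI: "0 \<le> co i (dr p)" for p unfolding dr_def by (rule co_Im_orbit[OF i(1) dom_lam])
  have incABD: "inc 0 (A @ B @ D)" "et 0 (A @ B @ D) = real n" using iA iB iD etA by (simp_all add: inc_append et_append)
  have okD: "okn bled D []" using Sokn[OF S] okn_append[of bled "take (Suc q) xs" "drop (Suc q) xs" "[]"] by (simp add: D_def)
  have okAB: "okn bled (A @ B) (nw D [])"
  proof -
    have AB: "A @ B = map ?c (take (Suc q) xs)" unfolding A_def B_def map_append[symmetric] by (simp only: tq[symmetric])
    have "okn bled (map ?c (drop l (take (Suc q) xs))) (nw D [])" if "l \<le> Suc q" for l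
      using that
    proof (induction l rule: inc_induct)
      case base
      then show ?case by simp
    next
      case (step l)
      have d: "drop l (take (Suc q) xs) = xs ! l # drop (Suc l) (take (Suc q) xs)"
        using step q(2) by (simp add: Cons_nth_drop_Suc[symmetric])
      let ?p = "xs ! l"
      have "sg bled (?c ?p) (nw (map ?c (drop (Suc l) (take (Suc q) xs))) (nw D []))"
      proof (cases "l = q")
        case True
        have "nw (map ?c (drop (Suc l) (take (Suc q) xs))) (nw D []) = ?z q" using True by (simp add: D_def)
        moreover have "dr (?c ?p) = \<eta>" using q(1) q(3)[of q] w(1) True by (simp add: dr_def)
        ultimately show ?thesis
          using sgq eta(2) mv_ble[OF w(2) dom_lam] q(1) q(3)[of q] True unfolding sg_def by (simp add: a_def)
      next
        case False
        then have lq: "l < q" using step by simp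
        then have "drop (Suc l) (take (Suc q) xs) \<noteq> []" using q(2) by simp
        then have nwl: "nw (map ?c (drop (Suc l) (take (Suc q) xs))) (nw D []) = w" by (cases "drop (Suc l) (take (Suc q) xs)") auto
        have "W w (lam (?f l)) \<in> re_orbit co al (lam (?f l))" if iz: "fst ?p \<in> \<int>"
        proof (cases "l < k")
          case True
          then have "W w (lam (?f l)) = W [] (lam (?f l))" using wl by simp
          then show ?thesis unfolding re_orbit_def by (intro CollectI exI[of _ "[]"]) simp
        next
          \<comment> \<open>Inside the block no break is at an integer time, since the next segment
            would then belong to the next factor.\<close>
          case ge: False
          have ff: "?f l = m" "?f (Suc l) = m" using q(3)[of l] q(3)[of "Suc l"] ge lq by auto
          have lN: "l < ?N" "Suc l < ?N" using lq q(2) by auto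
          have "fst ?p - real (?f l) = 1" by (rule frac_time(2)[OF seg_times[OF Sinc[OF S] lN(1)] iz])
          then have fp: "fst ?p = real m + 1" using ff by simp
          have "?f (Suc l) = nat \<lfloor>fst ?p\<rfloor>"
            using fac_eq(1)[OF seg_times[OF Sinc[OF S] lN(2)]] et_take[OF lN(1), of 0] by simp
          then show ?thesis using ff fp by simp
        qed
        then show ?thesis unfolding nwl sg_def by (simp add: dr_def ble_weq)
      qed
      then show ?case using step d by simp
    qed
    from this[of 0] show ?thesis using AB by simp
  qed
  have SY: "Sdata bled (A @ B @ D)" using incABD okAB okD by (simp add: Sdata_def okn_append nw_append)
  have px: "pth (A @ flip i B @ D) = pth xs"
  proof -
    have "sim xs (A @ flip i B @ D)"
      using sim_append[OF simA sim_append[OF simB sim_refl[of D]]] by (simp only: xs[symmetric])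
    then show ?thesis using sim_pth by metis
  qed
  have P: "0 \<le> co i (pth (A @ B @ D) t) \<and> (et 0 A < real n * t \<longrightarrow> 0 < co i (pth (A @ B @ D) t))" for t
  proof (intro conjI impI)
    show "0 \<le> co i (pth (A @ B @ D) t)" unfolding pth_def by (rule Q_nonneg[OF nnI])
    assume t: "et 0 A < real n * t"
    have "0 < 0 + co i (Q (real m) B (real n * t))"
    proof (rule Q_gt_start[OF iB])
      show "real m < real n * t" using t etA by simp
      fix Y Y' assume Y: "B = Y @ Y'" "Y \<noteq> []"
      have "inc (real m) Y" using iB Y by (simp add: inc_append)
      moreover have "\<forall>p\<in>set Y. 0 < co i (dr p)" using posB Y by auto
      ultimately show "0 < 0 + co i (tot (real m) Y)" using tot_pos[OF _ Y(2)] by simp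
    qed (use Bne in auto)
    moreover have "0 \<le> co i (Q (et (real m) B) D (real n * t))" by (rule Q_nonneg[OF nnI])
    ultimately show "0 < co i (pth (A @ B @ D) t)"
      using Q_flat[OF flatA, of 0 "real n * t"] etA by (simp add: pth_def Q_append)
  qed
  have fr: "\<exists>q. froot co al i path = Some q \<and> (\<forall>t. 0 \<le> t \<longrightarrow> t \<le> 1 \<longrightarrow> q t = pth xs t)"
    if path: "\<forall>t. 0 \<le> t \<longrightarrow> t \<le> 1 \<longrightarrow> path t = pth (A @ B @ D) t" for path
  proof -
    have "\<exists>q. froot co al i path = Some q \<and> (\<forall>t. 0 \<le> t \<longrightarrow> t \<le> 1 \<longrightarrow> q t = pth (A @ flip i B @ D) t)"
    proof (rule froot_data[where M = 0, OF incABD Bne posB Ints_0])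
      show "co i (tot 0 A) = 0" by (rule tot_flat[OF flatA])
      show "co i (tot (et 0 A) B) = 1" using tB etA by simp
      show "0 \<le> co i (pth (A @ B @ D) t)" for t using P by blast
      show "0 < co i (pth (A @ B @ D) t)" if "et 0 A < real n * t" for t using P that by blast
      show "path t = pth (A @ B @ D) t" if "0 \<le> t" "t \<le> 1" for t using path that by simp
    qed
    then show ?thesis using px by simp
  qed
  have "pth (A @ B @ D) 1 = pth xs 1 + al i"
  proof -
    have "inc 0 (A @ flip i B @ D)" "et 0 (A @ flip i B @ D) = real n"
      using incABD by (auto simp: inc_append et_append flip_eqs)
    then have "pth xs 1 = tot 0 (A @ flip i B @ D)" unfolding px[symmetric] pth_def using Q_after[of 0 "A @ flip i B @ D"] by simp
    moreover have "pth (A @ B @ D) 1 = tot 0 (A @ B @ D)" unfolding pth_def using Q_after[OF incABD(1)] incABD(2) by simp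
    moreover have "r i (tot (real m) B) = tot (real m) B - al i" using tB by (simp add: srefl_def)
    ultimately show ?thesis using etA by (simp add: tot_append tot_refl flip_eqs)
  qed
  then show ?thesis using SY fr by blast
qed

text \<open>The concatenation of the straight lines, in the time scale of segment lists.\<close>

definition LF :: "real \<Rightarrow> 'v" where
  "LF s = (\<Sum>m<nat \<lfloor>s\<rfloor>. lam m) + (s - of_int \<lfloor>s\<rfloor>) *\<^sub>R lam (nat \<lfloor>s\<rfloor>)"

lemma LF_seg: assumes "0 \<le> s" "s < \<tau>" "\<tau> \<le> of_int \<lfloor>s\<rfloor> + 1" shows "LF \<tau> = LF s + (\<tau> - s) *\<^sub>R lam (fac \<tau>)"
proof -
  have f: "fac \<tau> = nat \<lfloor>s\<rfloor>" "real (fac \<tau>) = of_int \<lfloor>s\<rfloor>" using fac_eq[OF assms] by auto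
  have Ls: "LF s = (\<Sum>m<fac \<tau>. lam m) + (s - real (fac \<tau>)) *\<^sub>R lam (fac \<tau>)" unfolding LF_def f(2) by (simp add: f(1))
  have "LF \<tau> = (\<Sum>m<fac \<tau>. lam m) + (\<tau> - real (fac \<tau>)) *\<^sub>R lam (fac \<tau>)"
  proof (cases "\<tau> \<in> \<int>")
    case True
    have e: "\<tau> = real (fac \<tau>) + 1" using frac_time(2)[OF assms True] by simp
    then have "\<lfloor>\<tau>\<rfloor> = int (fac \<tau>) + 1" by linarith
    then have g: "nat \<lfloor>\<tau>\<rfloor> = Suc (fac \<tau>)" "\<tau> - of_int \<lfloor>\<tau>\<rfloor> = 0" "\<tau> - real (fac \<tau>) = 1" using e by auto
    show ?thesis unfolding LF_def g by simp
  next
    case False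
    then show ?thesis using frac_time(3)[OF assms False] by (simp add: LF_def)
  qed
  then show ?thesis using Ls by (simp flip: scaleR_left_distrib)
qed

lemma LF_0 [simp]: "LF 0 = 0" by (simp add: LF_def)

lemma line_Q:
  assumes "inc s xs" "0 \<le> s" "\<forall>p\<in>set xs. dr p = lam (fac (fst p))" "s \<le> t" "t \<le> et s xs"
  shows "Q s xs t = LF t - LF s"
  using assms
proof (induction xs arbitrary: s)
  case (Cons p xs)
  have i: "s < fst p" "fst p \<le> of_int \<lfloor>s\<rfloor> + 1" "inc (fst p) xs" using Cons.prems by auto
  have d: "dr p = lam (fac (fst p))" using Cons.prems by simp
  show ?case
  proof (cases "t \<le> fst p")
    case True
    have "Q (fst p) xs t = 0" by (rule Q_before[OF i(3) True])
    moreover have "LF t = LF s + (t - s) *\<^sub>R lam (fac (fst p))"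
    proof (cases "s = t")
      case False
      then have st: "s < t" using Cons.prems by simp
      have "fac t = fac (fst p)" by (rule fac_split[OF Cons.prems(2) st True i(2)])
      then show ?thesis using LF_seg[OF Cons.prems(2) st] True i(2) by simp
    qed simp
    ultimately show ?thesis using True d Cons.prems(4) by simp
  next
    case False
    have "Q (fst p) xs t = LF t - LF (fst p)" using Cons.IH[OF i(3)] Cons.prems i False by simp
    then show ?thesis using LF_seg[OF Cons.prems(2) i(1,2)] False i(1) d by simp
  qed
qed simp

text \<open>Every direction is the straight one minus a nonnegative combination of simple roots, so
  the height of the deficit is nonnegative and can serve as a measure.\<close>

lemma tot_cone: "inc s xs \<Longrightarrow> 0 \<le> s \<Longrightarrow> LF (et s xs) - LF s - tot s xs \<in> cone al UNIV"
proof (induction xs arbitrary: s)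
  case (Cons p xs)
  have i: "s < fst p" "fst p \<le> of_int \<lfloor>s\<rfloor> + 1" "inc (fst p) xs" using Cons.prems by auto
  have "lam (fac (fst p)) - dr p \<in> cone al UNIV" unfolding dr_def by (rule orbit_cone_UNIV[OF dom_lam])
  then have 1: "(fst p - s) *\<^sub>R (lam (fac (fst p)) - dr p) \<in> cone al UNIV" using i(1) by (intro cone_scale) auto
  have 2: "LF (et (fst p) xs) - LF (fst p) - tot (fst p) xs \<in> cone al UNIV" using Cons.IH[OF i(3)] Cons.prems i by simp
  have 3: "LF (et s (p # xs)) - LF s - tot s (p # xs) = (fst p - s) *\<^sub>R (lam (fac (fst p)) - dr p) +
    (LF (et (fst p) xs) - LF (fst p) - tot (fst p) xs)"
    using LF_seg[OF Cons.prems(2) i(1,2)] by (simp add: scaleR_diff_right)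
  show ?case unfolding 3 by (rule cone_add[OF 1 2])
qed (simp add: cone_0)

theorem Sdata_standard:
  assumes "Sdata bled xs" "\<And>t. 0 \<le> t \<Longrightarrow> t \<le> 1 \<Longrightarrow> path t = LF (real n * t)"
  shows "\<exists>F q. apply_F co al F path = Some q \<and> (\<forall>t. 0 \<le> t \<longrightarrow> t \<le> 1 \<longrightarrow> q t = pth xs t)"
proof -
  have cn: "LF (real n) - pth xs 1 \<in> cone al UNIV" if "Sdata bled xs" for xs
  proof -
    have "pth xs 1 = tot 0 xs" unfolding pth_def using Q_after[OF Sinc[OF that]] Set[OF that] by simp
    then show ?thesis using tot_cone[OF Sinc[OF that]] Set[OF that] by simp
  qed
  have "\<exists>F q. apply_F co al F path = Some q \<and> (\<forall>t. 0 \<le> t \<longrightarrow> t \<le> 1 \<longrightarrow> q t = pth xs t)"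
    if "Sdata bled xs" "ht (LF (real n) - pth xs 1) \<le> real N" for N xs
    using that
  proof (induction N arbitrary: xs rule: nat_less_induct)
    case (1 N)
    show ?case
    proof (cases "\<forall>p\<in>set xs. dr p = lam (fac (fst p))")
      case True
      have "pth xs t = LF (real n * t)" if "0 \<le> t" "t \<le> 1" for t
        unfolding pth_def using line_Q[OF Sinc[OF "1"(2)] _ True, of "real n * t"] Set[OF "1"(2)] that n1
        by (simp add: mult_left_le)
      then show ?thesis using assms(2) by (intro exI[of _ "[]"] exI[of _ path]) (simp add: apply_F_def)
    next
      case False
      have "\<exists>ys i. Sdata bled ys \<and> pth ys 1 = pth xs 1 + al i \<and>
        (\<forall>path. (\<forall>t. 0 \<le> t \<longrightarrow> t \<le> 1 \<longrightarrow> path t = pth ys t) \<longrightarrow>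
          (\<exists>q. froot co al i path = Some q \<and> (\<forall>t. 0 \<le> t \<longrightarrow> t \<le> 1 \<longrightarrow> q t = pth xs t)))"
      proof (cases "\<exists>j k. j \<in> Re \<and> k \<le> length xs \<and> hh j xs k < 0")
        case True
        then obtain j k where "j \<in> Re" "k \<le> length xs" "hh j xs k < 0" by blast
        then show ?thesis using e_real[OF "1"(2)] by blast
      next
        case nn: False
        then have "0 \<le> hh j xs k" if "j \<in> Re" "k \<le> length xs" for j k using that by (meson not_less)
        moreover have "\<exists>p\<in>set xs. dr p \<noteq> lam (fac (fst p))" using False by blast
        ultimately show ?thesis using e_Im[OF "1"(2)] by blast
      qed
      then obtain ys i where ys: "Sdata bled ys" "pth ys 1 = pth xs 1 + al i"
        "\<forall>path. (\<forall>t. 0 \<le> t \<longrightarrow> t \<le> 1 \<longrightarrow> path t = pth ys t) \<longrightarrow>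
          (\<exists>q. froot co al i path = Some q \<and> (\<forall>t. 0 \<le> t \<longrightarrow> t \<le> 1 \<longrightarrow> q t = pth xs t))" by blast
      have e: "LF (real n) - pth ys 1 = (LF (real n) - pth xs 1) - 1 *\<^sub>R al i" using ys(2) by simp
      have h: "ht (LF (real n) - pth ys 1) = ht (LF (real n) - pth xs 1) - 1"
        unfolding e by (rule ht_sub_al[OF cone_sp[OF cn[OF "1"(2)]]])
      have "0 \<le> ht (LF (real n) - pth ys 1)" by (rule ht_nonneg[OF cn[OF ys(1)]])
      then have N1: "N \<ge> 1" using h "1"(3) by (cases N) auto
      then have "ht (LF (real n) - pth ys 1) \<le> real (N - 1)" using h "1"(3) by (simp add: of_nat_diff)
      moreover have "N - 1 < N" using N1 by simp
      ultimately obtain F q where F: "apply_F co al F path = Some q" "\<forall>t. 0 \<le> t \<longrightarrow> t \<le> 1 \<longrightarrow> q t = pth ys t"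
        using "1"(1) ys(1) by blast
      obtain q' where "froot co al i q = Some q'" "\<forall>t. 0 \<le> t \<longrightarrow> t \<le> 1 \<longrightarrow> q' t = pth xs t" using ys(3) F(2) by blast
      then show ?thesis using F(1) by (intro exI[of _ "i # F"] exI[of _ q']) (simp add: apply_F_def)
    qed
  qed
  moreover have "ht (LF (real n) - pth xs 1) \<le> real (nat \<lceil>ht (LF (real n) - pth xs 1)\<rceil>)" by linarith
  ultimately show ?thesis using assms(1) by blast
qed

theorem standard_Sdata:
  assumes "\<And>t. 0 \<le> t \<Longrightarrow> t \<le> 1 \<Longrightarrow> path t = LF (real n * t)" "apply_F co al F path = Some q"
  shows "\<exists>xs. Sdata mv xs \<and> (\<forall>t. 0 \<le> t \<longrightarrow> t \<le> 1 \<longrightarrow> q t = pth xs t)"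
  using assms(2)
proof (induction F arbitrary: q)
  case Nil
  \<comment> \<open>One segment per factor, all with the empty word and trivial chains.\<close>
  define X where "X l = map (\<lambda>k. (real (Suc k), [] :: 'i list)) [l..<n]" for l
  have f: "fac (real (Suc k)) = k" for k unfolding fac_def by (simp only: ceiling_of_nat)
  have sgX: "sg mv (real (Suc k), []) []" for k
    unfolding sg_def dr_def re_orbit_def using f[of k] by (auto intro!: exI[of _ "[]"])
  have XX: "inc (real l) (X l) \<and> et (real l) (X l) = real n \<and> okn mv (X l) []" if "l \<le> n" for l
    using that
  proof (induction l rule: inc_induct)
    case base
    then show ?case by (simp add: X_def)
  next
    case (step l)
    have X: "X l = (real (Suc l), []) # X (Suc l)" using step(2) by (simp add: X_def upt_conv_Cons)
    have "nw (X (Suc l)) [] = []" by (cases "X (Suc l)") (auto simp: X_def)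
    then show ?case using step X sgX[of l] by simp
  qed
  have S: "Sdata mv (X 0)" using XX[of 0] by (simp add: Sdata_def)
  have "\<forall>p\<in>set (X 0). dr p = lam (fac (fst p))" by (auto simp: X_def dr_def)
  then have "pth (X 0) t = LF (real n * t)" if "0 \<le> t" "t \<le> 1" for t
    unfolding pth_def using line_Q[OF Sinc[OF S], of "real n * t"] Set[OF S] that n1 by (simp add: mult_left_le)
  then show ?case using S Nil assms(1) by (intro exI[of _ "X 0"]) (simp add: apply_F_def)
next
  case (Cons i F)
  obtain q0 where q0: "apply_F co al F path = Some q0" "froot co al i q0 = Some q"
    using Cons.prems by (auto simp: apply_F_def bind_eq_Some_conv)
  obtain xs where xs: "Sdata mv xs" "\<forall>t. 0 \<le> t \<longrightarrow> t \<le> 1 \<longrightarrow> q0 t = pth xs t" using Cons.IH[OF q0(1)] by blast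
  show ?case
  proof (cases "i \<in> Re")
    case True
    then show ?thesis using f_real_closed[OF xs(1) True _ q0(2)] xs(2) by blast
  next
    case False
    then show ?thesis using f_Im_closed[OF xs(1) _ _ q0(2)] xs(2) Im_iff by blast
  qed
qed

end

section \<open>Concatenations of GLS paths\<close>

lemma tensor_cong: "1 \<le> n \<Longrightarrow> (\<And>m. m < n \<Longrightarrow> ps m = qs m) \<Longrightarrow> tensor n ps = tensor n qs"
  by (auto simp: tensor_def Let_def fun_eq_iff intro!: sum.cong)

text \<open>At a positive integer time the ceiling in \<open>tensor\<close> selects the factor that
  ends there; the next factor gives the same value because its path starts at 0.\<close>

lemma tensor_at:
  assumes "m < n" "real m \<le> s" "s \<le> real m + 1" "\<And>m. m < n \<Longrightarrow> ps m 0 = 0"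
  shows "tensor n ps (s / real n) = (\<Sum>l<m. ps l 1) + ps m (s - real m)"
proof (cases "s = real m \<and> m \<noteq> 0")
  case False
  have "nat (\<lceil>s\<rceil> - 1) = m"
  proof (cases "s = real m")
    case True
    then have "m = 0" "s = 0" using False by auto
    then show ?thesis by simp
  next
    case ne: False
    then have "\<lceil>s\<rceil> = int m + 1" using assms(2,3) by (intro ceiling_unique) auto
    then show ?thesis by simp
  qed
  moreover have "min (n - 1) m = m" using assms(1) by simp
  ultimately show ?thesis using assms(1) by (simp add: tensor_def Let_def)
next
  case True
  then obtain k where k: "m = Suc k" "s = real (Suc k)" by (cases m) auto
  have "nat (\<lceil>s\<rceil> - 1) = k" unfolding k(2) ceiling_of_nat by simp
  moreover have "min (n - 1) k = k" using assms(1) k by simp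
  ultimately show ?thesis using assms(1,4) k by (simp add: tensor_def Let_def)
qed

lemma real_segment:
  assumes "1 \<le> n" "0 \<le> s" "s \<le> real n"
  shows "\<exists>m<n. real m \<le> s \<and> s \<le> real m + 1"
proof (cases "s = 0")
  case True
  then show ?thesis using assms(1) by (intro exI[of _ 0]) auto
next
  case False
  then have "real (nat (\<lceil>s\<rceil> - 1)) = of_int (\<lceil>s\<rceil> - 1)" using assms(2) by simp
  moreover have "\<lceil>s\<rceil> - 1 < int n" using assms(3) by linarith
  ultimately show ?thesis using assms(1) False by (intro exI[of _ "nat (\<lceil>s\<rceil> - 1)"]) linarith
qed

context bc
begin

text \<open>A reduced word is built up by edges, so the identity is least. This supplies the
  comparison with the empty word that closes \<open>Sdata\<close>.\<close>

lemma ble_Nil: "ble [] w"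
proof -
  have "ble [] y" if "len y = length y" for y
    using that
  proof (induction y)
    case Nil
    show ?case by (rule ble_weq[OF weq_refl'])
  next
    case (Cons i y)
    have y: "len y = length y" "len y < len (i # y)" using red_tl[OF Cons.prems] by auto
    have "be y (i # y)"
      unfolding bedge_def using rrep_Nil[of i] y(2) by (intro exI[of _ "[]"] exI[of _ i]) (simp add: rword_def)
    then show ?case using ble_trans[OF Cons.IH[OF y(1)] ble_be] by blast
  qed
  moreover obtain y where y: "y \<approx> w" "length y = len w" using len_ex by blast
  ultimately have "ble [] y" using len_cong[OF y(1)] by simp
  then show ?thesis by (rule ble_trans[OF _ ble_weq[OF y(1)]])
qed

end

context paths
begin

lemma LF_nat: "LF (real m) = (\<Sum>l<m. lam l)" by (simp add: LF_def)

lemma tensor_lines: assumes "0 \<le> t" "t \<le> 1" shows "tensor n (\<lambda>m. path_line (lam m)) t = LF (real n * t)"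
proof -
  let ?s = "real n * t"
  have s: "0 \<le> ?s" "?s \<le> real n" using assms n1 by (auto simp: mult_left_le)
  obtain m where m: "m < n" "real m \<le> ?s" "?s \<le> real m + 1" using real_segment[OF n1 s] by blast
  have "tensor n (\<lambda>m. path_line (lam m)) (?s / real n) = (\<Sum>l<m. lam l) + (?s - real m) *\<^sub>R lam m"
    using tensor_at[OF m, of "\<lambda>m. path_line (lam m)"] by (simp add: path_line_def)
  also have "\<dots> = LF ?s"
  proof (cases "?s = real m")
    case True
    then show ?thesis by (simp add: LF_nat)
  next
    case False
    then have lt: "real m < ?s" using m by simp
    have u: "?s \<le> of_int \<lfloor>real m\<rfloor> + 1" using m(3) by simp
    have "fac ?s = m" using fac_eq(1)[OF _ lt u] by simp
    then show ?thesis using LF_seg[OF _ lt u] by (simp add: LF_nat)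
  qed
  finally show ?thesis using n1 by simp
qed

lemma okn_mono: "okn C xs z \<Longrightarrow> (\<And>m u v. C (lam m) u v \<Longrightarrow> C' (lam m) u v) \<Longrightarrow> okn C' xs z"
  by (induction xs) (auto simp: sg_def)

lemma Q_slope:
  assumes "inc 0 xs" "k < length xs" "et 0 (take k xs) \<le> s" "s \<le> t" "t \<le> fst (xs ! k)"
  shows "Q 0 xs t - Q 0 xs s = (t - s) *\<^sub>R dr (xs ! k)"
proof -
  let ?A = "take k xs" and ?B = "drop (Suc k) xs"
  have xs: "?A @ xs ! k # ?B = xs" using take_split[OF assms(2)] by simp
  have "inc 0 (?A @ xs ! k # ?B)" using assms(1) by (simp only: xs)
  then have i: "inc 0 ?A" "inc (fst (xs ! k)) ?B" "et 0 ?A < fst (xs ! k)" by (auto simp: inc_append)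
  have "Q 0 (?A @ xs ! k # ?B) u = tot 0 ?A + (u - et 0 ?A) *\<^sub>R dr (xs ! k)" if "et 0 ?A \<le> u" "u \<le> fst (xs ! k)" for u
    using Q_after[OF i(1) that(1)] Q_before[OF i(2) that(2)] that unfolding Q_append by simp
  then have "Q 0 xs u = tot 0 ?A + (u - et 0 ?A) *\<^sub>R dr (xs ! k)" if "et 0 ?A \<le> u" "u \<le> fst (xs ! k)" for u
    using that by (simp only: xs)
  then show ?thesis using assms(3-5) by (simp flip: scaleR_left_diff_distrib)
qed

fun lin :: "(real \<Rightarrow> 'v) \<Rightarrow> real \<Rightarrow> 'i seg list \<Rightarrow> bool" where
  "lin T s [] \<longleftrightarrow> True"
| "lin T s (p # xs) \<longleftrightarrow> (\<forall>t. s \<le> t \<longrightarrow> t \<le> fst p \<longrightarrow> T t = T s + (t - s) *\<^sub>R dr p) \<and> lin T (fst p) xs"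

lemma lin_append: "lin T s (A @ B) \<longleftrightarrow> lin T s A \<and> lin T (et s A) B" by (induction A arbitrary: s) auto

lemma lin_Q: "inc s xs \<Longrightarrow> lin T s xs \<Longrightarrow> s \<le> t \<Longrightarrow> t \<le> et s xs \<Longrightarrow> Q s xs t = T t - T s"
proof (induction xs arbitrary: s)
  case (Cons p xs)
  have i: "s < fst p" "inc (fst p) xs" and l: "lin T (fst p) xs" using Cons.prems(1,2) unfolding lin.simps inc.simps by blast+
  have "\<forall>t. s \<le> t \<longrightarrow> t \<le> fst p \<longrightarrow> T t = T s + (t - s) *\<^sub>R dr p" using Cons.prems(2) unfolding lin.simps by blast
  then have T: "T u = T s + (u - s) *\<^sub>R dr p" if "s \<le> u" "u \<le> fst p" for u using that by blast
  show ?case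
  proof (cases "t \<le> fst p")
    case True
    then show ?thesis using T[of t] Q_before[OF i(2) True] Cons.prems(3) by simp
  next
    case False
    have "Q (fst p) xs t = T t - T (fst p)" using Cons.IH[OF i(2) l] Cons.prems(3,4) False by simp
    then show ?thesis using T[of "fst p"] False i(1) by simp
  qed
qed simp

end

section \<open>GLS paths compared with segment lists\<close>

locale gls_paths = paths co al P n lam for co :: "'i::countable \<Rightarrow> 'v::real_vector \<Rightarrow> real" and al P n lam +
  fixes p :: "nat \<Rightarrow> 'v list \<times> real list"
  assumes gls: "m < n \<Longrightarrow> is_GLS co al (lam m) (p m)"
begin

abbreviation kap where "kap m \<equiv> length (fst (p m))"
abbreviation ll where "ll m l \<equiv> fst (p m) ! l"
abbreviation ae where "ae m l \<equiv> snd (p m) ! l"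
definition ap :: "nat \<Rightarrow> nat \<Rightarrow> real" where "ap m l = (if l = 0 then 0 else ae m (l - 1))"

lemma ap_0 [simp]: "ap m 0 = 0" and ap_Suc [simp]: "ap m (Suc l) = ae m l" by (simp_all add: ap_def)

context
  fixes m assumes m: "m < n"
begin

lemma kap1: "1 \<le> kap m" and a0: "0 < ae m 0" and a_lt: "Suc l < kap m \<Longrightarrow> ae m l < ae m (Suc l)"
  and a_last: "ae m (kap m - 1) = 1"
  and a_ch: "Suc l < kap m \<Longrightarrow> a_chain co al (ae m l) (ll m l) (ll m (Suc l))"
  and a_ch1: "a_chain co al 1 (ll m (kap m - 1)) (lam m)"
  using gls[OF m] unfolding is_GLS_def Let_def by auto

lemma kne: "fst (p m) \<noteq> []" using kap1 by (cases "fst (p m)") simp_all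

lemma a_pos: "l < kap m \<Longrightarrow> 0 < ae m l"
proof (induction l)
  case (Suc l)
  then show ?case using a_lt[of l] by simp
qed (rule a0)

lemma a_less: "k < l \<Longrightarrow> l < kap m \<Longrightarrow> ae m k < ae m l"
proof (induction l rule: less_Suc_induct)
  case (1 l)
  then show ?case by (rule a_lt)
qed simp

lemma a_le1: assumes "l < kap m" shows "ae m l \<le> 1"
proof (cases "l = kap m - 1")
  case False
  then have "l < kap m - 1" "kap m - 1 < kap m" using assms by linarith+
  from a_less[OF this] show ?thesis unfolding a_last by simp
qed (use a_last in simp)

lemma a_lt1: "Suc l < kap m \<Longrightarrow> ae m l < 1" using a_lt[of l] a_le1[of "Suc l"] by simp

lemma ap_lt: "l < kap m \<Longrightarrow> ap m l < ae m l"
  using a0 a_lt[of "l - 1"] by (cases l) auto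

lemma ap_ge0: "l \<le> kap m \<Longrightarrow> 0 \<le> ap m l"
  using a_pos[of "l - 1"] by (cases l) auto

lemma path_of_at:
  assumes l: "l < kap m" "ap m l \<le> t" "t \<le> ae m l"
  shows "path_of (p m) t = (\<Sum>k<l. (ae m k - ap m k) *\<^sub>R ll m k) + (t - ap m l) *\<^sub>R ll m l"
proof -
  have e: "\<exists>s<kap m. t \<le> ae m s" using l by blast
  have P: "path_of (p m) t = (\<Sum>k<s. (ae m k - ap m k) *\<^sub>R ll m k) + (t - ap m s) *\<^sub>R ll m s"
    if "(LEAST s. s < kap m \<and> t \<le> ae m s) = s" for s
    unfolding path_of_def Let_def ap_def[abs_def] using e that by simp
  show ?thesis
  proof (cases "l \<noteq> 0 \<and> t = ap m l")
    case False
    have "(LEAST s. s < kap m \<and> t \<le> ae m s) = l"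
    proof (rule Least_equality)
      fix s assume s: "s < kap m \<and> t \<le> ae m s"
      show "l \<le> s"
      proof (rule ccontr)
        assume "\<not> l \<le> s"
        then obtain k where k: "l = Suc k" "s \<le> k" by (cases l) auto
        have "ae m s \<le> ae m k" using a_less[of s k] k l(1) by (cases "s = k") auto
        then show False using False l(2) k s by simp
      qed
    qed (use l in simp)
    then show ?thesis by (rule P)
  next
    \<comment> \<open>At a break point the \<open>LEAST\<close> in \<open>path_of\<close> picks the
      earlier piece; both formulas agree there.\<close>
    case True
    then obtain k where k: "l = Suc k" "t = ae m k" by (cases l) auto
    have "(LEAST s. s < kap m \<and> t \<le> ae m s) = k"
    proof (rule Least_equality)
      fix s assume s: "s < kap m \<and> t \<le> ae m s"
      show "k \<le> s" using a_less[of s k] s k l(1) by (cases "s < k") auto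
    qed (use k l(1) in simp)
    from P[OF this] show ?thesis using k by simp
  qed
qed

lemma path_of_0: "path_of (p m) 0 = 0" 
proof -
  have "0 < kap m" using kap1 by linarith
  from path_of_at[OF this, of 0] show ?thesis using a0 by simp
qed

end

definition T :: "real \<Rightarrow> 'v" where "T s = tensor n (\<lambda>m. path_of (p m)) (s / real n)"

lemma T_0: "T 0 = 0"
  using tensor_at[of 0 n 0 "\<lambda>m. path_of (p m)"] path_of_0 n1 by (simp add: T_def)

lemma T_slope:
  assumes "m < n" "l < kap m" "real m + ap m l \<le> s" "s \<le> t" "t \<le> real m + ae m l"
  shows "T t - T s = (t - s) *\<^sub>R ll m l"
proof -
  have T: "T u = (\<Sum>k<m. path_of (p k) 1) + ((\<Sum>k<l. (ae m k - ap m k) *\<^sub>R ll m k) + (u - real m - ap m l) *\<^sub>R ll m l)"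
    if u: "real m + ap m l \<le> u" "u \<le> real m + ae m l" for u
  proof -
    have "real m \<le> u" "u \<le> real m + 1" using u ap_ge0[OF assms(1), of l] a_le1[OF assms(1,2)] assms(2) by auto
    then have "T u = (\<Sum>k<m. path_of (p k) 1) + path_of (p m) (u - real m)"
      unfolding T_def by (intro tensor_at assms(1) path_of_0)
    then show ?thesis using path_of_at[OF assms(1,2), of "u - real m"] u by simp
  qed
  show ?thesis using T[of s] T[of t] assms(3-5) by (simp flip: scaleR_left_diff_distrib)
qed

text \<open>A segment and a piece of a GLS path that overlap in an interval of positive length
  describe the same linear function on it.\<close>

lemma slopes_agree:
  assumes "inc 0 xs" "\<And>s. 0 \<le> s \<Longrightarrow> s \<le> real n \<Longrightarrow> Q 0 xs s = T s" "k < length xs" "m < n" "l < kap m"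
    "et 0 (take k xs) < real m + ae m l" "real m + ap m l < fst (xs ! k)"
  shows "dr (xs ! k) = ll m l"
proof -
  define s t where "s = max (et 0 (take k xs)) (real m + ap m l)" and "t = min (fst (xs ! k)) (real m + ae m l)"
  have st: "s < t" unfolding s_def t_def
    using assms(6,7) ap_lt[OF assms(4,5)] seg_times(2)[OF assms(1,3)] by simp
  have "0 \<le> s" using seg_times(1)[OF assms(1,3)] by (simp add: s_def le_max_iff_disj)
  moreover have "real m + ae m l \<le> real n" using a_le1[OF assms(4,5)] assms(4) by linarith
  then have "t \<le> real n" by (simp add: t_def min_le_iff_disj)
  ultimately have "T t - T s = Q 0 xs t - Q 0 xs s" using assms(2) st by simp
  also have "\<dots> = (t - s) *\<^sub>R dr (xs ! k)"
    using st by (intro Q_slope[OF assms(1,3)]) (auto simp: s_def t_def)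
  finally have b: "T t - T s = (t - s) *\<^sub>R dr (xs ! k)" .
  have a: "T t - T s = (t - s) *\<^sub>R ll m l"
    using st by (intro T_slope[OF assms(4,5)]) (auto simp: s_def t_def)
  have "(t - s) *\<^sub>R dr (xs ! k) = (t - s) *\<^sub>R ll m l" by (rule trans[OF b[symmetric] a])
  then show ?thesis using st by simp
qed

definition chain_cond :: "(nat \<Rightarrow> nat \<Rightarrow> 'i list) \<Rightarrow> bool" where
  "chain_cond w \<longleftrightarrow> (\<forall>m<n. \<forall>l<kap m. W (w m l) (lam m) = ll m l) \<and>
     (\<forall>m<n. \<forall>l. l + 1 < kap m \<longrightarrow> ble (w m (l+1)) (w m l)) \<and>
     (\<forall>m. m + 1 < n \<longrightarrow> ble (w (m+1) 0) (w m (kap m - 1))) \<and>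
     (\<forall>m. m + 1 < n \<longrightarrow> W (w (m+1) 0) (lam m) \<in> re_orbit co al (lam m)) \<and>
     (\<forall>m. m + 1 < n \<longrightarrow> a_chain co al 1 (last (fst (p m))) (W (w (m+1) 0) (lam m)))"

text \<open>The segment list may break more often than the GLS paths, so \<open>w m l\<close> is
  read off at the start of the \<open>l\<close>-th piece of factor \<open>m\<close>. Later times
  give later segments and hence smaller words.\<close>

lemma Sdata_chain:
  assumes S: "Sdata mv xs" and QT: "\<And>s. 0 \<le> s \<Longrightarrow> s \<le> real n \<Longrightarrow> Q 0 xs s = T s"
  shows "\<exists>w. chain_cond w"
proof -
  let ?N = "length xs"
  \<comment> \<open>Segments count as half-open here: a break point belongs to the segment that
    starts there.\<close>
  define kk where "kk \<sigma> = (LEAST k. k < ?N \<and> \<sigma> < fst (xs ! k))" for \<sigma>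
  have kk: "kk \<sigma> < ?N" "\<sigma> < fst (xs ! kk \<sigma>)" "et 0 (take (kk \<sigma>) xs) \<le> \<sigma>" if sig: "0 \<le> \<sigma>" "\<sigma> < real n" for \<sigma>
  proof -
    have "fst (xs ! (?N - 1)) = real n" using et_take[of "?N - 1" xs 0] Set[OF S] Sne[OF S] by simp
    then have "\<exists>k. k < ?N \<and> \<sigma> < fst (xs ! k)" using sig Sne[OF S] by (intro exI[of _ "?N - 1"]) simp
    from LeastI_ex[OF this] show k: "kk \<sigma> < ?N" "\<sigma> < fst (xs ! kk \<sigma>)" unfolding kk_def by simp_all
    show "et 0 (take (kk \<sigma>) xs) \<le> \<sigma>"
    proof (cases "kk \<sigma>")
      case 0
      then show ?thesis using sig by simp
    next
      case (Suc j)
      then have "\<not> (j < ?N \<and> \<sigma> < fst (xs ! j))" using not_less_Least[of j "\<lambda>k. k < ?N \<and> \<sigma> < fst (xs ! k)"]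
        unfolding kk_def by simp
      then show ?thesis using Suc k(1) et_take[of j xs 0] by simp
    qed
  qed
  have kk_le: "kk \<sigma> \<le> kk \<tau>" if "0 \<le> \<sigma>" "\<sigma> \<le> \<tau>" "\<tau> < real n" for \<sigma> \<tau>
    unfolding kk_def[of \<sigma>] using kk(1,2)[of \<tau>] that by (intro Least_le) auto
  have fl: "\<lfloor>et 0 (take (kk \<sigma>) xs)\<rfloor> = int m" "fac (fst (xs ! kk \<sigma>)) = m"
    if sig: "real m \<le> \<sigma>" "\<sigma> < real m + 1" "m < n" for m \<sigma>
  proof -
    have "0 \<le> \<sigma>" "\<sigma> < real n" using sig by linarith+
    note k = kk[OF this]
    note st = seg_times[OF Sinc[OF S] k(1)]
    show f: "\<lfloor>et 0 (take (kk \<sigma>) xs)\<rfloor> = int m" using st k sig by linarith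
    show "fac (fst (xs ! kk \<sigma>)) = m" using fac_eq(1)[OF st] f by simp
  qed
  define \<sigma> where "\<sigma> m l = real m + ap m l" for m l
  have sig: "real m \<le> \<sigma> m l" "\<sigma> m l < real m + 1" "0 \<le> \<sigma> m l" "\<sigma> m l < real n" "\<sigma> m l < real m + ae m l"
    if "m < n" "l < kap m" for m l
  proof -
    show 1: "real m \<le> \<sigma> m l" using ap_ge0[OF that(1), of l] that(2) by (simp add: \<sigma>_def)
    show 2: "\<sigma> m l < real m + ae m l" using ap_lt[OF that] by (simp add: \<sigma>_def)
    then show 3: "\<sigma> m l < real m + 1" using a_le1[OF that] by simp
    show "0 \<le> \<sigma> m l" using 1 by linarith
    show "\<sigma> m l < real n" using 3 that(1) by linarith
  qed
  define w where "w m l = snd (xs ! kk (\<sigma> m l))" for m l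
  have ok: "okn bled xs []" by (rule okn_mono[OF Sokn[OF S]]) (rule mv_ble[OF _ dom_lam])
  have bl: "ble (w m' l') (w m l)" if "m < n" "l < kap m" "m' < n" "l' < kap m'" "\<sigma> m l \<le> \<sigma> m' l'" for m l m' l'
    unfolding w_def using that
    by (intro ble_later[OF ok] kk_le kk(1) sig) auto
  have c1: "W (w m l) (lam m) = ll m l" if ml: "m < n" "l < kap m" for m l
  proof -
    note s = sig[OF ml]
    note k = kk[OF s(3,4)]
    have "dr (xs ! kk (\<sigma> m l)) = ll m l"
      using k s(5) by (intro slopes_agree[OF Sinc[OF S] QT k(1) ml]) (auto simp: \<sigma>_def)
    then show ?thesis using fl(2)[OF s(1,2) ml(1)] by (simp add: dr_def w_def)
  qed
  have c2: "ble (w m (l + 1)) (w m l)" if "m < n" "l + 1 < kap m" for m l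
    using ap_lt[OF that(1), of l] that by (intro bl) (auto simp: \<sigma>_def)
  have c3: "ble (w (m + 1) 0) (w m (kap m - 1))" if m1: "m + 1 < n" for m
  proof -
    have mn: "m < n" using m1 by simp
    have k: "kap m - 1 < kap m" "0 < kap (m + 1)" using kap1[OF mn] kap1[OF m1] by linarith+
    have "\<sigma> m (kap m - 1) \<le> \<sigma> (m + 1) 0" using sig(2)[OF mn k(1)] by (simp add: \<sigma>_def)
    then show ?thesis by (rule bl[OF mn k(1) m1 k(2)])
  qed
  have c4: "W (w (m + 1) 0) (lam m) \<in> re_orbit co al (lam m) \<and>
    a_chain co al 1 (last (fst (p m))) (W (w (m + 1) 0) (lam m))" if m1: "m + 1 < n" for m
  proof -
    let ?k = "kk (\<sigma> (m + 1) 0)"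
    have z: "0 < kap (m + 1)" using kne[OF m1] by simp
    note s = sig[OF m1 z]
    note k = kk[OF s(3,4)]
    \<comment> \<open>No segment crosses an integer time, so one ends exactly at
      \<open>m + 1\<close>; its \<open>sg\<close> condition, at local time 1, yields the real-orbit
      condition and the 1-chain.\<close>
    have "real (m + 1) \<le> et 0 (take ?k xs)" using fl(1)[OF s(1,2) m1] by linarith
    then have e: "et 0 (take ?k xs) = real (m + 1)" using k(3) by (simp add: \<sigma>_def)
    have "?k \<noteq> 0"
    proof
      assume "?k = 0"
      then show False using e by simp
    qed
    then obtain j where j: "?k = Suc j" by (cases ?k) auto
    have jN: "j < ?N" "Suc j < ?N" using j k(1) by auto
    have fj: "fst (xs ! j) = real (m + 1)" using e j et_take[OF jN(1), of 0] by simp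
    have facj: "fac (fst (xs ! j)) = m" unfolding fj fac_def by (simp only: ceiling_of_nat)
    have "sg mv (xs ! j) (nw (drop (Suc j) xs) [])" by (rule seg_sg[OF Sokn[OF S] jN(1)])
    then have "sg mv (xs ! j) (w (m + 1) 0)" using nw_drop[OF jN(2)] j by (simp add: w_def)
    then have sg: "ach 1 (dr (xs ! j)) (W (w (m + 1) 0) (lam m))" "W (w (m + 1) 0) (lam m) \<in> re_orbit co al (lam m)"
      using fj unfolding sg_def facj by simp_all
    have mn: "m < n" and km: "kap m - 1 < kap m" using m1 kne[of m] by auto
    have "dr (xs ! j) = ll m (kap m - 1)"
    proof (rule slopes_agree[OF Sinc[OF S] QT jN(1) mn km])
      show "et 0 (take j xs) < real m + ae m (kap m - 1)"
        using seg_times(2)[OF Sinc[OF S] jN(1)] fj a_last[OF mn] by simp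
      show "real m + ap m (kap m - 1) < fst (xs ! j)" using ap_lt[OF mn km] fj a_last[OF mn] by simp
    qed
    also have "\<dots> = last (fst (p m))" by (rule last_conv_nth[symmetric, OF kne[OF mn]])
    finally have "dr (xs ! j) = last (fst (p m))" .
    then show ?thesis using ach_a_chain[OF sg(1)] sg(2) by simp
  qed
  have "chain_cond w" unfolding chain_cond_def using c1 c2 c3 c4 by blast
  then show ?thesis by blast
qed

lemma fac_at: "0 < a \<Longrightarrow> a \<le> 1 \<Longrightarrow> fac (real m + a) = m"
  using fac_eq(1)[of "real m" "real m + a"] by simp

lemma chain_Sdata:
  assumes cc: "chain_cond w"
  shows "\<exists>xs. Sdata bled xs \<and> (\<forall>s. 0 \<le> s \<longrightarrow> s \<le> real n \<longrightarrow> Q 0 xs s = T s)"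
proof -
  define B where "B m l = map (\<lambda>l. (real m + ae m l, w m l)) [l..<kap m]" for m l
  \<comment> \<open>The word following factor \<open>m\<close>: the first one of the next factor,
    and the empty word after the last.\<close>
  define z where "z m = (if m + 1 < n then w (m + 1) 0 else [])" for m
  have c1: "W (w m l) (lam m) = ll m l" if "m < n" "l < kap m" for m l
    using cc that unfolding chain_cond_def by blast
  have sgl: "sg bled (real m + ae m l, w m l) (w m (Suc l))" if ml: "m < n" "Suc l < kap m" for m l
  proof -
    have a: "0 < ae m l" "ae m l < 1" using a_pos[OF ml(1), of l] a_lt1[OF ml] ml by auto
    have f: "fac (real m + ae m l) = m" using a by (intro fac_at) auto
    have "real m + ae m l \<notin> \<int>"
    proof
      assume "real m + ae m l \<in> \<int>"
      then obtain i where "real m + ae m l = of_int i" by (elim Ints_cases)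
      then have "int m < i" "i < int m + 1" using a by linarith+
      then show False by simp
    qed
    moreover have "ach (ae m l) (ll m l) (ll m (Suc l))" by (rule a_chain_ach[OF a_ch[OF ml]])
    moreover have "ble (w m (Suc l)) (w m l)" using cc ml unfolding chain_cond_def by simp
    ultimately show ?thesis using c1[of m l] c1[of m "Suc l"] ml by (simp add: sg_def dr_def f)
  qed
  have sge: "sg bled (real m + ae m (kap m - 1), w m (kap m - 1)) (z m)" if mn: "m < n" for m
  proof -
    have f: "fac (real m + 1) = m" by (intro fac_at) auto
    have k: "kap m - 1 < kap m" "fst (p m) \<noteq> []" using kne[OF mn] by auto
    have "ach 1 (ll m (kap m - 1)) (W (z m) (lam m)) \<and> W (z m) (lam m) \<in> re_orbit co al (lam m) \<and> ble (z m) (w m (kap m - 1))"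
    proof (cases "m + 1 < n")
      case True
      then have "a_chain co al 1 (last (fst (p m))) (W (w (m+1) 0) (lam m))"
        "W (w (m+1) 0) (lam m) \<in> re_orbit co al (lam m)" "ble (w (m+1) 0) (w m (kap m - 1))"
        using cc unfolding chain_cond_def by blast+
      then show ?thesis using a_chain_ach True last_conv_nth[OF k(2)] by (simp add: z_def)
    next
      case False
      have "lam m \<in> re_orbit co al (lam m)" unfolding re_orbit_def by (intro CollectI exI[of _ "[]"]) simp
      then show ?thesis using a_chain_ach[OF a_ch1[OF mn]] ble_Nil False by (simp add: z_def)
    qed
    then show ?thesis unfolding sg_def dr_def fst_conv snd_conv a_last[OF mn] f c1[OF mn k(1)] by simp
  qed
  have blk: "inc (real m + ap m l) (B m l) \<and> et (real m + ap m l) (B m l) = real m + 1 \<and>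
      lin T (real m + ap m l) (B m l) \<and> okn bled (B m l) (z m)" if mn: "m < n" and "l \<le> kap m" for m l
    using that(2)
  proof (induction l rule: inc_induct)
    case base
    have "ap m (kap m) = 1" using a_last[OF mn] kne[OF mn] by (simp add: ap_def)
    then show ?case by (simp add: B_def)
  next
    case (step l)
    have l: "l < kap m" using step by simp
    have B: "B m l = (real m + ae m l, w m l) # B m (Suc l)" using l by (simp add: B_def upt_conv_Cons)
    have fl: "\<lfloor>real m + ap m l\<rfloor> = int m"
      using ap_ge0[OF mn, of l] ap_lt[OF mn l] a_le1[OF mn l] l by linarith
    have d: "dr (real m + ae m l, w m l) = ll m l"
      using fac_at[OF a_pos[OF mn l] a_le1[OF mn l]] c1[OF mn l] by (simp add: dr_def)
    have li: "T t = T (real m + ap m l) + (t - (real m + ap m l)) *\<^sub>R ll m l"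
      if "real m + ap m l \<le> t" "t \<le> real m + ae m l" for t
      using T_slope[OF mn l order_refl that] by (simp add: algebra_simps)
    have sgB: "sg bled (real m + ae m l, w m l) (nw (B m (Suc l)) (z m))"
    proof (cases "Suc l < kap m")
      case True
      then show ?thesis using sgl[OF mn True] by (simp add: B_def upt_conv_Cons)
    next
      case False
      then have "l = kap m - 1" using l by simp
      then show ?thesis using sge[OF mn] False by (simp add: B_def)
    qed
    have IH: "inc (real m + ae m l) (B m (Suc l))" "et (real m + ae m l) (B m (Suc l)) = real m + 1"
      "lin T (real m + ae m l) (B m (Suc l))" "okn bled (B m (Suc l)) (z m)" using step(3) by simp_all
    show ?case unfolding B inc.simps et.simps lin.simps okn.simps fst_conv d fl
    proof (intro conjI allI impI)
      show "real m + ap m l < real m + ae m l" using ap_lt[OF mn l] by simp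
      show "real m + ae m l \<le> of_int (int m) + 1" using a_le1[OF mn l] by simp
    qed (rule IH sgB li; assumption?)+
  qed
  define X where "X m = concat (map (\<lambda>m. B m 0) [m..<n])" for m
  have XX: "inc (real m) (X m) \<and> et (real m) (X m) = real n \<and> lin T (real m) (X m) \<and> okn bled (X m) []"
    if "m \<le> n" for m
    using that
  proof (induction m rule: inc_induct)
    case base
    then show ?case by (simp add: X_def)
  next
    case (step m)
    have mn: "m < n" using step by simp
    have X: "X m = B m 0 @ X (Suc m)" using mn by (simp add: X_def upt_conv_Cons)
    have "nw (X (Suc m)) [] = z m"
    proof (cases "m + 1 < n")
      case True
      then have "B (Suc m) 0 = (real (Suc m) + ae (Suc m) 0, w (Suc m) 0) # B (Suc m) 1"
        using kne[of "Suc m"] by (simp add: B_def upt_conv_Cons)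
      then show ?thesis using True by (simp add: X_def z_def upt_conv_Cons)
    qed (simp add: X_def z_def)
    moreover have "real (Suc m) = real m + 1" by simp
    ultimately show ?case using step(3) blk[OF mn, of 0] unfolding X inc_append et_append lin_append okn_append
      by (simp only: ap_0 add_0_right le0)
  qed
  have x: "inc 0 (X 0)" "et 0 (X 0) = real n" "lin T 0 (X 0)" "okn bled (X 0) []" using XX[of 0] by auto
  have "Sdata bled (X 0)" using x by (simp add: Sdata_def)
  moreover have "Q 0 (X 0) s = T s" if "0 \<le> s" "s \<le> real n" for s
    using lin_Q[OF x(1,3) that(1)] that(2) x(2) T_0 by simp
  ultimately show ?thesis by blast
qed

theorem standard_iff:
  "(\<exists>F q. apply_F co al F (tensor n (\<lambda>m. path_line (lam m))) = Some q \<and>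
     (\<forall>t\<in>{0..1}. q t = tensor n (\<lambda>m. path_of (p m)) t)) \<longleftrightarrow> (\<exists>w. chain_cond w)"
proof
  assume "\<exists>F q. apply_F co al F (tensor n (\<lambda>m. path_line (lam m))) = Some q \<and>
     (\<forall>t\<in>{0..1}. q t = tensor n (\<lambda>m. path_of (p m)) t)"
  then obtain F q where F: "apply_F co al F (tensor n (\<lambda>m. path_line (lam m))) = Some q"
    "\<forall>t\<in>{0..1}. q t = tensor n (\<lambda>m. path_of (p m)) t" by blast
  obtain xs where xs: "Sdata mv xs" "\<forall>t. 0 \<le> t \<longrightarrow> t \<le> 1 \<longrightarrow> q t = pth xs t"
    using standard_Sdata[OF tensor_lines F(1)] by blast
  have "Q 0 xs s = T s" if "0 \<le> s" "s \<le> real n" for s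
  proof -
    have t: "0 \<le> s / real n" "s / real n \<le> 1" using that n1 by auto
    have "pth xs (s / real n) = T s" using xs(2) F(2) t by (simp add: T_def)
    then show ?thesis using n1 by (simp add: pth_def)
  qed
  then show "\<exists>w. chain_cond w" by (rule Sdata_chain[OF xs(1)])
next
  assume "\<exists>w. chain_cond w"
  then obtain w where "chain_cond w" by blast
  from chain_Sdata[OF this] obtain xs where xs: "Sdata bled xs" "\<forall>s. 0 \<le> s \<longrightarrow> s \<le> real n \<longrightarrow> Q 0 xs s = T s" by blast
  obtain F q where F: "apply_F co al F (tensor n (\<lambda>m. path_line (lam m))) = Some q"
    "\<forall>t. 0 \<le> t \<longrightarrow> t \<le> 1 \<longrightarrow> q t = pth xs t"
    using Sdata_standard[OF xs(1) tensor_lines] by blast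
  have "q t = tensor n (\<lambda>m. path_of (p m)) t" if "t \<in> {0..1}" for t
  proof -
    have t: "0 \<le> t" "t \<le> 1" using that by auto
    then have "real n * t \<le> real n" by (simp add: mult_left_le)
    then have "Q 0 xs (real n * t) = T (real n * t)" using xs(2) t(1) by simp
    then show ?thesis using F(2) t n1 by (simp add: pth_def T_def)
  qed
  then show "\<exists>F q. apply_F co al F (tensor n (\<lambda>m. path_line (lam m))) = Some q \<and>
     (\<forall>t\<in>{0..1}. q t = tensor n (\<lambda>m. path_of (p m)) t)" using F(1) by blast
qed

end

theorem theorem5p2p2:
  fixes co :: "'i::countable \<Rightarrow> 'v::real_vector \<Rightarrow> real" and al :: "'i \<Rightarrow> 'v" and P :: "'v set"
    and n :: nat and lam :: "nat \<Rightarrow> 'v" and p :: "nat \<Rightarrow> 'v list \<times> real list"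
  assumes "bc_datum co al P"
    and "n \<ge> 1"
    and "\<forall>m<n. lam m \<in> Pplus co P"
    and "\<forall>m<n. is_GLS co al (lam m) (p m)"
  shows "(\<exists>F q. apply_F co al F (tensor n (\<lambda>m. path_line (lam m))) = Some q \<and>
            (\<forall>t\<in>{0..1}. q t = tensor n (\<lambda>m. path_of (p m)) t))
    \<longleftrightarrow>
    (\<exists>w :: nat \<Rightarrow> nat \<Rightarrow> 'i list.
       (\<forall>m<n. \<forall>l<length (fst (p m)). act co al (w m l) (lam m) = fst (p m) ! l) \<and>
       (\<forall>m<n. \<forall>l. l + 1 < length (fst (p m)) \<longrightarrow> bruhat_le co al (w m (l+1)) (w m l)) \<and>
       (\<forall>m. m + 1 < n \<longrightarrow> bruhat_le co al (w (m+1) 0) (w m (length (fst (p m)) - 1))) \<and>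
       (\<forall>m. m + 1 < n \<longrightarrow> act co al (w (m+1) 0) (lam m) \<in> re_orbit co al (lam m)) \<and>
       (\<forall>m. m + 1 < n \<longrightarrow> a_chain co al 1 (last (fst (p m))) (act co al (w (m+1) 0) (lam m))))"
proof -
  \<comment> \<open>Padding with the dominant weight 0 meets the locale assumption for indices
    beyond \<open>n\<close>.\<close>
  define lam' where "lam' m = (if m < n then lam m else 0)" for m
  interpret bc co al P by unfold_locales (rule assms(1))
  have "0 \<in> P" using assms(1) unfolding bc_datum_def by (elim conjE)
  then have "0 \<in> Pplus co P" using linear_0[OF lin_co] by (simp add: Pplus_def)
  then have lamP: "lam' m \<in> Pplus co P" for m using assms(3) by (simp add: lam'_def)
  have lam: "lam' m = lam m" if "m < n" for m using that by (simp add: lam'_def)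
  interpret gls_paths co al P n lam' p
  proof unfold_locales
    show "1 \<le> n" by (rule assms(2))
    show "lam' m \<in> Pplus co P" for m by (rule lamP)
    show "is_GLS co al (lam' m) (p m)" if "m < n" for m using assms(4) that by (simp add: lam)
  qed
  have t: "tensor n (\<lambda>m. path_line (lam m)) = tensor n (\<lambda>m. path_line (lam' m))"
    by (rule tensor_cong[OF assms(2)]) (simp add: lam)
  have lam_Suc: "lam' m = lam m" if "Suc m < n" for m using that by (simp add: lam'_def)
  show ?thesis unfolding t standard_iff unfolding chain_cond_def by (simp add: lam lam_Suc)
qed

end
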